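(* Let $F_0$ be the c.d.f. of a probability distribution on $\mathbb{R}$ symmetric about $0$, with density $f_0$ when it exists, let $X_1,X_2,\dots$ be i.i.d. real random variables with c.d.f. $G(x)=\lambda_0F_0(x-\mu_1^0)+(1-\lambda_0)F_0(x-\mu_2^0)$, and consider the estimation problems (P1) and (P2), the conditions C1 and C2 on $F_0$, and the estimators $$\hat F_n=\tfrac12(I+S_r)A_{\hat\theta_n}^{-1}\hat G_n,\qquad \hat f_n=\tfrac12(I+S_d)A_{\hat\theta_n}^{-1}\hat g_n,$$ all defined in the context. Then, as $n\to+\infty$: (i) If $F_0$ satisfies C1, then $\|\hat F_n-F_0\|_\infty$ converges almost surely to $0$, both for problem (P1) and for problem (P2). (ii) If $F_0$ satisfies C1, then $\|\hat F_n-F_0\|_\infty=O_P(n^{-1/2})$ for problem (P1). If $F_0$ satisfies C2, then for problem (P2), $\|\hat F_n-F_0\|_\infty=o_{\mathrm{a.s.}}(n^{-1/4+\alpha})$ for any $\alpha>0$. (iii) If $F_0$ satisfies C1, then for problem (P1) $\|\hat f_n-f_0\|_1$ converges almost surely to $0$; if $F_0$ satisfies C2, then for problem (P2) $\|\hat f_n-f_0\|_1$ converges almost surely to $0$.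
   Context: Conditions. C1: $F_0$ is strictly increasing and Lipschitz on $\mathbb{R}$. C2: $F_0$ is strictly increasing, twice continuously differentiable on $\mathbb{R}$, and $F_0''\in L^1(\mathbb{R})$. Operators. $\tau_\mu f=f(\cdot-\mu)$; for $\theta=(\lambda,\mu_1,\mu_2)$ with $\lambda\in[0,1/2)$, $\mu_1\ne\mu_2$, $\eta=\mu_2-\mu_1$, $$A_\theta=\lambda\tau_{\mu_1}+(1-\lambda)\tau_{\mu_2},\qquad A_\theta^{-1}=\frac{1}{1-\lambda}\sum_{k\ge 0}\Big(\frac{-\lambda}{1-\lambda}\Big)^k\tau_{-\mu_2-k\eta},$$ acting on $L^\infty(\mathbb{R})$ (for c.d.f.'s) or $L^1(\mathbb{R})$ (for densities). $I$ is the identity, $(S_rF)(x)=1-F(-x)$, $(S_df)(x)=f(-x)$. $\|\cdot\|_\infty$ is the supremum norm and $\|\cdot\|_1$ the $L^1(\mathbb{R})$ norm. Nonparametric estimators of $G$ and its density. $\hat G_n(x)=\frac1n\sum_{i=1}^n\mathbf{1}_{X_i\le x}$; $\hat g_n(x)=\frac1{nb_n}\sum_{i=1}^nq\big(\frac{x-X_i}{b_n}\big)$; $\tilde G_n(x)=\int_{-\infty}^x\hat g_n(y)\,dy$. Here $q$ is an even probability density function with compact support and second-order moment equal to $1$, and $(b_n)_{n\ge1}$ is a sequence of positive real numbers decreasing to $0$ with $nb_n\to+\infty$ and $\sqrt n\,b_n^2=O(1)$. Problem (P1): $\mu_1^0\ne\mu_2^0$ are known, $\lambda_0\in[0,1/2-d]$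 for a fixed $d\in(0,1/2)$; $\hat\theta_n=(\hat\lambda_n,\mu_1^0,\mu_2^0)$, where $\hat\lambda_n$ minimizes over $\lambda\in[0,1/2-d]$ the function $K(\lambda;\hat G_n)=\int_{\mathbb{R}}(A_\theta S_rA_\theta^{-1}\hat G_n-\hat G_n)^2\,d\hat G_n$ with $\theta=(\lambda,\mu_1^0,\mu_2^0)$. Problem (P2): $\theta_0=(\lambda_0,\mu_1^0,\mu_2^0)$ is unknown and is an interior point of $\Theta=[0,1/2-d]\times\mathcal{X}$, where $d\in(0,1/2)$ and $\mathcal{X}\subset\mathbb{R}^2$ is compact and disjoint from the diagonal $\{(x,x):x\in\mathbb{R}\}$; $\hat\theta_n$ minimizes over $\theta\in\Theta$ the function $K_r(\theta;\hat G_n)=\int_{\mathbb{R}}(A_\theta S_rA_\theta^{-1}\tilde G_n-\tilde G_n)^2\,d\hat G_n$. $O_P(n^{-1/2})$ means that the sequence multiplied by $n^{1/2}$ is bounded in probability; $o_{\mathrm{a.s.}}(r_n)$ means that the sequence divided by $r_n$ converges to $0$ almost surely. *)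

theory Defs
  imports "HOL-Probability.Probability" "HOL-Library.Landau_Symbols"
begin

section \<open>Operators and norms\<close>

text \<open>A parameter is a triple \<open>\<theta> = (\<lambda>, \<mu>\<^sub>1, \<mu>\<^sub>2)\<close>.\<close>

definition shift :: "real \<Rightarrow> (real \<Rightarrow> real) \<Rightarrow> real \<Rightarrow> real" where
  "shift \<mu> f = (\<lambda>x. f (x - \<mu>))"

definition A_op :: "real \<times> real \<times> real \<Rightarrow> (real \<Rightarrow> real) \<Rightarrow> real \<Rightarrow> real" where
  "A_op = (\<lambda>(l, \<mu>1, \<mu>2) f x. l * shift \<mu>1 f x + (1 - l) * shift \<mu>2 f x)"

text \<open>The operator series is evaluated pointwise. For \<open>0 \<le> l < 1/2\<close> and \<open>\<mu>1 \<noteq> \<mu>2\<close> it converges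
  absolutely at every point if \<open>f\<close> is bounded, it is a finite sum at every point if \<open>f\<close> has bounded
  support, and it converges absolutely almost everywhere (to the \<open>L\<^sup>1\<close> sum) if \<open>f\<close> is integrable.\<close>

definition A_inv :: "real \<times> real \<times> real \<Rightarrow> (real \<Rightarrow> real) \<Rightarrow> real \<Rightarrow> real" where
  "A_inv = (\<lambda>(l, \<mu>1, \<mu>2) f x.
     1 / (1 - l) * (\<Sum>k. (- l / (1 - l)) ^ k * shift (- \<mu>2 - real k * (\<mu>2 - \<mu>1)) f x))"

definition S_r :: "(real \<Rightarrow> real) \<Rightarrow> real \<Rightarrow> real" where
  "S_r F = (\<lambda>x. 1 - F (- x))"

definition S_d :: "(real \<Rightarrow> real) \<Rightarrow> real \<Rightarrow> real" where
  "S_d f = (\<lambda>x. f (- x))"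

text \<open>Only applied to bounded functions.\<close>

definition sup_norm :: "(real \<Rightarrow> real) \<Rightarrow> real" where
  "sup_norm f = (SUP x. \<bar>f x\<bar>)"

text \<open>Extended-valued, so that convergence to \<open>0\<close> does not depend on the value that the Bochner
  integral gives to non-integrable functions.\<close>

definition L1_norm :: "(real \<Rightarrow> real) \<Rightarrow> ennreal" where
  "L1_norm f = (\<integral>\<^sup>+ x. ennreal \<bar>f x\<bar> \<partial>lborel)"


section \<open>The unknown symmetric distribution\<close>

definition symmetric_law :: "real measure \<Rightarrow> bool" where
  "symmetric_law P \<longleftrightarrow> real_distribution P \<and> distr P borel uminus = P"

definition is_density :: "real measure \<Rightarrow> (real \<Rightarrow> real) \<Rightarrow> bool" where
  "is_density P f \<longleftrightarrow> f \<in> borel_measurable borel \<and> (\<forall>x. 0 \<le> f x) \<and>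
     P = density lborel (\<lambda>x. ennreal (f x))"

definition C1 :: "(real \<Rightarrow> real) \<Rightarrow> bool" where
  "C1 F \<longleftrightarrow> strict_mono F \<and> (\<exists>L. L-lipschitz_on UNIV F)"

definition C2 :: "(real \<Rightarrow> real) \<Rightarrow> bool" where
  "C2 F \<longleftrightarrow> strict_mono F \<and>
     (\<exists>F' F''. (\<forall>x. (F has_real_derivative F' x) (at x)) \<and>
               (\<forall>x. (F' has_real_derivative F'' x) (at x)) \<and>
               continuous_on UNIV F'' \<and> integrable lborel F'')"


section \<open>Nonparametric estimators\<close>

text \<open>A realised sample is a sequence \<open>xs\<close>; the first \<open>n\<close> observations are \<open>xs 1, \<dots>, xs n\<close>.\<close>

definition G_hat :: "nat \<Rightarrow> (nat \<Rightarrow> real) \<Rightarrow> real \<Rightarrow> real" where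
  "G_hat n xs x = 1 / real n * (\<Sum>i = 1..n. if xs i \<le> x then 1 else 0)"

definition g_hat ::
  "(real \<Rightarrow> real) \<Rightarrow> (nat \<Rightarrow> real) \<Rightarrow> nat \<Rightarrow> (nat \<Rightarrow> real) \<Rightarrow> real \<Rightarrow> real" where
  "g_hat q b n xs x = 1 / (real n * b n) * (\<Sum>i = 1..n. q ((x - xs i) / b n))"

definition G_tilde ::
  "(real \<Rightarrow> real) \<Rightarrow> (nat \<Rightarrow> real) \<Rightarrow> nat \<Rightarrow> (nat \<Rightarrow> real) \<Rightarrow> real \<Rightarrow> real" where
  "G_tilde q b n xs x = (LINT y:{..x}|lborel. g_hat q b n xs y)"

definition smoothing_kernel :: "(real \<Rightarrow> real) \<Rightarrow> bool" where
  "smoothing_kernel q \<longleftrightarrow> q \<in> borel_measurable borel \<and> (\<forall>x. 0 \<le> q x) \<and> (LINT x|lborel. q x) = 1 \<and>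
     (\<forall>x. q (- x) = q x) \<and> compact (closure {x. q x \<noteq> 0}) \<and> (LINT x|lborel. x\<^sup>2 * q x) = 1"

definition bandwidth :: "(nat \<Rightarrow> real) \<Rightarrow> bool" where
  "bandwidth b \<longleftrightarrow> (\<forall>n\<ge>1. 0 < b n) \<and> (\<forall>n\<ge>1. b (Suc n) \<le> b n) \<and> b \<longlonglongrightarrow> 0 \<and>
     filterlim (\<lambda>n. real n * b n) at_top sequentially \<and>
     (\<lambda>n. sqrt (real n) * (b n)\<^sup>2) \<in> O(\<lambda>n. 1)"


section \<open>Minimum contrast estimation\<close>

text \<open>\<open>dG\<close> is the Lebesgue-Stieltjes measure of the distribution function \<open>G\<close>. The contrast \<open>K\<close> is
  obtained for \<open>H = G = G_hat\<close>, and \<open>K\<^sub>r\<close> for \<open>H = G_tilde\<close>, \<open>G = G_hat\<close>.\<close>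

definition contrast ::
  "real \<times> real \<times> real \<Rightarrow> (real \<Rightarrow> real) \<Rightarrow> (real \<Rightarrow> real) \<Rightarrow> real" where
  "contrast \<theta> H G = (LINT x|interval_measure G. (A_op \<theta> (S_r (A_inv \<theta> H)) x - H x)\<^sup>2)"

definition problem_P1 ::
  "'a measure \<Rightarrow> (nat \<Rightarrow> 'a \<Rightarrow> real) \<Rightarrow> real \<Rightarrow> real \<Rightarrow> real \<Rightarrow> real \<Rightarrow> (nat \<Rightarrow> 'a \<Rightarrow> real) \<Rightarrow> bool" where
  "problem_P1 M X l0 \<mu>1 \<mu>2 d l_hat \<longleftrightarrow>
     0 < d \<and> d < 1/2 \<and> \<mu>1 \<noteq> \<mu>2 \<and> l0 \<in> {0..1/2 - d} \<and>
     (\<forall>n\<ge>1. \<forall>\<omega>\<in>space M.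
        is_arg_min
          (\<lambda>l. contrast (l, \<mu>1, \<mu>2) (G_hat n (\<lambda>i. X i \<omega>)) (G_hat n (\<lambda>i. X i \<omega>)))
          (\<lambda>l. l \<in> {0..1/2 - d}) (l_hat n \<omega>))"

definition problem_P2 ::
  "'a measure \<Rightarrow> (nat \<Rightarrow> 'a \<Rightarrow> real) \<Rightarrow> (real \<Rightarrow> real) \<Rightarrow> (nat \<Rightarrow> real) \<Rightarrow> real \<Rightarrow> real \<Rightarrow> real \<Rightarrow>
     real \<Rightarrow> (real \<times> real) set \<Rightarrow> (nat \<Rightarrow> 'a \<Rightarrow> real \<times> real \<times> real) \<Rightarrow> bool" where
  "problem_P2 M X q b l0 \<mu>1 \<mu>2 d \<X> \<theta>_hat \<longleftrightarrow>
     0 < d \<and> d < 1/2 \<and> compact \<X> \<and> \<X> \<inter> {(x, x) |x. True} = {} \<and>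
     (l0, \<mu>1, \<mu>2) \<in> interior ({0..1/2 - d} \<times> \<X>) \<and>
     (\<forall>n\<ge>1. \<forall>\<omega>\<in>space M.
        is_arg_min
          (\<lambda>\<theta>. contrast \<theta> (G_tilde q b n (\<lambda>i. X i \<omega>)) (G_hat n (\<lambda>i. X i \<omega>)))
          (\<lambda>\<theta>. \<theta> \<in> {0..1/2 - d} \<times> \<X>) (\<theta>_hat n \<omega>))"

definition F_hat :: "real \<times> real \<times> real \<Rightarrow> nat \<Rightarrow> (nat \<Rightarrow> real) \<Rightarrow> real \<Rightarrow> real" where
  "F_hat \<theta> n xs x = 1/2 * (A_inv \<theta> (G_hat n xs) x + S_r (A_inv \<theta> (G_hat n xs)) x)"

definition f_hat ::
  "real \<times> real \<times> real \<Rightarrow> (real \<Rightarrow> real) \<Rightarrow> (nat \<Rightarrow> real) \<Rightarrow> nat \<Rightarrow> (nat \<Rightarrow> real) \<Rightarrow> real \<Rightarrow> real" where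
  "f_hat \<theta> q b n xs x =
     1/2 * (A_inv \<theta> (g_hat q b n xs) x + S_d (A_inv \<theta> (g_hat q b n xs)) x)"


section \<open>Stochastic boundedness\<close>

text \<open>\<open>Z n = O\<^sub>P(1)\<close>. The exceptional set is covered by an event, i.e. its outer probability is
  bounded: for random variables \<open>Z n\<close> this is the usual notion, and it does not degenerate when
  \<open>Z n\<close> is not measurable (no measurability of the minimisers or of the supremum is presupposed).\<close>

definition bounded_in_probability :: "'a measure \<Rightarrow> (nat \<Rightarrow> 'a \<Rightarrow> real) \<Rightarrow> bool" where
  "bounded_in_probability M Z \<longleftrightarrow>
     (\<forall>\<epsilon>>0. \<exists>C. \<forall>n. \<exists>E\<in>sets M. {\<omega> \<in> space M. C < \<bar>Z n \<omega>\<bar>} \<subseteq> E \<and> measure M E \<le> \<epsilon>)"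

end

theory Submission
  imports Defs "HOL-Probability.Hoeffding" "HOL-Real_Asymp.Real_Asymp"
begin

text \<open>Let \<open>Q\<close> be the \<open>asymmetry\<close> of \<open>G\<close> at \<open>\<theta>\<close>, the amount by which \<open>A\<^sub>\<theta> (S\<^sub>r G)\<close> fails to be
  the c.d.f. of a symmetric law. The residual \<open>D = A\<^sub>\<theta> S\<^sub>r A\<^sub>\<theta>\<^sup>-\<^sup>1 G - G\<close> satisfies
  \<open>D (- x) = (A\<^sub>\<theta>\<^sup>-\<^sup>1 Q) (x)\<close>, and \<open>Q\<close> is an explicit combination of translates of \<open>F0\<close>. For known
  locations \<open>Q\<close> is \<open>\<lambda> - \<lambda>\<^sub>0\<close> times a fixed nonzero function, so that \<open>\<integral> D\<^sup>2 dG\<close> is at least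
  of order \<open>(\<lambda> - \<lambda>\<^sub>0)\<^sup>2\<close>. For unknown locations the cosine transform of \<open>Q\<close> is that of \<open>F0\<close> times a
  sine polynomial whose coefficients determine \<open>\<theta>\<close>; under C2 the derivative of \<open>Q\<close> in \<open>\<theta>\<close> at
  \<open>\<theta>\<^sub>0\<close> is injective for the same reason, and a compactness argument gives
  \<open>\<integral> D\<^sup>2 dG \<ge> c \<parallel>\<theta> - \<theta>\<^sub>0\<parallel>\<^sup>2\<close>.

  The minimiser of the empirical contrast makes \<open>\<integral> D\<^sup>2 dG\<close> small because \<open>A\<^sub>\<theta>\<^sup>-\<^sup>1\<close> is bounded
  on \<open>L\<^sup>\<infinity>\<close> and \<open>D\<close>, a difference of bounded monotone functions, can be integrated against
  \<open>G_hat\<close> instead of \<open>G\<close> at the cost of \<open>\<Delta> = sup \<bar>G_hat - G\<bar>\<close>. For known locations the variation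
  of \<open>D\<close> is of order \<open>\<bar>\<lambda> - \<lambda>\<^sub>0\<bar>\<close> as well, which gives the rate \<open>\<Delta>\<close> instead of \<open>\<Delta>\<^sup>1\<^sup>/\<^sup>2\<close>.
  The deviation \<open>\<Delta>\<close> is \<open>O(n\<^sup>-\<^sup>1\<^sup>/\<^sup>2)\<close> in probability by Doob's inequality and
  \<open>n\<^sup>-\<^sup>1\<^sup>/\<^sup>2\<^sup>+\<^sup>\<alpha>\<close> almost surely by Hoeffding's inequality at the quantiles of \<open>G\<close>. The
  \<open>L\<^sup>1\<close> consistency of the kernel estimator follows from Hoeffding's inequality for all unions of
  finitely many cells whose diameter is small compared with the bandwidth.\<close>

section \<open>The mixing operators\<close>

text \<open>Once a sample is fixed, the estimates for the parameter and for \<open>F_hat\<close> are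
  deterministic: they are bounded by a nonrandom function of \<Delta> and of the bandwidth. The
  minimisers force this form, being arbitrary functions of the outcome, neither unique nor assumed
  measurable. Nor is a uniform law of large numbers over \<theta> needed, as the variation of the
  residual is bounded uniformly in \<theta>.

  The obstacle is a lower bound for the contrast, the integral of a squared infinite series. It is
  reached from a single point: \<open>A_op\<close> inverts \<open>A_inv\<close>, so one nonzero
  value of the asymmetry forces the residual to be large at one of two explicit points; a common
  modulus of continuity spreads this over an interval, and strict monotonicity of G gives the
  interval mass. For unknown locations the squared parameter error is then of the order of \<Delta>
  plus the squared bandwidth, whence the exponent -1/4.

  The cosine transform of the law of \<open>F0\<close> may vanish away from the origin, so
  identification uses only frequencies near 0 and reads off coefficients from derivatives
  there.\<close>

lemma ratio_bounds:
  fixes l :: real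
  assumes "0 \<le> l" "l < 1/2"
  shows "0 \<le> l / (1 - l)" "l / (1 - l) < 1" "(\<Sum>k. (l / (1 - l)) ^ k) = (1 - l) / (1 - 2 * l)"
proof -
  show *: "0 \<le> l / (1 - l)" "l / (1 - l) < 1"
    using assms by (auto simp: field_simps)
  have "norm (l / (1 - l)) < 1"
    unfolding real_norm_def abs_of_nonneg[OF *(1)] by (rule *(2))
  then have "(\<Sum>k. (l / (1 - l)) ^ k) = 1 / (1 - l / (1 - l))"
    by (rule suminf_geometric)
  also have "\<dots> = (1 - l) / (1 - 2 * l)"
    using assms by (simp add: field_simps)
  finally show "(\<Sum>k. (l / (1 - l)) ^ k) = (1 - l) / (1 - 2 * l)" .
qed

lemma A_op_eq: "A_op (l, m1, m2) f x = l * f (x - m1) + (1 - l) * f (x - m2)"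
  by (simp add: A_op_def shift_def)

lemma A_inv_eq:
  "A_inv (l, m1, m2) f x =
     (\<Sum>k. (- l / (1 - l)) ^ k * f (x + m2 + real k * (m2 - m1))) / (1 - l)"
proof -
  have "x - (- m2 - real k * (m2 - m1)) = x + m2 + real k * (m2 - m1)" for k
    by simp
  then show ?thesis unfolding A_inv_def shift_def by (simp only: prod.case) simp
qed

lemma summable_ratio:
  fixes l :: real
  assumes "0 \<le> l" "l < 1/2"
  shows "summable (\<lambda>k. (l / (1 - l)) ^ k)"
proof (rule summable_geometric)
  show "norm (l / (1 - l)) < 1"
    unfolding real_norm_def abs_of_nonneg[OF ratio_bounds(1)[OF assms]] by (rule ratio_bounds(2)[OF assms])
qed

lemma A_inv_add_arg: "A_inv (l, m1, m2) (\<lambda>x. f (x + h)) x = A_inv (l, m1, m2) f (x + h)"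
proof -
  have "x + m2 + real k * (m2 - m1) + h = x + h + m2 + real k * (m2 - m1)" for k
    by simp
  then show ?thesis
    unfolding A_inv_eq by (simp only:)
qed

lemma summable_A_inv:
  fixes l :: real
  assumes l: "0 \<le> l" "l < 1/2" and f: "\<And>k. \<bar>f k\<bar> \<le> B"
  shows "summable (\<lambda>k. \<bar>(- l / (1 - l)) ^ k * f k\<bar>)" "summable (\<lambda>k. (- l / (1 - l)) ^ k * f k)"
proof -
  have "norm \<bar>(- l / (1 - l)) ^ k * f k\<bar> \<le> (l / (1 - l)) ^ k * B" for k
    using ratio_bounds(1)[OF l] l f[of k] by (simp add: abs_mult power_abs mult_left_mono)
  moreover have "summable (\<lambda>k. (l / (1 - l)) ^ k * B)"
    by (intro summable_mult2 summable_ratio l)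
  ultimately show "summable (\<lambda>k. \<bar>(- l / (1 - l)) ^ k * f k\<bar>)"
    by (metis (no_types, lifting) summable_comparison_test')
  then show "summable (\<lambda>k. (- l / (1 - l)) ^ k * f k)"
    by (rule summable_rabs_cancel)
qed

text \<open>Termwise estimate by the geometric series: \<open>1 / (1 - l)\<close> times
  \<open>(1 - l) / (1 - 2 * l)\<close>. On the parameter sets \<open>l \<le> 1/2 - d\<close>, so the
  operator norm is at most \<open>1 / (2 * d)\<close> whatever the locations are; this factor recurs
  in all later bounds.\<close>

lemma A_inv_bound:
  assumes l: "0 \<le> l" "l < 1/2" and f: "\<And>x. \<bar>f x\<bar> \<le> B"
  shows "\<bar>A_inv (l, m1, m2) f x\<bar> \<le> B / (1 - 2 * l)"
proof -
  let ?y = "\<lambda>k. f (x + m2 + real k * (m2 - m1))"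
  have "\<bar>\<Sum>k. (- l / (1 - l)) ^ k * ?y k\<bar> \<le> (\<Sum>k. \<bar>(- l / (1 - l)) ^ k * ?y k\<bar>)"
    by (intro summable_rabs summable_A_inv[OF l, of _ B] f)
  also have "\<dots> \<le> (\<Sum>k. (l / (1 - l)) ^ k * B)"
  proof (intro suminf_le summable_A_inv[OF l, of _ B] f)
    show "summable (\<lambda>k. (l / (1 - l)) ^ k * B)"
      by (intro summable_mult2 summable_ratio l)
    show "\<bar>(- l / (1 - l)) ^ k * ?y k\<bar> \<le> (l / (1 - l)) ^ k * B" for k
      using ratio_bounds(1)[OF l] l f by (simp add: abs_mult power_abs mult_left_mono)
  qed
  also have "\<dots> = (1 - l) / (1 - 2 * l) * B"
    using ratio_bounds[OF l] summable_ratio[OF l] by (simp flip: suminf_mult2)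
  finally show ?thesis
    using l by (simp add: A_inv_eq field_simps)
qed

lemma A_inv_linear:
  assumes l: "0 \<le> l" "l < 1/2" and f: "\<And>x. \<bar>f x\<bar> \<le> B" and g: "\<And>x. \<bar>g x\<bar> \<le> C"
  shows "A_inv (l, m1, m2) (\<lambda>x. a * f x + c * g x) x =
    a * A_inv (l, m1, m2) f x + c * A_inv (l, m1, m2) g x"
proof -
  let ?y = "\<lambda>k. x + m2 + real k * (m2 - m1)" and ?r = "- l / (1 - l)"
  have "(\<Sum>k. ?r ^ k * (a * f (?y k) + c * g (?y k)))
      = (\<Sum>k. a * (?r ^ k * f (?y k)) + c * (?r ^ k * g (?y k)))"
    by (simp add: algebra_simps)
  also have "\<dots> = (\<Sum>k. a * (?r ^ k * f (?y k))) + (\<Sum>k. c * (?r ^ k * g (?y k)))"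
    by (intro suminf_add[symmetric] summable_mult summable_A_inv[OF l, of _ B] summable_A_inv[OF l, of _ C] f g)
  also have "\<dots> = a * (\<Sum>k. ?r ^ k * f (?y k)) + c * (\<Sum>k. ?r ^ k * g (?y k))"
    by (intro arg_cong2[where f = "(+)"] suminf_mult summable_A_inv[OF l, of _ B] summable_A_inv[OF l, of _ C] f g)
  finally show ?thesis
    by (simp add: A_inv_eq add_divide_distrib)
qed

lemma A_inv_diff:
  assumes l: "0 \<le> l" "l < 1/2" and f: "\<And>x. \<bar>f x\<bar> \<le> B" and g: "\<And>x. \<bar>g x\<bar> \<le> C"
  shows "A_inv (l, m1, m2) (\<lambda>x. f x - g x) x = A_inv (l, m1, m2) f x - A_inv (l, m1, m2) g x"
  using A_inv_linear[where a = 1 and c = "-1", OF l f g] by simp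

text \<open>The series telescopes: its k-th term reads f at the k-th and the (k+1)-th point of the
  progression \<open>x + real k * (m2 - m1)\<close>, and the ratio of the series matches the two
  weights of \<open>A_op\<close>. Only the decay of the remainder is assumed, so the lemma serves
  bounded f everywhere and integrable f almost everywhere.\<close>

lemma A_inv_A_op:
  assumes l: "0 \<le> l" "l < 1/2"
    and lim: "(\<lambda>k. (l / (1 - l)) ^ k * f (x + real k * (m2 - m1))) \<longlonglongrightarrow> 0"
  shows "A_inv (l, m1, m2) (A_op (l, m1, m2) f) x = f x"
proof -
  define t where "t k = (- l / (1 - l)) ^ k * f (x + real k * (m2 - m1))" for k
  have "(\<lambda>k. \<bar>t k\<bar>) \<longlonglongrightarrow> 0"
    using tendsto_rabs[OF lim] l by (simp add: t_def abs_mult power_abs)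
  then have "t \<longlonglongrightarrow> 0"
    by (rule tendsto_rabs_zero_cancel)
  then have "(\<lambda>k. t k - t (Suc k)) sums (t 0 - 0)"
    by (rule telescope_sums')
  then have "(\<lambda>k. (1 - l) * (t k - t (Suc k))) sums ((1 - l) * f x)"
    using sums_mult by (fastforce simp: t_def)
  moreover have "(1 - l) * (t k - t (Suc k)) =
      (- l / (1 - l)) ^ k * A_op (l, m1, m2) f (x + m2 + real k * (m2 - m1))" for k
  proof -
    have e: "x + m2 + real k * (m2 - m1) - m1 = x + real (Suc k) * (m2 - m1)"
      "x + m2 + real k * (m2 - m1) - m2 = x + real k * (m2 - m1)"
      by (simp_all add: algebra_simps)
    have "(1 - l) * t (Suc k) = - l * ((- l / (1 - l)) ^ k * f (x + real (Suc k) * (m2 - m1)))"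
      using l by (simp add: t_def)
    then show ?thesis
      unfolding A_op_eq e by (simp add: t_def algebra_simps)
  qed
  ultimately have "(\<Sum>k. (- l / (1 - l)) ^ k * A_op (l, m1, m2) f (x + m2 + real k * (m2 - m1)))
      = (1 - l) * f x"
    by (simp add: sums_iff)
  then show ?thesis
    using l by (simp add: A_inv_eq)
qed

lemma A_inv_A_op_bounded:
  assumes l: "0 \<le> l" "l < 1/2" and f: "\<And>x. \<bar>f x\<bar> \<le> B"
  shows "A_inv (l, m1, m2) (A_op (l, m1, m2) f) x = f x"
proof (rule A_inv_A_op[OF l])
  have "summable (\<lambda>k. \<bar>(- l / (1 - l)) ^ k * f (x + real k * (m2 - m1))\<bar>)"
    by (intro summable_A_inv[OF l, of _ B] f)
  then have "(\<lambda>k. \<bar>(- l / (1 - l)) ^ k * f (x + real k * (m2 - m1))\<bar>) \<longlonglongrightarrow> 0"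
    by (rule summable_LIMSEQ_zero)
  then show "(\<lambda>k. (l / (1 - l)) ^ k * f (x + real k * (m2 - m1))) \<longlonglongrightarrow> 0"
    using l by (subst tendsto_rabs_zero_iff[symmetric]) (simp add: abs_mult power_abs)
qed

text \<open>\<open>A_inv\<close> is linear and commutes with translations, hence with
  \<open>A_op\<close>, so the left inverse is also a right inverse. This direction recovers the
  asymmetry from the residual.\<close>

lemma A_op_A_inv:
  assumes l: "0 \<le> l" "l < 1/2" and f: "\<And>x. \<bar>f x\<bar> \<le> B"
  shows "A_op (l, m1, m2) (A_inv (l, m1, m2) f) x = f x"
proof -
  have "A_op (l, m1, m2) (A_inv (l, m1, m2) f) x =
     l * A_inv (l, m1, m2) (\<lambda>x. f (x + (- m1))) x + (1 - l) * A_inv (l, m1, m2) (\<lambda>x. f (x + (- m2))) x"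
    unfolding A_inv_add_arg A_op_eq by simp
  also have "\<dots> = A_inv (l, m1, m2) (A_op (l, m1, m2) f) x"
    unfolding A_op_eq[abs_def] by (subst A_inv_linear[OF l, symmetric]) (use f in auto)
  also have "\<dots> = f x"
    by (rule A_inv_A_op_bounded[OF l f])
  finally show ?thesis .
qed

text \<open>The integrand of \<open>contrast\<close> before squaring. For the true mixture and the
  true parameter it is 0: \<open>A_inv\<close> returns the symmetric component, which
  \<open>S_r\<close> fixes.\<close>

definition residual :: "real \<times> real \<times> real \<Rightarrow> (real \<Rightarrow> real) \<Rightarrow> real \<Rightarrow> real" where
  "residual \<theta> H x = A_op \<theta> (S_r (A_inv \<theta> H)) x - H x"

definition asymmetry :: "real \<times> real \<times> real \<Rightarrow> (real \<Rightarrow> real) \<Rightarrow> real \<Rightarrow> real" where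
  "asymmetry \<theta> H x = A_op \<theta> (S_r H) x + A_op \<theta> (S_r H) (- x) - 1"

lemma residual_eq:
  "residual (l, m1, m2) H x =
     1 - (l * A_inv (l, m1, m2) H (m1 - x) + (1 - l) * A_inv (l, m1, m2) H (m2 - x)) - H x"
proof -
  have "l * (1 - u) + (1 - l) * (1 - v) = 1 - (l * u + (1 - l) * v)" for u v
    by (simp add: algebra_simps)
  then show ?thesis
    unfolding residual_def A_op_eq S_r_def minus_diff_eq by (simp only:)
qed

text \<open>\<open>A_inv\<close> is applied to the two halves of the asymmetry. On
  \<open>A_op \<theta> (S_r H)\<close> it is a left inverse and returns \<open>S_r H\<close>; the
  reflected half is a combination of translates of H by +m1 and +m2, and translations pass through
  \<open>A_inv\<close>. Together they form the residual at -x.\<close>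

lemma residual_conv_asymmetry:
  assumes l: "0 \<le> l" "l < 1/2" and H: "\<And>x. \<bar>H x\<bar> \<le> B"
  shows "residual (l, m1, m2) H (- x) = A_inv (l, m1, m2) (asymmetry (l, m1, m2) H) x"
proof -
  let ?A = "A_inv (l, m1, m2)"
  have H': "\<bar>S_r H x\<bar> \<le> 1 + B" for x
    using H[of "- x"] by (simp add: S_r_def)
  have A: "\<bar>A_op (l, m1, m2) (S_r H) x\<bar> \<le> 1 + B" for x
  proof -
    have "\<bar>A_op (l, m1, m2) (S_r H) x\<bar> \<le> l * \<bar>S_r H (x - m1)\<bar> + (1 - l) * \<bar>S_r H (x - m2)\<bar>"
      using l unfolding A_op_eq by (intro order.trans[OF abs_triangle_ineq]) (simp add: abs_mult)
    also have "\<dots> \<le> l * (1 + B) + (1 - l) * (1 + B)"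
      using l H' by (intro add_mono mult_left_mono) auto
    finally show ?thesis by (simp add: algebra_simps)
  qed
  have A': "\<bar>l * H (x + m1) + (1 - l) * H (x + m2)\<bar> \<le> B" for x
  proof -
    have "\<bar>l * H (x + m1) + (1 - l) * H (x + m2)\<bar> \<le> l * \<bar>H (x + m1)\<bar> + (1 - l) * \<bar>H (x + m2)\<bar>"
      using l by (intro order.trans[OF abs_triangle_ineq]) (simp add: abs_mult)
    also have "\<dots> \<le> l * B + (1 - l) * B"
      using l H by (intro add_mono mult_left_mono) auto
    finally show ?thesis
      by (simp add: algebra_simps)
  qed
  have "asymmetry (l, m1, m2) H = (\<lambda>x. A_op (l, m1, m2) (S_r H) x - (l * H (x + m1) + (1 - l) * H (x + m2)))"
    by (auto simp: asymmetry_def A_op_eq S_r_def algebra_simps)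
  then have "?A (asymmetry (l, m1, m2) H) x =
      ?A (A_op (l, m1, m2) (S_r H)) x - ?A (\<lambda>x. l * H (x + m1) + (1 - l) * H (x + m2)) x"
    by (simp add: A_inv_diff[OF l A A'])
  also have "?A (A_op (l, m1, m2) (S_r H)) x = S_r H x"
    by (rule A_inv_A_op_bounded[OF l H'])
  also have "?A (\<lambda>x. l * H (x + m1) + (1 - l) * H (x + m2)) x = l * ?A H (x + m1) + (1 - l) * ?A H (x + m2)"
    by (subst A_inv_linear[OF l]) (use H in \<open>auto simp: A_inv_add_arg\<close>)
  finally show ?thesis
    by (simp add: residual_eq S_r_def add.commute)
qed

lemma residual_diff_bound:
  assumes l: "0 \<le> l" "l < 1/2" and H: "\<And>x. \<bar>H x\<bar> \<le> B" "\<And>x. \<bar>K x\<bar> \<le> C"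
    and D: "\<And>x. \<bar>H x - K x\<bar> \<le> \<Delta>"
  shows "\<bar>residual (l, m1, m2) H x - residual (l, m1, m2) K x\<bar> \<le> \<Delta> / (1 - 2 * l) + \<Delta>"
proof -
  let ?A = "A_inv (l, m1, m2)"
  have *: "\<bar>?A H y - ?A K y\<bar> \<le> \<Delta> / (1 - 2 * l)" for y
    using A_inv_bound[OF l D] by (simp add: A_inv_diff[OF l H])
  have "\<bar>residual (l, m1, m2) H x - residual (l, m1, m2) K x\<bar> =
     \<bar>l * (?A K (m1 - x) - ?A H (m1 - x)) + (1 - l) * (?A K (m2 - x) - ?A H (m2 - x)) + (K x - H x)\<bar>"
    by (simp add: residual_eq algebra_simps)
  also have "\<dots> \<le> l * \<bar>?A H (m1 - x) - ?A K (m1 - x)\<bar> + (1 - l) * \<bar>?A H (m2 - x) - ?A K (m2 - x)\<bar> + \<bar>H x - K x\<bar>"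
    using l by (intro order.trans[OF abs_triangle_ineq] add_mono) (auto simp: abs_mult abs_minus_commute)
  also have "\<dots> \<le> l * (\<Delta> / (1 - 2 * l)) + (1 - l) * (\<Delta> / (1 - 2 * l)) + \<Delta>"
    using l * D by (intro add_mono mult_left_mono) auto
  also have "\<dots> = \<Delta> / (1 - 2 * l) + \<Delta>"
    unfolding distrib_right[symmetric] by simp
  finally show ?thesis .
qed

text \<open>Both parts are nonnegative with the same bound C, so that products of parts are again
  monotone and bounded; squares of such functions are then differences of bounded monotone functions
  too.\<close>

definition bounded_variation :: "real \<Rightarrow> (real \<Rightarrow> real) \<Rightarrow> bool" where
  "bounded_variation C h \<longleftrightarrow> (\<exists>U V. mono U \<and> mono V \<and> (\<forall>x. 0 \<le> U x \<and> U x \<le> C) \<and>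
     (\<forall>x. 0 \<le> V x \<and> V x \<le> C) \<and> (\<forall>x. h x = U x - V x))"

lemma bounded_variation_weaken: "bounded_variation C h \<Longrightarrow> C \<le> C' \<Longrightarrow> bounded_variation C' h"
  unfolding bounded_variation_def by (meson order.trans)

lemma bounded_variation_cmult:
  assumes "bounded_variation C h"
  shows "bounded_variation (\<bar>a\<bar> * C) (\<lambda>x. a * h x)"
proof -
  obtain U V where UV: "mono U" "mono V" "\<And>x. 0 \<le> U x \<and> U x \<le> C" "\<And>x. 0 \<le> V x \<and> V x \<le> C"
    and h: "\<And>x. h x = U x - V x"
    using assms unfolding bounded_variation_def by blast
  show ?thesis
  proof (cases "0 \<le> a")
    case True
    then show ?thesis
      unfolding bounded_variation_def using UV
      by (intro exI[of _ "\<lambda>x. a * U x"] exI[of _ "\<lambda>x. a * V x"])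
        (auto simp: h mono_def right_diff_distrib mult_left_mono)
  next
    case False
    then show ?thesis
      unfolding bounded_variation_def using UV
      by (intro exI[of _ "\<lambda>x. - a * V x"] exI[of _ "\<lambda>x. - a * U x"])
        (auto simp: h mono_def right_diff_distrib mult_left_mono_neg mult_le_0_iff)
  qed
qed

lemma bounded_variation_reflect:
  assumes "bounded_variation C h"
  shows "bounded_variation C (\<lambda>x. h (- x))"
proof -
  obtain U V where UV: "mono U" "mono V" "\<And>x. 0 \<le> U x \<and> U x \<le> C" "\<And>x. 0 \<le> V x \<and> V x \<le> C"
    and h: "\<And>x. h x = U x - V x"
    using assms unfolding bounded_variation_def by blast
  show ?thesis
    unfolding bounded_variation_def using UV
    by (intro exI[of _ "\<lambda>x. C - V (- x)"] exI[of _ "\<lambda>x. C - U (- x)"])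
      (auto simp: h mono_def)
qed

text \<open>The ratio of the series is negative, so the monotone parts are regrouped: U enters the
  even terms and V the odd terms of \<open>P U V\<close>, and conversely in \<open>P V U\<close>.
  All weights are then nonnegative and monotonicity survives.\<close>

lemma A_inv_bounded_variation:
  assumes l: "0 \<le> l" "l < 1/2" and h: "bounded_variation C h"
  shows "bounded_variation (C / (1 - 2 * l)) (A_inv (l, m1, m2) h)"
proof -
  obtain U V where UV: "mono U" "mono V" "\<And>x. 0 \<le> U x \<and> U x \<le> C" "\<And>x. 0 \<le> V x \<and> V x \<le> C"
    and h: "\<And>x. h x = U x - V x"
    using h unfolding bounded_variation_def by blast
  define r where "r = l / (1 - l)"
  have r: "0 \<le> r" "r < 1"
    using ratio_bounds[OF l] by (auto simp: r_def)
  define y where "y k x = x + m2 + real k * (m2 - m1)" for k x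
  define P where "P F F' x = (\<Sum>k. r ^ k * (if even k then F (y k x) else F' (y k x))) / (1 - l)"
    for F F' :: "real \<Rightarrow> real" and x
  have sum: "summable (\<lambda>k. r ^ k * (if even k then F (y k x) else F' (y k x)))"
    if "\<And>x. 0 \<le> F x \<and> F x \<le> C" "\<And>x. 0 \<le> F' x \<and> F' x \<le> C" for F F' :: "real \<Rightarrow> real" and x
  proof (rule summable_comparison_test'[where N = 0])
    show "summable (\<lambda>k. r ^ k * C)"
      unfolding r_def by (intro summable_mult2 summable_ratio l)
    show "norm (r ^ k * (if even k then F (y k x) else F' (y k x))) \<le> r ^ k * C" for k
      using r that by (auto intro: mult_left_mono)
  qed
  have mono: "mono (P F F')" if "\<And>x. 0 \<le> F x \<and> F x \<le> C" "\<And>x. 0 \<le> F' x \<and> F' x \<le> C" "mono F" "mono F'" for F F'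
  proof (rule monoI)
    fix x x' :: real assume x: "x \<le> x'"
    then have y: "y k x \<le> y k x'" for k
      by (simp add: y_def)
    show "P F F' x \<le> P F F' x'"
      unfolding P_def using l r monoD[OF \<open>mono F\<close> y] monoD[OF \<open>mono F'\<close> y]
      by (intro divide_right_mono suminf_le sum[OF that(1,2)] mult_left_mono) auto
  qed
  have bd: "0 \<le> P F F' x \<and> P F F' x \<le> C / (1 - 2 * l)"
    if "\<And>x. 0 \<le> F x \<and> F x \<le> C" "\<And>x. 0 \<le> F' x \<and> F' x \<le> C" for F F' x
  proof
    show "0 \<le> P F F' x"
      unfolding P_def using l r that by (intro divide_nonneg_pos suminf_nonneg sum) auto
    have "(\<Sum>k. r ^ k * (if even k then F (y k x) else F' (y k x))) \<le> (\<Sum>k. r ^ k * C)"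
      using r that summable_mult2[OF summable_ratio[OF l], of C]
      by (intro suminf_le sum mult_left_mono) (auto simp: r_def)
    also have "\<dots> = (1 - l) / (1 - 2 * l) * C"
      using ratio_bounds[OF l] summable_ratio[OF l] by (simp add: r_def flip: suminf_mult2)
    finally show "P F F' x \<le> C / (1 - 2 * l)"
      using l by (simp add: P_def field_simps)
  qed
  have "A_inv (l, m1, m2) h x = P U V x - P V U x" for x
  proof -
    have "(- l / (1 - l)) ^ k * h (y k x) = r ^ k * (if even k then U (y k x) else V (y k x)) -
        r ^ k * (if even k then V (y k x) else U (y k x))" for k
    proof -
      have "(- l / (1 - l)) ^ k = (if even k then r ^ k else - (r ^ k))"
        by (simp add: r_def power_minus_odd flip: minus_divide_left)
      then show ?thesis by (simp add: h algebra_simps)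
    qed
    then have "(\<Sum>k. (- l / (1 - l)) ^ k * h (y k x)) =
       (\<Sum>k. r ^ k * (if even k then U (y k x) else V (y k x))) -
       (\<Sum>k. r ^ k * (if even k then V (y k x) else U (y k x)))"
      using suminf_diff[OF sum[of U V x] sum[of V U x]] UV by simp
    then show ?thesis
      by (simp add: A_inv_eq P_def y_def diff_divide_distrib)
  qed
  then show ?thesis
    unfolding bounded_variation_def using UV
    by (intro exI[of _ "P U V"] exI[of _ "P V U"]) (auto intro!: mono simp: bd)
qed

section \<open>Deviations of the empirical distribution\<close>

text \<open>The empirical measure of an arbitrary set. Half-lines give \<open>G_hat\<close>; grid
  cells and their unions are needed for the kernel estimator.\<close>

definition freq :: "nat \<Rightarrow> (nat \<Rightarrow> real) \<Rightarrow> real set \<Rightarrow> real" where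
  "freq n xs B = (\<Sum>i = 1..n. indicator B (xs i)) / real n"

locale iid_sample = prob_space M for M :: "'a measure" +
  fixes X :: "nat \<Rightarrow> 'a \<Rightarrow> real" and N :: "real measure"
  assumes indep: "indep_vars (\<lambda>_. borel) X {1..}"
    and law: "\<And>i. 1 \<le> i \<Longrightarrow> distr M borel (X i) = N"
begin

lemma measurable_X [measurable]: "1 \<le> i \<Longrightarrow> X i \<in> borel_measurable M"
  using indep unfolding indep_vars_def by auto

lemma real_distribution_law: "real_distribution N"
  using real_distribution_distr[OF measurable_X[of 1]] unfolding law[OF order.refl] by simp

sublocale law: real_distribution N
  by (rule real_distribution_law)

lemma measurable_freq [measurable]: "B \<in> sets borel \<Longrightarrow> (\<lambda>\<omega>. freq n (\<lambda>i. X i \<omega>) B) \<in> borel_measurable M"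
  unfolding freq_def
  by (intro borel_measurable_divide borel_measurable_sum borel_measurable_const
      measurable_compose[OF measurable_X borel_measurable_indicator]) auto

lemma expectation_law:
  fixes f :: "real \<Rightarrow> real"
  assumes "f \<in> borel_measurable borel" "1 \<le> i"
  shows "expectation (\<lambda>\<omega>. f (X i \<omega>)) = (LINT y|N. f y)"
  using assms by (simp add: law[symmetric, OF assms(2)] integral_distr)

lemma G_hat_freq: "G_hat n (\<lambda>i. X i \<omega>) x = freq n (\<lambda>i. X i \<omega>) {..x}"
  by (simp add: G_hat_def freq_def indicator_def of_bool_def)

lemma hoeffding_freq:
  assumes B: "B \<in> sets borel" and n: "1 \<le> n" and \<epsilon>: "0 \<le> \<epsilon>"
  shows "prob {\<omega> \<in> space M. \<epsilon> \<le> \<bar>freq n (\<lambda>i. X i \<omega>) B - measure N B\<bar>} \<le> 2 * exp (- 2 * real n * \<epsilon>\<^sup>2)"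
proof -
  define W :: "nat \<Rightarrow> 'a \<Rightarrow> real" where "W i \<omega> = indicator B (X i \<omega>)" for i \<omega>
  have [measurable]: "W i \<in> borel_measurable M" if "1 \<le> i" for i
    unfolding W_def[abs_def] using B that by measurable
  have d: "distr M borel (W i) = distr N borel (indicator B)" if "1 \<le> i" for i
    using B that by (simp add: law[symmetric, OF that] distr_distr comp_def W_def[abs_def])
  interpret H: Hoeffding_ineq_iid M "{1..n}" W "W 1" 0 1 "measure N B"
  proof unfold_locales
    show "indep_vars (\<lambda>_. borel) W {1..n}"
      unfolding W_def[abs_def]
      by (rule indep_vars_compose2[OF indep_vars_subset[OF indep]]) (use B in auto)
    show "measure N B \<equiv> expectation (W 1)"
      using expectation_law[of "indicator B" 1] B by (simp add: W_def[abs_def])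
  qed (auto simp: d W_def)
  show ?thesis
    using H.Hoeffding_ineq_abs_ge'[OF \<epsilon>] n by (simp add: W_def freq_def)
qed

text \<open>\<open>g\<close> may depend on all observations but the i-th, so the mean of the product
  factors and contains the zero mean of f. This yields the orthogonality of the martingale
  increments as well as the vanishing of the mixed terms in the variance.\<close>

lemma expectation_mult_indep:
  fixes f :: "real \<Rightarrow> real" and g :: "(nat \<Rightarrow> real) \<Rightarrow> real"
  assumes f: "f \<in> borel_measurable borel" "\<And>x. \<bar>f x\<bar> \<le> c"
    and g: "g \<in> borel_measurable (PiM ({1..n} - {i}) (\<lambda>_. borel))" "\<And>y. \<bar>g y\<bar> \<le> d"
    and i: "i \<in> {1..n}"
    and f0: "(LINT y|N. f y) = 0"
  shows "expectation (\<lambda>\<omega>. f (X i \<omega>) * g (restrict (\<lambda>j. X j \<omega>) ({1..n} - {i}))) = 0"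
proof -
  have "indep_var (PiM {i} (\<lambda>_. borel)) (\<lambda>\<omega>. restrict (\<lambda>j. X j \<omega>) {i})
     (PiM ({1..n} - {i}) (\<lambda>_. borel)) (\<lambda>\<omega>. restrict (\<lambda>j. X j \<omega>) ({1..n} - {i}))"
    using i by (intro indep_var_restrict[OF indep]) auto
  then have iv: "indep_var borel ((\<lambda>y. f (y i)) \<circ> (\<lambda>\<omega>. restrict (\<lambda>j. X j \<omega>) {i}))
     borel (g \<circ> (\<lambda>\<omega>. restrict (\<lambda>j. X j \<omega>) ({1..n} - {i})))"
    using f g by (intro indep_var_compose) auto
  then have "expectation (\<lambda>\<omega>. f (X i \<omega>) * g (restrict (\<lambda>j. X j \<omega>) ({1..n} - {i}))) =
     expectation (\<lambda>\<omega>. f (X i \<omega>)) * expectation (\<lambda>\<omega>. g (restrict (\<lambda>j. X j \<omega>) ({1..n} - {i})))"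
  proof -
    have "integrable M ((\<lambda>y. f (y i)) \<circ> (\<lambda>\<omega>. restrict (\<lambda>j. X j \<omega>) {i}))"
      using indep_var_rv1[OF iv] f by (intro integrable_const_bound[where B = c]) auto
    moreover have "integrable M (g \<circ> (\<lambda>\<omega>. restrict (\<lambda>j. X j \<omega>) ({1..n} - {i})))"
      using indep_var_rv2[OF iv] g by (intro integrable_const_bound[where B = d]) auto
    ultimately show ?thesis
      using indep_var_lebesgue_integral[OF iv] by (simp add: comp_def)
  qed
  also have "expectation (\<lambda>\<omega>. f (X i \<omega>)) = 0"
    using expectation_law[OF f(1)] f0 i by simp
  finally show ?thesis by (simp only: mult_zero_left)
qed

text \<open>Doob's maximal inequality for the martingale
  \<open>j \<mapsto> \<Sum>i. indicator (B j) (X i) / p j - 1\<close>. Before the first passage the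
  martingale depends on \<open>X i\<close> only through whether \<open>X i \<in> B k\<close>, so that replacing its
  contribution by the value on \<open>B k\<close> makes the passage event independent of \<open>X i\<close>.\<close>

lemma maximal_inequality:
  fixes B :: "nat \<Rightarrow> real set"
  assumes B: "\<And>j. B j \<in> sets borel" and dec: "\<And>j k. j \<le> k \<Longrightarrow> B k \<subseteq> B j"
    and p: "\<And>j. j \<le> m \<Longrightarrow> 1/2 \<le> measure N (B j)" and t: "0 < t"
  shows "prob {\<omega> \<in> space M. \<exists>j\<le>m. t \<le> \<bar>(\<Sum>i = 1..n. indicator (B j) (X i \<omega>) - measure N (B j))\<bar>} \<le> real n / t\<^sup>2"
proof -
  define p where "p j = measure N (B j)" for j
  have p2: "1/2 \<le> p j" "p j \<le> 1" if "j \<le> m" for j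
    using assms(3)[OF that] by (auto simp: p_def)
  \<comment> \<open>Normalised to mean 0. The values are \<open>1 / p j - 1\<close> on
    \<open>B j\<close> and -1 off it, and \<open>1/2 \<le> p j\<close> keeps both in [-1, 1]; this
    is the reason for the lower bound on the masses.\<close>
  define f :: "nat \<Rightarrow> real \<Rightarrow> real" where "f j y = indicator (B j) y / p j - 1" for j y
  have fm [measurable]: "f j \<in> borel_measurable borel" for j
    using B[of j] unfolding f_def[abs_def] by measurable
  have fb: "\<bar>f j y\<bar> \<le> 1" if "j \<le> m" for j y
    using p2[OF that] by (auto simp: f_def indicator_def abs_le_iff field_simps)
  have f0: "(LINT y|N. f j y) = 0" if "j \<le> m" for j
  proof -
    have "(LINT y|N. f j y) = (LINT y|N. indicator (B j) y / p j) - (LINT y|N. 1)"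
      unfolding f_def by (rule Bochner_Integration.integral_diff)
        (use B[of j] in \<open>auto intro!: integrable_real_indicator simp: law.emeasure_eq_measure\<close>)
    then show ?thesis
      using B[of j] p2[OF that] law.prob_space by (simp add: p_def)
  qed
  define z where "z j y = (\<Sum>i = 1..n. f j (y i))" for j and y :: "nat \<Rightarrow> real"
  define Z where "Z j \<omega> = z j (\<lambda>i. X i \<omega>)" for j \<omega>
  have [measurable]: "Z j \<in> borel_measurable M" for j
    unfolding Z_def z_def by (intro borel_measurable_sum measurable_compose[OF measurable_X fm]) auto
  have zb: "\<bar>z j y\<bar> \<le> real n" if "j \<le> m" for j y
    unfolding z_def using sum_mono[of "{1..n}" "\<lambda>i. \<bar>f j (y i)\<bar>" "\<lambda>_. 1"] fb[OF that]
    by (intro order.trans[OF sum_abs]) auto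
  have int: "integrable M (\<lambda>\<omega>. f j (X i \<omega>) * g \<omega>)"
    if "j \<le> m" "1 \<le> i" "g \<in> borel_measurable M" "\<And>\<omega>. \<bar>g \<omega>\<bar> \<le> c" for j i g c
  proof (rule integrable_const_bound[where B = "1 * c"])
    show "AE \<omega> in M. norm (f j (X i \<omega>) * g \<omega>) \<le> 1 * c"
      unfolding real_norm_def abs_mult using fb[OF that(1)] that(4)
      by (intro AE_I2 mult_mono) auto
    show "(\<lambda>\<omega>. f j (X i \<omega>) * g \<omega>) \<in> borel_measurable M"
      by (intro borel_measurable_times measurable_compose[OF measurable_X[OF that(2)] fm] that(3))
  qed
  define pass where "pass k v \<longleftrightarrow> t \<le> \<bar>v k\<bar> \<and> (\<forall>j<k. \<bar>v j\<bar> < t)" for k and v :: "nat \<Rightarrow> real"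
  \<comment> \<open>The martingale at its first passage through the level t, split according to the
    passage index k.\<close>
  define h where "h k \<omega> = (if pass k (\<lambda>j. Z j \<omega>) then Z k \<omega> else 0)" for k \<omega>
  have hm [measurable]: "h k \<in> borel_measurable M" for k
    unfolding h_def pass_def by measurable
  have hb: "\<bar>h k \<omega>\<bar> \<le> real n" if "k \<le> m" for k \<omega>
    using zb[OF that] by (auto simp: h_def Z_def)
  have orth: "expectation (\<lambda>\<omega>. (f m (X i \<omega>) - f k (X i \<omega>)) * h k \<omega>) = 0"
    if k: "k \<le> m" and i: "i \<in> {1..n}" for k i
  proof -
    define z' where "z' j y = (1 / p j - 1) + (\<Sum>i'\<in>{1..n} - {i}. f j (y i'))" for j and y :: "nat \<Rightarrow> real"
    define g where "g y = (if pass k (\<lambda>j. z' j y) then z' k y else 0)" for y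
    have "z' j \<in> borel_measurable (PiM ({1..n} - {i}) (\<lambda>_. borel))" for j
      unfolding z'_def by measurable
    then have gm: "g \<in> borel_measurable (PiM ({1..n} - {i}) (\<lambda>_. borel))"
      unfolding g_def pass_def by measurable
    have gb: "\<bar>g y\<bar> \<le> 1 + real n" for y
    proof -
      have "\<bar>\<Sum>i'\<in>{1..n} - {i}. f k (y i')\<bar> \<le> (\<Sum>i'\<in>{1..n} - {i}. 1)"
        using fb[OF k] by (intro order.trans[OF sum_abs] sum_mono) auto
      also have "\<dots> \<le> real n"
        using i by simp
      finally have "\<bar>\<Sum>i'\<in>{1..n} - {i}. f k (y i')\<bar> \<le> real n" .
      moreover have "\<bar>1 / p k - 1\<bar> \<le> 1"
        using p2[OF k] by (auto simp: abs_le_iff field_simps)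
      ultimately show ?thesis
        by (auto simp: g_def z'_def)
    qed
    have "(f m (X i \<omega>) - f k (X i \<omega>)) * h k \<omega> =
        (f m (X i \<omega>) - f k (X i \<omega>)) * g (restrict (\<lambda>j. X j \<omega>) ({1..n} - {i}))" for \<omega>
    proof (cases "X i \<omega> \<in> B k")
      case True
      have "Z j \<omega> = z' j (restrict (\<lambda>j. X j \<omega>) ({1..n} - {i}))" if "j \<le> k" for j
      proof -
        have "X i \<omega> \<in> B j"
          using True dec[OF that] by auto
        then have "f j (X i \<omega>) = 1 / p j - 1"
          by (simp add: f_def)
        moreover have "Z j \<omega> = f j (X i \<omega>) + (\<Sum>i'\<in>{1..n} - {i}. f j (X i' \<omega>))"
          unfolding Z_def z_def using i by (intro sum.remove) auto
        moreover have "(\<Sum>i'\<in>{1..n} - {i}. f j (X i' \<omega>)) =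
            (\<Sum>i'\<in>{1..n} - {i}. f j (restrict (\<lambda>j. X j \<omega>) ({1..n} - {i}) i'))"
          by (intro sum.cong) auto
        ultimately show ?thesis
          by (simp only: z'_def)
      qed
      then have eqz: "\<And>j. j \<le> k \<Longrightarrow> Z j \<omega> = z' j (restrict (\<lambda>j. X j \<omega>) ({1..n} - {i}))" .
      have "pass k (\<lambda>j. Z j \<omega>) \<longleftrightarrow> pass k (\<lambda>j. z' j (restrict (\<lambda>j. X j \<omega>) ({1..n} - {i})))"
        unfolding pass_def using eqz by (metis less_imp_le order.refl)
      then have "h k \<omega> = g (restrict (\<lambda>j. X j \<omega>) ({1..n} - {i}))"
        unfolding h_def g_def using eqz[of k] by (simp only: order.refl simp_thms if_True)
      then show ?thesis by simp
    next
      case False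
      \<comment> \<open>Off \<open>B k\<close>, and hence off \<open>B m\<close>, both
        \<open>f m\<close> and \<open>f k\<close> equal -1 and their difference is 0, so the other
        factor does not matter.\<close>
      then have "X i \<omega> \<notin> B m"
        using dec[OF k] by auto
      with False show ?thesis by (simp add: f_def)
    qed
    then have "expectation (\<lambda>\<omega>. (f m (X i \<omega>) - f k (X i \<omega>)) * h k \<omega>) =
        expectation (\<lambda>\<omega>. (f m (X i \<omega>) - f k (X i \<omega>)) * g (restrict (\<lambda>j. X j \<omega>) ({1..n} - {i})))"
      by (simp only:)
    also have "\<dots> = 0"
    proof (rule expectation_mult_indep[OF _ _ gm gb i])
      show "\<bar>f m x - f k x\<bar> \<le> 2" for x
        using fb[of m x] fb[OF k, of x] by auto
      have "integrable N (f j)" if "j \<le> m" for j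
        using fb[OF that] by (intro law.integrable_const_bound[where B = 1]) auto
      then show "(LINT y|N. f m y - f k y) = 0"
        using f0 k by (subst Bochner_Integration.integral_diff) auto
    qed simp
    finally show ?thesis .
  qed
  define E where "E = {\<omega> \<in> space M. \<exists>j\<le>m. t \<le> \<bar>Z j \<omega>\<bar>}"
  have Em [measurable]: "E \<in> sets M"
    unfolding E_def by measurable
  \<comment> \<open>On E only the first passage index k contributes to the sum. The claim is then
    \<open>t\<^sup>2 \<le> (Z k \<omega>)\<^sup>2\<close> combined with the expansion of
    \<open>(Z m \<omega>)\<^sup>2\<close> around \<open>Z k \<omega>\<close>, whose square remainder
    is dropped. In expectation the sum vanishes by \<open>orth\<close>.\<close>
  have ptw: "t\<^sup>2 * indicator E \<omega> + 2 * (\<Sum>k\<le>m. (Z m \<omega> - Z k \<omega>) * h k \<omega>) \<le> (Z m \<omega>)\<^sup>2" if "\<omega> \<in> space M" for \<omega>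
  proof (cases "\<omega> \<in> E")
    case False
    then have "h k \<omega> = 0" if "k \<le> m" for k
      using \<open>\<omega> \<in> space M\<close> that by (auto simp: h_def E_def pass_def)
    then show ?thesis
      using False by simp
  next
    case True
    define k where "k = (LEAST k. t \<le> \<bar>Z k \<omega>\<bar>)"
    obtain k0 where k0: "k0 \<le> m" "t \<le> \<bar>Z k0 \<omega>\<bar>"
      using True by (auto simp: E_def)
    have k: "t \<le> \<bar>Z k \<omega>\<bar>"
      unfolding k_def by (rule LeastI[of "\<lambda>k. t \<le> \<bar>Z k \<omega>\<bar>", OF k0(2)])
    have km: "k \<le> m"
      using Least_le[of "\<lambda>k. t \<le> \<bar>Z k \<omega>\<bar>", OF k0(2)] k0(1) unfolding k_def by linarith
    have less: "\<bar>Z j \<omega>\<bar> < t" if "j < k" for j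
      using not_less_Least[OF that[unfolded k_def]] by linarith
    have "h j \<omega> = 0" if "j \<noteq> k" for j
    proof -
      have "\<not> pass j (\<lambda>j. Z j \<omega>)"
        using that k less[of j] by (cases "j < k") (auto simp: pass_def not_le not_less linorder_neq_iff)
      then show ?thesis by (simp add: h_def)
    qed
    then have "(\<Sum>k\<le>m. (Z m \<omega> - Z k \<omega>) * h k \<omega>) = (\<Sum>j\<in>{k}. (Z m \<omega> - Z j \<omega>) * h j \<omega>)"
      using km by (intro sum.mono_neutral_right) auto
    also have "\<dots> = (Z m \<omega> - Z k \<omega>) * Z k \<omega>"
      using k less by (simp add: h_def pass_def)
    finally have eq: "(\<Sum>k\<le>m. (Z m \<omega> - Z k \<omega>) * h k \<omega>) = (Z m \<omega> - Z k \<omega>) * Z k \<omega>" .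
    have "t\<^sup>2 \<le> (Z k \<omega>)\<^sup>2"
      using k t by (simp add: abs_le_square_iff[symmetric])
    moreover have "0 \<le> (Z m \<omega> - Z k \<omega>)\<^sup>2"
      by simp
    ultimately show ?thesis
      unfolding eq using True by (simp add: power2_eq_square algebra_simps)
  qed
  have Zint: "integrable M (\<lambda>\<omega>. (Z m \<omega>)\<^sup>2)"
  proof (rule integrable_const_bound[where B = "(real n)\<^sup>2"])
    show "AE \<omega> in M. norm ((Z m \<omega>)\<^sup>2) \<le> (real n)\<^sup>2"
      using zb[of m] by (auto simp: Z_def abs_le_square_iff[symmetric])
  qed measurable
  have hint: "integrable M (\<lambda>\<omega>. (f m (X i \<omega>) - f k (X i \<omega>)) * h k \<omega>)" if "k \<le> m" "i \<in> {1..n}" for k i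
    unfolding left_diff_distrib using that
    by (intro Bochner_Integration.integrable_diff int[OF _ _ hm hb]) auto
  have eqh: "(Z m \<omega> - Z k \<omega>) * h k \<omega> = (\<Sum>i = 1..n. (f m (X i \<omega>) - f k (X i \<omega>)) * h k \<omega>)" for k \<omega>
    by (simp add: Z_def z_def sum_subtractf flip: sum_distrib_right)
  have hint': "integrable M (\<lambda>\<omega>. (Z m \<omega> - Z k \<omega>) * h k \<omega>)" if "k \<le> m" for k
    unfolding eqh using hint[OF that] by (intro Bochner_Integration.integrable_sum) auto
  have h0: "expectation (\<lambda>\<omega>. (Z m \<omega> - Z k \<omega>) * h k \<omega>) = 0" if "k \<le> m" for k
    unfolding eqh using hint[OF that] orth[OF that] by (subst Bochner_Integration.integral_sum) auto
  \<comment> \<open>The mixed products have mean 0 by independence, and each of the n squares is at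
    most 1.\<close>
  have ZZ: "expectation (\<lambda>\<omega>. (Z m \<omega>)\<^sup>2) \<le> real n"
  proof -
    have c: "expectation (\<lambda>\<omega>. f m (X i \<omega>) * f m (X j \<omega>)) \<le> (if i = j then 1 else 0)"
      if ij: "i \<in> {1..n}" "j \<in> {1..n}" for i j
    proof (cases "i = j")
      case True
      have "expectation (\<lambda>\<omega>. f m (X i \<omega>) * f m (X i \<omega>)) \<le> expectation (\<lambda>_. 1)"
      proof (rule integral_mono)
        show "integrable M (\<lambda>\<omega>. f m (X i \<omega>) * f m (X i \<omega>))"
          using ij fb by (intro int[of _ _ _ 1]) auto
        show "f m (X i \<omega>) * f m (X i \<omega>) \<le> 1" for \<omega>
          using abs_square_le_1[of "f m (X i \<omega>)"] fb[of m "X i \<omega>"] by (simp add: power2_eq_square)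
      qed simp
      then show ?thesis using True prob_space by simp
    next
      case False
      have "expectation (\<lambda>\<omega>. f m (X i \<omega>) * f m ((restrict (\<lambda>j. X j \<omega>) ({1..n} - {i})) j)) = 0"
        by (rule expectation_mult_indep[where g = "\<lambda>y. f m (y j)"]) (use ij False fb f0 in auto)
      then show ?thesis
        using ij False by simp
    qed
    have "(\<lambda>\<omega>. (Z m \<omega>)\<^sup>2) = (\<lambda>\<omega>. \<Sum>i = 1..n. \<Sum>j = 1..n. f m (X i \<omega>) * f m (X j \<omega>))"
      by (simp add: Z_def z_def power2_eq_square sum_product)
    then have "expectation (\<lambda>\<omega>. (Z m \<omega>)\<^sup>2) =
        (\<Sum>i = 1..n. \<Sum>j = 1..n. expectation (\<lambda>\<omega>. f m (X i \<omega>) * f m (X j \<omega>)))"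
    proof -
      have i: "integrable M (\<lambda>\<omega>. f m (X i \<omega>) * f m (X j \<omega>))" if "i \<in> {1..n}" "j \<in> {1..n}" for i j
        using that fb by (intro int[of _ _ _ 1] measurable_compose[OF measurable_X fm]) auto
      have "expectation (\<lambda>\<omega>. \<Sum>i = 1..n. \<Sum>j = 1..n. f m (X i \<omega>) * f m (X j \<omega>)) =
          (\<Sum>i = 1..n. expectation (\<lambda>\<omega>. \<Sum>j = 1..n. f m (X i \<omega>) * f m (X j \<omega>)))"
        by (intro Bochner_Integration.integral_sum Bochner_Integration.integrable_sum i)
      also have "\<dots> = (\<Sum>i = 1..n. \<Sum>j = 1..n. expectation (\<lambda>\<omega>. f m (X i \<omega>) * f m (X j \<omega>)))"
        by (intro sum.cong refl Bochner_Integration.integral_sum i)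
      finally show ?thesis
        using \<open>(\<lambda>\<omega>. (Z m \<omega>)\<^sup>2) = _\<close> by (simp only:)
    qed
    also have "\<dots> \<le> (\<Sum>i = 1..n. \<Sum>j = 1..n. if i = j then 1 else 0)"
      using c by (intro sum_mono) auto
    also have "\<dots> = real n"
      by simp
    finally show ?thesis .
  qed
  have iE: "integrable M (\<lambda>\<omega>. t\<^sup>2 * indicator E \<omega>)"
    by (intro integrable_mult_right integrable_real_indicator Em) (simp add: emeasure_eq_measure)
  have iS: "integrable M (\<lambda>\<omega>. \<Sum>k\<le>m. (Z m \<omega> - Z k \<omega>) * h k \<omega>)"
    using hint' by (intro Bochner_Integration.integrable_sum) auto
  have "expectation (\<lambda>\<omega>. \<Sum>k\<le>m. (Z m \<omega> - Z k \<omega>) * h k \<omega>) =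
      (\<Sum>k\<le>m. expectation (\<lambda>\<omega>. (Z m \<omega> - Z k \<omega>) * h k \<omega>))"
    using hint' by (intro Bochner_Integration.integral_sum) auto
  also have "\<dots> = 0"
    using h0 by (intro sum.neutral) auto
  finally have "t\<^sup>2 * prob E = expectation (\<lambda>\<omega>. t\<^sup>2 * indicator E \<omega> + 2 * (\<Sum>k\<le>m. (Z m \<omega> - Z k \<omega>) * h k \<omega>))"
    using iE iS Em by (simp add: Int_absorb2 sets.sets_into_space)
  also have "\<dots> \<le> expectation (\<lambda>\<omega>. (Z m \<omega>)\<^sup>2)"
    by (intro integral_mono Bochner_Integration.integrable_add integrable_mult_right iE iS Zint ptw)
  also note ZZ
  finally have "prob E \<le> real n / t\<^sup>2"
    using t by (simp add: field_simps)
  moreover have "{\<omega> \<in> space M. \<exists>j\<le>m. t \<le> \<bar>(\<Sum>i = 1..n. indicator (B j) (X i \<omega>) - measure N (B j))\<bar>} \<subseteq> E"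
  proof clarsimp
    fix \<omega> j assume \<omega>: "\<omega> \<in> space M" and j: "j \<le> m"
      and le: "t \<le> \<bar>(\<Sum>i = Suc 0..n. indicator (B j) (X i \<omega>) - measure N (B j))\<bar>"
    \<comment> \<open>Undoing the normalisation multiplies by \<open>p j \<le> 1\<close>, which can
      only lower the absolute value, so the bound for Z covers the raw deviations.\<close>
    have "indicator (B j) y - measure N (B j) = p j * f j y" for y
      using p2[OF j] by (simp add: f_def p_def[symmetric] field_simps)
    then have "(\<Sum>i = Suc 0..n. indicator (B j) (X i \<omega>) - measure N (B j)) = p j * Z j \<omega>"
      by (simp add: Z_def z_def sum_distrib_left)
    then have "t \<le> p j * \<bar>Z j \<omega>\<bar>"
      using le p2[OF j] by (simp add: abs_mult)
    also have "\<dots> \<le> 1 * \<bar>Z j \<omega>\<bar>"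
      using p2[OF j] by (intro mult_right_mono) auto
    finally show "\<omega> \<in> E"
      using \<omega> j by (auto simp: E_def)
  qed
  ultimately show ?thesis
    using finite_measure_mono[OF _ Em] by (meson order.trans)
qed

section \<open>Comparison of the empirical and the true c.d.f. at quantiles\<close>

lemma law_quantiles:
  assumes cont: "continuous_on UNIV (cdf N)" and n: "1 \<le> n"
  obtains x where "\<And>j. j \<in> {1..<n} \<Longrightarrow> cdf N (x j) = real j / real n"
proof -
  have "\<exists>y. cdf N y = real j / real n" if j: "j \<in> {1..<n}" for j
  proof -
    have "eventually (\<lambda>y. cdf N y < real j / real n) at_bot"
      using law.cdf_lim_at_bot j by (intro order_tendstoD) auto
    moreover have "eventually (\<lambda>y. y \<le> (0::real)) at_bot"
      by (rule eventually_le_at_bot)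
    ultimately obtain a where a: "cdf N a < real j / real n" "a \<le> 0"
      by (metis (mono_tags, lifting) eventually_at_bot_linorder linear order.trans)
    have "eventually (\<lambda>y. real j / real n < cdf N y) at_top"
      using law.cdf_lim_at_top_prob j by (intro order_tendstoD) auto
    then obtain b where b: "real j / real n < cdf N b" "0 \<le> b"
      by (metis (mono_tags, lifting) eventually_at_top_linorder linear order.trans)
    show ?thesis
      using IVT'[of "cdf N" a "real j / real n" b] a b continuous_on_subset[OF cont] by auto
  qed
  then show ?thesis
    using that by metis
qed

text \<open>\<open>F\<close> and \<open>G\<close> need only be compared at the \<open>n\<close>-quantiles \<open>x j\<close> of \<open>G\<close>.\<close>

lemma deviation_from_grid:
  fixes F G :: "real \<Rightarrow> real"
  assumes F: "mono F" "\<And>y. 0 \<le> F y" "\<And>y. F y \<le> 1"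
    and G: "strict_mono G" "\<And>y. 0 \<le> G y" "\<And>y. G y \<le> 1" and n: "1 \<le> n" and t: "0 \<le> t"
    and x: "\<And>j. j \<in> {1..<n} \<Longrightarrow> G (x j) = real j / real n"
    and dev: "\<And>j. j \<in> {1..<n} \<Longrightarrow> \<bar>F (x j) - real j / real n\<bar> \<le> t"
  shows "\<bar>F y - G y\<bar> \<le> t + 1 / real n"
proof -
  \<comment> \<open>G y lies in [j/n, (j+1)/n). The value j = n, attained when G y = 1, has no
    quantile of its own and needs separate treatment.\<close>
  define j where "j = nat \<lfloor>real n * G y\<rfloor>"
  have "real j \<le> real n * G y" "real n * G y < real j + 1"
    using G(2)[of y] n by (auto simp: j_def)
  then have j: "real j / real n \<le> G y" "G y < (real j + 1) / real n"
    using n by (auto simp: field_simps)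
  have "F y - G y \<le> t + 1 / real n"
  proof (cases "j + 1 < n")
    case True
    then have "G y < G (x (j + 1))"
      using x[of "j + 1"] j by (simp add: add.commute)
    then have "F y \<le> F (x (j + 1))"
      using strict_mono_less[OF G(1)] monoD[OF F(1)] by (metis less_imp_le)
    also have "\<dots> \<le> real (j + 1) / real n + t"
      using dev[of "j + 1"] True by auto
    finally show ?thesis
      using j by (simp add: add_divide_distrib)
  next
    case False
    then have "1 \<le> (real j + 1) / real n"
      using n by (simp add: field_simps)
    then show ?thesis
      using j t F(3)[of y] by (simp add: add_divide_distrib)
  qed
  moreover have "G y - F y \<le> t + 1 / real n"
  proof (cases "1 \<le> j \<and> j < n")
    case True
    then have "G (x j) \<le> G y"
      using x[of j] j by simp
    then have "F (x j) \<le> F y"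
      using strict_mono_less_eq[OF G(1)] monoD[OF F(1)] by blast
    moreover have "real j / real n - t \<le> F (x j)"
      using dev[of j] True by auto
    ultimately show ?thesis
      using j by (simp add: add_divide_distrib)
  next
    case False
    show ?thesis
    proof (cases "j = 0")
      case True
      then show ?thesis
        using j F(2)[of y] t by simp
    next
      case 2: False
      with False have "real n \<le> real j"
        by simp
      then have "1 \<le> real j / real n"
        using n by simp
      then have "1 \<le> G y"
        using j by simp
      then have "\<And>k. k \<in> {1..<n} \<Longrightarrow> x k \<le> y"
        using x strict_mono_less_eq[OF G(1)] G(3) by (metis order.trans)
      \<comment> \<open>Here G y = 1, and the last quantile \<open>x (n - 1)\<close> stands in for
        y. For n = 1 there is no quantile, and the slack \<open>1 / real n\<close> is enough by
        itself.\<close>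
      show ?thesis
      proof (cases "n = 1")
        case True
        then show ?thesis
          using F(2)[of y] G(3)[of y] t by simp
      next
        case False
        have "real (n - 1) / real n - t \<le> F (x (n - 1))"
        proof -
          have "\<bar>F (x (n - 1)) - real (n - 1) / real n\<bar> \<le> t"
            by (rule dev) (use False n in auto)
          then show ?thesis
            by linarith
        qed
        also have "\<dots> \<le> F y"
          using \<open>\<And>k. k \<in> {1..<n} \<Longrightarrow> x k \<le> y\<close>[of "n - 1"] False n monoD[OF F(1)] by auto
        finally show ?thesis
          using G(3)[of y] n by (simp add: diff_divide_distrib of_nat_diff)
      qed
    qed
  qed
  ultimately show ?thesis
    by (simp add: abs_le_iff)
qed

lemma G_hat_props:
  assumes "1 \<le> n"
  shows "mono (G_hat n xs)" "0 \<le> G_hat n xs y" "G_hat n xs y \<le> 1"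
proof -
  show "mono (G_hat n xs)"
    unfolding G_hat_def mono_def by (intro allI impI mult_left_mono sum_mono) auto
  show "0 \<le> G_hat n xs y"
    unfolding G_hat_def by (intro mult_nonneg_nonneg sum_nonneg) auto
  have "(\<Sum>i = 1..n. if xs i \<le> y then 1 else 0) \<le> (\<Sum>i = 1..n. 1 :: real)"
    by (intro sum_mono) auto
  then show "G_hat n xs y \<le> 1"
    using assms by (simp add: G_hat_def field_simps)
qed

text \<open>The maximal inequality requires decreasing sets of mass at least 1/2. Quantiles of index
  up to n/2 are therefore handled through their upper half-lines, and the remaining ones through
  their lower half-lines, with the index counted downwards from n.\<close>

lemma G_hat_deviation_in_probability:
  assumes cont: "continuous_on UNIV (cdf N)" and mono: "strict_mono (cdf N)" and \<epsilon>: "0 < \<epsilon>"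
  obtains C where "0 < C" "\<And>n. 1 \<le> n \<Longrightarrow> \<exists>E\<in>events. prob E \<le> \<epsilon> \<and>
    (\<forall>\<omega>\<in>space M - E. \<forall>y. \<bar>G_hat n (\<lambda>i. X i \<omega>) y - cdf N y\<bar> \<le> C / sqrt (real n))"
proof
  \<comment> \<open>Each of the two passage events has probability at most
    \<open>real n / t\<^sup>2\<close>, which is \<open>1 / c\<^sup>2\<close>, half of \<epsilon>.
    The extra 1 in the final constant absorbs the grid error, as \<open>1 / real n\<close> is at
    most \<open>1 / sqrt (real n)\<close>.\<close>
  define c where "c = sqrt (2 / \<epsilon>)"
  have c: "0 < c" "2 / c\<^sup>2 = \<epsilon>"
    using \<epsilon> by (auto simp: c_def)
  then show "0 < c + 1" by simp
  fix n :: nat assume n: "1 \<le> n"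
  obtain x where x: "\<And>j. j \<in> {1..<n} \<Longrightarrow> cdf N (x j) = real j / real n"
    using law_quantiles[OF cont n] by blast
  have xle: "x i \<le> x j" if "i \<in> {1..<n}" "j \<in> {1..<n}" "i \<le> j" for i j
  proof -
    have "cdf N (x i) \<le> cdf N (x j)"
      using x[OF that(1)] x[OF that(2)] that(3) by (simp add: divide_right_mono)
    then show ?thesis
      using strict_mono_less_eq[OF mono] by blast
  qed
  define m where "m = n div 2"
  define t where "t = c * sqrt (real n)"
  have t: "0 < t" "real n / t\<^sup>2 = 1 / c\<^sup>2"
    using c n by (auto simp: t_def power_mult_distrib)
  define S where "S B \<omega> = (\<Sum>i = 1..n. indicator B (X i \<omega>) - measure N B)" for B \<omega>
  \<comment> \<open>Index 0 is the whole line, with deviation 0, and indices beyond m repeat the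
    m-th set, so the family decreases over all indices. For n = 1, when m = 0 and there is no
    quantile, only the whole line is looked at.\<close>
  define B1 where "B1 j = (if j = 0 then UNIV else {x (min j m)<..})" for j
  define B2 where "B2 j = (if j = 0 then UNIV else {..x (n - min j m)})" for j
  have m1: "measure N {x j<..} = 1 - real j / real n" if "j \<in> {1..<n}" for j
    using law.prob_compl[of "{..x j}"] x[OF that] by (simp add: cdf_def Compl_eq_Diff_UNIV[symmetric] Compl_atMost)
  have P1: "prob {\<omega> \<in> space M. \<exists>j\<le>m. t \<le> \<bar>S (B1 j) \<omega>\<bar>} \<le> real n / t\<^sup>2"
    unfolding S_def
  proof (rule maximal_inequality[OF _ _ _ t(1)])
    show "B1 k \<subseteq> B1 j" if "j \<le> k" for j k
    proof (cases "j = 0 \<or> m = 0")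
      case False
      then have "x (min j m) \<le> x (min k m)"
        using that by (intro xle) (auto simp: m_def min_def)
      then show ?thesis
        using that by (auto simp: B1_def)
    qed (use that in \<open>auto simp: B1_def\<close>)
    show "1/2 \<le> measure N (B1 j)" if "j \<le> m" for j
    proof (cases "j = 0")
      case False
      then have "real j \<le> real n / 2"
        using that by (auto simp: m_def)
      then show ?thesis
        using False that m1[of j] n by (auto simp: B1_def m_def min_def divide_le_eq)
    qed (use law.prob_space in \<open>simp add: B1_def\<close>)
  qed (auto simp: B1_def)
  have P2: "prob {\<omega> \<in> space M. \<exists>j\<le>m. t \<le> \<bar>S (B2 j) \<omega>\<bar>} \<le> real n / t\<^sup>2"
    unfolding S_def
  proof (rule maximal_inequality[OF _ _ _ t(1)])
    show "B2 k \<subseteq> B2 j" if "j \<le> k" for j k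
    proof (cases "j = 0 \<or> m = 0")
      case False
      then have "x (n - min k m) \<le> x (n - min j m)"
        using that by (intro xle) (auto simp: m_def min_def)
      then show ?thesis
        using that by (auto simp: B2_def)
    qed (use that in \<open>auto simp: B2_def\<close>)
    show "1/2 \<le> measure N (B2 j)" if "j \<le> m" for j
    proof (cases "j = 0")
      case False
      then have "real j \<le> real n / 2" "n - j \<in> {1..<n}"
        using that by (auto simp: m_def)
      then show ?thesis
        using False that x[of "n - j"] n
        by (auto simp: B2_def m_def cdf_def min_def of_nat_diff le_divide_eq)
    qed (use law.prob_space in \<open>simp add: B2_def\<close>)
  qed (auto simp: B2_def)
  define E where "E = {\<omega> \<in> space M. \<exists>j\<le>m. t \<le> \<bar>S (B1 j) \<omega>\<bar>} \<union>
     {\<omega> \<in> space M. \<exists>j\<le>m. t \<le> \<bar>S (B2 j) \<omega>\<bar>}"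
  have meas: "{\<omega> \<in> space M. \<exists>j\<le>m. t \<le> \<bar>S (B j) \<omega>\<bar>} \<in> events"
    if "\<And>j. B j \<in> sets borel" for B :: "nat \<Rightarrow> real set"
  proof -
    have [measurable]: "S (B j) \<in> borel_measurable M" for j
      unfolding S_def[abs_def] by (intro borel_measurable_sum borel_measurable_diff borel_measurable_const
          measurable_compose[OF measurable_X borel_measurable_indicator] that) auto
    show ?thesis by measurable
  qed
  have Bm: "B1 j \<in> sets borel" "B2 j \<in> sets borel" for j
    by (auto simp: B1_def B2_def)
  have "E \<in> events"
    unfolding E_def by (intro sets.Un meas Bm)
  moreover have "prob E \<le> real n / t\<^sup>2 + real n / t\<^sup>2"
    unfolding E_def by (rule order.trans[OF measure_Un_le[OF meas[OF Bm(1)] meas[OF Bm(2)]] add_mono[OF P1 P2]])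
  moreover have "real n / t\<^sup>2 + real n / t\<^sup>2 = \<epsilon>"
    unfolding t(2) using c by simp
  moreover have "\<bar>G_hat n (\<lambda>i. X i \<omega>) y - cdf N y\<bar> \<le> (c + 1) / sqrt (real n)" if \<omega>: "\<omega> \<in> space M - E" for \<omega> y
  proof -
    have "\<bar>G_hat n (\<lambda>i. X i \<omega>) (x j) - real j / real n\<bar> \<le> c / sqrt (real n)" if j: "j \<in> {1..<n}" for j
    proof -
      have sum_le: "(\<Sum>i = 1..n. indicator {..x j} (X i \<omega>)) = real n * G_hat n (\<lambda>i. X i \<omega>) (x j)"
        using n by (simp add: G_hat_freq freq_def)
      have "\<bar>real n * G_hat n (\<lambda>i. X i \<omega>) (x j) - real j\<bar> < t"
      proof (cases "j \<le> m")
        case True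
        then have "\<bar>S (B1 j) \<omega>\<bar> < t"
          using \<omega> unfolding E_def not_le[symmetric] by blast
        moreover have "indicator (B1 j) y = 1 - (indicator {..x j} y :: real)" for y :: real
          using True j by (auto simp: B1_def indicator_def)
        moreover have "measure N (B1 j) = 1 - real j / real n"
          using True j m1[OF j] by (simp add: B1_def)
        ultimately show ?thesis
          using n sum_le by (simp add: S_def sum_subtractf abs_minus_commute right_diff_distrib)
      next
        case False
        then have "n - j \<le> m" "n - j \<noteq> 0" "n - (n - j) = j"
          using j by (auto simp: m_def)
        moreover from this have "\<bar>S (B2 (n - j)) \<omega>\<bar> < t"
          using \<omega> unfolding E_def not_le[symmetric] by blast
        moreover have "B2 (n - j) = {..x j}"
          using calculation by (simp add: B2_def)
        moreover have "measure N {..x j} = real j / real n"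
          using x[OF j] by (simp add: cdf_def)
        ultimately show ?thesis
          using n sum_le by (simp add: S_def sum_subtractf)
      qed
      moreover have "real n * G_hat n (\<lambda>i. X i \<omega>) (x j) - real j = real n * (G_hat n (\<lambda>i. X i \<omega>) (x j) - real j / real n)"
        using n by (simp add: field_simps)
      ultimately have "real n * \<bar>G_hat n (\<lambda>i. X i \<omega>) (x j) - real j / real n\<bar> < t"
        by (simp only: abs_mult abs_of_nat)
      then have "\<bar>G_hat n (\<lambda>i. X i \<omega>) (x j) - real j / real n\<bar> < t / real n"
        using n by (simp add: field_simps)
      also have "t / real n = c / sqrt (real n)"
        using n by (simp add: t_def real_div_sqrt field_simps)
      finally show ?thesis by simp
    qed
    then have "\<bar>G_hat n (\<lambda>i. X i \<omega>) y - cdf N y\<bar> \<le> c / sqrt (real n) + 1 / real n"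
      using c by (intro deviation_from_grid[OF _ _ _ mono _ _ n _ x] G_hat_props n law.cdf_nonneg law.cdf_bounded_prob) auto
    also have "1 / real n \<le> 1 / sqrt (real n)"
      using n by (intro divide_left_mono) (auto intro!: real_le_lsqrt simp: power2_eq_square)
    finally show ?thesis
      by (simp add: add_divide_distrib)
  qed
  ultimately show "\<exists>E\<in>events. prob E \<le> \<epsilon> \<and>
    (\<forall>\<omega>\<in>space M - E. \<forall>y. \<bar>G_hat n (\<lambda>i. X i \<omega>) y - cdf N y\<bar> \<le> (c + 1) / sqrt (real n))"
    by (intro bexI[of _ E]) auto
qed

text \<open>A union bound over fewer than n quantiles multiplies the Hoeffding tail
  \<open>2 * exp (- 2 * real n powr (2 * \<alpha>))\<close> by at most n. This stays summable for
  every positive \<alpha>, so Borel-Cantelli applies; the grid comparison adds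
  \<open>1 / real n\<close>.\<close>

lemma G_hat_deviation_AE:
  assumes cont: "continuous_on UNIV (cdf N)" and mono: "strict_mono (cdf N)" and \<alpha>: "0 < \<alpha>"
  shows "AE \<omega> in M. eventually (\<lambda>n. \<forall>y. \<bar>G_hat n (\<lambda>i. X i \<omega>) y - cdf N y\<bar> \<le>
    real n powr (- 1/2 + \<alpha>) + 1 / real n) sequentially"
proof -
  define e where "e n = real n powr (- 1/2 + \<alpha>)" for n :: nat
  have "\<exists>x. \<forall>j\<in>{1..<n}. cdf N (x j) = real j / real n" for n
  proof (cases "1 \<le> n")
    case True
    show ?thesis by (rule law_quantiles[OF cont True]) blast
  qed auto
  then obtain x where x: "\<And>n j. j \<in> {1..<n} \<Longrightarrow> cdf N (x n j) = real j / real n"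
    by metis
  define A where "A n = (\<Union>j\<in>{1..<n}. {\<omega> \<in> space M. e n \<le> \<bar>freq n (\<lambda>i. X i \<omega>) {..x n j} - measure N {..x n j}\<bar>})" for n
  have [measurable]: "A n \<in> events" for n
    unfolding A_def by measurable
  have bd: "prob (A n) \<le> real n * (2 * exp (- 2 * real n powr (2 * \<alpha>)))" if n: "1 \<le> n" for n
  proof -
    have "prob (A n) \<le> (\<Sum>j\<in>{1..<n}. prob {\<omega> \<in> space M. e n \<le> \<bar>freq n (\<lambda>i. X i \<omega>) {..x n j} - measure N {..x n j}\<bar>})"
      unfolding A_def by (intro finite_measure_subadditive_finite) auto
    also have "\<dots> \<le> (\<Sum>j\<in>{1..<n}. 2 * exp (- 2 * real n * (e n)\<^sup>2))"
      by (intro sum_mono hoeffding_freq n) (auto simp: e_def)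
    also have "(\<Sum>j\<in>{1..<n}. 2 * exp (- 2 * real n * (e n)\<^sup>2)) \<le> real n * (2 * exp (- 2 * real n * (e n)\<^sup>2))"
      by (simp add: mult_right_mono)
    also have "- 2 * real n * (e n)\<^sup>2 = - 2 * real n powr (2 * \<alpha>)"
    proof -
      have "real n * (e n)\<^sup>2 = real n powr 1 * (real n powr (- 1/2 + \<alpha>) * real n powr (- 1/2 + \<alpha>))"
        using n by (simp add: e_def power2_eq_square)
      also have "\<dots> = real n powr (2 * \<alpha>)"
        unfolding powr_add[symmetric] by simp
      finally show ?thesis by simp
    qed
    finally show ?thesis .
  qed
  have "eventually (\<lambda>n. real n * (2 * exp (- 2 * real n powr (2 * \<alpha>))) \<le> 1 / real n ^ 2) sequentially"
    using \<alpha> by real_asymp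
  then have ev: "eventually (\<lambda>n. norm (prob (A n)) \<le> 1 / real n ^ 2) sequentially"
    using eventually_ge_at_top[of 1]
  proof eventually_elim
    case (elim n)
    then show ?case using bd[of n] by simp
  qed
  have "summable (\<lambda>n. prob (A n))"
    by (rule summable_comparison_test_ev[OF ev]) (rule inverse_power_summable[of 2, simplified inverse_eq_divide], simp)
  then have "AE \<omega> in M. eventually (\<lambda>n. \<omega> \<in> space M - A n) sequentially"
    by (intro borel_cantelli_AE1) (auto simp: emeasure_eq_measure)
  then show ?thesis
  proof eventually_elim
    case (elim \<omega>)
    then show ?case
      using eventually_ge_at_top[of 1]
    proof eventually_elim
      case (elim n)
      have "\<bar>G_hat n (\<lambda>i. X i \<omega>) y - cdf N y\<bar> \<le> e n + 1 / real n" for y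
      proof (rule deviation_from_grid[OF _ _ _ mono _ _ _ _ x])
        fix j assume j: "j \<in> {1..<n}"
        then have "\<bar>freq n (\<lambda>i. X i \<omega>) {..x n j} - measure N {..x n j}\<bar> < e n"
          using elim by (auto simp: A_def not_le)
        then show "\<bar>G_hat n (\<lambda>i. X i \<omega>) (x n j) - real j / real n\<bar> \<le> e n"
          using x[OF j] by (simp add: G_hat_freq cdf_def)
      qed (use elim in \<open>auto intro!: G_hat_props law.cdf_nonneg law.cdf_bounded_prob simp: e_def\<close>)
      then show ?case
        by (simp add: e_def)
    qed
  qed
qed

text \<open>The sum of absolute deviations over the cells equals the deviation of the union of the
  cells with nonnegative deviation minus that of the union of the others. It is thus at most twice
  the largest deviation over all \<open>2 ^ card S\<close> unions.\<close>

lemma finite_partition_deviation: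
  fixes T :: "real \<Rightarrow> real"
  assumes T: "T \<in> borel_measurable borel" and S: "finite S" "range T \<subseteq> S" and n: "1 \<le> n" and \<epsilon>: "0 \<le> \<epsilon>"
  obtains E where "E \<in> events" "prob E \<le> 2 ^ card S * (2 * exp (- 2 * real n * \<epsilon>\<^sup>2))"
    "\<And>\<omega>. \<omega> \<in> space M - E \<Longrightarrow> (\<Sum>s\<in>S. \<bar>freq n (\<lambda>i. X i \<omega>) (T -` {s}) - measure N (T -` {s})\<bar>) \<le> 2 * \<epsilon>"
proof
  have TB: "T -` B \<in> sets borel" if "B \<subseteq> S" for B
    using measurable_sets[OF T, of B] finite_imp_closed[OF finite_subset[OF that S(1)]] by simp
  define E where "E = (\<Union>B\<in>Pow S. {\<omega> \<in> space M. \<epsilon> \<le> \<bar>freq n (\<lambda>i. X i \<omega>) (T -` B) - measure N (T -` B)\<bar>})"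
  have m: "{\<omega> \<in> space M. \<epsilon> \<le> \<bar>freq n (\<lambda>i. X i \<omega>) (T -` B) - measure N (T -` B)\<bar>} \<in> events" if "B \<subseteq> S" for B
    using TB[OF that] by measurable
  show "E \<in> events"
    unfolding E_def using S m by (intro sets.finite_UN) auto
  have "prob E \<le> (\<Sum>B\<in>Pow S. prob {\<omega> \<in> space M. \<epsilon> \<le> \<bar>freq n (\<lambda>i. X i \<omega>) (T -` B) - measure N (T -` B)\<bar>})"
    unfolding E_def using S m by (intro finite_measure_subadditive_finite) auto
  also have "\<dots> \<le> (\<Sum>B\<in>Pow S. 2 * exp (- 2 * real n * \<epsilon>\<^sup>2))"
    using TB n \<epsilon> by (intro sum_mono hoeffding_freq) auto
  also have "\<dots> = 2 ^ card S * (2 * exp (- 2 * real n * \<epsilon>\<^sup>2))"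
    using S by (simp add: card_Pow)
  finally show "prob E \<le> 2 ^ card S * (2 * exp (- 2 * real n * \<epsilon>\<^sup>2))" .
  fix \<omega> assume \<omega>: "\<omega> \<in> space M - E"
  define \<Delta> where "\<Delta> B = freq n (\<lambda>i. X i \<omega>) (T -` B) - measure N (T -` B)" for B
  have \<Delta>: "\<bar>\<Delta> B\<bar> \<le> \<epsilon>" if "B \<subseteq> S" for B
    using \<omega> that by (auto simp: E_def \<Delta>_def not_le less_imp_le)
  have add: "(\<Sum>s\<in>B. \<Delta> {s}) = \<Delta> B" if "B \<subseteq> S" for B
  proof -
    have fin: "finite B"
      using that S finite_subset by auto
    have ind: "indicator (T -` B) y = (\<Sum>s\<in>B. indicator (T -` {s}) y :: real)" for y
      using fin by (auto simp: indicator_def)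
    have "freq n (\<lambda>i. X i \<omega>) (T -` B) = (\<Sum>s\<in>B. freq n (\<lambda>i. X i \<omega>) (T -` {s}))"
      unfolding freq_def ind sum_divide_distrib by (rule sum.swap)
    moreover have "measure N (\<Union>s\<in>B. T -` {s}) = (\<Sum>s\<in>B. measure N (T -` {s}))"
      using fin TB that by (intro law.finite_measure_finite_Union) (auto simp: disjoint_family_on_def)
    moreover have "(\<Union>s\<in>B. T -` {s}) = T -` B"
      by auto
    ultimately show ?thesis
      by (simp add: \<Delta>_def sum_subtractf)
  qed
  define P where "P = {s \<in> S. 0 \<le> \<Delta> {s}}"
  have "(\<Sum>s\<in>S. \<bar>\<Delta> {s}\<bar>) = (\<Sum>s\<in>P. \<bar>\<Delta> {s}\<bar>) + (\<Sum>s\<in>S - P. \<bar>\<Delta> {s}\<bar>)"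
    using sum.subset_diff[of P S "\<lambda>s. \<bar>\<Delta> {s}\<bar>"] S(1) by (auto simp: P_def add.commute)
  also have "(\<Sum>s\<in>P. \<bar>\<Delta> {s}\<bar>) = (\<Sum>s\<in>P. \<Delta> {s})"
    by (intro sum.cong) (auto simp: P_def)
  also have "(\<Sum>s\<in>S - P. \<bar>\<Delta> {s}\<bar>) = - (\<Sum>s\<in>S - P. \<Delta> {s})"
    unfolding sum_negf[symmetric] by (intro sum.cong) (auto simp: P_def)
  also have "(\<Sum>s\<in>P. \<Delta> {s}) + - (\<Sum>s\<in>S - P. \<Delta> {s}) = \<Delta> P - \<Delta> (S - P)"
    by (subst (1 2) add) (auto simp: P_def)
  also have "\<dots> \<le> 2 * \<epsilon>"
    using \<Delta>[of P] \<Delta>[of "S - P"] by (auto simp: P_def)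
  finally show "(\<Sum>s\<in>S. \<bar>freq n (\<lambda>i. X i \<omega>) (T -` {s}) - measure N (T -` {s})\<bar>) \<le> 2 * \<epsilon>"
    by (simp add: \<Delta>_def)
qed

end

section \<open>Translations in \<open>L\<^sup>1\<close>\<close>

definition L1_modulus :: "(real \<Rightarrow> real) \<Rightarrow> real \<Rightarrow> ennreal" where
  "L1_modulus f h = L1_norm (\<lambda>x. f (x + h) - f x)"

lemma L1_norm_eq_integral:
  assumes "integrable lborel f"
  shows "L1_norm f = ennreal (\<integral>x. \<bar>f x\<bar> \<partial>lborel)"
  using assms unfolding L1_norm_def by (intro nn_integral_eq_integral) auto

lemma L1_norm_triangle:
  assumes [measurable]: "f \<in> borel_measurable borel" "g \<in> borel_measurable borel"
  shows "L1_norm (\<lambda>x. f x + g x) \<le> L1_norm f + L1_norm g"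
proof -
  have "L1_norm (\<lambda>x. f x + g x) \<le> (\<integral>\<^sup>+ x. ennreal \<bar>f x\<bar> + ennreal \<bar>g x\<bar> \<partial>lborel)"
    unfolding L1_norm_def by (intro nn_integral_mono) (simp flip: ennreal_plus)
  also have "\<dots> = L1_norm f + L1_norm g"
    unfolding L1_norm_def by (intro nn_integral_add) auto
  finally show ?thesis .
qed

lemma L1_norm_diff_triangle:
  assumes [measurable]: "f \<in> borel_measurable borel" "g \<in> borel_measurable borel" "h \<in> borel_measurable borel"
  shows "L1_norm (\<lambda>x. f x - h x) \<le> L1_norm (\<lambda>x. f x - g x) + L1_norm (\<lambda>x. g x - h x)"
  using L1_norm_triangle[of "\<lambda>x. f x - g x" "\<lambda>x. g x - h x"] by simp

lemma L1_norm_cmult: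
  assumes [measurable]: "f \<in> borel_measurable borel"
  shows "L1_norm (\<lambda>x. c * f x) = ennreal \<bar>c\<bar> * L1_norm f"
  unfolding L1_norm_def by (simp add: abs_mult ennreal_mult nn_integral_cmult)

lemma L1_norm_affine:
  assumes [measurable]: "f \<in> borel_measurable borel" and c: "c \<noteq> 0"
  shows "ennreal \<bar>c\<bar> * L1_norm (\<lambda>x. f (t + c * x)) = L1_norm f"
  unfolding L1_norm_def using nn_integral_real_affine[OF _ c, of "\<lambda>x. ennreal \<bar>f x\<bar>" t] by simp

lemma L1_norm_shift:
  assumes [measurable]: "f \<in> borel_measurable borel"
  shows "L1_norm (\<lambda>x. f (x + h)) = L1_norm f"
  using L1_norm_affine[of f 1 h] by (simp add: add.commute)

lemma L1_norm_reflect: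
  assumes [measurable]: "f \<in> borel_measurable borel"
  shows "L1_norm (\<lambda>x. f (- x)) = L1_norm f"
  using L1_norm_affine[of f "-1" 0] by simp

lemma L1_norm_cong_AE: "AE x in lborel. f x = g x \<Longrightarrow> L1_norm f = L1_norm g"
  unfolding L1_norm_def by (intro nn_integral_cong_AE) auto

text \<open>Translation invariance equates the mass gained with the mass lost, so it suffices to
  bound the loss \<open>P\<close>. A point of an open set stays inside under small shifts; hence the
  loss tends to 0 pointwise, dominated by the indicator of U.\<close>

lemma translation_tendsto_open:
  fixes U :: "real set"
  assumes U: "open U" and fin: "emeasure lborel U < \<infinity>" and h: "h \<longlonglongrightarrow> 0"
  shows "(\<lambda>n. \<integral>x. \<bar>indicator U (x + h n) - indicator U x\<bar> \<partial>lborel) \<longlonglongrightarrow> (0 :: real)"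
proof -
  have [measurable]: "U \<in> sets borel"
    using U by simp
  have iU: "integrable lborel (indicator U :: real \<Rightarrow> real)"
    using fin by (intro integrable_real_indicator) auto
  have iU': "integrable lborel (\<lambda>x. indicator U (x + t) :: real)" for t
    using lborel_integrable_real_affine[OF iU, of 1 t] by (simp add: add.commute)
  have eq: "(\<integral>x. indicator U (x + t) \<partial>lborel) = (\<integral>x. indicator U x \<partial>lborel :: real)" for t
    using lborel_integral_real_affine[of 1 "indicator U :: real \<Rightarrow> real" t] by (simp add: add.commute)
  define P where "P t x = max 0 (indicator U x - indicator U (x + t) :: real)" for t x
  have Pm [measurable]: "P t \<in> borel_measurable borel" for t
    unfolding P_def by measurable
  have "(\<lambda>n. \<integral>x. P (h n) x \<partial>lborel) \<longlonglongrightarrow> (\<integral>x. 0 \<partial>(lborel :: real measure))"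
  proof (rule integral_dominated_convergence[OF _ _ iU])
    show "AE x in lborel. (\<lambda>n. P (h n) x) \<longlonglongrightarrow> 0"
    proof (intro AE_I2)
      fix x :: real
      show "(\<lambda>n. P (h n) x) \<longlonglongrightarrow> 0"
      proof (cases "x \<in> U")
        case True
        have "(\<lambda>n. x + h n) \<longlonglongrightarrow> x + 0"
          by (intro tendsto_intros h)
        then have "eventually (\<lambda>n. x + h n \<in> U) sequentially"
          using U True by (auto dest: topological_tendstoD)
        then have "eventually (\<lambda>n. P (h n) x = 0) sequentially"
          by eventually_elim (simp add: P_def True)
        then show ?thesis
          by (rule tendsto_eventually)
      qed (simp add: P_def)
    qed
    show "AE x in lborel. norm (P (h n) x) \<le> indicator U x" for n
      by (auto simp: P_def indicator_def)
  qed measurable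
  then have "(\<lambda>n. 2 * (\<integral>x. P (h n) x \<partial>lborel)) \<longlonglongrightarrow> 2 * 0"
    by (intro tendsto_mult_left) simp
  moreover have "(\<integral>x. \<bar>indicator U (x + t) - indicator U x\<bar> \<partial>lborel) = 2 * (\<integral>x. P t x \<partial>lborel)" for t
  proof -
    have iP: "integrable lborel (P t)"
      by (rule Bochner_Integration.integrable_bound[OF iU]) (auto simp: P_def indicator_def)
    have "(\<integral>x. \<bar>indicator U (x + t) - indicator U x\<bar> \<partial>lborel) =
        (\<integral>x. 2 * P t x + (indicator U (x + t) - indicator U x) \<partial>lborel)"
      by (intro Bochner_Integration.integral_cong) (auto simp: P_def indicator_def)
    also have "\<dots> = 2 * (\<integral>x. P t x \<partial>lborel) + ((\<integral>x. indicator U (x + t) \<partial>lborel) - (\<integral>x. indicator U x \<partial>lborel))"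
      using iP iU iU' by simp
    finally show ?thesis
      unfolding eq by simp
  qed
  ultimately show ?thesis by simp
qed

text \<open>Continuity of translation in \<open>L\<^sup>1\<close>. Indicators of sets of finite
  measure are reduced to open sets by outer regularity, and the limit step of the induction is
  another approximation.\<close>

lemma translation_tendsto:
  fixes f :: "real \<Rightarrow> real"
  assumes "integrable lborel f" and h: "h \<longlonglongrightarrow> 0"
  shows "(\<lambda>n. \<integral>x. \<bar>f (x + h n) - f x\<bar> \<partial>lborel) \<longlonglongrightarrow> 0"
  using assms(1)
proof (induction rule: integrable_induct)
  have int': "integrable lborel (\<lambda>x. f (x + t))" if "integrable lborel f" for f :: "real \<Rightarrow> real" and t
    using lborel_integrable_real_affine[OF that, of 1 t] by (simp add: add.commute)
  have eq: "(\<integral>x. f (x + t) \<partial>lborel) = (\<integral>x. f x \<partial>lborel)" for f :: "real \<Rightarrow> real" and t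
    using lborel_integral_real_affine[of 1 f t] by (simp add: add.commute)
  \<comment> \<open>The property passes to \<open>L\<^sup>1\<close> limits: g is chosen within r/4
    of f, translation preserves that error, and the shifts of g contribute less than r/2. It is used
    twice, from open to measurable sets and in the limit step.\<close>
  have close: "(\<lambda>n. \<integral>x. \<bar>f (x + h n) - f x\<bar> \<partial>lborel) \<longlonglongrightarrow> 0"
    if f: "integrable lborel f"
      and g: "\<And>\<epsilon>. 0 < \<epsilon> \<Longrightarrow> \<exists>g. integrable lborel g \<and> (\<integral>x. \<bar>f x - g x\<bar> \<partial>lborel) \<le> \<epsilon> \<and>
        (\<lambda>n. \<integral>x. \<bar>g (x + h n) - g x\<bar> \<partial>lborel) \<longlonglongrightarrow> 0" for f :: "real \<Rightarrow> real"
  proof (rule LIMSEQ_I)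
    fix r :: real assume r: "0 < r"
    obtain g where gi: "integrable lborel g" and gr: "(\<integral>x. \<bar>f x - g x\<bar> \<partial>lborel) \<le> r / 4"
      and gl: "(\<lambda>n. \<integral>x. \<bar>g (x + h n) - g x\<bar> \<partial>lborel) \<longlonglongrightarrow> 0"
      using g[of "r / 4"] r by auto
    obtain n0 where n0: "\<And>n. n0 \<le> n \<Longrightarrow> norm ((\<integral>x. \<bar>g (x + h n) - g x\<bar> \<partial>lborel) - 0) < r / 2"
      using LIMSEQ_D[OF gl, of "r / 2"] r by auto
    have "(\<integral>x. \<bar>f (x + h n) - f x\<bar> \<partial>lborel) < r" if "n0 \<le> n" for n
    proof -
      have "(\<integral>x. \<bar>f (x + h n) - f x\<bar> \<partial>lborel) \<le>
          (\<integral>x. \<bar>f (x + h n) - g (x + h n)\<bar> + \<bar>g (x + h n) - g x\<bar> + \<bar>f x - g x\<bar> \<partial>lborel)"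
        by (intro integral_mono Bochner_Integration.integrable_add integrable_abs
            Bochner_Integration.integrable_diff int' f gi) auto
      also have "\<dots> = (\<integral>x. \<bar>f (x + h n) - g (x + h n)\<bar> \<partial>lborel) + (\<integral>x. \<bar>g (x + h n) - g x\<bar> \<partial>lborel)
          + (\<integral>x. \<bar>f x - g x\<bar> \<partial>lborel)"
        using f gi by (simp add: int')
      also have "(\<integral>x. \<bar>f (x + h n) - g (x + h n)\<bar> \<partial>lborel) = (\<integral>x. \<bar>f x - g x\<bar> \<partial>lborel)"
        using eq[of "\<lambda>x. \<bar>f x - g x\<bar>" "h n"] by simp
      finally show ?thesis
        using gr n0[OF that] by auto
    qed
    then show "\<exists>no. \<forall>n\<ge>no. norm ((\<integral>x. \<bar>f (x + h n) - f x\<bar> \<partial>lborel) - 0) < r"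
      by (intro exI[of _ n0]) auto
  qed
  {
    case (base A c)
    then have [measurable]: "A \<in> sets borel" by simp
    have ind: "(\<lambda>n. \<integral>x. \<bar>indicator A (x + h n) - indicator A x\<bar> \<partial>lborel) \<longlonglongrightarrow> (0 :: real)"
    proof (rule close)
      show "integrable lborel (indicator A :: real \<Rightarrow> real)"
        using base by (intro integrable_real_indicator) auto
      fix \<epsilon> :: real assume \<epsilon>: "0 < \<epsilon>"
      obtain U where U: "open U" "A \<subseteq> U" "emeasure lborel (U - A) < \<epsilon>"
        using outer_regular_lborel[of A \<epsilon>] \<epsilon> by auto
      have [measurable]: "U \<in> sets borel"
        using U by simp
      have "emeasure lborel U = emeasure lborel A + emeasure lborel (U - A)"
        using U(2) by (subst plus_emeasure) (auto simp: Un_absorb1)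
      then have fin: "emeasure lborel U < \<infinity>"
        using base U(3) by (auto simp: less_top[symmetric] top_unique)
      have "(\<integral>x. \<bar>indicator A x - indicator U x\<bar> \<partial>lborel) = (\<integral>x. indicator (U - A) x \<partial>lborel :: real)"
        using U(2) by (intro Bochner_Integration.integral_cong) (auto simp: indicator_def)
      also have "\<dots> \<le> \<epsilon>"
        using U(3) \<epsilon> by (simp add: measure_def enn2real_leI less_imp_le)
      finally show "\<exists>g. integrable lborel g \<and> (\<integral>x. \<bar>indicator A x - g x\<bar> \<partial>lborel) \<le> \<epsilon> \<and>
        (\<lambda>n. \<integral>x. \<bar>g (x + h n) - g x\<bar> \<partial>lborel) \<longlonglongrightarrow> (0 :: real)"
        using fin by (intro exI[of _ "indicator U"] conjI translation_tendsto_open U h integrable_real_indicator) auto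
    qed
    have "(\<lambda>n. \<bar>c\<bar> * (\<integral>x. \<bar>indicator A (x + h n) - indicator A x\<bar> \<partial>lborel)) \<longlonglongrightarrow> \<bar>c\<bar> * 0"
      by (intro tendsto_mult_left ind)
    moreover have "\<bar>indicator A (x + t) *\<^sub>R c - indicator A x *\<^sub>R c\<bar> = \<bar>c\<bar> * \<bar>indicator A (x + t) - indicator A x\<bar>" for x t
      by (simp add: abs_mult[symmetric] algebra_simps)
    ultimately show ?case
      by simp
  next
    case (add f g)
    show ?case
    proof (rule tendsto_sandwich[OF _ _ tendsto_const])
      show "(\<lambda>n. (\<integral>x. \<bar>f (x + h n) - f x\<bar> \<partial>lborel) + (\<integral>x. \<bar>g (x + h n) - g x\<bar> \<partial>lborel)) \<longlonglongrightarrow> 0"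
        using tendsto_add[OF add(3,4)] by simp
      show "\<forall>\<^sub>F n in sequentially. (\<integral>x. \<bar>f (x + h n) + g (x + h n) - (f x + g x)\<bar> \<partial>lborel) \<le>
         (\<integral>x. \<bar>f (x + h n) - f x\<bar> \<partial>lborel) + (\<integral>x. \<bar>g (x + h n) - g x\<bar> \<partial>lborel)"
      proof (intro always_eventually allI)
        fix n
        have "(\<integral>x. \<bar>f (x + h n) + g (x + h n) - (f x + g x)\<bar> \<partial>lborel) \<le>
           (\<integral>x. \<bar>f (x + h n) - f x\<bar> + \<bar>g (x + h n) - g x\<bar> \<partial>lborel)"
          by (intro integral_mono Bochner_Integration.integrable_add integrable_abs
              Bochner_Integration.integrable_diff int' add(1,2)) auto
        then show "(\<integral>x. \<bar>f (x + h n) + g (x + h n) - (f x + g x)\<bar> \<partial>lborel) \<le>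
         (\<integral>x. \<bar>f (x + h n) - f x\<bar> \<partial>lborel) + (\<integral>x. \<bar>g (x + h n) - g x\<bar> \<partial>lborel)"
          using add(1,2) by (simp add: int')
      qed
    qed (auto intro!: always_eventually)
  next
    case (lim f s)
    show ?case
    proof (rule close[OF lim(4)])
      fix \<epsilon> :: real assume \<epsilon>: "0 < \<epsilon>"
      have "(\<lambda>i. \<integral>x. \<bar>f x - s i x\<bar> \<partial>lborel) \<longlonglongrightarrow> (\<integral>x. 0 \<partial>(lborel :: real measure))"
      proof (rule integral_dominated_convergence[where w = "\<lambda>x. 3 * \<bar>f x\<bar>"])
        show "AE x in lborel. (\<lambda>i. \<bar>f x - s i x\<bar>) \<longlonglongrightarrow> 0"
          using lim(2) by (intro AE_I2 tendsto_rabs_zero) (auto intro!: tendsto_eq_intros)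
        show "AE x in lborel. norm \<bar>f x - s i x\<bar> \<le> 3 * \<bar>f x\<bar>" for i
        proof (intro AE_I2)
          fix x :: real
          show "norm \<bar>f x - s i x\<bar> \<le> 3 * \<bar>f x\<bar>"
            using lim(3)[of x i] unfolding real_norm_def by (simp add: abs_if split: if_splits)
        qed
      qed (use lim in auto)
      then have "eventually (\<lambda>i. (\<integral>x. \<bar>f x - s i x\<bar> \<partial>lborel) < \<epsilon>) sequentially"
        using \<epsilon> by (intro order_tendstoD) auto
      then obtain i where "(\<integral>x. \<bar>f x - s i x\<bar> \<partial>lborel) < \<epsilon>"
        by (auto simp: eventually_sequentially)
      then show "\<exists>g. integrable lborel g \<and> (\<integral>x. \<bar>f x - g x\<bar> \<partial>lborel) \<le> \<epsilon> \<and>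
        (\<lambda>n. \<integral>x. \<bar>g (x + h n) - g x\<bar> \<partial>lborel) \<longlonglongrightarrow> 0"
        using lim by (intro exI[of _ "s i"]) auto
    qed
  }
qed

lemma L1_modulus_tendsto:
  assumes f: "integrable lborel f" and h: "h \<longlonglongrightarrow> 0"
  shows "(\<lambda>n. L1_modulus f (h n)) \<longlonglongrightarrow> 0"
proof -
  have "integrable lborel (\<lambda>x. f (x + t) - f x)" for t
    using lborel_integrable_real_affine[OF f, of 1 t] f by (simp add: add.commute)
  then have "L1_modulus f (h n) = ennreal (\<integral>x. \<bar>f (x + h n) - f x\<bar> \<partial>lborel)" for n
    unfolding L1_modulus_def by (rule L1_norm_eq_integral)
  then show ?thesis
    using tendsto_ennrealI[OF translation_tendsto[OF f h]] by simp
qed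

lemma L1_modulus_small:
  assumes f: "integrable lborel f" and \<epsilon>: "0 < \<epsilon>"
  obtains \<delta> where "0 < \<delta>" "\<And>h. \<bar>h\<bar> \<le> \<delta> \<Longrightarrow> L1_modulus f h \<le> ennreal \<epsilon>"
proof (rule ccontr)
  assume "\<not> thesis"
  then have "\<exists>h. \<bar>h\<bar> \<le> inverse (real (Suc n)) \<and> \<not> L1_modulus f h \<le> ennreal \<epsilon>" for n
    using that[of "inverse (real (Suc n))"] by force
  then obtain h where h: "\<And>n. \<bar>h n\<bar> \<le> inverse (real (Suc n))" "\<And>n. ennreal \<epsilon> < L1_modulus f (h n)"
    unfolding not_le by metis
  have "h \<longlonglongrightarrow> 0"
    by (rule Lim_null_comparison[OF _ LIMSEQ_inverse_real_of_nat]) (use h(1) in \<open>simp add: always_eventually\<close>)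
  then have "eventually (\<lambda>n. L1_modulus f (h n) < ennreal \<epsilon>) sequentially"
    using \<epsilon> by (intro order_tendstoD[OF L1_modulus_tendsto[OF f]]) auto
  then show False
    using h(2) by (auto simp: eventually_sequentially dest: less_asym)
qed

text \<open>\<open>L * x - cdf P x\<close> is again continuous and nondecreasing, so it generates a
  measure Q such that P + Q is L times Lebesgue measure. Lebesgue null sets are therefore null for
  P, and Radon-Nikodym applies.\<close>

lemma lipschitz_cdf_imp_density:
  assumes P: "real_distribution P" and L: "L-lipschitz_on UNIV (cdf P)"
  shows "\<exists>f. is_density P f"
proof -
  interpret real_distribution P by fact
  define Q where "Q = interval_measure (\<lambda>x. L * x - cdf P x)"
  have L0: "0 \<le> L"
    using L by (rule lipschitz_on_nonneg)
  have cont: "continuous_on UNIV (cdf P)"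
    using L by (rule lipschitz_on_continuous_on)
  have diff: "cdf P y - cdf P x \<le> L * (y - x)" if "x \<le> y" for x y
    using lipschitz_onD[OF L, of y x] that cdf_nondecreasing[OF that] by (simp add: dist_real_def)
  have mono: "L * x - cdf P x \<le> L * y - cdf P y" if "x \<le> y" for x y
    using diff[OF that] by (simp add: algebra_simps)
  have "continuous_on UNIV (\<lambda>x. L * x - cdf P x)"
    by (intro continuous_intros cont)
  then have right: "continuous (at_right a) (\<lambda>x. L * x - cdf P x)" for a
    by (metis UNIV_I continuous_on_eq_continuous_within continuous_within_subset subset_UNIV)
  define R where "R = measure_of UNIV (sets borel) (\<lambda>A. emeasure P A + emeasure Q A)"
  have sR: "sets R = sets borel"
    unfolding R_def using sets.sigma_sets_eq[of borel] by simp
  have R: "emeasure R A = emeasure P A + emeasure Q A" if A: "A \<in> sets borel" for A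
    unfolding R_def
  proof (rule emeasure_measure_of_sigma)
    show "sigma_algebra (UNIV :: real set) (sets borel)"
      using sets.sigma_algebra_axioms[of borel] by simp
    show "positive (sets borel) (\<lambda>A. emeasure P A + emeasure Q A)"
      by (simp add: positive_def)
    show "countably_additive (sets borel) (\<lambda>A. emeasure P A + emeasure Q A)"
    proof (rule countably_additiveI)
      fix A :: "nat \<Rightarrow> real set"
      assume A: "range A \<subseteq> sets borel" "disjoint_family A"
      have "(\<Sum>i. emeasure P (A i) + emeasure Q (A i)) = (\<Sum>i. emeasure P (A i)) + (\<Sum>i. emeasure Q (A i))"
        by (intro suminf_add[symmetric] summableI)
      also have "(\<Sum>i. emeasure P (A i)) = emeasure P (\<Union>i. A i)"
        using A by (intro suminf_emeasure) auto
      also have "(\<Sum>i. emeasure Q (A i)) = emeasure Q (\<Union>i. A i)"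
        using A by (intro suminf_emeasure) (auto simp: Q_def)
      finally show "(\<Sum>i. emeasure P (A i) + emeasure Q (A i)) = emeasure P (\<Union>i. A i) + emeasure Q (\<Union>i. A i)" .
    qed
  qed (use A in auto)
  have Ioc: "emeasure R {a<..b} = ennreal (L * (b - a))" if "a \<le> b" for a b
  proof -
    have "emeasure R {a<..b} = ennreal (cdf P b - cdf P a) + ennreal ((L * b - cdf P b) - (L * a - cdf P a))"
      using emeasure_Ioc[OF that] emeasure_interval_measure_Ioc[OF that mono right]
      by (simp add: R Q_def)
    also have "\<dots> = ennreal (L * (b - a))"
      using cdf_nondecreasing[OF that] mono[OF that]
      by (subst ennreal_plus[symmetric]) (auto simp: algebra_simps)
    finally show ?thesis .
  qed
  have RL: "R = density lborel (\<lambda>_. ennreal L)"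
  proof (rule measure_eqI_generator_eq)
    let ?E = "range (\<lambda>(a, b). {a<..b::real})"
    show "Int_stable ?E"
      by (auto simp: Int_stable_def Int_greaterThanAtMost)
    show "emeasure R X = emeasure (density lborel (\<lambda>_. ennreal L)) X" if XE: "X \<in> ?E" for X
    proof -
      obtain a b where X: "X = {a<..b}"
        using XE by auto
      show ?thesis
      proof (cases "a \<le> b")
        case True
        have "emeasure (density lborel (\<lambda>_. ennreal L)) X = ennreal L * ennreal (b - a)"
          using True by (simp add: X emeasure_density nn_integral_cmult_indicator)
        then show ?thesis
          using Ioc[OF True] L0 True by (simp add: X ennreal_mult)
      qed (simp add: X)
    qed
    show "range (\<lambda>n::nat. {- real n<..real n}) \<subseteq> ?E" by auto
    show "(\<Union>n::nat. {- real n<..real n}) = UNIV"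
      by (rule UN_Ioc_eq_UNIV)
    show "emeasure R {- real n<..real n} \<noteq> \<infinity>" for n :: nat
      by (subst Ioc) auto
  qed (auto simp: sR borel_sigma_sets_Ioc)
  have "absolutely_continuous lborel P"
    unfolding absolutely_continuous_def
  proof (intro subsetI null_setsI)
    fix A :: "real set" assume "A \<in> null_sets lborel"
    then have A: "A \<in> sets borel" "emeasure lborel A = 0"
      by auto
    then have "emeasure R A = 0"
      by (simp add: RL emeasure_density nn_integral_cmult_indicator)
    then show "emeasure P A = 0" "A \<in> sets P"
      using A R by auto
  qed
  then obtain g where g: "g \<in> borel_measurable lborel" "density lborel g = P"
    using sigma_finite_measure.Radon_Nikodym[OF lborel.sigma_finite_measure_axioms, of P] by auto
  \<comment> \<open>The Radon-Nikodym density takes values in \<open>ennreal\<close>. Its integral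
    is 1, so it is finite almost everywhere, and a real-valued version gives the same
    measure.\<close>
  have "integral\<^sup>N lborel g = 1"
    using emeasure_space_1 g emeasure_density[of g lborel UNIV] by simp
  then have "AE x in lborel. g x \<noteq> \<infinity>"
    using g by (intro nn_integral_PInf_AE) auto
  then have "density lborel g = density lborel (\<lambda>x. ennreal (enn2real (g x)))"
    using g by (intro density_cong) (auto simp: less_top)
  then show ?thesis
    unfolding is_density_def using g by (intro exI[of _ "\<lambda>x. enn2real (g x)"]) auto
qed

lemma is_densityD:
  assumes "is_density P f" "prob_space P"
  shows "f \<in> borel_measurable borel" "\<And>x. 0 \<le> f x" "integrable lborel f" "L1_norm f = 1"
    "(\<integral>x. f x \<partial>lborel) = 1"
proof -
  interpret prob_space P by fact
  show [measurable]: "f \<in> borel_measurable borel" and pos: "\<And>x. 0 \<le> f x"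
    using assms by (auto simp: is_density_def)
  have P: "P = density lborel (\<lambda>x. ennreal (f x))"
    using assms by (auto simp: is_density_def)
  have "(\<integral>\<^sup>+x. ennreal (f x) \<partial>lborel) = 1"
    using emeasure_space_1 unfolding P by (simp add: emeasure_density)
  then show "integrable lborel f" and "L1_norm f = 1" and "(\<integral>x. f x \<partial>lborel) = 1"
    using pos by (auto simp: L1_norm_def intro!: integrableI_nonneg integral_eq_nn_integral[THEN trans])
qed

section \<open>Kernel density estimators of discretised samples\<close>

text \<open>The bump that one observation y contributes; \<open>g_hat\<close> is the mean of these
  over the sample.\<close>

definition smear :: "(real \<Rightarrow> real) \<Rightarrow> real \<Rightarrow> real \<Rightarrow> real \<Rightarrow> real" where
  "smear q b y x = q ((x - y) / b) / b"

lemma L1_norm_sum: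
  assumes "finite S" "\<And>i. i \<in> S \<Longrightarrow> f i \<in> borel_measurable borel"
  shows "L1_norm (\<lambda>x. \<Sum>i\<in>S. f i x) \<le> (\<Sum>i\<in>S. L1_norm (f i))"
  using assms
proof (induction rule: finite_induct)
  case empty
  then show ?case by (simp add: L1_norm_def)
next
  case (insert i S)
  have "L1_norm (\<lambda>x. f i x + (\<Sum>i\<in>S. f i x)) \<le> L1_norm (f i) + L1_norm (\<lambda>x. \<Sum>i\<in>S. f i x)"
    by (intro L1_norm_triangle borel_measurable_sum insert.prems) auto
  also have "\<dots> \<le> L1_norm (f i) + (\<Sum>i\<in>S. L1_norm (f i))"
    by (intro add_left_mono insert.IH insert.prems) auto
  finally show ?case
    using insert.hyps by simp
qed

lemma L1_norm_smear:
  assumes [measurable]: "q \<in> borel_measurable borel" and b: "0 < b"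
  shows "L1_norm (smear q b y) = L1_norm q"
proof -
  have "L1_norm (smear q b y) = L1_norm (\<lambda>x. (1 / b) * q (- y / b + (1 / b) * x))"
    unfolding smear_def[abs_def] by (simp add: diff_divide_distrib)
  also have "\<dots> = ennreal \<bar>1 / b\<bar> * L1_norm (\<lambda>x. q (- y / b + (1 / b) * x))"
    by (rule L1_norm_cmult) measurable
  also have "\<dots> = L1_norm q"
    using b by (intro L1_norm_affine) auto
  finally show ?thesis .
qed

text \<open>Rescaling removes b except from the displacement. Moving an observation by \<delta> b
  thus costs the modulus of q at \<delta>, uniformly in the bandwidth, and a grid of width
  proportional to b is fine enough.\<close>

lemma L1_norm_smear_diff:
  assumes [measurable]: "q \<in> borel_measurable borel" and b: "0 < b"
  shows "L1_norm (\<lambda>x. smear q b y x - smear q b y' x) = L1_modulus q ((y' - y) / b)"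
proof -
  define f where "f u = q (u + (y' - y) / b) - q u" for u
  have [measurable]: "f \<in> borel_measurable borel"
    unfolding f_def by measurable
  have "- y' / b + (1 / b) * x + (y' - y) / b = (x - y) / b" "- y' / b + (1 / b) * x = (x - y') / b" for x
    using b by (simp_all add: field_simps)
  then have "(\<lambda>x. smear q b y x - smear q b y' x) = (\<lambda>x. (1 / b) * f (- y' / b + (1 / b) * x))"
    unfolding f_def smear_def by (simp add: diff_divide_distrib)
  then have "L1_norm (\<lambda>x. smear q b y x - smear q b y' x) = ennreal \<bar>1 / b\<bar> * L1_norm (\<lambda>x. f (- y' / b + (1 / b) * x))"
    by (simp only:) (rule L1_norm_cmult, measurable)
  also have "\<dots> = L1_norm f"
    using b by (intro L1_norm_affine) auto
  finally show ?thesis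
    by (simp add: L1_modulus_def f_def[abs_def])
qed

text \<open>Two errors separate the averaged, discretised bumps from g: rounding y to
  \<open>T y\<close>, integrated against N by Fubini, and smoothing g by the rescaled kernel, which
  averages translates of g and so costs its \<open>L\<^sup>1\<close> modulus.\<close>

lemma smear_mixture_bias:
  fixes T :: "real \<Rightarrow> real"
  assumes q [measurable]: "q \<in> borel_measurable borel" and q0: "\<And>x. 0 \<le> q x"
    and q1: "integrable lborel q" "(\<integral>x. q x \<partial>lborel) = 1" and b: "0 < b"
    and N: "real_distribution N" "is_density N g"
    and T [measurable]: "T \<in> borel_measurable borel" and S: "finite S" "range T \<subseteq> S"
    and K: "\<And>y. L1_norm (\<lambda>x. smear q b (T y) x - smear q b y x) \<le> ennreal (\<omega> + 2 * indicator B y)"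
    and B [measurable]: "B \<in> sets borel" and \<omega>: "0 \<le> \<omega>"
    and \<eta>: "\<And>u. q u \<noteq> 0 \<Longrightarrow> L1_modulus g (- b * u) \<le> ennreal \<eta>" "0 \<le> \<eta>"
  shows "L1_norm (\<lambda>x. (\<Sum>s\<in>S. measure N (T -` {s}) * smear q b s x) - g x) \<le> ennreal (\<omega> + 2 * measure N B + \<eta>)"
proof -
  interpret N: real_distribution N by fact
  note g = is_densityD[OF N(2) N.prob_space_axioms]
  note [measurable] = g(1)
  have Neq: "N = density lborel (\<lambda>x. ennreal (g x))"
    using N(2) by (simp add: is_density_def)
  have Ng: "integrable lborel (\<lambda>y. indicator A y * g y)" "measure N A = (\<integral>y. indicator A y * g y \<partial>lborel)"
    if [measurable]: "A \<in> sets borel" for A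
  proof -
    show i: "integrable lborel (\<lambda>y. indicator A y * g y)"
      using integrable_mult_indicator[of A lborel g] g(3) by simp
    have "emeasure N A = (\<integral>\<^sup>+y. ennreal (indicator A y * g y) \<partial>lborel)"
      unfolding Neq by (subst emeasure_density) (auto intro!: nn_integral_cong simp: indicator_def)
    also have "\<dots> = ennreal (\<integral>y. indicator A y * g y \<partial>lborel)"
      using i g(2) by (intro nn_integral_eq_integral) auto
    finally show "measure N A = (\<integral>y. indicator A y * g y \<partial>lborel)"
      using g(2) by (simp add: measure_def integral_nonneg_AE)
  qed
  have Ts [measurable]: "T -` {s} \<in> sets borel" for s
    using measurable_sets[OF T, of "{s}"] by simp
  have sm [measurable]: "(\<lambda>(x, y). smear q b (T y) x) \<in> borel_measurable (borel \<Otimes>\<^sub>M borel)"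
    "(\<lambda>(x, y). smear q b y x) \<in> borel_measurable (borel \<Otimes>\<^sub>M borel)"
    unfolding smear_def by measurable
  have smT: "smear q b (T y) x = (\<Sum>s\<in>S. indicator (T -` {s}) y * smear q b s x)" for x y
  proof -
    have "(\<Sum>s\<in>S. indicator (T -` {s}) y * smear q b s x) = (\<Sum>s\<in>{T y}. indicator (T -` {s}) y * smear q b s x)"
      using S by (intro sum.mono_neutral_right) auto
    then show ?thesis by simp
  qed
  have sm0: "0 \<le> smear q b y x" for x y
    using q0 b by (simp add: smear_def)
  have ptw: "ennreal \<bar>(\<Sum>s\<in>S. measure N (T -` {s}) * smear q b s x) - g x\<bar> \<le>
     (\<integral>\<^sup>+y. ennreal \<bar>smear q b (T y) x - smear q b y x\<bar> * ennreal (g y) \<partial>lborel) +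
     (\<integral>\<^sup>+u. ennreal (q u) * ennreal \<bar>g (x + (- b * u)) - g x\<bar> \<partial>lborel)" (is "_ \<le> ?I1 + ?I2") for x
  proof -
    have iT: "integrable lborel (\<lambda>y. smear q b (T y) x * g y)"
    proof -
      have "smear q b (T y) x * g y = (\<Sum>s\<in>S. smear q b s x * (indicator (T -` {s}) y * g y))" for y
        unfolding smT sum_distrib_right by (intro sum.cong refl) (simp only: mult_ac)
      then show ?thesis
        by (simp only:) (intro Bochner_Integration.integrable_sum integrable_mult_right Ng(1) Ts)
    qed
    have mT: "(\<integral>y. smear q b (T y) x * g y \<partial>lborel) = (\<Sum>s\<in>S. measure N (T -` {s}) * smear q b s x)"
    proof -
      have "(\<integral>y. smear q b (T y) x * g y \<partial>lborel) =
          (\<integral>y. (\<Sum>s\<in>S. smear q b s x * (indicator (T -` {s}) y * g y)) \<partial>lborel)"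
        unfolding smT sum_distrib_right by (simp add: mult_ac)
      also have "\<dots> = (\<Sum>s\<in>S. smear q b s x * (\<integral>y. indicator (T -` {s}) y * g y \<partial>lborel))"
        using Ng(1)[OF Ts] by (subst Bochner_Integration.integral_sum) auto
      finally show ?thesis
        by (simp add: Ng(2)[OF Ts] mult.commute)
    qed
    show ?thesis
    proof (cases "(\<integral>\<^sup>+y. ennreal (smear q b y x * g y) \<partial>lborel) = \<infinity>")
      \<comment> \<open>g and q are merely integrable, so their convolution may diverge at x, where
        the Bochner integral would be 0. The integral with rounded centres is finite, being a finite
        sum; hence the rounding error is infinite there and the bound is trivial.\<close>
      case True
      have "(\<integral>\<^sup>+y. ennreal (smear q b y x * g y) \<partial>lborel) \<le>
         (\<integral>\<^sup>+y. ennreal \<bar>smear q b (T y) x - smear q b y x\<bar> * ennreal (g y) + ennreal (smear q b (T y) x * g y) \<partial>lborel)"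
      proof (intro nn_integral_mono)
        fix y
        have "smear q b y x \<le> \<bar>smear q b (T y) x - smear q b y x\<bar> + smear q b (T y) x"
          by simp
        then have "smear q b y x * g y \<le> \<bar>smear q b (T y) x - smear q b y x\<bar> * g y + smear q b (T y) x * g y"
          using mult_right_mono[OF _ g(2)] by (simp flip: distrib_right)
        then show "ennreal (smear q b y x * g y) \<le>
           ennreal \<bar>smear q b (T y) x - smear q b y x\<bar> * ennreal (g y) + ennreal (smear q b (T y) x * g y)"
          using g(2) sm0 by (simp add: ennreal_leI flip: ennreal_mult ennreal_plus)
      qed
      also have "\<dots> = ?I1 + (\<integral>\<^sup>+y. ennreal (smear q b (T y) x * g y) \<partial>lborel)"
        using sm by (intro nn_integral_add) (auto simp: smear_def)
      also have "(\<integral>\<^sup>+y. ennreal (smear q b (T y) x * g y) \<partial>lborel) = ennreal (\<integral>y. smear q b (T y) x * g y \<partial>lborel)"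
        using g(2) sm0 by (intro nn_integral_eq_integral iT) auto
      finally have "?I1 = \<infinity>"
        using True by (auto simp: top_unique)
      then show ?thesis by simp
    next
      case False
      have meas: "(\<lambda>y. smear q b y x) \<in> borel_measurable borel"
        unfolding smear_def by measurable
      have i: "integrable lborel (\<lambda>y. smear q b y x * g y)"
      proof (rule integrableI_nonneg)
        show "(\<integral>\<^sup>+y. ennreal (smear q b y x * g y) \<partial>lborel) < \<infinity>"
          using False by (simp add: less_top)
      qed (use meas sm0 g(2) in auto)
      have aff: "integrable lborel (\<lambda>u. q u * g (x + (- b) * u))"
        "(\<integral>y. smear q b y x * g y \<partial>lborel) = (\<integral>u. q u * g (x + (- b) * u) \<partial>lborel)"
      proof -
        have e: "\<bar>- b\<bar> *\<^sub>R (smear q b (x + (- b) * u) x * g (x + (- b) * u)) = q u * g (x + (- b) * u)" for u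
          using b by (simp add: smear_def)
        have "integrable lborel (\<lambda>u. \<bar>- b\<bar> *\<^sub>R (smear q b (x + (- b) * u) x * g (x + (- b) * u)))"
          using b by (intro integrable_scaleR_right lborel_integrable_real_affine[OF i]) auto
        then show "integrable lborel (\<lambda>u. q u * g (x + (- b) * u))"
          unfolding e .
        have "(\<integral>y. smear q b y x * g y \<partial>lborel) = \<bar>- b\<bar> *\<^sub>R (\<integral>u. smear q b (x + (- b) * u) x * g (x + (- b) * u) \<partial>lborel)"
          using b by (intro lborel_integral_real_affine) auto
        also have "\<dots> = (\<integral>u. \<bar>- b\<bar> *\<^sub>R (smear q b (x + (- b) * u) x * g (x + (- b) * u)) \<partial>lborel)"
          by simp
        finally show "(\<integral>y. smear q b y x * g y \<partial>lborel) = (\<integral>u. q u * g (x + (- b) * u) \<partial>lborel)"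
          unfolding e .
      qed
      have "(\<Sum>s\<in>S. measure N (T -` {s}) * smear q b s x) - g x =
          ((\<integral>y. smear q b (T y) x * g y \<partial>lborel) - (\<integral>y. smear q b y x * g y \<partial>lborel)) +
          ((\<integral>u. q u * g (x + (- b) * u) \<partial>lborel) - (\<integral>u. q u * g x \<partial>lborel))"
        using aff(2) q1 mT by simp
      also have "\<dots> = (\<integral>y. (smear q b (T y) x - smear q b y x) * g y \<partial>lborel) +
          (\<integral>u. q u * (g (x + (- b * u)) - g x) \<partial>lborel)"
        using iT i aff(1) q1(1) by (simp add: left_diff_distrib right_diff_distrib)
      finally have "ennreal \<bar>(\<Sum>s\<in>S. measure N (T -` {s}) * smear q b s x) - g x\<bar> \<le>
         ennreal (norm (\<integral>y. (smear q b (T y) x - smear q b y x) * g y \<partial>lborel)) +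
         ennreal (norm (\<integral>u. q u * (g (x + (- b * u)) - g x) \<partial>lborel))"
        by (simp flip: ennreal_plus)
      also have "\<dots> \<le> (\<integral>\<^sup>+y. ennreal (norm ((smear q b (T y) x - smear q b y x) * g y)) \<partial>lborel) +
          (\<integral>\<^sup>+u. ennreal (norm (q u * (g (x + (- b * u)) - g x))) \<partial>lborel)"
        using iT i aff(1) q1(1)
        by (intro add_mono integral_norm_bound_ennreal) (auto simp: left_diff_distrib right_diff_distrib)
      also have "\<dots> = ?I1 + ?I2"
        using g(2) q0 by (simp add: abs_mult ennreal_mult)
      finally show ?thesis .
    qed
  qed
  have "L1_norm (\<lambda>x. (\<Sum>s\<in>S. measure N (T -` {s}) * smear q b s x) - g x) \<le>
     (\<integral>\<^sup>+x. (\<integral>\<^sup>+y. ennreal \<bar>smear q b (T y) x - smear q b y x\<bar> * ennreal (g y) \<partial>lborel) +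
     (\<integral>\<^sup>+u. ennreal (q u) * ennreal \<bar>g (x + (- b * u)) - g x\<bar> \<partial>lborel) \<partial>lborel)"
    unfolding L1_norm_def by (intro nn_integral_mono ptw)
  also have "\<dots> = (\<integral>\<^sup>+x. (\<integral>\<^sup>+y. ennreal \<bar>smear q b (T y) x - smear q b y x\<bar> * ennreal (g y) \<partial>lborel) \<partial>lborel) +
     (\<integral>\<^sup>+x. (\<integral>\<^sup>+u. ennreal (q u) * ennreal \<bar>g (x + (- b * u)) - g x\<bar> \<partial>lborel) \<partial>lborel)"
    unfolding smear_def by (intro nn_integral_add) measurable
  also have "(\<integral>\<^sup>+x. (\<integral>\<^sup>+y. ennreal \<bar>smear q b (T y) x - smear q b y x\<bar> * ennreal (g y) \<partial>lborel) \<partial>lborel) =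
      (\<integral>\<^sup>+y. (\<integral>\<^sup>+x. ennreal \<bar>smear q b (T y) x - smear q b y x\<bar> * ennreal (g y) \<partial>lborel) \<partial>lborel)"
    unfolding smear_def by (rule lborel_pair.Fubini') measurable
  also have "\<dots> = (\<integral>\<^sup>+y. L1_norm (\<lambda>x. smear q b (T y) x - smear q b y x) * ennreal (g y) \<partial>lborel)"
    unfolding L1_norm_def smear_def by (intro nn_integral_cong nn_integral_multc) measurable
  also have "(\<integral>\<^sup>+x. (\<integral>\<^sup>+u. ennreal (q u) * ennreal \<bar>g (x + (- b * u)) - g x\<bar> \<partial>lborel) \<partial>lborel) =
      (\<integral>\<^sup>+u. (\<integral>\<^sup>+x. ennreal (q u) * ennreal \<bar>g (x + (- b * u)) - g x\<bar> \<partial>lborel) \<partial>lborel)"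
    by (rule lborel_pair.Fubini') measurable
  also have "\<dots> = (\<integral>\<^sup>+u. ennreal (q u) * L1_modulus g (- b * u) \<partial>lborel)"
    unfolding L1_norm_def L1_modulus_def by (intro nn_integral_cong nn_integral_cmult) measurable
  also have "\<dots> \<le> (\<integral>\<^sup>+u. ennreal (q u) * ennreal \<eta> \<partial>lborel)"
    using \<eta>(1) by (intro nn_integral_mono) (metis ennreal_0 mult_left_mono mult_zero_left zero_le)
  also have "\<dots> = ennreal \<eta>"
    using q1 q0 by (simp add: nn_integral_multc nn_integral_eq_integral)
  also have "(\<integral>\<^sup>+y. L1_norm (\<lambda>x. smear q b (T y) x - smear q b y x) * ennreal (g y) \<partial>lborel) \<le>
      (\<integral>\<^sup>+y. ennreal ((\<omega> + 2 * indicator B y) * g y) \<partial>lborel)"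
    using K g(2) \<omega> by (intro nn_integral_mono) (auto simp: ennreal_mult intro!: mult_right_mono)
  also have "\<dots> = ennreal (\<integral>y. (\<omega> + 2 * indicator B y) * g y \<partial>lborel)"
    using Ng(1)[OF B] g(2,3) \<omega> by (intro nn_integral_eq_integral) (auto simp: distrib_right mult.assoc)
  also have "(\<integral>y. (\<omega> + 2 * indicator B y) * g y \<partial>lborel) = \<omega> + 2 * measure N B"
    using Ng[OF B] g(3,5) by (simp add: distrib_right mult.assoc)
  finally show ?thesis
    using \<omega> \<eta>(2) by (simp flip: ennreal_plus)
qed

text \<open>The estimator is compared with that of the rounded sample, this one with its mean, and
  the mean with g; the middle comparison involves only the frequencies of finitely many cells. The
  rounding error \<omega> and the exceptional set B occur twice, for the sample and for N, and on B
  two bumps of norm 1 are at most 2 apart.\<close>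

lemma L1_norm_kde_bound:
  fixes T :: "real \<Rightarrow> real"
  assumes q [measurable]: "q \<in> borel_measurable borel" and q0: "\<And>x. 0 \<le> q x"
    and q1: "integrable lborel q" "(\<integral>x. q x \<partial>lborel) = 1" and b: "0 < b n" and n: "1 \<le> n"
    and N: "real_distribution N" "is_density N g"
    and T [measurable]: "T \<in> borel_measurable borel" and S: "finite S" "range T \<subseteq> S"
    and \<omega>: "\<And>h. \<bar>h\<bar> \<le> \<delta> \<Longrightarrow> L1_modulus q h \<le> ennreal \<omega>" "0 \<le> \<omega>"
    and B [measurable]: "B \<in> sets borel" and TB: "\<And>y. y \<notin> B \<Longrightarrow> \<bar>T y - y\<bar> \<le> \<delta> * b n"
    and \<eta>: "\<And>u. q u \<noteq> 0 \<Longrightarrow> L1_modulus g (- b n * u) \<le> ennreal \<eta>" "0 \<le> \<eta>"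
  shows "L1_norm (\<lambda>x. g_hat q b n xs x - g x) \<le>
    ennreal (2 * \<omega> + 2 * freq n xs B + 2 * measure N B + \<eta> +
      (\<Sum>s\<in>S. \<bar>freq n xs (T -` {s}) - measure N (T -` {s})\<bar>))"
proof -
  interpret N: real_distribution N by fact
  note g = is_densityD[OF N(2) N.prob_space_axioms]
  note [measurable] = g(1)
  have sm [measurable]: "smear q (b n) y \<in> borel_measurable borel" for y
    unfolding smear_def[abs_def] by measurable
  have qL1: "L1_norm q = 1"
    using q1 q0 by (simp add: L1_norm_eq_integral)
  have K: "L1_norm (\<lambda>x. smear q (b n) y x - smear q (b n) (T y) x) \<le> ennreal (\<omega> + 2 * indicator B y)"
    "L1_norm (\<lambda>x. smear q (b n) (T y) x - smear q (b n) y x) \<le> ennreal (\<omega> + 2 * indicator B y)" for y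
  proof -
    have *: "L1_norm (\<lambda>x. smear q (b n) z x - smear q (b n) z' x) \<le> ennreal (\<omega> + 2 * indicator B y)"
      if "\<bar>z' - z\<bar> = \<bar>T y - y\<bar>" for z z'
    proof (cases "y \<in> B")
      case True
      have "L1_norm (\<lambda>x. smear q (b n) z x + (-1) * smear q (b n) z' x) \<le>
          L1_norm (smear q (b n) z) + L1_norm (\<lambda>x. (-1) * smear q (b n) z' x)"
        by (intro L1_norm_triangle) auto
      also have "\<dots> = ennreal 2"
        using b by (subst L1_norm_cmult) (auto simp: L1_norm_smear qL1)
      also have "\<dots> \<le> ennreal (\<omega> + 2 * indicator B y)"
        using True \<omega> by (intro ennreal_leI) simp
      finally show ?thesis by simp
    next
      case False
      then have "\<bar>(z' - z) / b n\<bar> \<le> \<delta>"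
        using TB[OF False] b that by (simp add: abs_divide pos_divide_le_eq)
      then show ?thesis
        using \<omega> False by (simp add: L1_norm_smear_diff b)
    qed
    show "L1_norm (\<lambda>x. smear q (b n) y x - smear q (b n) (T y) x) \<le> ennreal (\<omega> + 2 * indicator B y)"
      "L1_norm (\<lambda>x. smear q (b n) (T y) x - smear q (b n) y x) \<le> ennreal (\<omega> + 2 * indicator B y)"
      by (rule *; simp add: abs_minus_commute)+
  qed
  define gb where "gb x = (\<Sum>s\<in>S. freq n xs (T -` {s}) * smear q (b n) s x)" for x
  define gd where "gd x = (\<Sum>s\<in>S. measure N (T -` {s}) * smear q (b n) s x)" for x
  have [measurable]: "gb \<in> borel_measurable borel" "gd \<in> borel_measurable borel"
    unfolding gb_def gd_def by measurable
  have gh: "g_hat q b n xs x = (\<Sum>i = 1..n. (1 / real n) * smear q (b n) (xs i) x)" for x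
    by (simp add: g_hat_def smear_def sum_divide_distrib mult.commute)
  have [measurable]: "g_hat q b n xs \<in> borel_measurable borel"
    unfolding g_hat_def[abs_def] by measurable
  have smT: "smear q (b n) (T y) x = (\<Sum>s\<in>S. indicator (T -` {s}) y * smear q (b n) s x)" for x y
  proof -
    have "(\<Sum>s\<in>S. indicator (T -` {s}) y * smear q (b n) s x) = (\<Sum>s\<in>{T y}. indicator (T -` {s}) y * smear q (b n) s x)"
      using S by (intro sum.mono_neutral_right) auto
    then show ?thesis by simp
  qed
  have gb: "gb x = (\<Sum>i = 1..n. (1 / real n) * smear q (b n) (T (xs i)) x)" for x
    unfolding gb_def freq_def smT sum_divide_distrib sum_distrib_left sum_distrib_right
    by (subst sum.swap) (simp add: mult_ac)
  have 1: "L1_norm (\<lambda>x. g_hat q b n xs x - gb x) \<le> ennreal (\<omega> + 2 * freq n xs B)"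
  proof -
    have "L1_norm (\<lambda>x. g_hat q b n xs x - gb x) =
       L1_norm (\<lambda>x. \<Sum>i = 1..n. (1 / real n) * (smear q (b n) (xs i) x - smear q (b n) (T (xs i)) x))"
      by (simp add: gh gb sum_subtractf right_diff_distrib diff_divide_distrib)
    also have "\<dots> \<le> (\<Sum>i = 1..n. L1_norm (\<lambda>x. (1 / real n) * (smear q (b n) (xs i) x - smear q (b n) (T (xs i)) x)))"
      by (intro L1_norm_sum) auto
    also have "\<dots> = (\<Sum>i = 1..n. ennreal (1 / real n) * L1_norm (\<lambda>x. smear q (b n) (xs i) x - smear q (b n) (T (xs i)) x))"
      by (intro sum.cong refl, subst L1_norm_cmult) auto
    also have "\<dots> \<le> (\<Sum>i = 1..n. ennreal (1 / real n) * ennreal (\<omega> + 2 * indicator B (xs i)))"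
      by (intro sum_mono mult_left_mono K) auto
    also have "\<dots> = (\<Sum>i = 1..n. ennreal ((1 / real n) * (\<omega> + 2 * indicator B (xs i))))"
      using \<omega> by (intro sum.cong refl ennreal_mult[symmetric]) auto
    also have "\<dots> = ennreal (\<Sum>i = 1..n. (1 / real n) * (\<omega> + 2 * indicator B (xs i)))"
      using \<omega> by (intro sum_ennreal) auto
    also have "(\<Sum>i = 1..n. (1 / real n) * (\<omega> + 2 * indicator B (xs i))) = \<omega> + 2 * freq n xs B"
      using n by (simp add: freq_def sum.distrib add_divide_distrib flip: sum_divide_distrib sum_distrib_left)
    finally show ?thesis .
  qed
  have 2: "L1_norm (\<lambda>x. gb x - gd x) \<le> ennreal (\<Sum>s\<in>S. \<bar>freq n xs (T -` {s}) - measure N (T -` {s})\<bar>)"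
  proof -
    have "L1_norm (\<lambda>x. gb x - gd x) = L1_norm (\<lambda>x. \<Sum>s\<in>S. (freq n xs (T -` {s}) - measure N (T -` {s})) * smear q (b n) s x)"
      by (simp add: gb_def gd_def sum_subtractf left_diff_distrib)
    also have "\<dots> \<le> (\<Sum>s\<in>S. L1_norm (\<lambda>x. (freq n xs (T -` {s}) - measure N (T -` {s})) * smear q (b n) s x))"
      by (intro L1_norm_sum S) auto
    also have "\<dots> = (\<Sum>s\<in>S. ennreal \<bar>freq n xs (T -` {s}) - measure N (T -` {s})\<bar>)"
      using b by (intro sum.cong refl, subst L1_norm_cmult) (auto simp: L1_norm_smear qL1)
    also have "\<dots> = ennreal (\<Sum>s\<in>S. \<bar>freq n xs (T -` {s}) - measure N (T -` {s})\<bar>)"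
      by (intro sum_ennreal) auto
    finally show ?thesis .
  qed
  have 3: "L1_norm (\<lambda>x. gd x - g x) \<le> ennreal (\<omega> + 2 * measure N B + \<eta>)"
    unfolding gd_def by (rule smear_mixture_bias[OF q q0 q1 b N T S K(2) B \<omega>(2) \<eta>])
  have "L1_norm (\<lambda>x. g_hat q b n xs x - g x) \<le>
      L1_norm (\<lambda>x. g_hat q b n xs x - gb x) + (L1_norm (\<lambda>x. gb x - gd x) + L1_norm (\<lambda>x. gd x - g x))"
    by (intro order.trans[OF L1_norm_diff_triangle[where g = gb]] add_left_mono L1_norm_diff_triangle) auto
  also have "\<dots> \<le> ennreal (\<omega> + 2 * freq n xs B) +
      (ennreal (\<Sum>s\<in>S. \<bar>freq n xs (T -` {s}) - measure N (T -` {s})\<bar>) + ennreal (\<omega> + 2 * measure N B + \<eta>))"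
    by (intro add_mono 1 2 3)
  also have "\<dots> = ennreal (2 * \<omega> + 2 * freq n xs B + 2 * measure N B + \<eta> +
      (\<Sum>s\<in>S. \<bar>freq n xs (T -` {s}) - measure N (T -` {s})\<bar>))"
  proof -
    have "0 \<le> freq n xs B"
      by (auto simp: freq_def intro!: divide_nonneg_nonneg sum_nonneg)
    then show ?thesis
      using \<omega> \<eta> by (subst ennreal_plus[symmetric]; (simp add: sum_nonneg)?)+
  qed
  finally show ?thesis .
qed

section \<open>Integration against the empirical distribution\<close>

text \<open>An upward closed set of reals is empty, everything, or an open or closed half-line. The
  closed case needs the masses of \<open>{..<a}\<close>, to which the bound passes as a left limit
  of the c.d.f.s.\<close>

lemma upset_measure_le:
  assumes "real_distribution \<nu>" "real_distribution \<nu>'" and \<Delta>: "\<And>x. \<bar>cdf \<nu> x - cdf \<nu>' x\<bar> \<le> \<Delta>"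
    and A: "\<And>x y :: real. x \<in> A \<Longrightarrow> x \<le> y \<Longrightarrow> y \<in> A"
  shows "measure \<nu> A \<le> measure \<nu>' A + \<Delta>"
proof -
  interpret \<nu>: real_distribution \<nu> by fact
  interpret \<nu>': real_distribution \<nu>' by fact
  have \<Delta>0: "0 \<le> \<Delta>"
    using \<Delta>[of 0] by linarith
  consider "A = {}" | "A = UNIV" | a where "A = {a<..}" | a where "A = {a..}"
  proof (cases "A = {} \<or> A = UNIV")
    case False
    then obtain z where z: "z \<notin> A" by auto
    have bd: "bdd_below A"
      using A z by (intro bdd_belowI[of _ z]) (meson linear)
    have ge: "Inf A \<le> x" if "x \<in> A" for x
      using that bd by (rule cInf_lower)
    have gt: "x \<in> A" if x: "Inf A < x" for x
    proof -
      obtain y where "y \<in> A" "y < x"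
        using cInf_less_iff[of A x] False bd x by auto
      then show ?thesis using A by auto
    qed
    show ?thesis
    proof (cases "Inf A \<in> A")
      case True
      then have "A = {Inf A..}"
        using ge A by auto
      then show ?thesis using that by blast
    next
      case False
      then have "A = {Inf A<..}"
        using ge gt by (auto simp: less_le)
      then show ?thesis using that by blast
    qed
  qed (use that in blast)
  then show ?thesis
  proof cases
    case 1
    then show ?thesis using \<Delta>0 by simp
  next
    case 2
    then show ?thesis using \<Delta>0 \<nu>.prob_space \<nu>'.prob_space by simp
  next
    case (3 a)
    have "measure \<nu> A = 1 - cdf \<nu> a" "measure \<nu>' A = 1 - cdf \<nu>' a"
      using \<nu>.prob_compl[of "{..a}"] \<nu>'.prob_compl[of "{..a}"]
      by (simp_all add: 3 cdf_def Compl_eq_Diff_UNIV[symmetric] Compl_atMost)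
    then show ?thesis
      using \<Delta>[of a] by linarith
  next
    case (4 a)
    have "measure \<nu> A = 1 - measure \<nu> {..<a}" "measure \<nu>' A = 1 - measure \<nu>' {..<a}"
      using \<nu>.prob_compl[of "{..<a}"] \<nu>'.prob_compl[of "{..<a}"]
      by (simp_all add: 4 Compl_eq_Diff_UNIV[symmetric] Compl_lessThan)
    moreover have "measure \<nu>' {..<a} - measure \<nu> {..<a} \<le> \<Delta>"
    proof (rule tendsto_upperbound)
      show "((\<lambda>x. cdf \<nu>' x - cdf \<nu> x) \<longlongrightarrow> measure \<nu>' {..<a} - measure \<nu> {..<a}) (at_left a)"
        by (intro tendsto_diff \<nu>.cdf_at_left \<nu>'.cdf_at_left)
      show "\<forall>\<^sub>F x in at_left a. cdf \<nu>' x - cdf \<nu> x \<le> \<Delta>"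
        using \<Delta> by (intro always_eventually) (auto simp: abs_le_iff)
    qed simp
    ultimately show ?thesis by linarith
  qed
qed

text \<open>Layer cake: the integral of \<phi> is that of the mass of
  \<open>{x. t < \<phi> x}\<close> over t in [0, C), and monotonicity makes each such set upward
  closed. Jumps of \<phi> and atoms of the two laws do no harm.\<close>

lemma integral_mono_fun_le:
  assumes \<nu>: "real_distribution \<nu>" "real_distribution \<nu>'" and \<Delta>: "\<And>x. \<bar>cdf \<nu> x - cdf \<nu>' x\<bar> \<le> \<Delta>"
    and \<phi>: "mono \<phi>" "\<And>x. 0 \<le> \<phi> x" "\<And>x. \<phi> x \<le> C"
  shows "(\<integral>x. \<phi> x \<partial>\<nu>) \<le> (\<integral>x. \<phi> x \<partial>\<nu>') + C * \<Delta>"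
proof -
  have \<Delta>0: "0 \<le> \<Delta>"
    using \<Delta>[of 0] by linarith
  have C0: "0 \<le> C"
    using \<phi>(2,3)[of 0] by linarith
  have [measurable]: "\<phi> \<in> borel_measurable borel"
    using \<phi>(1) by (rule borel_measurable_mono)
  have layer: "ennreal (\<integral>x. \<phi> x \<partial>\<rho>) = (\<integral>\<^sup>+t. ennreal (measure \<rho> {x. t < \<phi> x}) * indicator {0..<C} t \<partial>lborel)"
    and int: "integrable \<rho> \<phi>"
    if "real_distribution \<rho>" for \<rho>
  proof -
    interpret \<rho>: real_distribution \<rho> by fact
    interpret L: pair_sigma_finite \<rho> lborel by standard
    show int: "integrable \<rho> \<phi>"
      using \<phi> by (intro \<rho>.integrable_const_bound[where B = C]) auto
    have ms: "{y. t < \<phi> y} \<in> sets borel" for t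
      by measurable
    have "ennreal (\<integral>x. \<phi> x \<partial>\<rho>) = (\<integral>\<^sup>+x. ennreal (\<phi> x) \<partial>\<rho>)"
      using int \<phi> by (intro nn_integral_eq_integral[symmetric]) auto
    also have "\<dots> = (\<integral>\<^sup>+x. (\<integral>\<^sup>+t. indicator {y. t < \<phi> y} x * indicator {0..<C} t \<partial>lborel) \<partial>\<rho>)"
    proof (intro nn_integral_cong)
      fix x
      have "(\<integral>\<^sup>+t. indicator {y. t < \<phi> y} x * indicator {0..<C} t \<partial>lborel) = (\<integral>\<^sup>+t. indicator {0..<\<phi> x} t \<partial>lborel)"
        using \<phi>(3)[of x] by (intro nn_integral_cong) (auto simp: indicator_def)
      then show "ennreal (\<phi> x) = (\<integral>\<^sup>+t. indicator {y. t < \<phi> y} x * indicator {0..<C} t \<partial>lborel)"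
        using \<phi>(2)[of x] by simp
    qed
    also have "\<dots> = (\<integral>\<^sup>+t. (\<integral>\<^sup>+x. indicator {y. t < \<phi> y} x * indicator {0..<C} t \<partial>\<rho>) \<partial>lborel)"
    proof -
      have "(\<lambda>z. indicator {y. snd z < \<phi> y} (fst z) * indicator {0..<C} (snd z) :: ennreal)
          = (\<lambda>z. indicator {z. snd z < \<phi> (fst z)} z * indicator {0..<C} (snd z))"
        by (auto simp: indicator_def)
      moreover have "(\<lambda>z. indicator {z. snd z < \<phi> (fst z)} z * indicator {0..<C} (snd z) :: ennreal)
          \<in> borel_measurable (\<rho> \<Otimes>\<^sub>M lborel)"
        by measurable
      ultimately show ?thesis
        by (intro L.Fubini'[symmetric]) (simp add: split_beta')
    qed
    also have "\<dots> = (\<integral>\<^sup>+t. ennreal (measure \<rho> {x. t < \<phi> x}) * indicator {0..<C} t \<partial>lborel)"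
      using ms by (intro nn_integral_cong) (simp add: nn_integral_multc \<rho>.emeasure_eq_measure)
    finally show "ennreal (\<integral>x. \<phi> x \<partial>\<rho>) = (\<integral>\<^sup>+t. ennreal (measure \<rho> {x. t < \<phi> x}) * indicator {0..<C} t \<partial>lborel)" .
  qed
  \<comment> \<open>The mass of the upper level sets decreases in t, which is what makes it
    measurable.\<close>
  have meas: "(\<lambda>t. ennreal (measure \<nu>' {x. t < \<phi> x}) * indicator {0..<C} t) \<in> borel_measurable lborel"
  proof -
    have "mono (\<lambda>t. - measure \<nu>' {x. t < \<phi> x})"
    proof (rule monoI)
      fix s t :: real assume "s \<le> t"
      interpret \<nu>': real_distribution \<nu>' by fact
      have "{x. s < \<phi> x} \<in> sets borel" by measurable
      then show "- measure \<nu>' {x. s < \<phi> x} \<le> - measure \<nu>' {x. t < \<phi> x}"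
        using \<open>s \<le> t\<close> by (auto intro!: \<nu>'.finite_measure_mono)
    qed
    then have "(\<lambda>t. - (- measure \<nu>' {x. t < \<phi> x})) \<in> borel_measurable borel"
      by (intro borel_measurable_uminus borel_measurable_mono)
    then have [measurable]: "(\<lambda>t. measure \<nu>' {x. t < \<phi> x}) \<in> borel_measurable borel"
      by simp
    show ?thesis by measurable
  qed
  have "ennreal (\<integral>x. \<phi> x \<partial>\<nu>) \<le> (\<integral>\<^sup>+t. ennreal (measure \<nu>' {x. t < \<phi> x}) * indicator {0..<C} t + ennreal \<Delta> * indicator {0..<C} t \<partial>lborel)"
    unfolding layer[OF \<nu>(1)]
  proof (intro nn_integral_mono)
    fix t
    have "measure \<nu> {x. t < \<phi> x} \<le> measure \<nu>' {x. t < \<phi> x} + \<Delta>"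
      using monoD[OF \<phi>(1)] by (intro upset_measure_le \<nu> \<Delta>) (auto intro: less_le_trans)
    then have "ennreal (measure \<nu> {x. t < \<phi> x}) \<le> ennreal (measure \<nu>' {x. t < \<phi> x}) + ennreal \<Delta>"
      using \<Delta>0 by (simp add: ennreal_leI flip: ennreal_plus)
    then show "ennreal (measure \<nu> {x. t < \<phi> x}) * indicator {0..<C} t \<le>
        ennreal (measure \<nu>' {x. t < \<phi> x}) * indicator {0..<C} t + ennreal \<Delta> * indicator {0..<C} t"
      unfolding distrib_right[symmetric] by (rule mult_right_mono) simp
  qed
  also have "\<dots> = ennreal (\<integral>x. \<phi> x \<partial>\<nu>') + ennreal \<Delta> * ennreal C"
    using meas C0 by (subst nn_integral_add) (auto simp: layer[OF \<nu>(2)] nn_integral_cmult_indicator)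
  also have "\<dots> = ennreal ((\<integral>x. \<phi> x \<partial>\<nu>') + C * \<Delta>)"
  proof -
    have "0 \<le> (\<integral>x. \<phi> x \<partial>\<nu>')"
      using \<phi> by simp
    then show ?thesis
      using C0 \<Delta>0 by (simp add: mult.commute flip: ennreal_mult ennreal_plus)
  qed
  finally show ?thesis
    using C0 \<Delta>0 \<phi>(2) by (subst (asm) ennreal_le_iff) (auto intro!: add_nonneg_nonneg)
qed

text \<open>The square of U - V is \<open>U * U + V * V\<close> minus \<open>2 * (U * V)\<close>.
  Both are nondecreasing because U and V are nonnegative, and both are at most
  \<open>2 * C\<^sup>2\<close>, so each contributes \<open>2 * C\<^sup>2 * \<Delta>\<close>.\<close>

lemma integral_square_bounded_variation:
  assumes \<nu>: "real_distribution \<nu>" "real_distribution \<nu>'" and \<Delta>: "\<And>x. \<bar>cdf \<nu> x - cdf \<nu>' x\<bar> \<le> \<Delta>"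
    and h: "bounded_variation C h"
  shows "(\<integral>x. (h x)\<^sup>2 \<partial>\<nu>) \<le> (\<integral>x. (h x)\<^sup>2 \<partial>\<nu>') + 4 * C\<^sup>2 * \<Delta>"
proof -
  obtain U V where UV: "mono U" "mono V" "\<And>x. 0 \<le> U x \<and> U x \<le> C" "\<And>x. 0 \<le> V x \<and> V x \<le> C"
    and h: "\<And>x. h x = U x - V x"
    using h unfolding bounded_variation_def by blast
  define \<phi> where "\<phi> x = U x * U x + V x * V x" for x
  define \<psi> where "\<psi> x = 2 * (U x * V x)" for x
  have C0: "0 \<le> C"
    using UV(3)[of 0] by linarith
  have mono: "mono \<phi>" "mono \<psi>"
    unfolding \<phi>_def \<psi>_def mono_def using UV
    by (auto intro!: add_mono mult_mono dest: monoD)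
  have pr: "0 \<le> W x * W' x \<and> W x * W' x \<le> C * C"
    if "0 \<le> W x \<and> W x \<le> C" "0 \<le> W' x \<and> W' x \<le> C" for W W' :: "real \<Rightarrow> real" and x
    using that C0 by (auto intro: mult_mono)
  have bd: "0 \<le> \<phi> x" "\<phi> x \<le> 2 * C\<^sup>2" "0 \<le> \<psi> x" "\<psi> x \<le> 2 * C\<^sup>2" for x
    using pr[of U x U] pr[of V x V] pr[of U x V] UV(3,4)[of x]
    by (auto simp: \<phi>_def \<psi>_def power2_eq_square)
  have [measurable]: "\<phi> \<in> borel_measurable borel" "\<psi> \<in> borel_measurable borel"
    using mono by (auto intro: borel_measurable_mono)
  have eq: "(h x)\<^sup>2 = \<phi> x - \<psi> x" for x
    by (simp add: h \<phi>_def \<psi>_def power2_eq_square algebra_simps)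
  have int: "integrable \<rho> \<phi>" "integrable \<rho> \<psi>" if "real_distribution \<rho>" for \<rho>
  proof -
    interpret \<rho>: real_distribution \<rho> by fact
    show "integrable \<rho> \<phi>" "integrable \<rho> \<psi>"
      using bd by (auto intro!: \<rho>.integrable_const_bound[where B = "2 * C\<^sup>2"])
  qed
  have \<Delta>': "\<bar>cdf \<nu>' x - cdf \<nu> x\<bar> \<le> \<Delta>" for x
    using \<Delta>[of x] by linarith
  have "(\<integral>x. \<phi> x \<partial>\<nu>) \<le> (\<integral>x. \<phi> x \<partial>\<nu>') + 2 * C\<^sup>2 * \<Delta>"
    by (intro integral_mono_fun_le \<nu> \<Delta> mono bd)
  moreover have "(\<integral>x. \<psi> x \<partial>\<nu>') \<le> (\<integral>x. \<psi> x \<partial>\<nu>) + 2 * C\<^sup>2 * \<Delta>"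
    by (intro integral_mono_fun_le \<nu> \<Delta>' mono bd)
  ultimately show ?thesis
    unfolding eq using int[OF \<nu>(1)] int[OF \<nu>(2)] by simp
qed

lemma G_hat_right_continuous: "continuous (at_right a) (G_hat n xs)"
proof -
  have "continuous (at_right a) (\<lambda>x. if y \<le> x then 1 else 0 :: real)" for y
  proof -
    have "\<forall>\<^sub>F x in at_right a. (if y \<le> x then 1 else 0 :: real) = (if y \<le> a then 1 else 0)"
    proof (cases "y \<le> a")
      case True
      then show ?thesis
        by (auto simp: eventually_at_right_field intro!: exI[of _ "a + 1"])
    next
      case False
      then show ?thesis
        by (auto simp: eventually_at_right_field intro!: exI[of _ y])
    qed
    then show ?thesis
      unfolding continuous_within by (rule tendsto_eventually)
  qed
  then show ?thesis
    unfolding G_hat_def[abs_def] by (intro continuous_intros)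
qed

lemma G_hat_mono: "mono (G_hat n xs)"
  unfolding G_hat_def mono_def by (intro allI impI mult_left_mono sum_mono) auto

lemma
  assumes n: "1 \<le> n"
  shows real_distribution_G_hat: "real_distribution (interval_measure (G_hat n xs))"
    and cdf_G_hat: "cdf (interval_measure (G_hat n xs)) = G_hat n xs"
proof -
  have top: "(G_hat n xs \<longlongrightarrow> 1) at_top"
  proof (rule tendsto_eventually)
    have "\<forall>\<^sub>F x in at_top. \<forall>i\<in>{1..n}. xs i \<le> x"
      by (intro eventually_ball_finite) (auto intro: eventually_ge_at_top)
    then show "\<forall>\<^sub>F x in at_top. G_hat n xs x = 1"
    proof eventually_elim
      case (elim x)
      have "(\<Sum>i = 1..n. if xs i \<le> x then 1 else 0) = (\<Sum>i = 1..n. 1 :: real)"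
        using elim by (intro sum.cong) auto
      then show ?case using n by (simp add: G_hat_def)
    qed
  qed
  have bot: "(G_hat n xs \<longlongrightarrow> 0) at_bot"
  proof (rule tendsto_eventually)
    have "\<forall>\<^sub>F x in at_bot. \<forall>i\<in>{1..n}. x < xs i"
      by (intro eventually_ball_finite) (auto intro: eventually_gt_at_bot)
    then show "\<forall>\<^sub>F x in at_bot. G_hat n xs x = 0"
    proof eventually_elim
      case (elim x)
      have "(\<Sum>i = 1..n. if xs i \<le> x then 1 else 0) = (\<Sum>i = 1..n. 0 :: real)"
        using elim by (intro sum.cong refl) (meson if_not_P not_le)
      then show ?case by (simp add: G_hat_def)
    qed
  qed
  show "real_distribution (interval_measure (G_hat n xs))"
    by (rule real_distribution_interval_measure[OF monoD[OF G_hat_mono] G_hat_right_continuous bot top])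
  show "cdf (interval_measure (G_hat n xs)) = G_hat n xs"
    by (rule cdf_interval_measure[OF monoD[OF G_hat_mono] G_hat_right_continuous bot])
qed

lemma measurable_A_inv [measurable]:
  assumes [measurable]: "f \<in> borel_measurable borel"
  shows "A_inv \<theta> f \<in> borel_measurable borel"
proof -
  obtain l m1 m2 where \<theta>: "\<theta> = (l, m1, m2)" by (cases \<theta>)
  show ?thesis
    unfolding \<theta> A_inv_eq[abs_def] by measurable
qed

lemma measurable_residual [measurable]:
  assumes [measurable]: "f \<in> borel_measurable borel"
  shows "residual \<theta> f \<in> borel_measurable borel"
proof -
  obtain l m1 m2 where \<theta>: "\<theta> = (l, m1, m2)" by (cases \<theta>)
  note [measurable] = measurable_A_inv[OF assms, unfolded \<theta>]
  show ?thesis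
    unfolding \<theta> residual_eq[abs_def] by measurable
qed

lemma contrast_residual: "contrast \<theta> H G = (\<integral>x. (residual \<theta> H x)\<^sup>2 \<partial>interval_measure G)"
  by (simp add: contrast_def residual_def)

section \<open>Trigonometric identification of mixtures\<close>

text \<open>For nonnegative a the increment is the mass of an interval of radius a around x, that
  is, P convolved with an indicator. It is integrable in x although the c.d.f. is not, and Fubini
  reduces the transform to integrals of the cosine over intervals around y. Negative a follow by
  oddness.\<close>

lemma cdf_increment_cosine_transform:
  assumes P: "real_distribution P" and t: "t \<noteq> 0"
  shows "integrable lborel (\<lambda>x. (cdf P (x + a) - cdf P (x - a)) * cos (t * x))" (is ?I)
    and "(\<integral>x. (cdf P (x + a) - cdf P (x - a)) * cos (t * x) \<partial>lborel) = 2 * sin (t * a) / t * (\<integral>y. cos (t * y) \<partial>P)" (is ?E)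
proof -
  interpret P: real_distribution P by fact
  interpret L: pair_sigma_finite lborel P by standard
  have main: "integrable lborel (\<lambda>x. (cdf P (x + a) - cdf P (x - a)) * cos (t * x)) \<and>
      (\<integral>x. (cdf P (x + a) - cdf P (x - a)) * cos (t * x) \<partial>lborel) = 2 * sin (t * a) / t * (\<integral>y. cos (t * y) \<partial>P)"
    if a: "0 \<le> a" for a
  proof -
    define f where "f x y = (if x - a < y \<and> y \<le> x + a then cos (t * x) else 0)" for x y :: real
    have fm [measurable]: "(\<lambda>(x, y). f x y) \<in> borel_measurable (lborel \<Otimes>\<^sub>M P)"
      unfolding f_def by measurable
    have f1: "f x y = indicator {x - a<..x + a} y * cos (t * x)" for x y
      by (auto simp: f_def indicator_def)
    have f2: "f x y = indicator {y - a..<y + a} x * cos (t * x)" for x y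
      by (auto simp: f_def indicator_def)
    have int: "integrable (lborel \<Otimes>\<^sub>M P) (\<lambda>(x, y). f x y)"
    proof (rule integrableI_bounded)
      have "(\<integral>\<^sup>+z. ennreal (norm (case z of (x, y) \<Rightarrow> f x y)) \<partial>(lborel \<Otimes>\<^sub>M P)) =
         (\<integral>\<^sup>+y. (\<integral>\<^sup>+x. ennreal (norm (f x y)) \<partial>lborel) \<partial>P)"
        by (subst L.nn_integral_snd[symmetric]) (auto simp: split_beta')
      also have "\<dots> \<le> (\<integral>\<^sup>+y. (\<integral>\<^sup>+x. indicator {y - a..<y + a} x \<partial>lborel) \<partial>P)"
      proof (intro nn_integral_mono)
        fix x y
        show "ennreal (norm (f x y)) \<le> indicator {y - a..<y + a} x"
          by (auto simp: f2 indicator_def)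
      qed
      also have "\<dots> < \<infinity>"
        using a by (simp add: P.emeasure_eq_measure ennreal_mult_less_top)
      finally show "(\<integral>\<^sup>+z. ennreal (norm (case z of (x, y) \<Rightarrow> f x y)) \<partial>(lborel \<Otimes>\<^sub>M P)) < \<infinity>" .
    qed (rule fm)
    have inner1: "(\<integral>y. f x y \<partial>P) = (cdf P (x + a) - cdf P (x - a)) * cos (t * x)" for x
    proof -
      have "(\<integral>y. f x y \<partial>P) = measure P {x - a<..x + a} * cos (t * x)"
        by (simp add: f1)
      also have "measure P {x - a<..x + a} = cdf P (x + a) - cdf P (x - a)"
        using a by (cases "a = 0") (auto simp: P.cdf_diff_eq)
      finally show ?thesis .
    qed
    have inner2: "(\<integral>x. f x y \<partial>lborel) = 2 * sin (t * a) / t * cos (t * y)" for y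
    proof -
      have "(\<integral>x. f x y \<partial>lborel) = (\<integral>x. indicator {y - a..y + a} x *\<^sub>R cos (t * x) \<partial>lborel)"
      proof (rule integral_cong_AE)
        show "AE x in lborel. f x y = indicator {y - a..y + a} x *\<^sub>R cos (t * x)"
          using AE_lborel_singleton[of "y + a"] by eventually_elim (auto simp: f2 indicator_def)
      qed (simp_all add: f2)
      also have "\<dots> = sin (t * (y + a)) / t - sin (t * (y - a)) / t"
        using t a by (intro integral_FTC_Icc)
          (auto intro!: derivative_eq_intros continuous_intros simp: has_real_derivative_iff_has_vector_derivative[symmetric])
      also have "\<dots> = 2 * sin (t * a) / t * cos (t * y)"
        by (simp add: distrib_left right_diff_distrib sin_add sin_diff flip: diff_divide_distrib)
      finally show ?thesis .
    qed
    have "integrable lborel (\<lambda>x. \<integral>y. f x y \<partial>P)"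
      using L.integrable_fst'[OF int] by simp
    moreover have "(\<integral>x. (\<integral>y. f x y \<partial>P) \<partial>lborel) = (\<integral>y. (\<integral>x. f x y \<partial>lborel) \<partial>P)"
      using L.Fubini_integral[OF int] by simp
    ultimately show ?thesis
      by (simp add: inner1 inner2)
  qed
  show ?I
    using main[of "\<bar>a\<bar>"] by (cases "0 \<le> a") (auto simp: left_diff_distrib dest: Bochner_Integration.integrable_minus)
  show ?E
  proof (cases "0 \<le> a")
    case False
    have "(\<integral>x. (cdf P (x + a) - cdf P (x - a)) * cos (t * x) \<partial>lborel) =
       (\<integral>x. - ((cdf P (x + (- a)) - cdf P (x - (- a))) * cos (t * x)) \<partial>lborel)"
      by (intro Bochner_Integration.integral_cong) (auto simp: algebra_simps)
    also have "\<dots> = - (2 * sin (t * (- a)) / t * (\<integral>y. cos (t * y) \<partial>P))"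
      using main[of "- a"] False by simp
    finally show ?thesis by simp
  qed (use main in blast)
qed

text \<open>The cosine transform is the real part of the characteristic function, continuous with
  value 1 at the origin. Zeros further out cannot be excluded, so the trigonometric identities
  derived from it hold only for small t.\<close>

lemma cosine_transform_nonzero:
  assumes P: "real_distribution P"
  obtains \<delta> where "0 < \<delta>" "\<And>t. \<bar>t\<bar> < \<delta> \<Longrightarrow> (\<integral>y. cos (t * y) \<partial>P) \<noteq> 0"
proof -
  interpret P: real_distribution P by fact
  define c where "c t = (\<integral>y. cos (t * y) \<partial>P)" for t
  have c: "c t = Re (char P t)" for t
    unfolding c_def char_def using P.integrable_iexp[of "\<lambda>x. t * x"]
    by (subst integral_Re[symmetric]) (auto simp: Re_exp intro!: Bochner_Integration.integral_cong)
  have "isCont (\<lambda>t. Re (char P t)) 0"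
    by (intro isCont_Re P.isCont_char)
  then have "isCont c 0" by (simp add: c[abs_def])
  moreover have "c 0 = 1"
    using P.prob_space by (simp add: c_def)
  ultimately have "\<exists>d>0. \<forall>y. dist y 0 < d \<longrightarrow> dist (c y) 1 < 1"
    by (simp add: continuous_at_eps_delta)
  then obtain d where d: "0 < d" "\<And>y. \<bar>y\<bar> < d \<Longrightarrow> \<bar>c y - 1\<bar> < 1"
    by (auto simp: dist_real_def)
  show thesis
  proof (rule that[OF d(1)])
    show "(\<integral>y. cos (t * y) \<partial>P) \<noteq> 0" if "\<bar>t\<bar> < d" for t
      using d(2)[OF that] by (auto simp: c_def)
  qed
qed

section \<open>Trigonometric sums that vanish near the origin\<close>

lemma derivative_of_locally_zero:
  fixes f :: "real \<Rightarrow> real"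
  assumes "\<And>t. \<bar>t\<bar> < \<delta> \<Longrightarrow> f t = 0" "\<bar>t\<bar> < \<delta>" "(f has_real_derivative D) (at t)"
  shows "D = 0"
proof -
  have "((\<lambda>_. 0) has_real_derivative D) (at t)"
    using assms(3)
  proof (rule DERIV_cong_ev[OF refl _ refl, THEN iffD1, rotated])
    have "open {t. \<bar>t\<bar> < \<delta>}"
      by (intro open_Collect_less continuous_intros)
    then show "\<forall>\<^sub>F x in nhds t. f x = 0"
      using assms(1,2) by (auto simp: eventually_nhds intro!: exI[of _ "{t. \<bar>t\<bar> < \<delta>}"])
  qed
  then show ?thesis
    using DERIV_unique DERIV_const by blast
qed

text \<open>Derivatives of order 2k + 1 at the origin: each pair of differentiations multiplies the
  coefficient of the j-th sine by \<open>- (b j)\<^sup>2\<close>, and the last one turns sines into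
  cosines.\<close>

lemma sine_sum_zero_imp_moments:
  fixes w b :: "'i \<Rightarrow> real"
  assumes \<delta>: "0 < \<delta>" and zero: "\<And>t. \<bar>t\<bar> < \<delta> \<Longrightarrow> (\<Sum>j\<in>J. w j * sin (t * b j)) = 0"
  shows "(\<Sum>j\<in>J. w j * b j * ((b j)\<^sup>2) ^ k) = 0"
proof -
  have dsin: "((\<lambda>t. \<Sum>j\<in>J. c j * sin (t * b j)) has_real_derivative (\<Sum>j\<in>J. c j * b j * cos (t * b j))) (at t)"
    for c :: "'i \<Rightarrow> real" and t
    by (intro DERIV_sum) (auto intro!: derivative_eq_intros)
  have dcos: "((\<lambda>t. \<Sum>j\<in>J. c j * cos (t * b j)) has_real_derivative (\<Sum>j\<in>J. - (c j * b j * sin (t * b j)))) (at t)"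
    for c :: "'i \<Rightarrow> real" and t
    by (intro DERIV_sum) (auto intro!: derivative_eq_intros)
  have step: "(\<Sum>j\<in>J. c j * b j * cos (t * b j)) = 0" if "\<And>t. \<bar>t\<bar> < \<delta> \<Longrightarrow> (\<Sum>j\<in>J. c j * sin (t * b j)) = 0" "\<bar>t\<bar> < \<delta>"
    for c t
    by (rule derivative_of_locally_zero[OF that dsin])
  have step': "(\<Sum>j\<in>J. c j * b j * sin (t * b j)) = 0" if "\<And>t. \<bar>t\<bar> < \<delta> \<Longrightarrow> (\<Sum>j\<in>J. c j * cos (t * b j)) = 0" "\<bar>t\<bar> < \<delta>"
    for c t
    using derivative_of_locally_zero[OF that dcos] unfolding sum_negf by simp
  have sin0: "(\<Sum>j\<in>J. w j * ((b j)\<^sup>2) ^ k * sin (t * b j)) = 0" if "\<bar>t\<bar> < \<delta>" for t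
    using that
  proof (induction k arbitrary: t)
    case 0
    then show ?case using zero by simp
  next
    case (Suc k)
    have "(\<Sum>j\<in>J. w j * ((b j)\<^sup>2) ^ k * b j * b j * sin (t * b j)) = 0"
      by (rule step'[OF step[OF Suc.IH] Suc.prems])
    moreover have "w j * ((b j)\<^sup>2) ^ Suc k = w j * ((b j)\<^sup>2) ^ k * b j * b j" for j
      by (simp add: power2_eq_square)
    ultimately show ?case
      by (simp only:)
  qed
  have "(\<Sum>j\<in>J. w j * ((b j)\<^sup>2) ^ k * b j * cos (0 * b j)) = 0"
    using step[OF sin0, of 0] \<delta> by simp
  then show ?thesis
    by (simp add: mult.assoc mult.commute[of "b _"])
qed

text \<open>As the odd moments vanish, so does the sum of
  \<open>w j * b j * poly p ((b j)\<^sup>2)\<close> for every polynomial p; the one whose roots are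
  the other squared frequencies isolates c. Sine is odd, so a frequency is visible only up to sign,
  hence the comparison of squares.\<close>

lemma sine_sum_zero_imp_coefficients:
  fixes w b :: "'i \<Rightarrow> real"
  assumes J: "finite J" and \<delta>: "0 < \<delta>" and zero: "\<And>t. \<bar>t\<bar> < \<delta> \<Longrightarrow> (\<Sum>j\<in>J. w j * sin (t * b j)) = 0"
  shows "(\<Sum>j\<in>J. if (b j)\<^sup>2 = c\<^sup>2 then w j * b j else 0) = 0"
proof -
  define p where "p = (\<Prod>u\<in>(\<lambda>j. (b j)\<^sup>2) ` J - {c\<^sup>2}. [:- u, 1:])"
  have p: "poly p x = (\<Prod>u\<in>(\<lambda>j. (b j)\<^sup>2) ` J - {c\<^sup>2}. x - u)" for x
    by (simp add: p_def poly_prod)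
  have "(\<Sum>j\<in>J. w j * b j * poly p ((b j)\<^sup>2)) = (\<Sum>j\<in>J. \<Sum>k\<le>degree p. coeff p k * (w j * b j * ((b j)\<^sup>2) ^ k))"
    by (simp add: poly_altdef sum_distrib_left mult_ac)
  also have "\<dots> = (\<Sum>k\<le>degree p. coeff p k * (\<Sum>j\<in>J. w j * b j * ((b j)\<^sup>2) ^ k))"
    by (subst sum.swap) (simp add: sum_distrib_left)
  also have "\<dots> = 0"
    using sine_sum_zero_imp_moments[OF \<delta> zero] by simp
  finally have "(\<Sum>j\<in>J. w j * b j * poly p ((b j)\<^sup>2)) = 0" .
  moreover have "w j * b j * poly p ((b j)\<^sup>2) = poly p (c\<^sup>2) * (if (b j)\<^sup>2 = c\<^sup>2 then w j * b j else 0)" if "j \<in> J" for j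
  proof (cases "(b j)\<^sup>2 = c\<^sup>2")
    case False
    then have "poly p ((b j)\<^sup>2) = 0"
      unfolding p using J that by (intro prod_zero) auto
    then show ?thesis using False by simp
  qed simp
  ultimately have "poly p (c\<^sup>2) * (\<Sum>j\<in>J. if (b j)\<^sup>2 = c\<^sup>2 then w j * b j else 0) = 0"
    by (simp add: sum_distrib_left cong: sum.cong)
  moreover have "poly p (c\<^sup>2) \<noteq> 0"
    unfolding p using J by (auto simp: prod_zero_iff)
  ultimately show ?thesis by simp
qed

text \<open>\<open>b1, b2, b3, b4\<close> are the differences \<open>\<mu> i - m k\<close> of the location parameters of two
  mixtures, which explains \<open>b1 + b4 = b2 + b3\<close>.\<close>

lemma mixture_frequencies_unique:
  fixes l l0 :: real
  assumes l: "0 \<le> l" "l < 1/2" and l0: "0 < l0" "l0 < 1/2"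
    and b: "b1 + b4 = b2 + b3" "b1 \<noteq> b2" "b1 \<noteq> b3"
    and zero: "\<And>c. (if b1\<^sup>2 = c\<^sup>2 then l * l0 * b1 else 0) + (if b2\<^sup>2 = c\<^sup>2 then l * (1 - l0) * b2 else 0) +
      (if b3\<^sup>2 = c\<^sup>2 then (1 - l) * l0 * b3 else 0) + (if b4\<^sup>2 = c\<^sup>2 then (1 - l) * (1 - l0) * b4 else 0) = (0::real)"
  shows "b4 = 0" "b1 = 0" "l = l0"
proof -
  have pos: "0 < 1 - 2 * l" "0 < 1 - 2 * l0" "0 < (1 - 2 * l) * (1 - 2 * l0)" "0 \<le> l * l0" "0 \<le> l * (1 - l0)"
    "0 < (1 - l) * l0" "0 < (1 - 2 * l) * (1 - l0)" "0 < (1 - 2 * l0) * (1 - l)"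
    using l l0 by auto
  show b4: "b4 = 0"
  proof (rule ccontr)
    assume b4: "b4 \<noteq> 0"
    \<comment> \<open>The sign with which x matches b4, and 0 if it matches neither b4 nor - b4. The
      condition at frequency b4 becomes a linear relation between the four weights.\<close>
    define sg where "sg x = (if x = b4 then 1 else if x = - b4 then - 1 else 0 :: real)" for x
    have sg: "(if x\<^sup>2 = b4\<^sup>2 then u * x else 0) = u * sg x * b4" for x u
      using b4 by (auto simp: sg_def power2_eq_iff)
    have "l * l0 * sg b1 * b4 + l * (1 - l0) * sg b2 * b4 + (1 - l) * l0 * sg b3 * b4 + (1 - l) * (1 - l0) * b4 = 0"
      using zero[of b4] by (simp only: sg) (simp add: sg_def)
    then have "(l * l0 * sg b1 + l * (1 - l0) * sg b2 + (1 - l) * l0 * sg b3 + (1 - l) * (1 - l0)) * b4 = 0"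
      by (simp add: algebra_simps)
    then have e: "l * l0 * sg b1 + l * (1 - l0) * sg b2 + (1 - l) * l0 * sg b3 + (1 - l) * (1 - l0) = 0"
      using b4 by simp
    have v: "sg x = 0 \<or> sg x = 1 \<or> sg x = - 1" for x
      by (auto simp: sg_def)
    \<comment> \<open>The weight \<open>(1 - l) * (1 - l0)\<close> of b4 has to be cancelled. If b1
      = b4, an excess of at least \<open>(1 - 2 * l) * (1 - 2 * l0)\<close> remains. If b1 does not
      match, both b2 and b3 must be - b4, each weight alone being too small; then b1 = -3 b4 is
      isolated, so l = 0 and b3 would have to cancel alone. If b1 = - b4, then b3 = - b2 and their
      contributions have opposite signs.\<close>
    consider "sg b1 = 1" | "sg b1 = 0" | "sg b1 = - 1"
      using v by blast
    then show False
    proof cases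
      case 1
      then show False
        using e v[of b2] v[of b3] pos by (auto simp: algebra_simps)
    next
      case 2
      then have "sg b2 = - 1 \<and> sg b3 = - 1"
        using e v[of b2] v[of b3] pos by (auto simp: algebra_simps)
      then have b23: "b2 = - b4" "b3 = - b4"
        using b4 by (auto simp: sg_def split: if_splits)
      then have b1: "b1 = - 3 * b4"
        using b by linarith
      have "b1\<^sup>2 \<noteq> b4\<^sup>2"
        using b4 by (auto simp: b1 power2_eq_iff)
      then have "l * l0 * b1 = 0"
        using zero[of b1] by (simp add: b23 eq_commute[of "b4\<^sup>2"])
      then have "l = 0"
        using b1 b4 l0 by simp
      then show False
        using e 2 b23 pos v[of b3] by (auto simp: algebra_simps)
    next
      case 3
      then have b1: "b1 = - b4"
        using b4 by (auto simp: sg_def split: if_splits)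
      then have "b3 = - b2"
        using b by linarith
      then have "sg b3 = - sg b2"
        using b4 by (auto simp: sg_def)
      then show False
        using e 3 v[of b2] pos by (auto simp: algebra_simps)
    qed
  qed
  have b1: "b1 = b2 + b3"
    using b b4 by simp
  have b2: "b2 \<noteq> 0" and b3: "b3 \<noteq> 0"
    using b b1 by auto
  \<comment> \<open>The weight of b3 is positive, so b3 must be matched by another frequency. If b2
    = b3 the two terms reinforce each other and b1 = 2 b3 cannot help; if only b1 matches, b2 is
    isolated, which forces l = 0 and thereby removes b1.\<close>
  have "b2 = - b3"
  proof (rule ccontr)
    assume n: "b2 \<noteq> - b3"
    show False
    proof (cases "b2 = b3")
      case True
      have "b1\<^sup>2 \<noteq> b3\<^sup>2"
        using b3 b1 True by (auto simp: power2_eq_iff)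
      then have "(l * (1 - l0) + (1 - l) * l0) * b3 = 0"
        using zero[of b3] b3 by (simp add: b4 True algebra_simps)
      then show False
        using b3 pos by auto
    next
      case False
      then have b23: "b2\<^sup>2 \<noteq> b3\<^sup>2"
        using n by (auto simp: power2_eq_iff)
      have "b1\<^sup>2 = b3\<^sup>2"
      proof (rule ccontr)
        assume "b1\<^sup>2 \<noteq> b3\<^sup>2"
        then have "(1 - l) * l0 * b3 = 0"
          using zero[of b3] b23 b3 by (simp add: b4)
        then show False
          using b3 pos by auto
      qed
      then have "l * (1 - l0) * b2 = 0"
        using zero[of b2] b23 b2 by (simp add: b4)
      then have "l = 0"
        using b2 l0 by auto
      then show False
        using zero[of b3] b23 b3 l0 by (simp add: b4 split: if_splits)
    qed
  qed
  then show "b1 = 0"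
    using b1 by simp
  then have "(1 - l) * l0 * b3 - l * (1 - l0) * b3 = 0"
    using zero[of b3] b3 \<open>b2 = - b3\<close> by (simp add: b4)
  then have "((1 - l) * l0 - l * (1 - l0)) * b3 = 0"
    by (simp add: algebra_simps)
  then show "l = l0"
    using b3 by (simp add: algebra_simps)
qed

text \<open>The third derivative at 0 gives u s = 3 \<beta>. Under this relation the cosine terms of
  the third derivative cancel for every small t, so that \<beta> t sin(t s) vanishes as
  well.\<close>

lemma trigonometric_identity_trivial:
  fixes u \<alpha> \<beta> s :: real
  assumes s: "s \<noteq> 0" and \<delta>: "0 < \<delta>"
    and zero: "\<And>t. \<bar>t\<bar> < \<delta> \<Longrightarrow> 2 * u * sin (t * s) - t * (\<alpha> + 2 * \<beta> * cos (t * s)) = 0"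
  shows "u = 0" "\<alpha> = 0" "\<beta> = 0"
proof -
  have d1: "2 * u * s * cos (t * s) - (\<alpha> + 2 * \<beta> * cos (t * s)) + 2 * \<beta> * s * t * sin (t * s) = 0" if "\<bar>t\<bar> < \<delta>" for t
    by (rule derivative_of_locally_zero[OF zero that]) (auto intro!: derivative_eq_intros simp: algebra_simps)
  have d2: "(- 2 * u * s * s + 4 * \<beta> * s) * sin (t * s) + 2 * \<beta> * s * s * t * cos (t * s) = 0" if "\<bar>t\<bar> < \<delta>" for t
    by (rule derivative_of_locally_zero[OF d1 that]) (auto intro!: derivative_eq_intros simp: algebra_simps)
  have d3: "(- 2 * u * s * s + 4 * \<beta> * s) * s * cos (t * s) + 2 * \<beta> * s * s * cos (t * s) - 2 * \<beta> * s * s * s * t * sin (t * s) = 0"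
    if "\<bar>t\<bar> < \<delta>" for t
    by (rule derivative_of_locally_zero[OF d2 that]) (auto intro!: derivative_eq_intros simp: algebra_simps)
  have "s * s * (- 2 * u * s + 6 * \<beta>) = 0"
    using d3[of 0] \<delta> by (simp add: algebra_simps)
  then have us: "u * s = 3 * \<beta>"
    using s by simp
  \<comment> \<open>Inside the neighbourhood, and with t \<bar>s\<bar> at most pi/2, so that the
    sine is nonzero.\<close>
  define t where "t = min (\<delta> / 2) (pi / (2 * \<bar>s\<bar>))"
  have t: "0 < t" "\<bar>t\<bar> < \<delta>"
    using \<delta> s by (auto simp: t_def)
  have "t * \<bar>s\<bar> \<le> pi / (2 * \<bar>s\<bar>) * \<bar>s\<bar>"
    by (intro mult_right_mono) (auto simp: t_def)
  then have ts: "t * \<bar>s\<bar> \<le> pi / 2"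
    using s by simp
  have "(- 2 * u * s * s + 4 * \<beta> * s) * s * cos (t * s) + 2 * \<beta> * s * s * cos (t * s) = s * s * cos (t * s) * (- 2 * (u * s) + 6 * \<beta>)"
    by (simp add: algebra_simps)
  then have "2 * \<beta> * s * s * s * t * sin (t * s) = 0"
    using d3[OF t(2)] us by simp
  moreover have "sin (t * s) \<noteq> 0"
  proof -
    have "0 < sin (t * \<bar>s\<bar>)"
      using t s ts by (intro sin_gt_zero mult_pos_pos order.strict_trans1[OF ts]) auto
    then show ?thesis
      by (cases "0 \<le> s") auto
  qed
  ultimately show \<beta>: "\<beta> = 0"
    using s t by simp
  then show "u = 0"
    using us s by simp
  then show "\<alpha> = 0"
    using d1[of 0] \<delta> \<beta> by simp
qed

section \<open>The contrast for known locations\<close>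

text \<open>F' differs from its value at 0 by an integral of F'', so it is bounded by
  \<open>\<bar>F' 0\<bar>\<close> plus the \<open>L\<^sup>1\<close> norm of F''. Everything proved
  under C1 is thereby available under C2.\<close>

lemma C2_imp_C1:
  assumes "C2 F"
  shows "C1 F"
proof -
  obtain F' F'' where mono: "strict_mono F" and d1: "\<And>x. (F has_real_derivative F' x) (at x)"
    and d2: "\<And>x. (F' has_real_derivative F'' x) (at x)" and cont: "continuous_on UNIV F''" and int: "integrable lborel F''"
    using assms unfolding C2_def by blast
  define I where "I = (\<integral>x. \<bar>F'' x\<bar> \<partial>lborel)"
  have inc: "\<bar>F' y - F' x\<bar> \<le> I" if "x \<le> y" for x y
  proof -
    have "F' y - F' x = (\<integral>z. indicator {x..y} z *\<^sub>R F'' z \<partial>lborel)"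
      using that d2 cont by (intro integral_FTC_Icc[symmetric])
        (auto simp: has_real_derivative_iff_has_vector_derivative[symmetric] intro: has_field_derivative_at_within continuous_on_subset)
    then have "\<bar>F' y - F' x\<bar> \<le> (\<integral>z. \<bar>indicator {x..y} z *\<^sub>R F'' z\<bar> \<partial>lborel)"
      using integral_norm_bound[of lborel "\<lambda>z. indicator {x..y} z *\<^sub>R F'' z"] by simp
    also have "\<dots> \<le> I"
      unfolding I_def using int by (intro integral_mono_AE') (auto simp: indicator_def)
    finally show ?thesis .
  qed
  define L where "L = \<bar>F' 0\<bar> + I"
  have bd: "\<bar>F' x\<bar> \<le> L" for x
    using inc[of 0 x] inc[of x 0] by (cases "0 \<le> x") (auto simp: L_def)
  have "L-lipschitz_on UNIV F"
  proof (rule bounded_derivative_imp_lipschitz)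
    show "(F has_derivative (*) (F' x)) (at x within UNIV)" for x
      using d1[of x] by (simp add: has_field_derivative_def)
    show "onorm ((*) (F' x)) \<le> L" for x
      using bd[of x] by (intro onorm_le) (auto simp: abs_mult intro: mult_right_mono)
    show "0 \<le> L"
      using bd[of 0] by linarith
  qed simp
  with mono show ?thesis
    unfolding C1_def by blast
qed

text \<open>Uniform continuity of the density, although F'' need not be bounded. It provides the
  common modulus of continuity for the rescaled asymmetries near the true parameter.\<close>

lemma C2_derivative_modulus:
  assumes "C2 F"
  obtains F' where "\<And>x. (F has_real_derivative F' x) (at x)" "continuous_on UNIV F'"
    "\<And>\<epsilon>. 0 < \<epsilon> \<Longrightarrow> \<exists>\<delta>>0. \<forall>h. \<bar>h\<bar> \<le> \<delta> \<longrightarrow> (\<forall>x. \<bar>F' (x + h) - F' x\<bar> \<le> \<epsilon>)"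
proof -
  obtain F' F'' where mono: "strict_mono F" and d1: "\<And>x. (F has_real_derivative F' x) (at x)"
    and d2: "\<And>x. (F' has_real_derivative F'' x) (at x)" and cont: "continuous_on UNIV F''" and int: "integrable lborel F''"
    using assms unfolding C2_def by blast
  have inc: "F' y - F' x = (\<integral>z. indicator {x..y} z *\<^sub>R F'' z \<partial>lborel)" if "x \<le> y" for x y
    using that d2 cont by (intro integral_FTC_Icc[symmetric])
      (auto simp: has_real_derivative_iff_has_vector_derivative[symmetric] intro: has_field_derivative_at_within continuous_on_subset)
  show thesis
  proof (rule that[OF d1])
    show "continuous_on UNIV F'"
      using d2 by (meson DERIV_continuous_on has_field_derivative_at_within)
    fix \<epsilon> :: real assume \<epsilon>: "0 < \<epsilon>"
    obtain \<delta> where \<delta>: "0 < \<delta>" "\<And>h. \<bar>h\<bar> \<le> \<delta> \<Longrightarrow> L1_modulus F'' h \<le> ennreal (\<epsilon> / 2)"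
      using L1_modulus_small[OF int, of "\<epsilon> / 2"] \<epsilon> by auto
    have lim: "((\<lambda>h. (\<integral>z. \<bar>F'' (z + h) - F'' z\<bar> \<partial>lborel))) h \<le> \<epsilon> / 2" if "\<bar>h\<bar> \<le> \<delta>" for h
    proof -
      have i: "integrable lborel (\<lambda>z. F'' (z + h) - F'' z)"
        using lborel_integrable_real_affine[OF int, of 1 h] int by (simp add: add.commute)
      show ?thesis
        using \<delta>(2)[OF that] \<epsilon> unfolding L1_modulus_def L1_norm_eq_integral[OF i] by simp
    qed
    text \<open>Increments of \<open>F'\<close> over intervals of length \<open>h\<close> differ by at most the \<open>L\<^sup>1\<close> modulus
      of \<open>F''\<close>, wherever the intervals lie, and those over \<open>{n..n + h}\<close> tend to \<open>0\<close>.\<close>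
    have diff: "\<bar>(F' (y + h) - F' y) - (F' (x + h) - F' x)\<bar> \<le> \<epsilon> / 2" if h: "\<bar>h\<bar> \<le> \<delta>" and xy: "x \<le> y" for x y h
    proof -
      have i: "integrable lborel (\<lambda>z. F'' (z + h))"
        using lborel_integrable_real_affine[OF int, of 1 h] by (simp add: add.commute)
      have "F' (y + h) - F' (x + h) = (\<integral>z. indicator {x + h..y + h} z *\<^sub>R F'' z \<partial>lborel)"
        using xy by (intro inc) simp
      also have "\<dots> = (\<integral>z. indicator {x + h..y + h} (h + 1 * z) *\<^sub>R F'' (h + 1 * z) \<partial>lborel)"
        by (subst lborel_integral_real_affine[of 1 _ h]) auto
      also have "\<dots> = (\<integral>z. indicator {x..y} z *\<^sub>R F'' (z + h) \<partial>lborel)"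
        by (intro Bochner_Integration.integral_cong) (auto simp: indicator_def add.commute)
      finally have "(F' (y + h) - F' y) - (F' (x + h) - F' x) =
          (\<integral>z. indicator {x..y} z *\<^sub>R F'' (z + h) \<partial>lborel) - (\<integral>z. indicator {x..y} z *\<^sub>R F'' z \<partial>lborel)"
        using inc[OF xy] by simp
      also have "\<dots> = (\<integral>z. indicator {x..y} z *\<^sub>R (F'' (z + h) - F'' z) \<partial>lborel)"
        using i int by (simp add: right_diff_distrib integrable_real_mult_indicator Bochner_Integration.integral_diff mult.commute)
      finally have "\<bar>(F' (y + h) - F' y) - (F' (x + h) - F' x)\<bar> \<le>
          (\<integral>z. \<bar>indicator {x..y} z *\<^sub>R (F'' (z + h) - F'' z)\<bar> \<partial>lborel)"
        using integral_norm_bound[of lborel "\<lambda>z. indicator {x..y} z *\<^sub>R (F'' (z + h) - F'' z)"] by simp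
      also have "\<dots> \<le> (\<integral>z. \<bar>F'' (z + h) - F'' z\<bar> \<partial>lborel)"
        using i int by (intro integral_mono_AE') (auto simp: indicator_def)
      finally show ?thesis
        using lim[OF h] by simp
    qed
    have small: "\<exists>x0\<le>x. \<bar>F' (x0 + h) - F' x0\<bar> \<le> \<epsilon> / 2" for x h
    proof -
      have "(\<lambda>n::nat. \<integral>z. indicator {..- real n} z *\<^sub>R \<bar>F'' z\<bar> \<partial>lborel) \<longlonglongrightarrow> (\<integral>z. 0 \<partial>(lborel :: real measure))"
      proof (rule integral_dominated_convergence[where w = "\<lambda>z. \<bar>F'' z\<bar>"])
        show "AE z in lborel. (\<lambda>n::nat. indicator {..- real n} z *\<^sub>R \<bar>F'' z\<bar>) \<longlonglongrightarrow> 0"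
        proof (intro AE_I2 tendsto_eventually)
          fix z :: real
          obtain n0 :: nat where "- z < real n0"
            using reals_Archimedean2 by blast
          then show "\<forall>\<^sub>F n in sequentially. indicator {..- real n} z *\<^sub>R \<bar>F'' z\<bar> = 0"
            by (intro eventually_sequentiallyI[of n0]) (auto simp: indicator_def)
        qed
      qed (use int in \<open>auto simp: indicator_def\<close>)
      then have "eventually (\<lambda>n::nat. (\<integral>z. indicator {..- real n} z *\<^sub>R \<bar>F'' z\<bar> \<partial>lborel) < \<epsilon> / 2) sequentially"
        using \<epsilon> by (intro order_tendstoD) auto
      then obtain n :: nat where n: "(\<integral>z. indicator {..- real n} z *\<^sub>R \<bar>F'' z\<bar> \<partial>lborel) < \<epsilon> / 2"
        by (auto simp: eventually_sequentially)
      have bd: "\<bar>F' b - F' a\<bar> \<le> \<epsilon> / 2" if "a \<le> b" "b \<le> - real n" for a b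
      proof -
        have "\<bar>F' b - F' a\<bar> \<le> (\<integral>z. \<bar>indicator {a..b} z *\<^sub>R F'' z\<bar> \<partial>lborel)"
          unfolding inc[OF that(1)] using integral_norm_bound[of lborel "\<lambda>z. indicator {a..b} z *\<^sub>R F'' z"] by simp
        also have "\<dots> \<le> (\<integral>z. indicator {..- real n} z *\<^sub>R \<bar>F'' z\<bar> \<partial>lborel)"
          using that by (intro integral_mono integrable_mult_indicator integrable_abs int) (auto simp: indicator_def)
        finally show ?thesis using n by simp
      qed
      \<comment> \<open>Both \<open>x0\<close> and \<open>x0 + h\<close> lie to the left of
        \<open>- real n\<close>, and \<open>x0 \<le> x\<close>, the order in which
        \<open>diff\<close> is stated.\<close>
      define x0 where "x0 = min x (- real n - \<bar>h\<bar>)"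
      have "\<bar>F' (x0 + h) - F' x0\<bar> \<le> \<epsilon> / 2"
      proof (cases "0 \<le> h")
        case True
        then show ?thesis
          by (intro bd) (auto simp: x0_def)
      next
        case False
        then have "\<bar>F' x0 - F' (x0 + h)\<bar> \<le> \<epsilon> / 2"
          by (intro bd) (auto simp: x0_def)
        then show ?thesis
          by (simp add: abs_minus_commute)
      qed
      then show ?thesis
        by (intro exI[of _ x0]) (simp add: x0_def)
    qed
    have "\<bar>F' (x + h) - F' x\<bar> \<le> \<epsilon>" if h: "\<bar>h\<bar> \<le> \<delta>" for x h
    proof -
      obtain x0 where x0: "x0 \<le> x" "\<bar>F' (x0 + h) - F' x0\<bar> \<le> \<epsilon> / 2"
        using small by blast
      show ?thesis
        using diff[OF h x0(1)] x0(2) by linarith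
    qed
    with \<delta>(1) show "\<exists>\<delta>>0. \<forall>h. \<bar>h\<bar> \<le> \<delta> \<longrightarrow> (\<forall>x. \<bar>F' (x + h) - F' x\<bar> \<le> \<epsilon>)"
      by blast
  qed
qed

lemma integral_square_ge:
  assumes N: "real_distribution N" and v: "v \<in> borel_measurable borel" "\<And>x. \<bar>v x\<bar> \<le> B"
    and ge: "\<And>x. x \<in> A \<Longrightarrow> e \<le> \<bar>v x\<bar>" and A: "A \<in> sets borel" and e: "0 \<le> e"
  shows "e\<^sup>2 * measure N A \<le> (\<integral>x. (v x)\<^sup>2 \<partial>N)"
proof -
  interpret real_distribution N by fact
  have "e\<^sup>2 * measure N A = (\<integral>x. e\<^sup>2 * indicator A x \<partial>N)"
    using A by simp
  also have "\<dots> \<le> (\<integral>x. (v x)\<^sup>2 \<partial>N)"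
  proof (rule integral_mono)
    show "integrable N (\<lambda>x. e\<^sup>2 * indicator A x)"
      using A by (intro integrable_mult_right integrable_real_indicator) (auto simp: emeasure_eq_measure)
    show "integrable N (\<lambda>x. (v x)\<^sup>2)"
      using v by (intro integrable_const_bound[where B = "B\<^sup>2"]) (auto simp: abs_le_square_iff[symmetric] intro: order.trans[OF _ abs_ge_self])
    show "e\<^sup>2 * indicator A x \<le> (v x)\<^sup>2" for x
      using ge[of x] e by (auto simp: indicator_def abs_le_square_iff[symmetric])
  qed
  finally show ?thesis .
qed

text \<open>The mass is continuous and positive in the centre c, so compactness makes the bound
  uniform; later the centre varies with the parameter.\<close>

lemma compact_interval_mass_bound:
  assumes N: "real_distribution N" and cont: "continuous_on UNIV (cdf N)" and mono: "strict_mono (cdf N)" and r: "0 < r"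
  obtains m where "0 < m" "\<And>c. \<bar>c\<bar> \<le> R \<Longrightarrow> m \<le> measure N {c - r<..c + r}"
proof (cases "0 \<le> R")
  case True
  interpret N: real_distribution N by fact
  have "continuous_on {- R..R} (\<lambda>c. cdf N (c + r) - cdf N (c - r))"
    by (intro continuous_intros continuous_on_compose2[OF cont]) auto
  moreover have "compact {- R..R}" "{- R..R} \<noteq> {}"
    using True by auto
  ultimately obtain c0 where c0: "\<And>c. c \<in> {- R..R} \<Longrightarrow> cdf N (c0 + r) - cdf N (c0 - r) \<le> cdf N (c + r) - cdf N (c - r)"
    using continuous_attains_inf[of "{- R..R}" "\<lambda>c. cdf N (c + r) - cdf N (c - r)"] by blast
  show thesis
  proof (rule that)
    show "0 < cdf N (c0 + r) - cdf N (c0 - r)"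
      using strict_monoD[OF mono, of "c0 - r" "c0 + r"] r by simp
    show "cdf N (c0 + r) - cdf N (c0 - r) \<le> measure N {c - r<..c + r}" if "\<bar>c\<bar> \<le> R" for c
      using c0[of c] N.cdf_diff_eq[of "c - r" "c + r"] r that by (auto simp: abs_le_iff)
  qed
qed (use that[of 1] in auto)

lemma A_op_lipschitz_param:
  assumes F: "\<And>x. 0 \<le> F x" "\<And>x. F x \<le> 1" and lip: "\<And>x y. \<bar>F x - F y\<bar> \<le> L * \<bar>x - y\<bar>" and l0: "0 \<le> l0" "l0 \<le> 1"
  shows "\<bar>A_op (l, m1, m2) F x - A_op (l0, \<mu>1, \<mu>2) F x\<bar> \<le> \<bar>l - l0\<bar> + L * (\<bar>m1 - \<mu>1\<bar> + \<bar>m2 - \<mu>2\<bar>)"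
proof -
  have "A_op (l, m1, m2) F x - A_op (l0, \<mu>1, \<mu>2) F x = (l - l0) * (F (x - m1) - F (x - m2)) +
      l0 * (F (x - m1) - F (x - \<mu>1)) + (1 - l0) * (F (x - m2) - F (x - \<mu>2))"
    by (simp add: A_op_eq algebra_simps)
  also have "\<bar>\<dots>\<bar> \<le> \<bar>l - l0\<bar> * \<bar>F (x - m1) - F (x - m2)\<bar> + l0 * \<bar>F (x - m1) - F (x - \<mu>1)\<bar> + (1 - l0) * \<bar>F (x - m2) - F (x - \<mu>2)\<bar>"
    using l0 by (intro order.trans[OF abs_triangle_ineq] add_mono) (auto simp: abs_mult)
  also have "\<dots> \<le> \<bar>l - l0\<bar> * 1 + 1 * (L * \<bar>m1 - \<mu>1\<bar>) + 1 * (L * \<bar>m2 - \<mu>2\<bar>)"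
  proof (intro add_mono mult_mono)
    show "\<bar>F (x - m1) - F (x - m2)\<bar> \<le> 1"
      using F(1)[of "x - m1"] F(2)[of "x - m1"] F(1)[of "x - m2"] F(2)[of "x - m2"] by (simp add: abs_le_iff)
    show "\<bar>F (x - m1) - F (x - \<mu>1)\<bar> \<le> L * \<bar>m1 - \<mu>1\<bar>" "\<bar>F (x - m2) - F (x - \<mu>2)\<bar> \<le> L * \<bar>m2 - \<mu>2\<bar>"
      using lip[of "x - m1" "x - \<mu>1"] lip[of "x - m2" "x - \<mu>2"] by (simp_all add: abs_minus_commute)
  qed (use l0 in auto)
  finally show ?thesis
    by (simp add: algebra_simps)
qed

section \<open>The mixture model, its asymmetry and its residual\<close>

locale symmetric_mixture =
  fixes P0 :: "real measure" and F0 :: "real \<Rightarrow> real" and L l0 \<mu>1 \<mu>2 :: real and N :: "real measure"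
  assumes sym: "symmetric_law P0" and F0_def: "F0 = cdf P0" and mono: "strict_mono F0"
    and lip: "L-lipschitz_on UNIV F0" and l0: "0 \<le> l0" "l0 < 1/2"
    and N: "real_distribution N" and cdf_N: "cdf N = A_op (l0, \<mu>1, \<mu>2) F0"
begin

sublocale P0: real_distribution P0
  using sym by (simp add: symmetric_law_def)

sublocale N: real_distribution N
  by (rule N)

abbreviation "G \<equiv> A_op (l0, \<mu>1, \<mu>2) F0"

lemma L_nonneg: "0 \<le> L"
  using lip by (rule lipschitz_on_nonneg)

lemma F0_bounds: "0 \<le> F0 x" "F0 x \<le> 1" "\<bar>F0 x\<bar> \<le> 1"
  using P0.cdf_nonneg[of x] P0.cdf_bounded_prob[of x] by (auto simp: F0_def)

lemma F0_lip: "\<bar>F0 x - F0 y\<bar> \<le> L * \<bar>x - y\<bar>"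
  using lipschitz_onD[OF lip, of x y] by (simp add: dist_real_def)

lemma F0_cont: "continuous_on UNIV F0"
  using lip by (rule lipschitz_on_continuous_on)

lemma F0_minus: "F0 (- x) = 1 - F0 x"
proof -
  have "isCont F0 x"
    using F0_cont by (simp add: continuous_on_eq_continuous_at)
  then have "measure P0 {x} = 0"
    unfolding F0_def P0.isCont_cdf .
  then have "measure P0 {x..} = measure P0 {x<..}"
  proof -
    have "{x..} = {x} \<union> {x<..}" by auto
    then show ?thesis
      using P0.finite_measure_Union[of "{x}" "{x<..}"] \<open>measure P0 {x} = 0\<close> by simp
  qed
  also have "\<dots> = 1 - F0 x"
    using P0.prob_compl[of "{..x}"] by (simp add: F0_def cdf_def Compl_eq_Diff_UNIV[symmetric] Compl_atMost)
  finally have *: "measure P0 {x..} = 1 - F0 x" .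
  have "F0 (- x) = measure (distr P0 borel uminus) {..- x}"
    using sym by (simp add: F0_def cdf_def symmetric_law_def)
  also have "\<dots> = measure P0 {x..}"
    by (subst measure_distr) (auto simp: vimage_def intro!: arg_cong[where f = "measure P0"])
  finally show ?thesis using * by simp
qed

lemma G_bounds: "0 \<le> G x" "G x \<le> 1" "\<bar>G x\<bar> \<le> 1"
  using N.cdf_nonneg[of x] N.cdf_bounded_prob[of x] by (auto simp: cdf_N)

lemma G_mono: "strict_mono G"
proof (rule strict_monoI)
  fix x y :: real assume "x < y"
  then have "F0 (x - \<mu>1) < F0 (y - \<mu>1)" "F0 (x - \<mu>2) < F0 (y - \<mu>2)"
    using strict_mono_less[OF mono] by auto
  then show "G x < G y"
    unfolding A_op_eq using l0 by (intro add_le_less_mono mult_left_mono mult_strict_left_mono) auto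
qed

lemma G_lip: "\<bar>G x - G y\<bar> \<le> L * \<bar>x - y\<bar>"
proof -
  have "G x - G y = l0 * (F0 (x - \<mu>1) - F0 (y - \<mu>1)) + (1 - l0) * (F0 (x - \<mu>2) - F0 (y - \<mu>2))"
    by (simp add: A_op_eq algebra_simps)
  also have "\<bar>\<dots>\<bar> \<le> l0 * (L * \<bar>x - y\<bar>) + (1 - l0) * (L * \<bar>x - y\<bar>)"
    using l0 F0_lip[of "x - \<mu>1" "y - \<mu>1"] F0_lip[of "x - \<mu>2" "y - \<mu>2"]
    by (intro order.trans[OF abs_triangle_ineq] add_mono) (auto simp: abs_mult intro!: mult_left_mono)
  finally show ?thesis by (simp add: algebra_simps)
qed

lemma G_cont: "continuous_on UNIV G"
  unfolding A_op_eq[abs_def] by (intro continuous_intros continuous_on_compose2[OF F0_cont]) auto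

lemma measurable_G [measurable]: "G \<in> borel_measurable borel"
  using G_cont by (rule borel_measurable_continuous_onI)

lemma S_r_G: "S_r G x = l0 * F0 (x + \<mu>1) + (1 - l0) * F0 (x + \<mu>2)"
proof -
  have e: "F0 (- x - \<mu>) = 1 - F0 (x + \<mu>)" for \<mu>
    using F0_minus[of "x + \<mu>"] by simp
  show ?thesis
    unfolding S_r_def A_op_eq e by (simp add: algebra_simps)
qed

lemma asymmetry_G:
  "asymmetry (l, m1, m2) G x =
     l * l0 * (F0 (x + (\<mu>1 - m1)) - F0 (x - (\<mu>1 - m1))) + l * (1 - l0) * (F0 (x + (\<mu>2 - m1)) - F0 (x - (\<mu>2 - m1))) +
     (1 - l) * l0 * (F0 (x + (\<mu>1 - m2)) - F0 (x - (\<mu>1 - m2))) + (1 - l) * (1 - l0) * (F0 (x + (\<mu>2 - m2)) - F0 (x - (\<mu>2 - m2)))"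
proof -
  have e: "F0 (- x - m + \<mu>) = 1 - F0 (x - (\<mu> - m))" "F0 (x - m + \<mu>) = F0 (x + (\<mu> - m))" for m \<mu>
    using F0_minus[of "x - (\<mu> - m)"] by (simp_all add: algebra_simps)
  show ?thesis
    unfolding asymmetry_def A_op_eq[of l] S_r_G e by (simp add: algebra_simps)
qed

text \<open>The two unmixed differences are 0, the two mixed ones are opposite to each other, and
  \<open>l * (1 - l0) - (1 - l) * l0 = l - l0\<close>.\<close>

lemma asymmetry_known_locations:
  "asymmetry (l, \<mu>1, \<mu>2) G x = (l - l0) * (F0 (x + (\<mu>2 - \<mu>1)) - F0 (x - (\<mu>2 - \<mu>1)))"
  unfolding asymmetry_G by (simp add: algebra_simps)

lemma residual_G:
  assumes l: "0 \<le> l" "l < 1/2"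
  shows "residual (l, m1, m2) G x = A_inv (l, m1, m2) (asymmetry (l, m1, m2) G) (- x)"
  using residual_conv_asymmetry[OF l G_bounds(3), where x = "- x"] by simp

lemma residual_true: "residual (l0, \<mu>1, \<mu>2) G x = 0"
proof -
  have "asymmetry (l0, \<mu>1, \<mu>2) G = (\<lambda>x. 0)"
    by (rule ext) (simp add: asymmetry_known_locations)
  then show ?thesis
    using l0 by (simp add: residual_G A_inv_eq)
qed

lemma residual_bounded_variation:
  assumes l: "0 \<le> l" "l < 1/2" and a: "bounded_variation C (asymmetry (l, m1, m2) G)"
  shows "bounded_variation (C / (1 - 2 * l)) (residual (l, m1, m2) G)"
  using bounded_variation_reflect[OF A_inv_bounded_variation[OF l a, of m1 m2]]
  by (simp add: residual_G[OF l, abs_def])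

text \<open>The asymmetry is \<open>U x - (1 - U (- x))\<close> with U nondecreasing and between 0
  and 1, and the subtracted term has the same properties. The bound 1 holds whatever the locations
  are.\<close>

lemma asymmetry_bounded_variation:
  assumes l: "0 \<le> l" "l < 1/2"
  shows "bounded_variation 1 (asymmetry (l, m1, m2) G)"
proof -
  define U where "U = A_op (l, m1, m2) (S_r G)"
  have H: "0 \<le> S_r G x" "S_r G x \<le> 1" for x
    using G_bounds[of "- x"] by (auto simp: S_r_def)
  have U: "0 \<le> U x" "U x \<le> 1" for x
  proof -
    show "0 \<le> U x"
      unfolding U_def A_op_eq[of l] using l H by (intro add_nonneg_nonneg mult_nonneg_nonneg) auto
    have "U x \<le> l * 1 + (1 - l) * 1"
      unfolding U_def A_op_eq[of l] using l H by (intro add_mono mult_left_mono) auto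
    then show "U x \<le> 1" by simp
  qed
  have "mono (S_r G)"
    using strict_mono_less_eq[OF G_mono] by (auto simp: mono_def S_r_def)
  then have "mono U"
    unfolding U_def A_op_eq[of l, abs_def] mono_def using l
    by (auto intro!: add_mono mult_left_mono)
  then show ?thesis
    unfolding bounded_variation_def using U
    by (intro exI[of _ U] exI[of _ "\<lambda>x. 1 - U (- x)"])
      (auto simp: mono_def asymmetry_def U_def[symmetric])
qed

lemma asymmetry_bounds:
  assumes l: "0 \<le> l" "l < 1/2"
  shows "\<bar>asymmetry (l, m1, m2) G x\<bar> \<le> 1"
proof -
  obtain U V where "\<And>x. 0 \<le> U x \<and> U x \<le> 1" "\<And>x. 0 \<le> V x \<and> V x \<le> 1"
    and "\<And>x. asymmetry (l, m1, m2) G x = U x - V x"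
    using asymmetry_bounded_variation[OF l, of m1 m2] unfolding bounded_variation_def by blast
  from this(1)[of x] this(2)[of x] this(3)[of x] show ?thesis
    by linarith
qed

text \<open>The asymmetry at x0 is the combination of the residuals at \<open>m1 - x0\<close> and
  \<open>m2 - x0\<close> with weights l and 1 - l, so one of these is at least e. The modulus
  \<open>d * e\<close> of the asymmetry becomes at most \<open>d * e / (2 * d)\<close>, that is e/2,
  for the residual, which leaves e/2 on an interval of radius r. Value and modulus both scale with
  e, so the lemma can be used with e tending to 0 and r fixed.\<close>

lemma residual_lower_bound:
  assumes d: "0 < d" and l: "0 \<le> l" "l \<le> 1/2 - d" and e: "0 < e" "e \<le> \<bar>asymmetry (l, m1, m2) G x0\<bar>"
    and mod: "\<And>x y. \<bar>x - y\<bar> \<le> r \<Longrightarrow> \<bar>asymmetry (l, m1, m2) G x - asymmetry (l, m1, m2) G y\<bar> \<le> d * e"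
    and R: "\<bar>m1 - x0\<bar> \<le> R" "\<bar>m2 - x0\<bar> \<le> R" and m: "\<And>c. \<bar>c\<bar> \<le> R \<Longrightarrow> m \<le> measure N {c - r<..c + r}"
  shows "(e / 2)\<^sup>2 * m \<le> (\<integral>x. (residual (l, m1, m2) G x)\<^sup>2 \<partial>N)"
proof -
  have l': "0 \<le> l" "l < 1/2"
    using l d by auto
  let ?Q = "asymmetry (l, m1, m2) G" and ?D = "residual (l, m1, m2) G" and ?A = "A_inv (l, m1, m2)"
  note Q = asymmetry_bounds[OF l', of m1 m2]
  have Dmod: "\<bar>?D y - ?D z\<bar> \<le> e / 2" if "\<bar>y - z\<bar> \<le> r" for y z
  proof -
    have "?D y - ?D z = ?A (\<lambda>x. ?Q (x + - y)) 0 - ?A (\<lambda>x. ?Q (x + - z)) 0"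
      unfolding residual_G[OF l'] A_inv_add_arg by simp
    also have "\<dots> = ?A (\<lambda>x. ?Q (x + - y) - ?Q (x + - z)) 0"
      by (rule A_inv_diff[symmetric, OF l']) (rule Q)+
    also have "\<bar>\<dots>\<bar> \<le> d * e / (1 - 2 * l)"
      using that by (intro A_inv_bound l' mod) (simp add: abs_minus_commute)
    also have "\<dots> \<le> d * e / (2 * d)"
      using d e l by (intro divide_left_mono) auto
    finally show ?thesis using d by simp
  qed
  have "?Q x0 = A_op (l, m1, m2) (?A ?Q) x0"
    by (rule A_op_A_inv[symmetric, OF l' Q])
  also have "\<dots> = l * ?D (m1 - x0) + (1 - l) * ?D (m2 - x0)"
    by (simp add: residual_G[OF l'] A_op_eq)
  finally have "\<bar>?Q x0\<bar> = \<bar>l * ?D (m1 - x0) + (1 - l) * ?D (m2 - x0)\<bar>"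
    by simp
  also have "\<dots> \<le> l * \<bar>?D (m1 - x0)\<bar> + (1 - l) * \<bar>?D (m2 - x0)\<bar>"
    using l' by (intro order.trans[OF abs_triangle_ineq]) (simp add: abs_mult)
  finally have "e \<le> l * \<bar>?D (m1 - x0)\<bar> + (1 - l) * \<bar>?D (m2 - x0)\<bar>"
    using e(2) by linarith
  then have "e \<le> \<bar>?D (m1 - x0)\<bar> \<or> e \<le> \<bar>?D (m2 - x0)\<bar>"
  proof (rule contrapos_pp)
    assume "\<not> (e \<le> \<bar>?D (m1 - x0)\<bar> \<or> e \<le> \<bar>?D (m2 - x0)\<bar>)"
    then have "l * \<bar>?D (m1 - x0)\<bar> + (1 - l) * \<bar>?D (m2 - x0)\<bar> < l * e + (1 - l) * e"
      using l' by (intro add_le_less_mono mult_left_mono mult_strict_left_mono) auto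
    then show "\<not> e \<le> l * \<bar>?D (m1 - x0)\<bar> + (1 - l) * \<bar>?D (m2 - x0)\<bar>"
      by (simp add: algebra_simps)
  qed
  then obtain c where c: "\<bar>c\<bar> \<le> R" "e \<le> \<bar>?D c\<bar>"
    using R by blast
  have "(e / 2)\<^sup>2 * m \<le> (e / 2)\<^sup>2 * measure N {c - r<..c + r}"
    by (intro mult_left_mono m c) simp
  also have "\<dots> \<le> (\<integral>x. (?D x)\<^sup>2 \<partial>N)"
  proof (rule integral_square_ge[OF N.real_distribution_axioms])
    show "\<bar>?D x\<bar> \<le> 1 / (1 - 2 * l)" for x
      unfolding residual_G[OF l'] by (rule A_inv_bound[OF l' Q])
    show "e / 2 \<le> \<bar>?D x\<bar>" if "x \<in> {c - r<..c + r}" for x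
    proof -
      have "\<bar>x - c\<bar> \<le> r"
        using that by (simp add: abs_le_iff)
      then show ?thesis
        using Dmod[of x c] c(2) by linarith
    qed
  qed (use e in auto)
  finally show ?thesis .
qed

text \<open>At the true parameter the residual of G is 0, so that of H is at most E there, and the
  minimal contrast is at most \<open>E\<^sup>2\<close>. Passing from H to G at the minimiser gives
  \<open>4 * E\<^sup>2\<close> by
  \<open>a\<^sup>2 \<le> 2 * b\<^sup>2 + 2 * (b - a)\<^sup>2\<close>, and passing from the empirical
  law to N costs \<open>4 * C\<^sup>2 * \<Delta>\<close>. H is \<open>G_hat\<close> in one problem
  and \<open>G_tilde\<close> in the other, hence its own deviation \<Delta>'.\<close>

lemma minimiser_bound:
  assumes d: "0 < d" and l: "0 \<le> l" "l \<le> 1/2 - d" and l0d: "l0 \<le> 1/2 - d" and n: "1 \<le> n"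
    and H: "H \<in> borel_measurable borel" "\<And>x. \<bar>H x\<bar> \<le> B" "\<And>x. \<bar>H x - G x\<bar> \<le> \<Delta>'"
    and \<Delta>: "\<And>x. \<bar>G_hat n xs x - G x\<bar> \<le> \<Delta>"
    and min: "contrast (l, m1, m2) H (G_hat n xs) \<le> contrast (l0, \<mu>1, \<mu>2) H (G_hat n xs)"
    and bv: "bounded_variation C (residual (l, m1, m2) G)"
  shows "(\<integral>x. (residual (l, m1, m2) G x)\<^sup>2 \<partial>N) \<le> 4 * ((1 / (2 * d) + 1) * \<Delta>')\<^sup>2 + 4 * C\<^sup>2 * \<Delta>"
proof -
  define \<nu> where "\<nu> = interval_measure (G_hat n xs)"
  have \<nu>: "real_distribution \<nu>" and cdf_\<nu>: "cdf \<nu> = G_hat n xs"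
    using real_distribution_G_hat[OF n] cdf_G_hat[OF n] by (auto simp: \<nu>_def)
  interpret \<nu>: real_distribution \<nu> by fact
  define E where "E = (1 / (2 * d) + 1) * \<Delta>'"
  have \<Delta>'0: "0 \<le> \<Delta>'"
    using H(3)[of 0] by linarith
  have res: "\<bar>residual (l', m1', m2') H x - residual (l', m1', m2') G x\<bar> \<le> E"
    if l': "0 \<le> l'" "l' \<le> 1/2 - d" for l' m1' m2' x
  proof -
    have "\<bar>residual (l', m1', m2') H x - residual (l', m1', m2') G x\<bar> \<le> \<Delta>' / (1 - 2 * l') + \<Delta>'"
      using l' d by (intro residual_diff_bound[OF _ _ H(2) G_bounds(3) H(3)]) auto
    also have "\<Delta>' / (1 - 2 * l') \<le> \<Delta>' / (2 * d)"
      using l' d \<Delta>'0 by (intro divide_left_mono) auto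
    finally show ?thesis by (simp add: E_def algebra_simps)
  qed
  have E0: "0 \<le> E"
    using d \<Delta>'0 by (simp add: E_def)
  let ?DH = "residual (l, m1, m2) H" and ?DG = "residual (l, m1, m2) G" and ?D0 = "residual (l0, \<mu>1, \<mu>2) H"
  have D0: "\<bar>?D0 x\<bar> \<le> E" for x
    using res[OF l0(1) l0d, of \<mu>1 \<mu>2 x] by (simp add: residual_true)
  have l': "0 \<le> l" "l < 1/2"
    using l d by auto
  have DG: "\<bar>?DG x\<bar> \<le> 1 / (1 - 2 * l)" for x
    unfolding residual_G[OF l'] by (rule A_inv_bound[OF l' asymmetry_bounds[OF l']])
  have DH: "\<bar>?DH x\<bar> \<le> 1 / (1 - 2 * l) + E" for x
    using res[OF l, of m1 m2 x] DG[of x] by linarith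
  have int: "integrable \<nu> (\<lambda>x. (v x)\<^sup>2)" if "v \<in> borel_measurable borel" "\<And>x. \<bar>v x\<bar> \<le> B" for v :: "real \<Rightarrow> real" and B
    using that by (intro \<nu>.integrable_const_bound[where B = "B\<^sup>2"])
      (auto simp: abs_le_square_iff[symmetric] intro: order.trans[OF _ abs_ge_self])
  have [measurable]: "?DH \<in> borel_measurable borel" "?DG \<in> borel_measurable borel" "?D0 \<in> borel_measurable borel"
    using H(1) by measurable
  have "(\<integral>x. (?DH x)\<^sup>2 \<partial>\<nu>) \<le> (\<integral>x. (?D0 x)\<^sup>2 \<partial>\<nu>)"
    using min by (simp add: contrast_residual \<nu>_def)
  also have "\<dots> \<le> (\<integral>x. E\<^sup>2 \<partial>\<nu>)"
    using D0 E0 by (intro integral_mono int[OF _ D0]) (auto simp: abs_le_square_iff[symmetric])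
  also have "\<dots> = E\<^sup>2"
    using \<nu>.prob_space by simp
  finally have 1: "(\<integral>x. (?DH x)\<^sup>2 \<partial>\<nu>) \<le> E\<^sup>2" .
  have "(\<integral>x. (?DG x)\<^sup>2 \<partial>\<nu>) \<le> (\<integral>x. 2 * (?DH x)\<^sup>2 + 2 * E\<^sup>2 \<partial>\<nu>)"
  proof (rule integral_mono)
    fix x
    have "(?DG x)\<^sup>2 \<le> 2 * (?DH x)\<^sup>2 + 2 * (?DH x - ?DG x)\<^sup>2"
      using zero_le_power2[of "2 * ?DH x - ?DG x"] by (simp add: power2_eq_square algebra_simps)
    also have "(?DH x - ?DG x)\<^sup>2 \<le> E\<^sup>2"
      using res[OF l, of m1 m2 x] E0 by (simp add: abs_le_square_iff[symmetric])
    finally show "(?DG x)\<^sup>2 \<le> 2 * (?DH x)\<^sup>2 + 2 * E\<^sup>2" by simp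
  qed (auto intro!: int DG DH Bochner_Integration.integrable_add integrable_mult_right)
  also have "\<dots> = 2 * (\<integral>x. (?DH x)\<^sup>2 \<partial>\<nu>) + 2 * E\<^sup>2"
    using int[OF _ DH] \<nu>.prob_space by simp
  finally have 2: "(\<integral>x. (?DG x)\<^sup>2 \<partial>\<nu>) \<le> 4 * E\<^sup>2"
    using 1 by simp
  have "(\<integral>x. (?DG x)\<^sup>2 \<partial>N) \<le> (\<integral>x. (?DG x)\<^sup>2 \<partial>\<nu>) + 4 * C\<^sup>2 * \<Delta>"
    using \<Delta> by (intro integral_square_bounded_variation N.real_distribution_axioms \<nu> bv)
      (simp add: cdf_N cdf_\<nu> abs_minus_commute)
  with 2 show ?thesis
    by (simp add: E_def)
qed

text \<open>Before symmetrisation the error is \<open>A_inv\<close> applied to \<open>G_hat\<close>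
  minus \<open>A_op \<theta> F0\<close>, whose size is \<Delta> plus the effect of the parameter
  error; symmetrisation is an average that fixes \<open>F0\<close>. The lower bound 0 is recorded
  because a supremum of reals is meaningful only for bounded functions.\<close>

lemma F_hat_error:
  assumes d: "0 < d" and l: "0 \<le> l" "l \<le> 1/2 - d" and n: "1 \<le> n"
    and \<Delta>: "\<And>x. \<bar>G_hat n xs x - G x\<bar> \<le> \<Delta>"
  shows "0 \<le> sup_norm (\<lambda>x. F_hat (l, m1, m2) n xs x - F0 x)"
    "sup_norm (\<lambda>x. F_hat (l, m1, m2) n xs x - F0 x) \<le> (\<Delta> + \<bar>l - l0\<bar> + L * (\<bar>m1 - \<mu>1\<bar> + \<bar>m2 - \<mu>2\<bar>)) / (2 * d)"
proof -
  have l': "0 \<le> l" "l < 1/2"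
    using l d by auto
  define B where "B = \<Delta> + \<bar>l - l0\<bar> + L * (\<bar>m1 - \<mu>1\<bar> + \<bar>m2 - \<mu>2\<bar>)"
  let ?A = "A_inv (l, m1, m2)"
  have op: "\<bar>A_op (l, m1, m2) F0 x\<bar> \<le> 1" for x
  proof -
    have "\<bar>A_op (l, m1, m2) F0 x\<bar> \<le> l * \<bar>F0 (x - m1)\<bar> + (1 - l) * \<bar>F0 (x - m2)\<bar>"
      using l' unfolding A_op_eq by (intro order.trans[OF abs_triangle_ineq]) (simp add: abs_mult)
    also have "\<dots> \<le> l * 1 + (1 - l) * 1"
      using l' F0_bounds by (intro add_mono mult_left_mono) auto
    finally show ?thesis by simp
  qed
  have Gh: "\<bar>G_hat n xs x\<bar> \<le> 1 + \<Delta>" for x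
    using \<Delta>[of x] G_bounds[of x] by linarith
  have dif: "\<bar>G_hat n xs x - A_op (l, m1, m2) F0 x\<bar> \<le> B" for x
    using \<Delta>[of x] A_op_lipschitz_param[OF F0_bounds(1,2) F0_lip l0(1), of l m1 m2 x \<mu>1 \<mu>2] l0
    by (simp add: B_def)
  have err: "\<bar>?A (G_hat n xs) x - F0 x\<bar> \<le> B / (2 * d)" for x
  proof -
    have "?A (G_hat n xs) x - F0 x = ?A (\<lambda>x. G_hat n xs x - A_op (l, m1, m2) F0 x) x"
      by (simp add: A_inv_diff[OF l' Gh op] A_inv_A_op_bounded[OF l' F0_bounds(3)])
    also have "\<bar>\<dots>\<bar> \<le> B / (1 - 2 * l)"
      by (rule A_inv_bound[OF l' dif])
    also have "\<dots> \<le> B / (2 * d)"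
      using l d dif[of 0] by (intro divide_left_mono) auto
    finally show ?thesis .
  qed
  have bd: "\<bar>F_hat (l, m1, m2) n xs x - F0 x\<bar> \<le> B / (2 * d)" for x
  proof -
    have "F_hat (l, m1, m2) n xs x - F0 x =
        ((?A (G_hat n xs) x - F0 x) - (?A (G_hat n xs) (- x) - F0 (- x))) / 2"
      using F0_minus[of x] by (simp add: F_hat_def S_r_def field_simps)
    moreover have "\<bar>(u - v) / 2\<bar> \<le> c" if "\<bar>u\<bar> \<le> c" "\<bar>v\<bar> \<le> c" for u v c :: real
      using that by (simp add: abs_le_iff)
    ultimately show ?thesis
      using err[of x] err[of "- x"] by simp
  qed
  have bdd: "bdd_above (range (\<lambda>x. \<bar>F_hat (l, m1, m2) n xs x - F0 x\<bar>))"
    using bd by (rule bdd_aboveI2)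
  show "0 \<le> sup_norm (\<lambda>x. F_hat (l, m1, m2) n xs x - F0 x)"
    unfolding sup_norm_def by (rule order.trans[OF abs_ge_zero cSUP_upper[OF UNIV_I bdd]])
  show "sup_norm (\<lambda>x. F_hat (l, m1, m2) n xs x - F0 x) \<le> (\<Delta> + \<bar>l - l0\<bar> + L * (\<bar>m1 - \<mu>1\<bar> + \<bar>m2 - \<mu>2\<bar>)) / (2 * d)"
    unfolding sup_norm_def B_def[symmetric] using bd by (intro cSUP_least) auto
qed

text \<open>The asymmetry is \<open>l - l0\<close> times a fixed function with Lipschitz constant 2
  L, whose value \<open>F0 s - F0 (- s)\<close> at 0 is nonzero since \<open>F0\<close> is strictly
  increasing. Value and modulus scale together, so r and m do not depend on l.\<close>

lemma contrast_lower_bound_known_locations: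
  assumes d: "0 < d" and \<mu>: "\<mu>1 \<noteq> \<mu>2"
  obtains \<kappa> where "0 < \<kappa>" "\<And>l. 0 \<le> l \<Longrightarrow> l \<le> 1/2 - d \<Longrightarrow> \<kappa> * (l - l0)\<^sup>2 \<le> (\<integral>x. (residual (l, \<mu>1, \<mu>2) G x)\<^sup>2 \<partial>N)"
proof -
  define s where "s = \<mu>2 - \<mu>1"
  define e where "e = \<bar>F0 s - F0 (- s)\<bar>"
  have e: "0 < e"
    using \<mu> strict_mono_eq[OF mono, of s "- s"] by (simp add: e_def s_def)
  \<comment> \<open>Using 2 L + 1 instead of 2 L makes the quotient positive from
    \<open>0 \<le> L\<close> alone.\<close>
  define r where "r = d * e / (2 * L + 1)"
  have r: "0 < r"
    using d e L_nonneg by (simp add: r_def)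
  obtain m where m: "0 < m" "\<And>c. \<bar>c\<bar> \<le> max \<bar>\<mu>1\<bar> \<bar>\<mu>2\<bar> \<Longrightarrow> m \<le> measure N {c - r<..c + r}"
    using compact_interval_mass_bound[OF N.real_distribution_axioms _ _ r, of "max \<bar>\<mu>1\<bar> \<bar>\<mu>2\<bar>"]
    by (auto simp: cdf_N G_cont G_mono)
  show thesis
  proof (rule that)
    show "0 < (e / 2)\<^sup>2 * m"
      using e m(1) by simp
    fix l assume l: "0 \<le> l" "l \<le> 1/2 - d"
    show "(e / 2)\<^sup>2 * m * (l - l0)\<^sup>2 \<le> (\<integral>x. (residual (l, \<mu>1, \<mu>2) G x)\<^sup>2 \<partial>N)"
    proof (cases "l = l0")
      case False
      have "(\<bar>l - l0\<bar> * e / 2)\<^sup>2 * m \<le> (\<integral>x. (residual (l, \<mu>1, \<mu>2) G x)\<^sup>2 \<partial>N)"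
      proof (rule residual_lower_bound[where ?x0.0 = 0 and r = r and R = "max \<bar>\<mu>1\<bar> \<bar>\<mu>2\<bar>", OF d l])
        show "0 < \<bar>l - l0\<bar> * e"
          using False e by simp
        show "\<bar>l - l0\<bar> * e \<le> \<bar>asymmetry (l, \<mu>1, \<mu>2) G 0\<bar>"
          by (simp add: asymmetry_known_locations e_def s_def abs_mult)
        fix x y assume xy: "\<bar>x - y\<bar> \<le> r"
        have "asymmetry (l, \<mu>1, \<mu>2) G x - asymmetry (l, \<mu>1, \<mu>2) G y =
            (l - l0) * ((F0 (x + s) - F0 (y + s)) - (F0 (x - s) - F0 (y - s)))"
          by (simp add: asymmetry_known_locations s_def algebra_simps)
        also have "\<bar>\<dots>\<bar> \<le> \<bar>l - l0\<bar> * (2 * L * \<bar>x - y\<bar>)"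
          unfolding abs_mult using F0_lip[of "x + s" "y + s"] F0_lip[of "x - s" "y - s"]
          by (intro mult_left_mono) (auto simp: abs_le_iff)
        also have "\<dots> \<le> \<bar>l - l0\<bar> * (d * e)"
        proof (intro mult_left_mono)
          have "2 * L * \<bar>x - y\<bar> \<le> (2 * L + 1) * r"
            using L_nonneg xy r by (intro mult_mono) auto
          then show "2 * L * \<bar>x - y\<bar> \<le> d * e"
            using L_nonneg by (simp add: r_def)
        qed simp
        finally show "\<bar>asymmetry (l, \<mu>1, \<mu>2) G x - asymmetry (l, \<mu>1, \<mu>2) G y\<bar> \<le> d * (\<bar>l - l0\<bar> * e)"
          by (simp only: mult_ac)
      next
        show "\<bar>\<mu>1 - 0\<bar> \<le> max \<bar>\<mu>1\<bar> \<bar>\<mu>2\<bar>" "\<bar>\<mu>2 - 0\<bar> \<le> max \<bar>\<mu>1\<bar> \<bar>\<mu>2\<bar>"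
          by auto
      qed (rule m(2))
      moreover have "(\<bar>l - l0\<bar> * e / 2)\<^sup>2 * m = (e / 2)\<^sup>2 * m * (l - l0)\<^sup>2"
        by (simp add: power_mult_distrib power_divide)
      ultimately show ?thesis
        by (simp only:)
    qed simp
  qed
qed

text \<open>With p the error of the weight, the variation of the residual is O(p), and the contrast
  bounds read \<kappa> p^2 \<le> 4 A^2 \<Delta>^2 + c \<Delta> p^2. If c \<Delta> is at most
  \<kappa>/2, the last term is absorbed on the left and p = O(\<Delta>); otherwise \<Delta> is
  bounded below and the trivial bound p \<le> 1 is itself O(\<Delta>).\<close>

lemma known_locations_rate:
  assumes d: "0 < d" and \<mu>: "\<mu>1 \<noteq> \<mu>2" and l0d: "l0 \<le> 1/2 - d"
  obtains C where "0 \<le> C" "\<And>n l xs \<Delta>. 1 \<le> n \<Longrightarrow> 0 \<le> l \<Longrightarrow> l \<le> 1/2 - d \<Longrightarrow>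
    contrast (l, \<mu>1, \<mu>2) (G_hat n xs) (G_hat n xs) \<le> contrast (l0, \<mu>1, \<mu>2) (G_hat n xs) (G_hat n xs) \<Longrightarrow>
    (\<And>x. \<bar>G_hat n xs x - G x\<bar> \<le> \<Delta>) \<Longrightarrow> \<bar>l - l0\<bar> \<le> C * \<Delta>"
proof -
  obtain \<kappa> where \<kappa>: "0 < \<kappa>" "\<And>l. 0 \<le> l \<Longrightarrow> l \<le> 1/2 - d \<Longrightarrow> \<kappa> * (l - l0)\<^sup>2 \<le> (\<integral>x. (residual (l, \<mu>1, \<mu>2) G x)\<^sup>2 \<partial>N)"
    using contrast_lower_bound_known_locations[OF d \<mu>] by metis
  define A where "A = 1 / (2 * d) + 1"
  define c where "c = 1 / d\<^sup>2"
  define C where "C = sqrt (8 * A\<^sup>2 / \<kappa>) + 2 * c / \<kappa>"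
  have c: "0 < c" and C: "0 \<le> C"
    using d \<kappa>(1) by (auto simp: c_def C_def intro!: add_nonneg_nonneg)
  show thesis
  proof (rule that[OF C])
    fix n l xs \<Delta>
    assume n: "1 \<le> n" and l: "0 \<le> l" "l \<le> 1/2 - d"
      and min: "contrast (l, \<mu>1, \<mu>2) (G_hat n xs) (G_hat n xs) \<le> contrast (l0, \<mu>1, \<mu>2) (G_hat n xs) (G_hat n xs)"
      and \<Delta>: "\<And>x. \<bar>G_hat n xs x - G x\<bar> \<le> \<Delta>"
    have l': "0 \<le> l" "l < 1/2"
      using l d by auto
    have \<Delta>0: "0 \<le> \<Delta>"
      using \<Delta>[of 0] by linarith
    define p where "p = \<bar>l - l0\<bar>"
    have "bounded_variation 1 (\<lambda>x. F0 (x + (\<mu>2 - \<mu>1)) - F0 (x - (\<mu>2 - \<mu>1)))"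
      unfolding bounded_variation_def using F0_bounds strict_mono_mono[OF mono]
      by (intro exI[of _ "\<lambda>x. F0 (x + (\<mu>2 - \<mu>1))"] exI[of _ "\<lambda>x. F0 (x - (\<mu>2 - \<mu>1))"]) (auto simp: mono_def)
    from bounded_variation_cmult[OF this, of "l - l0"]
    have "bounded_variation p (asymmetry (l, \<mu>1, \<mu>2) G)"
      by (simp add: p_def asymmetry_known_locations[abs_def])
    from residual_bounded_variation[OF l' this]
    have "bounded_variation (p / (1 - 2 * l)) (residual (l, \<mu>1, \<mu>2) G)" .
    then have bv: "bounded_variation (p / (2 * d)) (residual (l, \<mu>1, \<mu>2) G)"
    proof (rule bounded_variation_weaken)
      show "p / (1 - 2 * l) \<le> p / (2 * d)"
        using d l by (intro divide_left_mono) (auto simp: p_def)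
    qed
    have m: "G_hat n xs \<in> borel_measurable borel"
      by (rule borel_measurable_mono[OF G_hat_mono])
    have "\<kappa> * (l - l0)\<^sup>2 \<le> 4 * (A * \<Delta>)\<^sup>2 + 4 * (p / (2 * d))\<^sup>2 * \<Delta>"
      unfolding A_def
    proof (rule order.trans[OF \<kappa>(2)[OF l] minimiser_bound[OF d l l0d n m _ \<Delta> \<Delta> min bv]])
      show "\<bar>G_hat n xs x\<bar> \<le> 1 + \<Delta>" for x
        using \<Delta>[of x] G_bounds[of x] by linarith
    qed
    then have main: "\<kappa> * p\<^sup>2 \<le> 4 * A\<^sup>2 * \<Delta>\<^sup>2 + c * \<Delta> * p\<^sup>2"
      by (simp add: p_def c_def power_mult_distrib power_divide mult_ac)
    show "\<bar>l - l0\<bar> \<le> C * \<Delta>"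
    proof (cases "c * \<Delta> \<le> \<kappa> / 2")
      case True
      then have "c * \<Delta> * p\<^sup>2 \<le> \<kappa> / 2 * p\<^sup>2"
        by (intro mult_right_mono) auto
      then have "p\<^sup>2 \<le> 8 * A\<^sup>2 / \<kappa> * \<Delta>\<^sup>2"
        using main \<kappa>(1) by (simp add: field_simps)
      then have "sqrt (p\<^sup>2) \<le> sqrt (8 * A\<^sup>2 / \<kappa> * \<Delta>\<^sup>2)"
        by (rule real_sqrt_le_mono)
      also have "sqrt (8 * A\<^sup>2 / \<kappa> * \<Delta>\<^sup>2) = sqrt (8 * A\<^sup>2 / \<kappa>) * \<Delta>"
        using \<Delta>0 by (subst real_sqrt_mult) simp
      finally have "p \<le> sqrt (8 * A\<^sup>2 / \<kappa>) * \<Delta>"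
        by (simp add: p_def)
      also have "\<dots> \<le> C * \<Delta>"
        using c \<kappa>(1) \<Delta>0 by (intro mult_right_mono) (auto simp: C_def)
      finally show ?thesis by (simp add: p_def)
    next
      case False
      then have "1 \<le> 2 * c / \<kappa> * \<Delta>"
        using \<kappa>(1) by (simp add: field_simps)
      also have "\<dots> \<le> C * \<Delta>"
        using \<kappa>(1) \<Delta>0 by (intro mult_right_mono) (auto simp: C_def)
      finally show ?thesis
        using l l0 l0d d by (simp add: abs_le_iff)
    qed
  qed
qed

end

section \<open>Consistency of the kernel density estimator\<close>

lemma smoothing_kernelD:
  assumes "smoothing_kernel q"
  shows "q \<in> borel_measurable borel" "\<And>x. 0 \<le> q x" "integrable lborel q" "(\<integral>x. q x \<partial>lborel) = 1"
proof -
  show "q \<in> borel_measurable borel" "\<And>x. 0 \<le> q x" and q1: "(LINT x|lborel. q x) = 1"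
    using assms by (auto simp: smoothing_kernel_def)
  \<comment> \<open>The integral of a non-integrable function is 0 by convention, so the value 1
    forces integrability.\<close>
  show "integrable lborel q"
    using q1 not_integrable_integral_eq by fastforce
qed

lemma smoothing_kernel_support:
  assumes "smoothing_kernel q"
  obtains R where "0 < R" "\<And>x. q x \<noteq> 0 \<Longrightarrow> \<bar>x\<bar> \<le> R"
proof -
  have "bounded (closure {x. q x \<noteq> 0})"
    using assms by (auto simp: smoothing_kernel_def intro: compact_imp_bounded)
  then have "bounded {x. q x \<noteq> 0}"
    using bounded_subset closure_subset by blast
  then obtain R where "0 < R" "\<And>x. q x \<noteq> 0 \<Longrightarrow> \<bar>x\<bar> \<le> R"
    by (auto simp: bounded_pos)
  then show thesis
    using that by blast
qed

lemma law_tail_small: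
  assumes N: "real_distribution N" and \<epsilon>: "0 < \<epsilon>"
  obtains R where "0 < R" "measure N {y. R < \<bar>y\<bar>} \<le> \<epsilon>"
proof -
  interpret real_distribution N by fact
  have "(\<lambda>n. measure N {y. real n < \<bar>y\<bar>}) \<longlonglongrightarrow> measure N (\<Inter>n. {y. real n < \<bar>y\<bar>})"
    by (intro finite_Lim_measure_decseq) (auto simp: decseq_def)
  moreover have "(\<Inter>n. {y. real n < \<bar>y\<bar>}) = {}"
    using reals_Archimedean2 by (auto dest: less_asym)
  ultimately have "(\<lambda>n. measure N {y. real n < \<bar>y\<bar>}) \<longlonglongrightarrow> 0"
    by simp
  then have "eventually (\<lambda>n. measure N {y. real n < \<bar>y\<bar>} < \<epsilon>) sequentially"
    using \<epsilon> by (rule order_tendstoD)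
  then have "eventually (\<lambda>n. 1 \<le> n \<and> measure N {y. real n < \<bar>y\<bar>} < \<epsilon>) sequentially"
    using eventually_ge_at_top by (rule eventually_conj[rotated])
  then obtain n where "1 \<le> n" "measure N {y. real n < \<bar>y\<bar>} < \<epsilon>"
    by (auto simp: eventually_sequentially)
  then show thesis
    using that[of "real n"] by simp
qed

text \<open>Rounding to a grid of width \<open>w\<close> on \<open>{- R..R}\<close>; the tails form a cell of their own.\<close>

definition grid_round :: "real \<Rightarrow> real \<Rightarrow> real \<Rightarrow> real" where
  "grid_round w R y = (if \<bar>y\<bar> \<le> R then w * of_int \<lfloor>y / w\<rfloor> else R + 1)"

definition grid_points :: "real \<Rightarrow> real \<Rightarrow> real set" where
  "grid_points w R = insert (R + 1) ((\<lambda>k. w * of_int k) ` {\<lfloor>- R / w\<rfloor>..\<lfloor>R / w\<rfloor>})"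

lemma grid_round:
  assumes w: "0 < w" and R: "0 < R"
  shows "grid_round w R \<in> borel_measurable borel" "finite (grid_points w R)" "range (grid_round w R) \<subseteq> grid_points w R"
    "\<bar>y\<bar> \<le> R \<Longrightarrow> \<bar>grid_round w R y - y\<bar> \<le> w" "grid_round w R -` {R + 1} = {y. R < \<bar>y\<bar>}"
    "real (card (grid_points w R)) \<le> 2 * R / w + 3"
proof -
  show "grid_round w R \<in> borel_measurable borel"
    unfolding grid_round_def[abs_def] by measurable
  show "finite (grid_points w R)"
    by (simp add: grid_points_def)
  have fl: "w * of_int \<lfloor>y / w\<rfloor> \<le> y" "y \<le> w * of_int \<lfloor>y / w\<rfloor> + w" for y
  proof -
    have "of_int \<lfloor>y / w\<rfloor> \<le> y / w" "y / w \<le> of_int \<lfloor>y / w\<rfloor> + 1"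
      by linarith+
    then have "of_int \<lfloor>y / w\<rfloor> * w \<le> y" "y \<le> (of_int \<lfloor>y / w\<rfloor> + 1) * w"
      unfolding pos_le_divide_eq[OF w] pos_divide_le_eq[OF w] .
    then show "w * of_int \<lfloor>y / w\<rfloor> \<le> y" "y \<le> w * of_int \<lfloor>y / w\<rfloor> + w"
      by (simp_all add: algebra_simps)
  qed
  show "range (grid_round w R) \<subseteq> grid_points w R"
  proof (intro subsetI, elim rangeE, goal_cases)
    case (1 x y)
    show ?case
    proof (cases "\<bar>y\<bar> \<le> R")
      case True
      then have "- R / w \<le> y / w" "y / w \<le> R / w"
        using w divide_right_mono[of "- R" y w] divide_right_mono[of y R w] by auto
      then have "\<lfloor>y / w\<rfloor> \<in> {\<lfloor>- R / w\<rfloor>..\<lfloor>R / w\<rfloor>}"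
        by (auto intro: floor_mono)
      then show ?thesis
        using True by (auto simp: 1 grid_round_def grid_points_def)
    qed (simp add: 1 grid_round_def grid_points_def)
  qed
  show "\<bar>y\<bar> \<le> R \<Longrightarrow> \<bar>grid_round w R y - y\<bar> \<le> w"
    using fl[of y] by (simp add: grid_round_def abs_le_iff)
  \<comment> \<open>Rounding down never exceeds \<open>y \<le> R\<close>, so the value
    \<open>R + 1\<close> marks the tails and nothing else.\<close>
  have "grid_round w R y \<noteq> R + 1" if "\<bar>y\<bar> \<le> R" for y
    using fl[of y] that by (simp add: grid_round_def)
  then show "grid_round w R -` {R + 1} = {y. R < \<bar>y\<bar>}"
    by (auto simp: not_less[symmetric]) (simp add: grid_round_def)
  have "card (grid_points w R) \<le> Suc (card ((\<lambda>k. w * of_int k) ` {\<lfloor>- R / w\<rfloor>..\<lfloor>R / w\<rfloor>}))"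
    unfolding grid_points_def by (subst card_insert_if) auto
  also have "\<dots> \<le> Suc (card {\<lfloor>- R / w\<rfloor>..\<lfloor>R / w\<rfloor>})"
    by (intro Suc_le_mono[THEN iffD2] card_image_le) simp
  finally have "card (grid_points w R) \<le> Suc (card {\<lfloor>- R / w\<rfloor>..\<lfloor>R / w\<rfloor>})" .
  then have "real (card (grid_points w R)) \<le> 1 + real (card {\<lfloor>- R / w\<rfloor>..\<lfloor>R / w\<rfloor>})"
    by linarith
  also have "real (card {\<lfloor>- R / w\<rfloor>..\<lfloor>R / w\<rfloor>}) \<le> 2 * R / w + 2"
  proof -
    have "- R / w \<le> R / w"
      using w R by (simp add: divide_right_mono)
    then have "\<lfloor>- R / w\<rfloor> \<le> \<lfloor>R / w\<rfloor>"
      by (rule floor_mono)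
    then have "real (card {\<lfloor>- R / w\<rfloor>..\<lfloor>R / w\<rfloor>}) = of_int \<lfloor>R / w\<rfloor> - of_int \<lfloor>- R / w\<rfloor> + 1"
      by simp
    also have "\<dots> \<le> R / w - (- R / w - 1) + 1"
      by (intro add_mono diff_mono) linarith+
    finally show ?thesis by simp
  qed
  finally show "real (card (grid_points w R)) \<le> 2 * R / w + 3" by simp
qed

context iid_sample
begin

text \<open>With cells of width proportional to \<open>b n\<close> their number is O(1 / b n) =
  o(n), because \<open>real n * b n\<close> tends to infinity. Then 2 to that power is at most
  \<open>exp (real n * \<epsilon>\<^sup>2)\<close>, and Hoeffding's factor
  \<open>exp (- 2 * real n * \<epsilon>\<^sup>2)\<close> leaves a summable bound.\<close>

lemma kde_L1_eventually_small:
  assumes q: "smoothing_kernel q" and b: "bandwidth b" and g: "is_density N g" and \<epsilon>: "0 < \<epsilon>"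
  shows "AE \<omega> in M. eventually (\<lambda>n. L1_norm (\<lambda>x. g_hat q b n (\<lambda>i. X i \<omega>) x - g x) \<le> ennreal (13 * \<epsilon>)) sequentially"
proof -
  note Q = smoothing_kernelD[OF q]
  obtain Rq where Rq: "0 < Rq" "\<And>x. q x \<noteq> 0 \<Longrightarrow> \<bar>x\<bar> \<le> Rq"
    using smoothing_kernel_support[OF q] by blast
  have bpos: "0 < b n" if "1 \<le> n" for n
    using b that by (auto simp: bandwidth_def)
  have b0: "b \<longlonglongrightarrow> 0" and nb: "filterlim (\<lambda>n. real n * b n) at_top sequentially"
    using b by (auto simp: bandwidth_def)
  obtain \<delta> where \<delta>: "0 < \<delta>" "\<And>h. \<bar>h\<bar> \<le> \<delta> \<Longrightarrow> L1_modulus q h \<le> ennreal \<epsilon>"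
    using L1_modulus_small[OF Q(3) \<epsilon>] by blast
  obtain \<delta>' where \<delta>': "0 < \<delta>'" "\<And>h. \<bar>h\<bar> \<le> \<delta>' \<Longrightarrow> L1_modulus g h \<le> ennreal \<epsilon>"
    using L1_modulus_small[OF is_densityD(3)[OF g law.prob_space_axioms] \<epsilon>] by blast
  obtain R where R: "0 < R" "measure N {y. R < \<bar>y\<bar>} \<le> \<epsilon>"
    using law_tail_small[OF real_distribution_law \<epsilon>] by blast
  define T where "T n = grid_round (\<delta> * b n) R" for n
  define S where "S n = grid_points (\<delta> * b n) R" for n
  define dev where "dev n \<omega> = (\<Sum>s\<in>S n. \<bar>freq n (\<lambda>i. X i \<omega>) (T n -` {s}) - measure N (T n -` {s})\<bar>)" for n \<omega>
  have w: "0 < \<delta> * b n" if "1 \<le> n" for n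
    using \<delta>(1) bpos[OF that] by simp
  note T = grid_round[OF w R(1), folded T_def S_def]
  have "\<exists>E\<in>events. prob E \<le> 2 ^ card (S n) * (2 * exp (- 2 * real n * \<epsilon>\<^sup>2)) \<and> (\<forall>\<omega>\<in>space M - E. dev n \<omega> \<le> 2 * \<epsilon>)"
    if n: "1 \<le> n" for n
  proof (rule finite_partition_deviation[OF T(1,2,3)[OF n] n less_imp_le[OF \<epsilon>]])
    fix E assume "E \<in> events" "prob E \<le> 2 ^ card (S n) * (2 * exp (- 2 * real n * \<epsilon>\<^sup>2))"
      "\<And>\<omega>. \<omega> \<in> space M - E \<Longrightarrow> (\<Sum>s\<in>S n. \<bar>freq n (\<lambda>i. X i \<omega>) (T n -` {s}) - measure N (T n -` {s})\<bar>) \<le> 2 * \<epsilon>"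
    then show ?thesis
      unfolding dev_def by blast
  qed
  then have "\<forall>n. \<exists>E. 1 \<le> n \<longrightarrow> E \<in> events \<and> prob E \<le> 2 ^ card (S n) * (2 * exp (- 2 * real n * \<epsilon>\<^sup>2)) \<and>
      (\<forall>\<omega>\<in>space M - E. dev n \<omega> \<le> 2 * \<epsilon>)"
    by blast
  then obtain E where E: "\<And>n. 1 \<le> n \<Longrightarrow> E n \<in> events"
    "\<And>n. 1 \<le> n \<Longrightarrow> prob (E n) \<le> 2 ^ card (S n) * (2 * exp (- 2 * real n * \<epsilon>\<^sup>2))"
    "\<And>n \<omega>. 1 \<le> n \<Longrightarrow> \<omega> \<in> space M - E n \<Longrightarrow> dev n \<omega> \<le> 2 * \<epsilon>"
    by metis
  define c where "c = 2 * R / \<delta> + 3"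
  have c: "0 < c"
    using R(1) \<delta>(1) by (simp add: c_def add_pos_pos)
  have "eventually (\<lambda>n. c / \<epsilon>\<^sup>2 \<le> real n * b n) sequentially"
    using nb by (simp add: filterlim_at_top)
  moreover have "eventually (\<lambda>n. b n < 1) sequentially"
    using b0 by (rule order_tendstoD) simp
  ultimately have card: "eventually (\<lambda>n. real (card (S n)) \<le> real n * \<epsilon>\<^sup>2) sequentially"
    using eventually_ge_at_top[of 1]
  proof eventually_elim
    case (elim n)
    have "real (card (S n)) \<le> 2 * R / (\<delta> * b n) + 3"
      using T(6)[OF elim(3)] by simp
    also have "\<dots> \<le> c / b n"
    proof -
      have "3 * 1 \<le> 3 * (1 / b n)"
        using bpos[OF elim(3)] elim(2) by (intro mult_left_mono) (simp_all add: pos_le_divide_eq)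
      moreover have "c / b n = 2 * R / (\<delta> * b n) + 3 * (1 / b n)"
        by (simp add: c_def add_divide_distrib)
      ultimately show ?thesis by linarith
    qed
    also have "\<dots> \<le> real n * \<epsilon>\<^sup>2"
    proof -
      have "c \<le> real n * b n * \<epsilon>\<^sup>2"
        using elim(1) \<epsilon> by (subst (asm) pos_divide_le_eq) auto
      then show ?thesis
        using bpos[OF elim(3)] by (subst pos_divide_le_eq) (auto simp: mult_ac)
    qed
    finally show ?case .
  qed
  define A where "A n = (if 1 \<le> n then E n else {})" for n
  have [measurable]: "A n \<in> events" for n
    using E(1) by (simp add: A_def)
  have "eventually (\<lambda>n. norm (prob (A n)) \<le> 2 * exp (- \<epsilon>\<^sup>2) ^ n) sequentially"
    using card eventually_ge_at_top[of 1]
  proof eventually_elim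
    case (elim n)
    have "(2::real) ^ card (S n) \<le> exp 1 ^ card (S n)"
      using exp_ge_add_one_self[of 1] by (intro power_mono) auto
    also have "\<dots> = exp (real (card (S n)))"
      by (simp flip: exp_of_nat_mult)
    also have "\<dots> \<le> exp (real n * \<epsilon>\<^sup>2)"
      using elim(1) by simp
    finally have "2 ^ card (S n) * (2 * exp (- 2 * real n * \<epsilon>\<^sup>2)) \<le> exp (real n * \<epsilon>\<^sup>2) * (2 * exp (- 2 * real n * \<epsilon>\<^sup>2))"
      by (rule mult_right_mono) simp
    also have "\<dots> = 2 * exp (- \<epsilon>\<^sup>2) ^ n"
      by (simp add: exp_of_nat_mult[symmetric] flip: exp_add)
    finally show ?case
      using E(2)[OF elim(2)] elim(2) by (simp add: A_def)
  qed
  then have "summable (\<lambda>n. prob (A n))"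
    by (rule summable_comparison_test_ev) (use \<epsilon> in \<open>auto intro!: summable_mult summable_geometric\<close>)
  then have AE: "AE \<omega> in M. eventually (\<lambda>n. \<omega> \<in> space M - A n) sequentially"
    by (intro borel_cantelli_AE1) (auto simp: emeasure_eq_measure)
  have "(\<lambda>n. b n * Rq) \<longlonglongrightarrow> 0 * Rq"
    by (intro tendsto_mult_right b0)
  then have bR: "eventually (\<lambda>n. b n * Rq < \<delta>') sequentially"
    using \<delta>'(1) by (intro order_tendstoD) auto
  from AE show ?thesis
  proof eventually_elim
    case (elim \<omega>)
    then show ?case
      using bR eventually_ge_at_top[of 1]
    proof eventually_elim
      case (elim n)
      have n: "1 \<le> n" by fact
      have dev: "dev n \<omega> \<le> 2 * \<epsilon>"
        using E(3)[OF n] elim(1) n by (simp add: A_def)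
      have tail: "freq n (\<lambda>i. X i \<omega>) {y. R < \<bar>y\<bar>} \<le> measure N {y. R < \<bar>y\<bar>} + dev n \<omega>"
      proof -
        have "\<bar>freq n (\<lambda>i. X i \<omega>) (T n -` {R + 1}) - measure N (T n -` {R + 1})\<bar> \<le> dev n \<omega>"
          unfolding dev_def using T(2)[OF n]
          by (intro member_le_sum[where f = "\<lambda>s. \<bar>freq n (\<lambda>i. X i \<omega>) (T n -` {s}) - measure N (T n -` {s})\<bar>"])
            (auto simp: S_def grid_points_def)
        then show ?thesis
          unfolding T(5)[OF n] by linarith
      qed
      have "L1_norm (\<lambda>x. g_hat q b n (\<lambda>i. X i \<omega>) x - g x) \<le>
          ennreal (2 * \<epsilon> + 2 * freq n (\<lambda>i. X i \<omega>) {y. R < \<bar>y\<bar>} + 2 * measure N {y. R < \<bar>y\<bar>} + \<epsilon> +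
            (\<Sum>s\<in>S n. \<bar>freq n (\<lambda>i. X i \<omega>) (T n -` {s}) - measure N (T n -` {s})\<bar>))"
      proof (rule L1_norm_kde_bound[where b = b and n = n and \<delta> = \<delta> and \<omega> = \<epsilon>, OF Q bpos[OF n] n real_distribution_law g T(1,2,3)[OF n] \<delta>(2)])
        show "\<bar>T n y - y\<bar> \<le> \<delta> * b n" if "y \<notin> {y. R < \<bar>y\<bar>}" for y
          using T(4)[OF n] that by simp
        show "L1_modulus g (- b n * u) \<le> ennreal \<epsilon>" if "q u \<noteq> 0" for u
        proof (rule \<delta>'(2))
          have "\<bar>- b n * u\<bar> \<le> b n * Rq"
            using Rq(2)[OF that] bpos[OF n] by (simp add: abs_mult)
          then show "\<bar>- b n * u\<bar> \<le> \<delta>'"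
            using elim(2) by linarith
        qed
      qed (use \<epsilon> in auto)
      \<comment> \<open>The 13 consists of 2 from rounding, 6 from the empirical tail (at most
        \<epsilon> + 2 \<epsilon>, doubled), 2 from the true tail, 1 from smoothing g, and 2 from
        the cells.\<close>
      also have "\<dots> \<le> ennreal (13 * \<epsilon>)"
        using tail R(2) dev unfolding dev_def[symmetric] by (intro ennreal_leI) linarith
      finally show ?case .
    qed
  qed
qed

lemma kde_L1_consistent:
  assumes q: "smoothing_kernel q" and b: "bandwidth b" and g: "is_density N g"
  shows "AE \<omega> in M. (\<lambda>n. L1_norm (\<lambda>x. g_hat q b n (\<lambda>i. X i \<omega>) x - g x)) \<longlonglongrightarrow> 0"
proof -
  have "AE \<omega> in M. eventually (\<lambda>n. L1_norm (\<lambda>x. g_hat q b n (\<lambda>i. X i \<omega>) x - g x) \<le>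
     ennreal (1 / real (Suc k))) sequentially" for k
  proof -
    have "13 * (1 / (13 * real (Suc k))) = 1 / real (Suc k)"
      by (simp add: divide_simps)
    moreover have "0 < 1 / (13 * real (Suc k))"
      by simp
    ultimately show ?thesis
      using kde_L1_eventually_small[OF q b g, of "1 / (13 * real (Suc k))"] by (simp only:)
  qed
  then have "AE \<omega> in M. \<forall>k. eventually (\<lambda>n. L1_norm (\<lambda>x. g_hat q b n (\<lambda>i. X i \<omega>) x - g x) \<le>
     ennreal (1 / real (Suc k))) sequentially"
    unfolding AE_all_countable by blast
  then show ?thesis
  proof eventually_elim
    case (elim \<omega>)
    show ?case
    proof (rule order_tendstoI)
      fix a :: ennreal assume "0 < a"
      then obtain k where k: "ennreal (1 / real (Suc k)) < a"
      proof (cases a)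
        case (real r)
        then obtain k where "1 / real (Suc k) < r"
          using nat_approx_posE[of r] \<open>0 < a\<close> by auto
        then show ?thesis
          using that real by (auto simp: ennreal_less_iff)
      qed (use that[of 0] in auto)
      have "eventually (\<lambda>n. L1_norm (\<lambda>x. g_hat q b n (\<lambda>i. X i \<omega>) x - g x) \<le> ennreal (1 / real (Suc k))) sequentially"
        using elim by blast
      then show "eventually (\<lambda>n. L1_norm (\<lambda>x. g_hat q b n (\<lambda>i. X i \<omega>) x - g x) < a) sequentially"
        by (rule eventually_mono) (rule le_less_trans[OF _ k])
    qed simp
  qed
qed

end

section \<open>The contrast for unknown locations\<close>

context symmetric_mixture
begin

text \<open>Dividing the cosine transform of the asymmetry by that of \<open>P0\<close>, nonzero
  near the origin, leaves a sum of sines in the four differences of locations. Weights below 1/2 are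
  what prevents the two components from being exchanged.\<close>

lemma asymmetry_eq_0_imp_true:
  assumes l: "0 \<le> l" "l < 1/2" and m: "m1 \<noteq> m2" and l0': "0 < l0" and \<mu>: "\<mu>1 \<noteq> \<mu>2"
    and zero: "\<And>x. asymmetry (l, m1, m2) G x = 0"
  shows "l = l0" "m1 = \<mu>1" "m2 = \<mu>2"
proof -
  define w where "w = (\<lambda>j::nat. [l * l0, l * (1 - l0), (1 - l) * l0, (1 - l) * (1 - l0)] ! j)"
  define b where "b = (\<lambda>j::nat. [\<mu>1 - m1, \<mu>2 - m1, \<mu>1 - m2, \<mu>2 - m2] ! j)"
  have "{..<4::nat} = {0, 1, 2, 3}"
    by auto
  then have J: "(\<Sum>j<4. h j) = h 0 + h 1 + h 2 + h 3" for h :: "nat \<Rightarrow> real"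
    by simp
  have wb: "w 0 = l * l0" "w 1 = l * (1 - l0)" "w 2 = (1 - l) * l0" "w 3 = (1 - l) * (1 - l0)"
    "b 0 = \<mu>1 - m1" "b 1 = \<mu>2 - m1" "b 2 = \<mu>1 - m2" "b 3 = \<mu>2 - m2"
    by (simp_all add: w_def b_def)
  have sum: "(\<Sum>j<4. w j * (F0 (x + b j) - F0 (x - b j))) = 0" for x
    using zero[of x] unfolding asymmetry_G J wb .
  obtain \<delta> where \<delta>: "0 < \<delta>" "\<And>t. \<bar>t\<bar> < \<delta> \<Longrightarrow> (\<integral>y. cos (t * y) \<partial>P0) \<noteq> 0"
    using cosine_transform_nonzero[OF P0.real_distribution_axioms] by metis
  have sin: "(\<Sum>j<4. w j * sin (t * b j)) = 0" if t: "\<bar>t\<bar> < \<delta>" for t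
  proof (cases "t = 0")
    case False
    note T = cdf_increment_cosine_transform[OF P0.real_distribution_axioms False, folded F0_def]
    have "0 = (\<integral>x. (\<Sum>j<4. w j * (F0 (x + b j) - F0 (x - b j))) * cos (t * x) \<partial>lborel)"
      by (simp only: sum) simp
    also have "\<dots> = (\<integral>x. (\<Sum>j<4. w j * ((F0 (x + b j) - F0 (x - b j)) * cos (t * x))) \<partial>lborel)"
      by (simp add: sum_distrib_right mult.assoc)
    also have "\<dots> = (\<Sum>j<4. w j * (2 * sin (t * b j) / t * (\<integral>y. cos (t * y) \<partial>P0)))"
      using T by (subst Bochner_Integration.integral_sum) auto
    also have "\<dots> = 2 / t * (\<integral>y. cos (t * y) \<partial>P0) * (\<Sum>j<4. w j * sin (t * b j))"
      by (simp add: sum_distrib_left mult_ac)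
    finally show ?thesis
      using False \<delta>(2)[OF t] by simp
  qed simp
  have zero': "(if (\<mu>1 - m1)\<^sup>2 = c\<^sup>2 then l * l0 * (\<mu>1 - m1) else 0) + (if (\<mu>2 - m1)\<^sup>2 = c\<^sup>2 then l * (1 - l0) * (\<mu>2 - m1) else 0) +
      (if (\<mu>1 - m2)\<^sup>2 = c\<^sup>2 then (1 - l) * l0 * (\<mu>1 - m2) else 0) +
      (if (\<mu>2 - m2)\<^sup>2 = c\<^sup>2 then (1 - l) * (1 - l0) * (\<mu>2 - m2) else 0) = 0" for c
    using sine_sum_zero_imp_coefficients[OF _ \<delta>(1) sin, of c] unfolding J wb by simp
  \<comment> \<open>The required distinctness of frequencies translates into that of locations: b1
    \<noteq> b2 is \<mu>1 \<noteq> \<mu>2, and b1 \<noteq> b3 is m1 \<noteq> m2.\<close>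
  have "\<mu>2 - m2 = 0" "\<mu>1 - m1 = 0" "l = l0"
    by (rule mixture_frequencies_unique[OF l l0' l0(2) _ _ _ zero']; use m \<mu> in simp)+
  then show "l = l0" "m1 = \<mu>1" "m2 = \<mu>2"
    by simp_all
qed

definition param_dist :: "real \<times> real \<times> real \<Rightarrow> real" where
  "param_dist = (\<lambda>(l, m1, m2). \<bar>l - l0\<bar> + \<bar>m1 - \<mu>1\<bar> + \<bar>m2 - \<mu>2\<bar>)"

definition limit_contrast :: "real \<times> real \<times> real \<Rightarrow> real" where
  "limit_contrast \<theta> = (\<integral>x. (residual \<theta> G x)\<^sup>2 \<partial>N)"

lemma asymmetry_lipschitz:
  assumes l: "0 \<le> l" "l \<le> 1"
  shows "\<bar>asymmetry (l, m1, m2) G x - asymmetry (l, m1, m2) G y\<bar> \<le> 2 * L * \<bar>x - y\<bar>"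
proof -
  have S: "\<bar>S_r G x - S_r G y\<bar> \<le> L * \<bar>x - y\<bar>" for x y
    using G_lip[of "- x" "- y"] by (simp add: S_r_def abs_minus_commute)
  have A: "\<bar>A_op (l, m1, m2) (S_r G) x - A_op (l, m1, m2) (S_r G) y\<bar> \<le> L * \<bar>x - y\<bar>" for x y
  proof -
    have "A_op (l, m1, m2) (S_r G) x - A_op (l, m1, m2) (S_r G) y =
        l * (S_r G (x - m1) - S_r G (y - m1)) + (1 - l) * (S_r G (x - m2) - S_r G (y - m2))"
      unfolding A_op_eq[of l] by (simp add: algebra_simps)
    also have "\<bar>\<dots>\<bar> \<le> l * (L * \<bar>x - y\<bar>) + (1 - l) * (L * \<bar>x - y\<bar>)"
      using l S[of "x - m1" "y - m1"] S[of "x - m2" "y - m2"]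
      by (intro order.trans[OF abs_triangle_ineq] add_mono) (auto simp: abs_mult intro!: mult_left_mono)
    finally show ?thesis by (simp add: algebra_simps)
  qed
  show ?thesis
    using A[of x y] A[of "- x" "- y"] abs_minus_commute[of x y] unfolding asymmetry_def
    by (simp add: abs_le_iff)
qed

lemma asymmetry_tendsto:
  assumes "(\<lambda>k. \<theta> k) \<longlonglongrightarrow> \<theta>'"
  shows "(\<lambda>k. asymmetry (\<theta> k) G x) \<longlonglongrightarrow> asymmetry \<theta>' G x"
proof -
  have \<theta>: "\<theta> k = (fst (\<theta> k), fst (snd (\<theta> k)), snd (snd (\<theta> k)))" for k
    by simp
  have t: "(\<lambda>k. fst (\<theta> k)) \<longlonglongrightarrow> fst \<theta>'" "(\<lambda>k. fst (snd (\<theta> k))) \<longlonglongrightarrow> fst (snd \<theta>')"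
    "(\<lambda>k. snd (snd (\<theta> k))) \<longlonglongrightarrow> snd (snd \<theta>')"
    by (intro tendsto_fst tendsto_snd assms)+
  have F: "(\<lambda>k. F0 (y k)) \<longlonglongrightarrow> F0 y'" if "y \<longlonglongrightarrow> y'" for y y'
    using continuous_on_tendsto_compose[OF F0_cont that] by simp
  have "(\<lambda>k. asymmetry (fst (\<theta> k), fst (snd (\<theta> k)), snd (snd (\<theta> k))) G x) \<longlonglongrightarrow>
      asymmetry (fst \<theta>', fst (snd \<theta>'), snd (snd \<theta>')) G x"
    unfolding asymmetry_G by (intro tendsto_intros F t)
  then show ?thesis by simp
qed

lemma unknown_locations_identified:
  assumes d: "0 < d" and X: "compact \<X>" "\<X> \<inter> {(x, x) |x. True} = {}" and l0': "0 < l0" and \<mu>: "\<mu>1 \<noteq> \<mu>2" and \<epsilon>: "0 < \<epsilon>"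
  obtains \<kappa> where "0 < \<kappa>"
    "\<And>\<theta>. \<theta> \<in> {0..1/2 - d} \<times> \<X> \<Longrightarrow> \<epsilon> \<le> param_dist \<theta> \<Longrightarrow> \<kappa> \<le> limit_contrast \<theta>"
proof (rule ccontr)
  assume contr: "\<not> thesis"
  have "\<exists>\<theta>\<in>{0..1/2 - d} \<times> \<X>. \<epsilon> \<le> param_dist \<theta> \<and> limit_contrast \<theta> < inverse (real (Suc k))" for k
    using contr that[of "inverse (real (Suc k))"] by (force simp: not_le)
  then obtain \<theta> where \<theta>: "\<And>k. \<theta> k \<in> {0..1/2 - d} \<times> \<X>" "\<And>k. \<epsilon> \<le> param_dist (\<theta> k)"
    "\<And>k. limit_contrast (\<theta> k) < inverse (real (Suc k))"
    by metis
  have cpt: "compact ({0..1/2 - d} \<times> \<X>)"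
    using X(1) by (intro compact_Times) auto
  then obtain \<theta>' \<sigma> where \<theta>': "\<theta>' \<in> {0..1/2 - d} \<times> \<X>" and \<sigma>: "strict_mono \<sigma>" and lim: "(\<theta> \<circ> \<sigma>) \<longlonglongrightarrow> \<theta>'"
    using \<theta>(1) unfolding compact_def by metis
  obtain l m1 m2 where \<theta>'_eq: "\<theta>' = (l, m1, m2)" by (cases \<theta>')
  have "(\<lambda>k. param_dist ((\<theta> \<circ> \<sigma>) k)) \<longlonglongrightarrow> param_dist \<theta>'"
    unfolding param_dist_def split_beta' by (intro tendsto_intros lim)
  then have "\<epsilon> \<le> param_dist \<theta>'"
    using \<theta>(2) by (intro tendsto_lowerbound) (auto intro!: always_eventually)
  then have ne: "\<not> (l = l0 \<and> m1 = \<mu>1 \<and> m2 = \<mu>2)"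
    using \<epsilon> by (auto simp: \<theta>'_eq param_dist_def)
  have lm: "0 \<le> l" "l < 1/2" "m1 \<noteq> m2"
    using \<theta>' d X(2) by (auto simp: \<theta>'_eq)
  obtain x0 where x0: "asymmetry \<theta>' G x0 \<noteq> 0"
    using asymmetry_eq_0_imp_true[OF lm l0' \<mu>] ne unfolding \<theta>'_eq by blast
  define e where "e = \<bar>asymmetry \<theta>' G x0\<bar> / 2"
  have e: "0 < e"
    using x0 by (simp add: e_def)
  have ev: "eventually (\<lambda>k. e < \<bar>asymmetry ((\<theta> \<circ> \<sigma>) k) G x0\<bar>) sequentially"
    by (rule order_tendstoD(1)[OF tendsto_rabs[OF asymmetry_tendsto]]) (use lim e in \<open>auto simp: comp_def e_def\<close>)
  obtain Rx where Rx: "\<And>z. z \<in> \<X> \<Longrightarrow> norm z \<le> Rx"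
    using compact_imp_bounded[OF X(1)] by (auto simp: bounded_iff)
  define R where "R = Rx + \<bar>x0\<bar>"
  define r where "r = d * e / (2 * L + 1)"
  have r: "0 < r"
    using d e L_nonneg by (simp add: r_def)
  obtain m where m: "0 < m" "\<And>c. \<bar>c\<bar> \<le> R \<Longrightarrow> m \<le> measure N {c - r<..c + r}"
    using compact_interval_mass_bound[OF N.real_distribution_axioms _ _ r, of R]
    by (auto simp: cdf_N G_cont G_mono)
  have "eventually (\<lambda>k. inverse (real (Suc k)) < (e / 2)\<^sup>2 * m) sequentially"
    using e m(1) by (intro order_tendstoD[OF LIMSEQ_inverse_real_of_nat]) simp
  then have "eventually (\<lambda>k. inverse (real (Suc (\<sigma> k))) < (e / 2)\<^sup>2 * m) sequentially"
    using \<sigma> by (rule eventually_subseq[rotated])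
  with ev have "eventually (\<lambda>k. False) sequentially"
  proof eventually_elim
    case (elim k)
    obtain l m1 m2 where \<theta>k: "\<theta> (\<sigma> k) = (l, m1, m2)" by (cases "\<theta> (\<sigma> k)")
    have l: "0 \<le> l" "l \<le> 1/2 - d" and mX: "(m1, m2) \<in> \<X>"
      using \<theta>(1)[of "\<sigma> k"] by (auto simp: \<theta>k)
    have "(e / 2)\<^sup>2 * m \<le> limit_contrast (l, m1, m2)"
      unfolding limit_contrast_def
    proof (rule residual_lower_bound[where ?x0.0 = x0 and r = r and R = R, OF d l e])
      show "e \<le> \<bar>asymmetry (l, m1, m2) G x0\<bar>"
        using elim(1) by (simp add: \<theta>k)
      fix x y assume xy: "\<bar>x - y\<bar> \<le> r"
      have "\<bar>asymmetry (l, m1, m2) G x - asymmetry (l, m1, m2) G y\<bar> \<le> 2 * L * \<bar>x - y\<bar>"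
        using l d by (intro asymmetry_lipschitz) auto
      also have "\<dots> \<le> (2 * L + 1) * r"
        using L_nonneg xy r by (intro mult_mono) auto
      also have "\<dots> = d * e"
        using L_nonneg by (simp add: r_def)
      finally show "\<bar>asymmetry (l, m1, m2) G x - asymmetry (l, m1, m2) G y\<bar> \<le> d * e" .
    next
      show "\<bar>m1 - x0\<bar> \<le> R" "\<bar>m2 - x0\<bar> \<le> R"
        using Rx[OF mX] norm_fst_le[of m1 m2] norm_snd_le[of m2 m1] by (auto simp: R_def)
    qed (rule m(2))
    then show ?case
      using \<theta>(3)[of "\<sigma> k"] elim(2) by (simp add: \<theta>k)
  qed
  then show False by simp
qed

end

section \<open>Densities and the directional derivative of the asymmetry\<close>

lemma cdf_derivative_is_density:
  assumes P: "real_distribution P" and d: "\<And>x. (cdf P has_real_derivative f x) (at x)" and cont: "continuous_on UNIV f"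
  shows "is_density P f"
proof -
  interpret real_distribution P by fact
  have f0: "0 \<le> f x" for x
    using mono_on_imp_deriv_nonneg[of UNIV "cdf P" "f x" x] d cdf_nondecreasing by (auto simp: mono_on_def)
  have fm [measurable]: "f \<in> borel_measurable borel"
    using cont by (rule borel_measurable_continuous_onI)
  have "P = density lborel (\<lambda>x. ennreal (f x))"
  proof (rule measure_eqI_generator_eq)
    let ?E = "range (\<lambda>(a, b). {a<..b::real})"
    show "Int_stable ?E"
      by (auto simp: Int_stable_def Int_greaterThanAtMost)
    show "emeasure P X = emeasure (density lborel (\<lambda>x. ennreal (f x))) X" if XE: "X \<in> ?E" for X
    proof -
      obtain a b where X: "X = {a<..b}"
        using XE by auto
      show ?thesis
      proof (cases "a \<le> b")
        case True
        have "emeasure (density lborel (\<lambda>x. ennreal (f x))) X = (\<integral>\<^sup>+x. ennreal (f x) * indicator {a<..b} x \<partial>lborel)"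
          unfolding X by (rule emeasure_density) auto
        also have "\<dots> = (\<integral>\<^sup>+x. ennreal (f x) * indicator {a..b} x \<partial>lborel)"
        proof (rule nn_integral_cong_AE)
          show "AE x in lborel. ennreal (f x) * indicator {a<..b} x = ennreal (f x) * indicator {a..b} x"
            using AE_lborel_singleton[of a] by eventually_elim (auto simp: indicator_def)
        qed
        also have "\<dots> = ennreal (cdf P b - cdf P a)"
          using True f0 d by (intro nn_integral_FTC_Icc) (auto intro: has_field_derivative_at_within)
        finally show ?thesis
          using emeasure_Ioc[OF True] by (simp add: X)
      qed (simp add: X)
    qed
    show "range (\<lambda>n::nat. {- real n<..real n}) \<subseteq> ?E" by auto
    show "(\<Union>n::nat. {- real n<..real n}) = UNIV"
      by (rule UN_Ioc_eq_UNIV)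
    show "emeasure P {- real n<..real n} \<noteq> \<infinity>" for n :: nat
      by simp
  qed (auto simp: borel_sigma_sets_Ioc)
  then show ?thesis
    using f0 by (simp add: is_density_def)
qed

lemma cosine_transform_density:
  assumes P: "real_distribution P" and f: "is_density P f"
  shows "integrable lborel (\<lambda>x. f (x + s) * cos (t * x))"
    "(\<integral>x. f (x + s) * cos (t * x) \<partial>lborel) = (\<integral>y. cos (t * (y - s)) \<partial>P)"
proof -
  interpret real_distribution P by fact
  note fD = is_densityD[OF f prob_space_axioms]
  note [measurable] = fD(1)
  have P: "P = density lborel (\<lambda>x. ennreal (f x))"
    using f by (simp add: is_density_def)
  have "integrable lborel (\<lambda>x. f (s + 1 * x))"
    by (rule lborel_integrable_real_affine[OF fD(3)]) simp
  then have i: "integrable lborel (\<lambda>x. f (x + s))"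
    by (simp add: add.commute)
  show "integrable lborel (\<lambda>x. f (x + s) * cos (t * x))"
    by (rule Bochner_Integration.integrable_bound[OF i]) (auto simp: abs_mult mult_left_le)
  have "(\<integral>y. cos (t * (y - s)) \<partial>P) = (\<integral>y. f y * cos (t * (y - s)) \<partial>lborel)"
    unfolding P using fD(2) by (subst integral_real_density) auto
  also have "\<dots> = (\<integral>x. f (s + 1 * x) * cos (t * (s + 1 * x - s)) \<partial>lborel)"
    by (subst lborel_integral_real_affine[of 1 _ s]) auto
  finally show "(\<integral>x. f (x + s) * cos (t * x) \<partial>lborel) = (\<integral>y. cos (t * (y - s)) \<partial>P)"
    by (simp add: add.commute)
qed

context symmetric_mixture
begin

text \<open>The hypothesis is that the derivative of the asymmetry at the true parameter vanishes in
  the direction (u1, u2, u3). After division by the cosine transform of \<open>P0\<close> it becomes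
  the identity of \<open>trigonometric_identity_trivial\<close>. Then \<beta> = 0 gives u2 = - u3,
  and \<alpha> = 0 becomes \<open>u3 * (1 - 2 * l0) = 0\<close>, so weights below 1/2 matter here
  too.\<close>

lemma asymmetry_derivative_nonzero:
  assumes l0': "0 < l0" and \<mu>: "\<mu>1 \<noteq> \<mu>2" and f: "is_density P0 f"
    and zero: "\<And>x. u1 * (F0 (x + (\<mu>2 - \<mu>1)) - F0 (x - (\<mu>2 - \<mu>1))) - (2 * l0\<^sup>2 * u2 + 2 * (1 - l0)\<^sup>2 * u3) * f x -
      l0 * (1 - l0) * (u2 + u3) * (f (x + (\<mu>2 - \<mu>1)) + f (x - (\<mu>2 - \<mu>1))) = 0"
  shows "u1 = 0" "u2 = 0" "u3 = 0"
proof -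
  define s where "s = \<mu>2 - \<mu>1"
  define \<alpha> where "\<alpha> = 2 * l0\<^sup>2 * u2 + 2 * (1 - l0)\<^sup>2 * u3"
  define \<beta> where "\<beta> = l0 * (1 - l0) * (u2 + u3)"
  have s: "s \<noteq> 0"
    using \<mu> by (simp add: s_def)
  obtain \<delta> where \<delta>: "0 < \<delta>" "\<And>t. \<bar>t\<bar> < \<delta> \<Longrightarrow> (\<integral>y. cos (t * y) \<partial>P0) \<noteq> 0"
    using cosine_transform_nonzero[OF P0.real_distribution_axioms] by metis
  have id: "2 * u1 * sin (t * s) - t * (\<alpha> + 2 * \<beta> * cos (t * s)) = 0" if t: "\<bar>t\<bar> < \<delta>" for t
  proof (cases "t = 0")
    case False
    define c where "c = (\<integral>y. cos (t * y) \<partial>P0)"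
    note T = cdf_increment_cosine_transform[OF P0.real_distribution_axioms False, of s, folded F0_def c_def]
    note D = cosine_transform_density[OF P0.real_distribution_axioms f, of _ t]
    have ci: "integrable P0 (\<lambda>y. cos (t * (y + a)))" for a
      by (rule P0.integrable_const_bound[where B = 1]) auto
    have "0 = (\<integral>x. (u1 * (F0 (x + s) - F0 (x - s)) - \<alpha> * f x - \<beta> * (f (x + s) + f (x - s))) * cos (t * x) \<partial>lborel)"
      using zero by (simp add: s_def[symmetric] \<alpha>_def[symmetric] \<beta>_def[symmetric])
    also have "\<dots> = (\<integral>x. u1 * ((F0 (x + s) - F0 (x - s)) * cos (t * x)) - \<alpha> * (f (x + 0) * cos (t * x)) -
        \<beta> * (f (x + s) * cos (t * x) + f (x + - s) * cos (t * x)) \<partial>lborel)"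
      by (simp add: algebra_simps)
    also have "\<dots> = u1 * (\<integral>x. (F0 (x + s) - F0 (x - s)) * cos (t * x) \<partial>lborel) - \<alpha> * (\<integral>x. f (x + 0) * cos (t * x) \<partial>lborel) -
        \<beta> * ((\<integral>x. f (x + s) * cos (t * x) \<partial>lborel) + (\<integral>x. f (x + - s) * cos (t * x) \<partial>lborel))"
      using T(1) D(1)[of 0] D(1)[of s] D(1)[of "- s"] by simp
    also have "\<dots> = u1 * (2 * sin (t * s) / t * c) - \<alpha> * c -
        \<beta> * ((\<integral>y. cos (t * (y + - s)) \<partial>P0) + (\<integral>y. cos (t * (y + s)) \<partial>P0))"
      unfolding T(2) D(2) by (simp add: c_def)
    also have "(\<integral>y. cos (t * (y + - s)) \<partial>P0) + (\<integral>y. cos (t * (y + s)) \<partial>P0) = (\<integral>y. cos (t * (y + - s)) + cos (t * (y + s)) \<partial>P0)"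
      by (rule Bochner_Integration.integral_add[symmetric]) (rule ci)+
    also have "\<dots> = (\<integral>y. 2 * cos (t * s) * cos (t * y) \<partial>P0)"
      by (intro Bochner_Integration.integral_cong refl) (simp add: right_diff_distrib distrib_left cos_add cos_diff)
    also have "\<dots> = 2 * cos (t * s) * c"
      by (simp add: c_def)
    finally have "c * (2 * u1 * sin (t * s) - t * (\<alpha> + 2 * \<beta> * cos (t * s))) = 0"
      using False by (simp add: field_simps)
    then show ?thesis
      using \<delta>(2)[OF t] by (simp add: c_def)
  qed simp
  note * = trigonometric_identity_trivial[OF s \<delta>(1) id]
  show "u1 = 0" by (rule *(1))
  have "u2 = - u3"
    using *(3) l0' l0 by (simp add: \<beta>_def)
  moreover have "u3 * (1 - 2 * l0) = 0"
    using *(2) calculation by (simp add: \<alpha>_def power2_eq_square algebra_simps)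
  ultimately show "u2 = 0" "u3 = 0"
    using l0 by auto
qed

end

text \<open>The normalising r k need not be the increment \<open>m k - \<mu>\<close>, which may even
  be 0. Caratheodory's factorisation of the increment of H by a continuous g avoids dividing by
  it.\<close>

lemma difference_quotient_tendsto:
  fixes H :: "real \<Rightarrow> real"
  assumes H: "(H has_real_derivative D) (at (x - \<mu>))" and m: "m \<longlonglongrightarrow> \<mu>" and u: "(\<lambda>k. (m k - \<mu>) / r k) \<longlonglongrightarrow> u"
  shows "(\<lambda>k. (H (x - m k) - H (x - \<mu>)) / r k) \<longlonglongrightarrow> - (u * D)"
proof -
  obtain g where g: "\<And>z. H z - H (x - \<mu>) = g z * (z - (x - \<mu>))" "isCont g (x - \<mu>)" "g (x - \<mu>) = D"
    using H unfolding CARAT_DERIV by blast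
  have "(\<lambda>k. g (x - m k)) \<longlonglongrightarrow> D"
    using isCont_tendsto_compose[OF g(2), of "\<lambda>k. x - m k" sequentially] tendsto_diff[OF tendsto_const[of x] m] g(3) by simp
  then have "(\<lambda>k. - ((m k - \<mu>) / r k * g (x - m k))) \<longlonglongrightarrow> - (u * D)"
    by (intro tendsto_minus tendsto_mult u)
  moreover have "(H (x - m k) - H (x - \<mu>)) / r k = - ((m k - \<mu>) / r k * g (x - m k))" for k
  proof -
    have "x - m k - (x - \<mu>) = - (m k - \<mu>)"
      by simp
    then show ?thesis
      unfolding g(1) by (simp only: mult_minus_right) (simp add: mult.commute)
  qed
  ultimately show ?thesis by simp
qed

text \<open>Mean value theorem for \<open>\<lambda>z. H (z + h) - H z\<close>. It yields a modulus
  of continuity of a difference of translates that is itself proportional to the distance of the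
  translates, as required after division by the parameter error.\<close>

lemma second_difference_bound:
  fixes H H' :: "real \<Rightarrow> real"
  assumes H: "\<And>z. (H has_real_derivative H' z) (at z)" and \<omega>: "\<And>z. \<bar>H' (z + h) - H' z\<bar> \<le> \<omega>"
  shows "\<bar>(H (a + h) - H (b + h)) - (H a - H b)\<bar> \<le> \<omega> * \<bar>a - b\<bar>"
proof -
  have "norm ((H (a + h) - H a) - (H (b + h) - H b)) \<le> \<omega> * norm (a - b)"
  proof (rule field_differentiable_bound[where S = UNIV and f' = "\<lambda>z. H' (z + h) - H' z"])
    show "((\<lambda>z. H (z + h) - H z) has_field_derivative H' (z + h) - H' z) (at z within UNIV)" for z
      using H by (auto intro!: derivative_eq_intros DERIV_chain2[OF H])
  qed (use \<omega> in auto)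
  then show ?thesis
    by (simp add: algebra_simps)
qed

context symmetric_mixture
begin

text \<open>The change of \<open>A_op \<theta> (S_r G)\<close> from its value at the true parameter,
  arranged so that each summand carries the error of one coordinate of \<theta>.\<close>

definition perturbation :: "real \<times> real \<times> real \<Rightarrow> real \<Rightarrow> real" where
  "perturbation = (\<lambda>(l, m1, m2) x. (l - l0) * (S_r G (x - m1) - S_r G (x - m2)) +
     l0 * (S_r G (x - m1) - S_r G (x - \<mu>1)) + (1 - l0) * (S_r G (x - m2) - S_r G (x - \<mu>2)))"

lemma asymmetry_perturbation: "asymmetry \<theta> G x = perturbation \<theta> x + perturbation \<theta> (- x)"
proof -
  obtain l m1 m2 where \<theta>: "\<theta> = (l, m1, m2)" by (cases \<theta>)
  have "A_op (l, m1, m2) (S_r G) x = A_op (l0, \<mu>1, \<mu>2) (S_r G) x + perturbation (l, m1, m2) x" for x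
    unfolding A_op_eq[of _ _ _ "S_r G"] perturbation_def by (simp add: algebra_simps)
  moreover have "asymmetry (l0, \<mu>1, \<mu>2) G x = 0"
    by (simp add: asymmetry_known_locations)
  ultimately show ?thesis
    unfolding \<theta> asymmetry_def by simp
qed

text \<open>A sequence violating the bound must approach the truth, by identification. Divided by
  the parameter error r, the asymmetries converge pointwise to the derivative V in a limit
  direction, which is nonzero by injectivity. Uniform continuity of the density gives the quotients
  a common modulus of continuity, so the contrast is at least a constant times the square of r, a
  contradiction.\<close>

lemma unknown_locations_quadratic:
  assumes d: "0 < d" and X: "compact \<X>" "\<X> \<inter> {(x, x) |x. True} = {}" and l0': "0 < l0" and \<mu>: "\<mu>1 \<noteq> \<mu>2"
    and C2: "C2 F0"
  obtains c where "0 < c" "\<And>\<theta>. \<theta> \<in> {0..1/2 - d} \<times> \<X> \<Longrightarrow> c * (param_dist \<theta>)\<^sup>2 \<le> limit_contrast \<theta>"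
proof (rule ccontr)
  assume contr: "\<not> thesis"
  obtain f where f: "\<And>x. (F0 has_real_derivative f x) (at x)" "continuous_on UNIV f"
    and fmod: "\<And>\<epsilon>. 0 < \<epsilon> \<Longrightarrow> \<exists>\<delta>>0. \<forall>h. \<bar>h\<bar> \<le> \<delta> \<longrightarrow> (\<forall>x. \<bar>f (x + h) - f x\<bar> \<le> \<epsilon>)"
    using C2_derivative_modulus[OF C2] by metis
  have dens: "is_density P0 f"
    using f by (intro cdf_derivative_is_density P0.real_distribution_axioms) (auto simp: F0_def)
  have f_minus: "f (- x) = f x" for x
  proof -
    have "((\<lambda>x. F0 (- x)) has_real_derivative - f (- x)) (at x)"
      using f(1)[of "- x"] by (simp add: DERIV_mirror)
    moreover have "((\<lambda>x. F0 (- x)) has_real_derivative - f x) (at x)"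
      unfolding F0_minus using f(1) by (auto intro!: derivative_eq_intros)
    ultimately show ?thesis
      using DERIV_unique by fastforce
  qed
  define H where "H = S_r G"
  define H' where "H' x = l0 * f (x + \<mu>1) + (1 - l0) * f (x + \<mu>2)" for x
  have H: "H x = l0 * F0 (x + \<mu>1) + (1 - l0) * F0 (x + \<mu>2)" for x
    by (simp add: H_def S_r_G)
  have dH: "(H has_real_derivative H' x) (at x)" for x
    unfolding H[abs_def] H'_def by (auto intro!: derivative_eq_intros DERIV_chain2[OF f(1)])
  have "\<exists>\<theta>\<in>{0..1/2 - d} \<times> \<X>. limit_contrast \<theta> < inverse (real (Suc k)) * (param_dist \<theta>)\<^sup>2" for k
    using contr that[of "inverse (real (Suc k))"] by (force simp: not_le)
  then obtain \<theta> where \<theta>: "\<And>k. \<theta> k \<in> {0..1/2 - d} \<times> \<X>"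
    "\<And>k. limit_contrast (\<theta> k) < inverse (real (Suc k)) * (param_dist (\<theta> k))\<^sup>2"
    by metis
  define r where "r k = param_dist (\<theta> k)" for k
  define ls where "ls k = fst (\<theta> k)" for k
  define m1s where "m1s k = fst (snd (\<theta> k))" for k
  define m2s where "m2s k = snd (snd (\<theta> k))" for k
  have \<theta>_eq: "\<theta> k = (ls k, m1s k, m2s k)" for k
    by (simp add: ls_def m1s_def m2s_def)
  have r_eq: "r k = \<bar>ls k - l0\<bar> + \<bar>m1s k - \<mu>1\<bar> + \<bar>m2s k - \<mu>2\<bar>" for k
    by (simp add: r_def \<theta>_eq param_dist_def)
  have lc0: "0 \<le> limit_contrast z" for z
    by (simp add: limit_contrast_def)
  \<comment> \<open>If \<open>r k\<close> were 0, the strict inequality would put the nonnegative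
    \<open>limit_contrast\<close> below 0; the differences may therefore be divided by
    \<open>r k\<close>.\<close>
  have r: "0 < r k" for k
  proof -
    have "r k \<noteq> 0"
      using \<theta>(2)[of k] lc0[of "\<theta> k"] by (auto simp: r_def)
    then show ?thesis
      by (simp add: r_eq)
  qed
  define u where "u k = ((ls k - l0) / r k, (m1s k - \<mu>1) / r k, (m2s k - \<mu>2) / r k)" for k
  have u1: "\<bar>(ls k - l0) / r k\<bar> + \<bar>(m1s k - \<mu>1) / r k\<bar> + \<bar>(m2s k - \<mu>2) / r k\<bar> = 1" for k
    using r[of k] unfolding abs_divide add_divide_distrib[symmetric] by (simp add: r_eq[symmetric])
  have u: "u k \<in> {-1..1} \<times> {-1..1} \<times> {-1..1}" for k
  proof -
    have "a \<in> {-1..1}" if "\<bar>a\<bar> \<le> 1" for a :: real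
      using that by (auto simp: abs_le_iff)
    moreover have "\<bar>(ls k - l0) / r k\<bar> \<le> 1" "\<bar>(m1s k - \<mu>1) / r k\<bar> \<le> 1" "\<bar>(m2s k - \<mu>2) / r k\<bar> \<le> 1"
      using u1[of k] by linarith+
    ultimately show ?thesis
      unfolding u_def by (intro SigmaI)
  qed
  \<comment> \<open>Parameters and normalised directions are collected in one compact set, so that a
    single subsequence serves both.\<close>
  define K where "K = ({0..1/2 - d} \<times> \<X>) \<times> ({-1..1::real} \<times> {-1..1::real} \<times> {-1..1::real})"
  have K: "compact K"
    unfolding K_def using X(1) by (intro compact_Times) auto
  moreover have "\<forall>k. (\<theta> k, u k) \<in> K"
    unfolding K_def using \<theta>(1) u by blast
  ultimately obtain z \<sigma> where \<sigma>: "strict_mono \<sigma>" and lim: "((\<lambda>k. (\<theta> k, u k)) \<circ> \<sigma>) \<longlonglongrightarrow> z"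
    using spec[OF K[unfolded compact_def], of "\<lambda>k. (\<theta> k, u k)"] by blast
  obtain v1 v2 v3 where v: "snd z = (v1, v2, v3)" by (cases "snd z")
  have lim\<theta>: "(\<lambda>k. \<theta> (\<sigma> k)) \<longlonglongrightarrow> fst z" and limu: "(\<lambda>k. u (\<sigma> k)) \<longlonglongrightarrow> snd z"
    using tendsto_fst[OF lim] tendsto_snd[OF lim] by (simp_all add: comp_def)
  have lims: "(\<lambda>k. (ls (\<sigma> k) - l0) / r (\<sigma> k)) \<longlonglongrightarrow> v1" "(\<lambda>k. (m1s (\<sigma> k) - \<mu>1) / r (\<sigma> k)) \<longlonglongrightarrow> v2"
    "(\<lambda>k. (m2s (\<sigma> k) - \<mu>2) / r (\<sigma> k)) \<longlonglongrightarrow> v3"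
    using tendsto_fst[OF limu] tendsto_fst[OF tendsto_snd[OF limu]] tendsto_snd[OF tendsto_snd[OF limu]]
    by (simp_all add: u_def v)
  have inv0: "(\<lambda>k. inverse (real (Suc (\<sigma> k)))) \<longlonglongrightarrow> 0"
    using LIMSEQ_subseq_LIMSEQ[OF LIMSEQ_inverse_real_of_nat \<sigma>] by (simp add: comp_def)
  have limr: "(\<lambda>k. r (\<sigma> k)) \<longlonglongrightarrow> param_dist (fst z)"
    unfolding r_def param_dist_def split_beta' by (intro tendsto_intros lim\<theta>)
  have "(\<lambda>k. inverse (real (Suc (\<sigma> k))) * (r (\<sigma> k))\<^sup>2) \<longlonglongrightarrow> 0 * (param_dist (fst z))\<^sup>2"
    by (intro tendsto_intros inv0 limr)
  then have up0: "(\<lambda>k. inverse (real (Suc (\<sigma> k))) * (r (\<sigma> k))\<^sup>2) \<longlonglongrightarrow> 0"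
    by simp
  have r0: "param_dist (fst z) = 0"
  proof (rule ccontr)
    assume "param_dist (fst z) \<noteq> 0"
    then have pos: "0 < param_dist (fst z)"
      by (auto simp: param_dist_def split: prod.splits)
    define \<epsilon> where "\<epsilon> = param_dist (fst z) / 2"
    have \<epsilon>: "0 < \<epsilon>"
      using pos by (simp add: \<epsilon>_def)
    obtain \<kappa> where \<kappa>: "0 < \<kappa>" "\<And>\<theta>. \<theta> \<in> {0..1/2 - d} \<times> \<X> \<Longrightarrow> \<epsilon> \<le> param_dist \<theta> \<Longrightarrow> \<kappa> \<le> limit_contrast \<theta>"
      using unknown_locations_identified[OF d X l0' \<mu> \<epsilon>] by blast
    have "eventually (\<lambda>k. \<epsilon> < r (\<sigma> k)) sequentially"
      using pos by (intro order_tendstoD(1)[OF limr]) (simp add: \<epsilon>_def)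
    moreover have "eventually (\<lambda>k. inverse (real (Suc (\<sigma> k))) * (r (\<sigma> k))\<^sup>2 < \<kappa>) sequentially"
      by (rule order_tendstoD(2)[OF up0 \<kappa>(1)])
    ultimately have "eventually (\<lambda>k. False) sequentially"
    proof eventually_elim
      case (elim k)
      then show ?case
        using \<kappa>(2)[OF \<theta>(1)[of "\<sigma> k"]] \<theta>(2)[of "\<sigma> k"] by (simp add: r_def)
    qed
    then show False by simp
  qed
  have fz: "fst z = (l0, \<mu>1, \<mu>2)"
    using r0 by (cases "fst z") (auto simp: param_dist_def add_nonneg_eq_0_iff)
  have lim\<mu>: "(\<lambda>k. m1s (\<sigma> k)) \<longlonglongrightarrow> \<mu>1" "(\<lambda>k. m2s (\<sigma> k)) \<longlonglongrightarrow> \<mu>2"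
    using tendsto_fst[OF tendsto_snd[OF lim\<theta>]] tendsto_snd[OF tendsto_snd[OF lim\<theta>]]
    by (simp_all add: fz m1s_def m2s_def)
  define s where "s = \<mu>2 - \<mu>1"
  define V where "V x = v1 * (F0 (x + s) - F0 (x - s)) - (2 * l0\<^sup>2 * v2 + 2 * (1 - l0)\<^sup>2 * v3) * f x -
      l0 * (1 - l0) * (v2 + v3) * (f (x + s) + f (x - s))" for x
  \<comment> \<open>Vanishing of V would force the direction (v1, v2, v3) to be 0, but the absolute
    values of its entries sum to 1, as those of the directions before the limit do.\<close>
  have "\<exists>x0. V x0 \<noteq> 0"
  proof (rule ccontr)
    assume "\<not> (\<exists>x0. V x0 \<noteq> 0)"
    then have "v1 = 0" "v2 = 0" "v3 = 0"
      using asymmetry_derivative_nonzero[OF l0' \<mu> dens, of v1 v2 v3] by (simp_all add: V_def s_def)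
    moreover have "(\<lambda>k. \<bar>(ls (\<sigma> k) - l0) / r (\<sigma> k)\<bar> + \<bar>(m1s (\<sigma> k) - \<mu>1) / r (\<sigma> k)\<bar> + \<bar>(m2s (\<sigma> k) - \<mu>2) / r (\<sigma> k)\<bar>)
        \<longlonglongrightarrow> \<bar>v1\<bar> + \<bar>v2\<bar> + \<bar>v3\<bar>"
      by (intro tendsto_intros lims)
    ultimately show False
      unfolding u1 by (simp add: LIMSEQ_const_iff)
  qed
  then obtain x0 where x0: "V x0 \<noteq> 0" by blast
  have HC: "isCont H x" for x
    using dH by (rule DERIV_isCont)
  have limP: "(\<lambda>k. perturbation (\<theta> (\<sigma> k)) x / r (\<sigma> k)) \<longlonglongrightarrow>
      v1 * (H (x - \<mu>1) - H (x - \<mu>2)) + l0 * - (v2 * H' (x - \<mu>1)) + (1 - l0) * - (v3 * H' (x - \<mu>2))" for x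
  proof -
    have e: "perturbation (\<theta> (\<sigma> k)) x / r (\<sigma> k) =
       (ls (\<sigma> k) - l0) / r (\<sigma> k) * (H (x - m1s (\<sigma> k)) - H (x - m2s (\<sigma> k))) +
       l0 * ((H (x - m1s (\<sigma> k)) - H (x - \<mu>1)) / r (\<sigma> k)) + (1 - l0) * ((H (x - m2s (\<sigma> k)) - H (x - \<mu>2)) / r (\<sigma> k))" for k
      unfolding perturbation_def \<theta>_eq H_def by (simp add: add_divide_distrib)
    show ?thesis
      unfolding e
      by (intro tendsto_add tendsto_mult tendsto_diff tendsto_const lims difference_quotient_tendsto dH lim\<mu>
          isCont_tendsto_compose[OF HC])
  qed
  have limA: "(\<lambda>k. asymmetry (\<theta> (\<sigma> k)) G x0 / r (\<sigma> k)) \<longlonglongrightarrow> V x0"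
  proof -
    have sh: "- x0 - \<mu>1 + \<mu>1 = - x0" "- x0 - \<mu>1 + \<mu>2 = - (x0 - s)" "- x0 - \<mu>2 + \<mu>1 = - (x0 + s)" "- x0 - \<mu>2 + \<mu>2 = - x0"
      "x0 - \<mu>1 + \<mu>1 = x0" "x0 - \<mu>1 + \<mu>2 = x0 + s" "x0 - \<mu>2 + \<mu>1 = x0 - s" "x0 - \<mu>2 + \<mu>2 = x0"
      by (simp_all add: s_def)
    have "V x0 = (v1 * (H (x0 - \<mu>1) - H (x0 - \<mu>2)) + l0 * - (v2 * H' (x0 - \<mu>1)) + (1 - l0) * - (v3 * H' (x0 - \<mu>2))) +
       (v1 * (H (- x0 - \<mu>1) - H (- x0 - \<mu>2)) + l0 * - (v2 * H' (- x0 - \<mu>1)) + (1 - l0) * - (v3 * H' (- x0 - \<mu>2)))"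
      unfolding H H'_def V_def sh F0_minus f_minus by (simp add: power2_eq_square algebra_simps)
    then show ?thesis
      unfolding asymmetry_perturbation add_divide_distrib using tendsto_add[OF limP[of x0] limP[of "- x0"]] by simp
  qed
  define e where "e = \<bar>V x0\<bar> / 2"
  have e: "0 < e"
    using x0 by (simp add: e_def)
  have ev: "eventually (\<lambda>k. e < \<bar>asymmetry (\<theta> (\<sigma> k)) G x0 / r (\<sigma> k)\<bar>) sequentially"
    by (rule order_tendstoD(1)[OF tendsto_rabs[OF limA]]) (use e in \<open>auto simp: e_def\<close>)
  obtain \<delta> where \<delta>: "0 < \<delta>" "\<And>h x. \<bar>h\<bar> \<le> \<delta> \<Longrightarrow> \<bar>f (x + h) - f x\<bar> \<le> d * e / 4"
    using fmod[of "d * e / 4"] d e by auto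
  \<comment> \<open>The bound by \<delta> controls the second differences and the other one the
    Lipschitz first differences. Within \<rho> the perturbation then moves by at most
    \<open>r k * (d * e / 2)\<close>, and adding its reflection gives the modulus
    \<open>d * (e * r k)\<close> that \<open>residual_lower_bound\<close> asks for.\<close>
  define \<rho> where "\<rho> = min \<delta> (d * e / (4 * (2 * L + 1)))"
  have \<rho>: "0 < \<rho>" "\<rho> \<le> \<delta>" "2 * L * \<rho> \<le> d * e / 4"
  proof -
    have pos: "0 < d * e / (4 * (2 * L + 1))"
      using d e L_nonneg by (intro divide_pos_pos mult_pos_pos) auto
    then show "0 < \<rho>" "\<rho> \<le> \<delta>"
      using \<delta>(1) by (auto simp: \<rho>_def)
    have "2 * L * \<rho> \<le> (2 * L + 1) * (d * e / (4 * (2 * L + 1)))"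
      using L_nonneg \<open>0 < \<rho>\<close> by (intro mult_mono) (auto simp: \<rho>_def)
    also have "\<dots> = d * e / 4"
      using L_nonneg by (simp add: divide_simps)
    finally show "2 * L * \<rho> \<le> d * e / 4" .
  qed
  have H'mod: "\<bar>H' (x + h) - H' x\<bar> \<le> d * e / 4" if "\<bar>h\<bar> \<le> \<delta>" for x h
  proof -
    have "H' (x + h) - H' x = l0 * (f (x + \<mu>1 + h) - f (x + \<mu>1)) + (1 - l0) * (f (x + \<mu>2 + h) - f (x + \<mu>2))"
      by (simp add: H'_def algebra_simps)
    also have "\<bar>\<dots>\<bar> \<le> l0 * \<bar>f (x + \<mu>1 + h) - f (x + \<mu>1)\<bar> + (1 - l0) * \<bar>f (x + \<mu>2 + h) - f (x + \<mu>2)\<bar>"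
      using l0 by (intro order.trans[OF abs_triangle_ineq]) (simp add: abs_mult)
    also have "\<dots> \<le> l0 * (d * e / 4) + (1 - l0) * (d * e / 4)"
      using l0 by (intro add_mono mult_left_mono \<delta>(2)[OF that]) auto
    also have "\<dots> = d * e / 4"
      unfolding distrib_right[symmetric] by simp
    finally show ?thesis .
  qed
  have HL: "\<bar>H x - H y\<bar> \<le> L * \<bar>x - y\<bar>" for x y
    using G_lip[of "- x" "- y"] by (simp add: H_def S_r_def abs_minus_commute)
  have pert: "\<bar>perturbation (\<theta> k) x - perturbation (\<theta> k) y\<bar> \<le> r k * (d * e / 2)" if xy: "\<bar>x - y\<bar> \<le> \<rho>" for k x y
  proof -
    have sd: "\<bar>(H (x - m) - H (x - \<mu>)) - (H (y - m) - H (y - \<mu>))\<bar> \<le> d * e / 4 * \<bar>m - \<mu>\<bar>" for m \<mu>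
    proof -
      have "\<bar>(H ((y - m) + (x - y)) - H ((y - \<mu>) + (x - y))) - (H (y - m) - H (y - \<mu>))\<bar> \<le> d * e / 4 * \<bar>(y - m) - (y - \<mu>)\<bar>"
        using xy \<rho>(2) by (intro second_difference_bound[OF dH] H'mod) simp
      moreover have "\<bar>(y - m) - (y - \<mu>)\<bar> = \<bar>m - \<mu>\<bar>"
        by simp
      ultimately show ?thesis by simp
    qed
    have fd: "\<bar>(H (x - m1s k) - H (x - m2s k)) - (H (y - m1s k) - H (y - m2s k))\<bar> \<le> d * e / 4"
    proof -
      have "\<bar>(H (x - m1s k) - H (x - m2s k)) - (H (y - m1s k) - H (y - m2s k))\<bar> \<le> L * \<bar>x - y\<bar> + L * \<bar>x - y\<bar>"
        using HL[of "x - m1s k" "y - m1s k"] HL[of "x - m2s k" "y - m2s k"] by simp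
      also have "\<dots> \<le> 2 * L * \<rho>"
        using mult_left_mono[OF xy L_nonneg] by simp
      finally show ?thesis using \<rho>(3) by simp
    qed
    have "perturbation (\<theta> k) x - perturbation (\<theta> k) y =
       (ls k - l0) * ((H (x - m1s k) - H (x - m2s k)) - (H (y - m1s k) - H (y - m2s k))) +
       l0 * ((H (x - m1s k) - H (x - \<mu>1)) - (H (y - m1s k) - H (y - \<mu>1))) +
       (1 - l0) * ((H (x - m2s k) - H (x - \<mu>2)) - (H (y - m2s k) - H (y - \<mu>2)))"
      unfolding \<theta>_eq perturbation_def H_def[symmetric] by (simp add: algebra_simps)
    also have "\<bar>\<dots>\<bar> \<le> \<bar>ls k - l0\<bar> * (d * e / 4) + 1 * (d * e / 4 * \<bar>m1s k - \<mu>1\<bar>) + 1 * (d * e / 4 * \<bar>m2s k - \<mu>2\<bar>)"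
      using l0 by (intro order.trans[OF abs_triangle_ineq] add_mono; unfold abs_mult; intro mult_mono fd sd) auto
    also have "\<dots> = r k * (d * e / 4)"
      by (simp add: r_eq algebra_simps)
    also have "\<dots> \<le> r k * (d * e / 2)"
      using r[of k] d e by (intro mult_left_mono) auto
    finally show ?thesis .
  qed
  obtain Rx where Rx: "\<And>z. z \<in> \<X> \<Longrightarrow> norm z \<le> Rx"
    using compact_imp_bounded[OF X(1)] by (auto simp: bounded_iff)
  define R where "R = Rx + \<bar>x0\<bar>"
  obtain m where m: "0 < m" "\<And>c. \<bar>c\<bar> \<le> R \<Longrightarrow> m \<le> measure N {c - \<rho><..c + \<rho>}"
    using compact_interval_mass_bound[OF N.real_distribution_axioms _ _ \<rho>(1), of R]
    by (auto simp: cdf_N G_cont G_mono)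
  have "eventually (\<lambda>k. inverse (real (Suc (\<sigma> k))) < (e / 2)\<^sup>2 * m) sequentially"
    by (rule order_tendstoD(2)[OF inv0]) (use e m(1) in simp)
  with ev have "eventually (\<lambda>k. False) sequentially"
  proof eventually_elim
    case (elim k)
    define j where "j = \<sigma> k"
    have l: "0 \<le> ls j" "ls j \<le> 1/2 - d" and mX: "(m1s j, m2s j) \<in> \<X>"
      using \<theta>(1)[of j] by (auto simp: \<theta>_eq)
    have "(e * r j / 2)\<^sup>2 * m \<le> limit_contrast (ls j, m1s j, m2s j)"
      unfolding limit_contrast_def
    proof (rule residual_lower_bound[where ?x0.0 = x0 and r = \<rho> and R = R, OF d l])
      show "0 < e * r j"
        using e r by simp
      show "e * r j \<le> \<bar>asymmetry (ls j, m1s j, m2s j) G x0\<bar>"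
        using elim(1) r[of j] by (simp add: j_def[symmetric] \<theta>_eq[symmetric] abs_divide pos_less_divide_eq)
      show "\<bar>m1s j - x0\<bar> \<le> R" "\<bar>m2s j - x0\<bar> \<le> R"
        using Rx[OF mX] norm_fst_le[of "m1s j" "m2s j"] norm_snd_le[of "m2s j" "m1s j"] by (auto simp: R_def)
      show "m \<le> measure N {c - \<rho><..c + \<rho>}" if "\<bar>c\<bar> \<le> R" for c
        using that by (rule m(2))
      fix x y assume xy: "\<bar>x - y\<bar> \<le> \<rho>"
      then have "\<bar>- x - - y\<bar> \<le> \<rho>"
        by simp
      have "r j * (d * e / 2) = d * (e * r j) / 2"
        by simp
      from pert[OF xy, of j, unfolded this] pert[OF \<open>\<bar>- x - - y\<bar> \<le> \<rho>\<close>, of j, unfolded this]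
      show "\<bar>asymmetry (ls j, m1s j, m2s j) G x - asymmetry (ls j, m1s j, m2s j) G y\<bar> \<le> d * (e * r j)"
        unfolding \<theta>_eq[symmetric] asymmetry_perturbation by linarith
    qed
    moreover have "(e * r j / 2)\<^sup>2 * m = (e / 2)\<^sup>2 * m * (r j)\<^sup>2"
      by (simp add: power_mult_distrib power_divide)
    moreover have "inverse (real (Suc j)) * (r j)\<^sup>2 < (e / 2)\<^sup>2 * m * (r j)\<^sup>2"
      using elim(2) r[of j] by (intro mult_strict_right_mono) (auto simp: j_def)
    moreover have "limit_contrast (\<theta> j) < inverse (real (Suc j)) * (r j)\<^sup>2"
      using \<theta>(2)[of j] by (simp only: r_def)
    ultimately show ?case
      unfolding \<theta>_eq[symmetric] by linarith
  qed
  then show False by simp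
qed

end

section \<open>The smoothed estimators\<close>

lemma smear_cdf:
  assumes q: "smoothing_kernel q" and b: "0 < b"
  shows "integrable lborel (\<lambda>y. indicator {..x} y *\<^sub>R smear q b a y)"
    "integrable lborel (\<lambda>u. (if a \<le> x - b * u then 1 else 0) * q u)"
    "(\<integral>y. indicator {..x} y *\<^sub>R smear q b a y \<partial>lborel) = (\<integral>u. (if a \<le> x - b * u then 1 else 0) * q u \<partial>lborel)"
proof -
  note Q = smoothing_kernelD[OF q]
  note [measurable] = Q(1)
  have e: "\<bar>b\<bar> *\<^sub>R (indicator {..x} (a + b * u) *\<^sub>R smear q b a (a + b * u)) = (if a \<le> x - b * u then 1 else 0) * q u" for u
    using b by (simp add: smear_def indicator_def algebra_simps)
  show i: "integrable lborel (\<lambda>u. (if a \<le> x - b * u then 1 else 0) * q u)"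
    by (rule Bochner_Integration.integrable_bound[OF Q(3)]) (use Q(2) in auto)
  have "integrable lborel (\<lambda>u. indicator {..x} (a + b * u) *\<^sub>R smear q b a (a + b * u))"
    using integrable_mult_right[OF i, of "1 / b"] b unfolding e[symmetric] by simp
  then show "integrable lborel (\<lambda>y. indicator {..x} y *\<^sub>R smear q b a y)"
    using b by (subst lborel_integrable_real_affine_iff[of b _ a, symmetric]) auto
  have "(\<integral>y. indicator {..x} y *\<^sub>R smear q b a y \<partial>lborel) =
      \<bar>b\<bar> *\<^sub>R (\<integral>u. indicator {..x} (a + b * u) *\<^sub>R smear q b a (a + b * u) \<partial>lborel)"
    using b by (intro lborel_integral_real_affine) auto
  also have "\<dots> = (\<integral>u. (if a \<le> x - b * u then 1 else 0) * q u \<partial>lborel)"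
    unfolding e[symmetric] by simp
  finally show "(\<integral>y. indicator {..x} y *\<^sub>R smear q b a y \<partial>lborel) = (\<integral>u. (if a \<le> x - b * u then 1 else 0) * q u \<partial>lborel)" .
qed

text \<open>\<open>G_tilde\<close> is \<open>G_hat\<close> convolved with the rescaled kernel; its
  distance to G is thus bounded by that of \<open>G_hat\<close> plus a bias, without a further
  probabilistic argument.\<close>

lemma G_tilde_eq_smoothed:
  assumes q: "smoothing_kernel q" and b: "0 < b n"
  shows "G_tilde q b n xs x = (\<integral>u. G_hat n xs (x - b n * u) * q u \<partial>lborel)"
    "integrable lborel (\<lambda>u. G_hat n xs (x - b n * u) * q u)"
proof -
  note S = smear_cdf[OF q b]
  have g: "g_hat q b n xs y = (\<Sum>i = 1..n. (1 / real n) * smear q (b n) (xs i) y)" for y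
    by (simp add: g_hat_def smear_def sum_divide_distrib mult.commute)
  have G: "G_hat n xs (x - b n * u) * q u = (\<Sum>i = 1..n. (1 / real n) * ((if xs i \<le> x - b n * u then 1 else 0) * q u))" for u
    by (simp add: G_hat_def sum_distrib_left sum_distrib_right mult_ac)
  show "integrable lborel (\<lambda>u. G_hat n xs (x - b n * u) * q u)"
    unfolding G by (intro Bochner_Integration.integrable_sum integrable_mult_right S(2))
  have "G_tilde q b n xs x = (\<integral>y. (\<Sum>i = 1..n. (1 / real n) * (indicator {..x} y *\<^sub>R smear q (b n) (xs i) y)) \<partial>lborel)"
    unfolding G_tilde_def set_lebesgue_integral_def g
    by (intro Bochner_Integration.integral_cong refl) (simp add: sum_distrib_left mult_ac)
  also have "\<dots> = (\<Sum>i = 1..n. (1 / real n) * (\<integral>y. indicator {..x} y *\<^sub>R smear q (b n) (xs i) y \<partial>lborel))"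
    using S(1) by (subst Bochner_Integration.integral_sum) auto
  also have "\<dots> = (\<Sum>i = 1..n. (1 / real n) * (\<integral>u. (if xs i \<le> x - b n * u then 1 else 0) * q u \<partial>lborel))"
    unfolding S(3) ..
  also have "\<dots> = (\<integral>u. G_hat n xs (x - b n * u) * q u \<partial>lborel)"
    unfolding G using S(2) by (subst Bochner_Integration.integral_sum) auto
  finally show "G_tilde q b n xs x = (\<integral>u. G_hat n xs (x - b n * u) * q u \<partial>lborel)" .
qed

lemma measurable_G_tilde:
  assumes q: "smoothing_kernel q"
  shows "G_tilde q b n xs \<in> borel_measurable borel"
proof -
  note [measurable] = smoothing_kernelD(1)[OF q]
  have "indicator {..x} y *\<^sub>R g_hat q b n xs y = (if y \<le> x then g_hat q b n xs y else 0)" for x y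
    by simp
  moreover have "(\<lambda>x. \<integral>y. (if y \<le> x then g_hat q b n xs y else 0) \<partial>lborel) \<in> borel_measurable borel"
    unfolding g_hat_def by measurable
  ultimately show ?thesis
    unfolding G_tilde_def[abs_def] set_lebesgue_integral_def by simp
qed

text \<open>The bias is bounded only to first order in the bandwidth, by the Lipschitz constant and
  the radius R of the support of q. This suffices, since it enters the contrast squared and the
  squared bandwidth is O(n^(-1/2)).\<close>

lemma G_tilde_deviation:
  assumes q: "smoothing_kernel q" and R: "\<And>u. q u \<noteq> 0 \<Longrightarrow> \<bar>u\<bar> \<le> R" and b: "0 < b n"
    and lip: "\<And>x y. \<bar>G x - G y\<bar> \<le> L * \<bar>x - y\<bar>" and L: "0 \<le> L"
    and \<Delta>: "\<And>x. \<bar>G_hat n xs x - G x\<bar> \<le> \<Delta>"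
  shows "\<bar>G_tilde q b n xs x - G x\<bar> \<le> \<Delta> + L * b n * R"
proof -
  note Q = smoothing_kernelD[OF q] and T = G_tilde_eq_smoothed[where b = b and n = n, OF q b]
  have "G_tilde q b n xs x - G x = (\<integral>u. G_hat n xs (x - b n * u) * q u \<partial>lborel) - (\<integral>u. G x * q u \<partial>lborel)"
    using Q(4) by (simp add: T(1))
  also have "\<dots> = (\<integral>u. (G_hat n xs (x - b n * u) - G x) * q u \<partial>lborel)"
    using T(2) Q(3) by (simp add: left_diff_distrib)
  also have "\<bar>\<dots>\<bar> \<le> (\<integral>u. \<bar>(G_hat n xs (x - b n * u) - G x) * q u\<bar> \<partial>lborel)"
    using integral_norm_bound[of lborel "\<lambda>u. (G_hat n xs (x - b n * u) - G x) * q u"] by simp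
  also have "\<dots> \<le> (\<integral>u. (\<Delta> + L * b n * R) * q u \<partial>lborel)"
  proof (rule integral_mono)
    show "integrable lborel (\<lambda>u. \<bar>(G_hat n xs (x - b n * u) - G x) * q u\<bar>)"
      using T(2)[of xs x] Q(3) by (intro integrable_abs) (simp add: left_diff_distrib)
    show "integrable lborel (\<lambda>u. (\<Delta> + L * b n * R) * q u)"
      using Q(3) by simp
    fix u
    show "\<bar>(G_hat n xs (x - b n * u) - G x) * q u\<bar> \<le> (\<Delta> + L * b n * R) * q u"
    proof (cases "q u = 0")
      case False
      have "\<bar>G_hat n xs (x - b n * u) - G x\<bar> \<le> \<Delta> + L * \<bar>b n * u\<bar>"
        using \<Delta>[of "x - b n * u"] lip[of "x - b n * u" x] by simp
      also have "L * \<bar>b n * u\<bar> \<le> L * (b n * R)"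
        using R[OF False] b L by (intro mult_left_mono) (auto simp: abs_mult)
      finally have "\<bar>G_hat n xs (x - b n * u) - G x\<bar> \<le> \<Delta> + L * b n * R"
        by (simp add: mult.assoc)
      then show ?thesis
        unfolding abs_mult using Q(2)[of u] by (simp add: mult_right_mono)
    qed simp
  qed
  also have "\<dots> = \<Delta> + L * b n * R"
    using Q(4) by simp
  finally show ?thesis .
qed

text \<open>Tonelli for the series of absolute values: each translate has the norm of h, so the
  integrals sum to a geometric series. Finiteness of the total gives convergence almost everywhere
  and the same operator norm as on bounded functions.\<close>

lemma A_inv_L1:
  assumes l: "0 \<le> l" "l < 1/2" and h [measurable]: "h \<in> borel_measurable borel" and fin: "L1_norm h < \<infinity>"
  shows "AE x in lborel. summable (\<lambda>k. (l / (1 - l)) ^ k * \<bar>h (x + m2 + real k * (m2 - m1))\<bar>)"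
    "L1_norm (A_inv (l, m1, m2) h) \<le> ennreal (1 / (1 - 2 * l)) * L1_norm h"
proof -
  define r where "r = l / (1 - l)"
  have r: "0 \<le> r"
    using ratio_bounds[OF l] by (simp add: r_def)
  define t where "t k x = r ^ k * \<bar>h (x + m2 + real k * (m2 - m1))\<bar>" for k x
  have [measurable]: "t k \<in> borel_measurable borel" for k
    unfolding t_def by measurable
  have t0: "0 \<le> t k x" for k x
    using r by (simp add: t_def)
  have tk: "(\<integral>\<^sup>+x. ennreal (t k x) \<partial>lborel) = ennreal (r ^ k) * L1_norm h" for k
  proof -
    have "(\<integral>\<^sup>+x. ennreal (t k x) \<partial>lborel) = ennreal (r ^ k) * L1_norm (\<lambda>x. h (x + (m2 + real k * (m2 - m1))))"
      unfolding t_def L1_norm_def using r by (simp add: ennreal_mult nn_integral_cmult add.assoc)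
    then show ?thesis
      by (simp add: L1_norm_shift)
  qed
  have "(\<integral>\<^sup>+x. (\<Sum>k. ennreal (t k x)) \<partial>lborel) = (\<Sum>k. \<integral>\<^sup>+x. ennreal (t k x) \<partial>lborel)"
    by (intro nn_integral_suminf) measurable
  also have "\<dots> = (\<Sum>k. ennreal (r ^ k) * L1_norm h)"
    unfolding tk ..
  also have "(\<Sum>k. ennreal (r ^ k) * L1_norm h) = ennreal ((1 - l) / (1 - 2 * l)) * L1_norm h"
  proof -
    have "(\<Sum>k. ennreal (r ^ k)) = ennreal (\<Sum>k. r ^ k)"
      using r summable_ratio[OF l] by (intro suminf_ennreal2) (auto simp: r_def)
    then show ?thesis
      using ratio_bounds(3)[OF l] by (simp add: r_def)
  qed
  finally have total: "(\<integral>\<^sup>+x. (\<Sum>k. ennreal (t k x)) \<partial>lborel) = ennreal ((1 - l) / (1 - 2 * l)) * L1_norm h" .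
  have "(\<integral>\<^sup>+x. (\<Sum>k. ennreal (t k x)) \<partial>lborel) \<noteq> \<infinity>"
    unfolding total using fin by (simp add: ennreal_mult_eq_top_iff)
  then have "AE x in lborel. (\<Sum>k. ennreal (t k x)) \<noteq> \<infinity>"
    by (intro nn_integral_PInf_AE) auto
  then have AE: "AE x in lborel. summable (\<lambda>k. t k x)"
    by eventually_elim (auto intro: summable_suminf_not_top t0)
  then show "AE x in lborel. summable (\<lambda>k. (l / (1 - l)) ^ k * \<bar>h (x + m2 + real k * (m2 - m1))\<bar>)"
    by (simp add: t_def r_def)
  have "L1_norm (A_inv (l, m1, m2) h) \<le> (\<integral>\<^sup>+x. ennreal (1 / (1 - l)) * (\<Sum>k. ennreal (t k x)) \<partial>lborel)"
    unfolding L1_norm_def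
  proof (rule nn_integral_mono_AE)
    show "AE x in lborel. ennreal \<bar>A_inv (l, m1, m2) h x\<bar> \<le> ennreal (1 / (1 - l)) * (\<Sum>k. ennreal (t k x))"
      using AE
    proof eventually_elim
      case (elim x)
      have ab: "\<bar>(- l / (1 - l)) ^ k * h (x + m2 + real k * (m2 - m1))\<bar> = t k x" for k
        using r l by (simp add: t_def r_def abs_mult power_abs)
      have "\<bar>\<Sum>k. (- l / (1 - l)) ^ k * h (x + m2 + real k * (m2 - m1))\<bar> \<le> (\<Sum>k. t k x)"
        using summable_rabs[of "\<lambda>k. (- l / (1 - l)) ^ k * h (x + m2 + real k * (m2 - m1))"] elim
        unfolding ab by simp
      then have "\<bar>A_inv (l, m1, m2) h x\<bar> \<le> 1 / (1 - l) * (\<Sum>k. t k x)"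
        using l by (simp add: A_inv_eq abs_divide divide_right_mono)
      then have "ennreal \<bar>A_inv (l, m1, m2) h x\<bar> \<le> ennreal (1 / (1 - l) * (\<Sum>k. t k x))"
        by (rule ennreal_leI)
      also have "\<dots> = ennreal (1 / (1 - l)) * ennreal (\<Sum>k. t k x)"
        using l elim t0 by (intro ennreal_mult suminf_nonneg) auto
      also have "ennreal (\<Sum>k. t k x) = (\<Sum>k. ennreal (t k x))"
        using elim t0 by (intro suminf_ennreal2[symmetric]) auto
      finally show ?case .
    qed
  qed
  also have "\<dots> = ennreal (1 / (1 - l)) * (ennreal ((1 - l) / (1 - 2 * l)) * L1_norm h)"
    by (subst nn_integral_cmult) (auto simp: total)
  also have "\<dots> = ennreal (1 / (1 - 2 * l)) * L1_norm h"
    using l by (simp flip: mult.assoc ennreal_mult)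
  finally show "L1_norm (A_inv (l, m1, m2) h) \<le> ennreal (1 / (1 - 2 * l)) * L1_norm h" .
qed

lemma measurable_A_op [measurable]:
  assumes [measurable]: "f \<in> borel_measurable borel"
  shows "A_op \<theta> f \<in> borel_measurable borel"
proof -
  obtain l m1 m2 where \<theta>: "\<theta> = (l, m1, m2)" by (cases \<theta>)
  show ?thesis
    unfolding \<theta> A_op_eq[abs_def] by measurable
qed

lemma L1_norm_A_op:
  assumes [measurable]: "f \<in> borel_measurable borel" and l: "0 \<le> l" "l \<le> 1"
  shows "L1_norm (A_op (l, m1, m2) f) \<le> L1_norm f"
proof -
  have "L1_norm (A_op (l, m1, m2) f) \<le> L1_norm (\<lambda>x. l * f (x + - m1)) + L1_norm (\<lambda>x. (1 - l) * f (x + - m2))"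
    unfolding A_op_eq[abs_def] using L1_norm_triangle[of "\<lambda>x. l * f (x + - m1)" "\<lambda>x. (1 - l) * f (x + - m2)"] by simp
  also have "\<dots> = ennreal l * L1_norm f + ennreal (1 - l) * L1_norm f"
    using l by (subst (1 2) L1_norm_cmult) (auto simp: L1_norm_shift simp del: add_uminus_conv_diff)
  also have "\<dots> = L1_norm f"
    using l by (simp flip: distrib_right ennreal_plus)
  finally show ?thesis .
qed

text \<open>The exceptional null set, on which one of the series diverges, depends on the parameter.\<close>

lemma A_inv_L1_error:
  assumes l: "0 \<le> l" "l < 1/2" and h [measurable]: "h \<in> borel_measurable borel" "L1_norm h < \<infinity>"
    and f [measurable]: "f \<in> borel_measurable borel" "L1_norm f < \<infinity>"
  shows "L1_norm (\<lambda>x. A_inv (l, m1, m2) h x - f x) \<le> ennreal (1 / (1 - 2 * l)) * L1_norm (\<lambda>x. h x - A_op (l, m1, m2) f x)"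
proof -
  let ?A = "A_inv (l, m1, m2)" and ?Af = "A_op (l, m1, m2) f"
  have Af: "L1_norm ?Af < \<infinity>"
    using L1_norm_A_op[OF f(1), of l m1 m2] l f(2) by (auto intro: le_less_trans)
  \<comment> \<open>Shifting f by \<open>- m2\<close> places the evaluation points at
    \<open>x + real k * (m2 - m1)\<close>, those of the telescoping sum. Convergence of this series
    supplies the decay that \<open>A_inv_A_op\<close> requires.\<close>
  have "L1_norm (\<lambda>x. f (x + - m2)) < \<infinity>"
    using f(2) by (subst L1_norm_shift) auto
  then have AEf: "AE x in lborel. summable (\<lambda>k. (l / (1 - l)) ^ k * \<bar>f (x + m2 + real k * (m2 - m1) + - m2)\<bar>)"
    by (intro A_inv_L1[OF l]) auto
  have "AE x in lborel. ?A h x - f x = ?A (\<lambda>x. h x - ?Af x) x"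
    using AEf A_inv_L1(1)[OF l h, of m2 m1] A_inv_L1(1)[OF l measurable_A_op[OF f(1)] Af, of m2 m1]
  proof eventually_elim
    case (elim x)
    define y where "y k = x + m2 + real k * (m2 - m1)" for k
    have sm: "summable (\<lambda>k. (- l / (1 - l)) ^ k * w (y k))" if "summable (\<lambda>k. (l / (1 - l)) ^ k * \<bar>w (y k)\<bar>)" for w
    proof (rule summable_rabs_cancel)
      have "\<bar>(- l / (1 - l)) ^ k * w (y k)\<bar> = (l / (1 - l)) ^ k * \<bar>w (y k)\<bar>" for k
        using l by (simp add: abs_mult power_abs)
      then show "summable (\<lambda>k. \<bar>(- l / (1 - l)) ^ k * w (y k)\<bar>)"
        using that by simp
    qed
    have "?A (\<lambda>x. h x - ?Af x) x = ?A h x - ?A ?Af x"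
    proof -
      have "(\<Sum>k. (- l / (1 - l)) ^ k * (h (y k) - ?Af (y k))) =
          (\<Sum>k. (- l / (1 - l)) ^ k * h (y k)) - (\<Sum>k. (- l / (1 - l)) ^ k * ?Af (y k))"
        unfolding right_diff_distrib
        by (rule suminf_diff[symmetric, OF sm[OF elim(2)[folded y_def]] sm[OF elim(3)[folded y_def]]])
      then show ?thesis
        unfolding A_inv_eq y_def[symmetric] by (simp only: diff_divide_distrib)
    qed
    moreover have "?A ?Af x = f x"
    proof (rule A_inv_A_op[OF l])
      have e: "x + m2 + real k * (m2 - m1) + - m2 = x + real k * (m2 - m1)" for k
        by simp
      have "(\<lambda>k. (l / (1 - l)) ^ k * \<bar>f (x + real k * (m2 - m1))\<bar>) \<longlonglongrightarrow> 0"
        using summable_LIMSEQ_zero[OF elim(1)] unfolding e .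
      then show "(\<lambda>k. (l / (1 - l)) ^ k * f (x + real k * (m2 - m1))) \<longlonglongrightarrow> 0"
        using l by (subst tendsto_rabs_zero_iff[symmetric]) (simp add: abs_mult power_abs)
    qed
    ultimately show ?case by simp
  qed
  then have "L1_norm (\<lambda>x. ?A h x - f x) = L1_norm (?A (\<lambda>x. h x - ?Af x))"
    by (rule L1_norm_cong_AE)
  also have "\<dots> \<le> ennreal (1 / (1 - 2 * l)) * L1_norm (\<lambda>x. h x - ?Af x)"
  proof (rule A_inv_L1(2)[OF l])
    have "L1_norm (\<lambda>x. h x + (-1) * ?Af x) \<le> L1_norm h + L1_norm (\<lambda>x. (-1) * ?Af x)"
      by (intro L1_norm_triangle) auto
    also have "\<dots> < \<infinity>"
      using h(2) Af by (subst L1_norm_cmult) (auto simp: less_top)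
    finally show "L1_norm (\<lambda>x. h x - ?Af x) < \<infinity>" by simp
  qed measurable
  finally show ?thesis .
qed

lemma L1_norm_A_op_param:
  assumes [measurable]: "f \<in> borel_measurable borel" and l0: "0 \<le> l0" "l0 \<le> 1"
  shows "L1_norm (\<lambda>x. A_op (l0, \<mu>1, \<mu>2) f x - A_op (l, m1, m2) f x) \<le>
    ennreal \<bar>l0 - l\<bar> * (2 * L1_norm f) + (L1_modulus f (m1 - \<mu>1) + L1_modulus f (m2 - \<mu>2))"
proof -
  have md: "L1_norm (\<lambda>x. f (x - \<mu>) - f (x - m)) = L1_modulus f (m - \<mu>)" for m \<mu>
  proof -
    have "(\<lambda>x. f (x - \<mu>) - f (x - m)) = (\<lambda>x. (\<lambda>y. f (y + (m - \<mu>)) - f y) (x + - m))"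
      by (simp add: algebra_simps)
    then show ?thesis
      unfolding L1_modulus_def by (simp only:) (rule L1_norm_shift, measurable)
  qed
  have "(\<lambda>x. A_op (l0, \<mu>1, \<mu>2) f x - A_op (l, m1, m2) f x) = (\<lambda>x. (l0 - l) * (f (x - m1) + (-1) * f (x - m2)) +
      (l0 * (f (x - \<mu>1) - f (x - m1)) + (1 - l0) * (f (x - \<mu>2) - f (x - m2))))"
    by (simp add: A_op_eq algebra_simps)
  then have "L1_norm (\<lambda>x. A_op (l0, \<mu>1, \<mu>2) f x - A_op (l, m1, m2) f x) \<le>
     L1_norm (\<lambda>x. (l0 - l) * (f (x - m1) + (-1) * f (x - m2))) +
     (L1_norm (\<lambda>x. l0 * (f (x - \<mu>1) - f (x - m1))) + L1_norm (\<lambda>x. (1 - l0) * (f (x - \<mu>2) - f (x - m2))))"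
    by (simp only:) (intro order.trans[OF L1_norm_triangle] add_left_mono L1_norm_triangle; measurable)
  also have "\<dots> \<le> ennreal \<bar>l0 - l\<bar> * (2 * L1_norm f) + (1 * L1_modulus f (m1 - \<mu>1) + 1 * L1_modulus f (m2 - \<mu>2))"
  proof (intro add_mono)
    have "L1_norm (\<lambda>x. f (x - m1) + (-1) * f (x - m2)) \<le> L1_norm (\<lambda>x. f (x + - m1)) + L1_norm (\<lambda>x. (-1) * f (x + - m2))"
      using L1_norm_triangle[of "\<lambda>x. f (x - m1)" "\<lambda>x. (-1) * f (x - m2)"] by simp
    also have "\<dots> = 2 * L1_norm f"
      by (subst L1_norm_cmult) (auto simp: L1_norm_shift mult_2 simp del: add_uminus_conv_diff)
    finally show "L1_norm (\<lambda>x. (l0 - l) * (f (x - m1) + (-1) * f (x - m2))) \<le> ennreal \<bar>l0 - l\<bar> * (2 * L1_norm f)"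
      by (subst L1_norm_cmult) (auto intro: mult_left_mono)
    have sc: "L1_norm (\<lambda>x. c * (f (x - \<mu>) - f (x - m))) \<le> 1 * L1_modulus f (m - \<mu>)" if c: "0 \<le> c" "c \<le> 1" for c \<mu> m
    proof -
      have "L1_norm (\<lambda>x. c * (f (x - \<mu>) - f (x - m))) = ennreal \<bar>c\<bar> * L1_norm (\<lambda>x. f (x - \<mu>) - f (x - m))"
        by (rule L1_norm_cmult) measurable
      also have "\<dots> \<le> 1 * L1_norm (\<lambda>x. f (x - \<mu>) - f (x - m))"
        using c by (intro mult_right_mono) auto
      finally show ?thesis
        by (simp only: md)
    qed
    show "L1_norm (\<lambda>x. l0 * (f (x - \<mu>1) - f (x - m1))) \<le> 1 * L1_modulus f (m1 - \<mu>1)"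
      "L1_norm (\<lambda>x. (1 - l0) * (f (x - \<mu>2) - f (x - m2))) \<le> 1 * L1_modulus f (m2 - \<mu>2)"
      using l0 by (intro sc; simp)+
  qed
  finally show ?thesis by simp
qed

context symmetric_mixture
begin

text \<open>f is an arbitrary version of the density, so evenness can hold only almost everywhere;
  it comes from uniqueness of densities and suffices for \<open>L\<^sup>1\<close> norms.\<close>

lemma density_even:
  assumes f: "is_density P0 f"
  shows "AE x in lborel. f (- x) = f x"
proof -
  note fD = is_densityD[OF f P0.prob_space_axioms]
  note [measurable] = fD(1)
  have P: "P0 = density lborel (\<lambda>x. ennreal (f x))"
    using f by (simp add: is_density_def)
  have "density lborel (\<lambda>x. ennreal (f (- x))) = density lborel (\<lambda>x. ennreal (f x))"
  proof (rule measure_eqI)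
    fix A assume "A \<in> sets (density lborel (\<lambda>x. ennreal (f (- x))))"
    then have A [measurable]: "A \<in> sets borel" by simp
    have [measurable]: "uminus -` A \<in> sets borel"
      using measurable_sets[of uminus borel borel A] by simp
    have "emeasure (density lborel (\<lambda>x. ennreal (f (- x)))) A = (\<integral>\<^sup>+x. ennreal (f (- x)) * indicator A x \<partial>lborel)"
      by (rule emeasure_density) auto
    also have "\<dots> = (\<integral>\<^sup>+x. ennreal (f x) * indicator (uminus -` A) x \<partial>lborel)"
      by (subst nn_integral_real_affine[of _ "-1" 0]) (auto intro!: nn_integral_cong simp: indicator_def)
    also have "\<dots> = emeasure P0 (uminus -` A)"
      unfolding P by (rule emeasure_density[symmetric]) auto
    also have "\<dots> = emeasure (distr P0 borel uminus) A"
      by (subst emeasure_distr) auto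
    also have "distr P0 borel uminus = density lborel (\<lambda>x. ennreal (f x))"
      using sym P by (simp add: symmetric_law_def)
    finally show "emeasure (density lborel (\<lambda>x. ennreal (f (- x)))) A = emeasure (density lborel (\<lambda>x. ennreal (f x))) A" .
  qed simp
  then have "AE x in lborel. ennreal (f (- x)) = ennreal (f x)"
    by (intro sigma_finite_measure.density_unique[OF lborel.sigma_finite_measure_axioms]) auto
  then show ?thesis
    using fD(2) by simp
qed

lemma mixture_density:
  assumes f: "is_density P0 f"
  shows "is_density N (A_op (l0, \<mu>1, \<mu>2) f)"
proof -
  note fD = is_densityD[OF f P0.prob_space_axioms]
  note [measurable] = fD(1)
  let ?g = "A_op (l0, \<mu>1, \<mu>2) f"
  have P: "P0 = density lborel (\<lambda>x. ennreal (f x))"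
    using f by (simp add: is_density_def)
  have g0: "0 \<le> ?g x" for x
    using l0 fD(2) by (simp add: A_op_eq)
  have gm [measurable]: "?g \<in> borel_measurable borel"
    by measurable
  have sh: "(\<integral>\<^sup>+y. ennreal (f (y - \<mu>)) * indicator A y \<partial>lborel) = emeasure P0 {y. y + \<mu> \<in> A}"
    if [measurable]: "A \<in> sets borel" for A \<mu>
  proof -
    have "(\<integral>\<^sup>+y. ennreal (f (y - \<mu>)) * indicator A y \<partial>lborel) = (\<integral>\<^sup>+y. ennreal (f y) * indicator {y. y + \<mu> \<in> A} y \<partial>lborel)"
      by (subst nn_integral_real_affine[of _ 1 \<mu>]) (auto intro!: nn_integral_cong simp: indicator_def add.commute)
    also have "\<dots> = emeasure P0 {y. y + \<mu> \<in> A}"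
      unfolding P by (rule emeasure_density[symmetric]) auto
    finally show ?thesis .
  qed
  have em: "emeasure (density lborel (\<lambda>x. ennreal (?g x))) A =
      ennreal l0 * emeasure P0 {y. y + \<mu>1 \<in> A} + ennreal (1 - l0) * emeasure P0 {y. y + \<mu>2 \<in> A}"
    if A [measurable]: "A \<in> sets borel" for A
  proof -
    have "emeasure (density lborel (\<lambda>x. ennreal (?g x))) A = (\<integral>\<^sup>+y. ennreal (?g y) * indicator A y \<partial>lborel)"
      by (rule emeasure_density) auto
    also have "\<dots> = (\<integral>\<^sup>+y. ennreal l0 * (ennreal (f (y - \<mu>1)) * indicator A y) + ennreal (1 - l0) * (ennreal (f (y - \<mu>2)) * indicator A y) \<partial>lborel)"
      using l0 fD(2) by (intro nn_integral_cong) (simp add: A_op_eq indicator_def ennreal_mult ennreal_plus)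
    also have "\<dots> = ennreal l0 * (\<integral>\<^sup>+y. ennreal (f (y - \<mu>1)) * indicator A y \<partial>lborel) +
        ennreal (1 - l0) * (\<integral>\<^sup>+y. ennreal (f (y - \<mu>2)) * indicator A y \<partial>lborel)"
      by (subst nn_integral_add) (auto simp: nn_integral_cmult)
    finally show ?thesis
      by (simp add: sh)
  qed
  have rd: "real_distribution (density lborel (\<lambda>x. ennreal (?g x)))"
  proof -
    have "emeasure (density lborel (\<lambda>x. ennreal (?g x))) UNIV = 1"
      using l0 P0.emeasure_space_1 by (subst em) (auto simp flip: ennreal_plus)
    then have "prob_space (density lborel (\<lambda>x. ennreal (?g x)))"
      by (intro prob_spaceI) simp
    then show ?thesis
      by (simp add: real_distribution_def real_distribution_axioms_def)
  qed
  have "cdf (density lborel (\<lambda>x. ennreal (?g x))) = cdf N"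
  proof
    fix x :: real
    have "{y. y + \<mu> \<in> {..x}} = {..x - \<mu>}" for \<mu>
      by auto
    then have "emeasure (density lborel (\<lambda>x. ennreal (?g x))) {..x} = ennreal (G x)"
      using l0 F0_bounds(1) by (subst em) (auto simp: P0.emeasure_eq_measure A_op_eq F0_def cdf_def ennreal_mult ennreal_plus)
    then show "cdf (density lborel (\<lambda>x. ennreal (?g x))) x = cdf N x"
      using G_bounds(1) by (simp add: cdf_def[of "density _ _"] cdf_N measure_def)
  qed
  then have "density lborel (\<lambda>x. ennreal (?g x)) = N"
    by (rule cdf_unique[OF rd N.real_distribution_axioms])
  then show ?thesis
    using g0 gm by (simp add: is_density_def)
qed

text \<open>The argument for \<open>F_hat\<close> in the \<open>L\<^sup>1\<close> norm. Densities
  need not be Lipschitz, so the effect of the location errors is measured by the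
  \<open>L\<^sup>1\<close> modulus of f, which gives consistency but no rate.\<close>

lemma f_hat_error:
  assumes d: "0 < d" and l: "0 \<le> l" "l \<le> 1/2 - d" and f: "is_density P0 f"
    and q: "smoothing_kernel q" and b: "0 < b n" and n: "1 \<le> n"
  shows "L1_norm (\<lambda>x. f_hat (l, m1, m2) q b n xs x - f x) \<le> ennreal (1 / (2 * d)) *
    (L1_norm (\<lambda>x. g_hat q b n xs x - A_op (l0, \<mu>1, \<mu>2) f x) +
      (ennreal \<bar>l0 - l\<bar> * 2 + (L1_modulus f (m1 - \<mu>1) + L1_modulus f (m2 - \<mu>2))))"
proof -
  have l': "0 \<le> l" "l < 1/2"
    using l d by auto
  note fD = is_densityD[OF f P0.prob_space_axioms]
  note Q = smoothing_kernelD[OF q]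
  note [measurable] = fD(1) Q(1)
  let ?A = "A_inv (l, m1, m2) (g_hat q b n xs)"
  have gm [measurable]: "g_hat q b n xs \<in> borel_measurable borel"
    unfolding g_hat_def[abs_def] by measurable
  have Am [measurable]: "?A \<in> borel_measurable borel"
    by measurable
  have gfin: "L1_norm (g_hat q b n xs) < \<infinity>"
  proof -
    have "(\<lambda>x. g_hat q b n xs x) = (\<lambda>x. \<Sum>i = 1..n. (1 / real n) * smear q (b n) (xs i) x)"
      by (simp add: g_hat_def smear_def sum_divide_distrib mult.commute)
    then have "L1_norm (g_hat q b n xs) \<le> (\<Sum>i = 1..n. L1_norm (\<lambda>x. (1 / real n) * smear q (b n) (xs i) x))"
      by (simp only:) (intro L1_norm_sum; (unfold smear_def)?; measurable)
    also have "\<dots> = (\<Sum>i = 1..n. ennreal (1 / real n) * 1)"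
    proof (intro sum.cong refl)
      fix i
      have [measurable]: "smear q (b n) (xs i) \<in> borel_measurable borel"
        unfolding smear_def[abs_def] by measurable
      show "L1_norm (\<lambda>x. (1 / real n) * smear q (b n) (xs i) x) = ennreal (1 / real n) * 1"
        using Q by (subst L1_norm_cmult) (auto simp: L1_norm_smear[OF Q(1) b] L1_norm_eq_integral)
    qed
    also have "\<dots> < \<infinity>"
      by (simp add: ennreal_mult_less_top of_nat_less_top)
    finally show ?thesis .
  qed
  have err: "L1_norm (\<lambda>x. ?A x - f x) \<le> ennreal (1 / (2 * d)) *
    (L1_norm (\<lambda>x. g_hat q b n xs x - A_op (l0, \<mu>1, \<mu>2) f x) +
      (ennreal \<bar>l0 - l\<bar> * 2 + (L1_modulus f (m1 - \<mu>1) + L1_modulus f (m2 - \<mu>2))))"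
  proof -
    have "L1_norm (\<lambda>x. ?A x - f x) \<le> ennreal (1 / (1 - 2 * l)) * L1_norm (\<lambda>x. g_hat q b n xs x - A_op (l, m1, m2) f x)"
      using fD(4) by (intro A_inv_L1_error l' gm gfin fD(1)) simp
    also have "\<dots> \<le> ennreal (1 / (2 * d)) * (L1_norm (\<lambda>x. g_hat q b n xs x - A_op (l0, \<mu>1, \<mu>2) f x) +
        L1_norm (\<lambda>x. A_op (l0, \<mu>1, \<mu>2) f x - A_op (l, m1, m2) f x))"
    proof (intro mult_mono)
      show "ennreal (1 / (1 - 2 * l)) \<le> ennreal (1 / (2 * d))"
        using l d by (intro ennreal_leI divide_left_mono) auto
      show "L1_norm (\<lambda>x. g_hat q b n xs x - A_op (l, m1, m2) f x) \<le> L1_norm (\<lambda>x. g_hat q b n xs x - A_op (l0, \<mu>1, \<mu>2) f x) +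
        L1_norm (\<lambda>x. A_op (l0, \<mu>1, \<mu>2) f x - A_op (l, m1, m2) f x)"
        by (intro L1_norm_diff_triangle) measurable
    qed auto
    also have "\<dots> \<le> ennreal (1 / (2 * d)) *
      (L1_norm (\<lambda>x. g_hat q b n xs x - A_op (l0, \<mu>1, \<mu>2) f x) +
        (ennreal \<bar>l0 - l\<bar> * (2 * L1_norm f) + (L1_modulus f (m1 - \<mu>1) + L1_modulus f (m2 - \<mu>2))))"
      using l0 by (intro mult_left_mono add_left_mono L1_norm_A_op_param fD(1)) auto
    finally show ?thesis
      by (simp add: fD(4))
  qed
  have refl: "L1_norm (\<lambda>x. ?A (- x) - f x) = L1_norm (\<lambda>x. ?A x - f x)"
  proof -
    have "L1_norm (\<lambda>x. ?A (- x) - f x) = L1_norm (\<lambda>x. (\<lambda>y. ?A y - f y) (- x))"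
      using density_even[OF f] by (intro L1_norm_cong_AE) (auto elim!: eventually_mono)
    then show ?thesis
      by (simp only:) (rule L1_norm_reflect, measurable)
  qed
  have "(\<lambda>x. f_hat (l, m1, m2) q b n xs x - f x) = (\<lambda>x. (1 / 2) * (?A x - f x) + (1 / 2) * (?A (- x) - f x))"
    by (rule ext) (simp add: f_hat_def S_d_def field_simps)
  then have "L1_norm (\<lambda>x. f_hat (l, m1, m2) q b n xs x - f x) \<le>
      L1_norm (\<lambda>x. (1 / 2) * (?A x - f x)) + L1_norm (\<lambda>x. (1 / 2) * (?A (- x) - f x))"
    by (simp only:) (intro L1_norm_triangle; measurable)
  also have "\<dots> = ennreal (1 / 2) * L1_norm (\<lambda>x. ?A x - f x) + ennreal (1 / 2) * L1_norm (\<lambda>x. ?A x - f x)"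
    by (subst (1 2) L1_norm_cmult) (auto simp: refl)
  also have "\<dots> = L1_norm (\<lambda>x. ?A x - f x)"
    by (subst distrib_right[symmetric], subst ennreal_plus[symmetric]) auto
  finally show ?thesis
    using err by (rule order.trans)
qed

lemma f_hat_consistent:
  assumes d: "0 < d" and f: "is_density P0 f" and q: "smoothing_kernel q" and b: "\<And>n. 1 \<le> n \<Longrightarrow> 0 < b n"
    and l: "\<And>n. 1 \<le> n \<Longrightarrow> 0 \<le> l n \<and> l n \<le> 1/2 - d"
    and lim: "l \<longlonglongrightarrow> l0" "m1 \<longlonglongrightarrow> \<mu>1" "m2 \<longlonglongrightarrow> \<mu>2"
    and kde: "(\<lambda>n. L1_norm (\<lambda>x. g_hat q b n xs x - A_op (l0, \<mu>1, \<mu>2) f x)) \<longlonglongrightarrow> 0"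
  shows "(\<lambda>n. L1_norm (\<lambda>x. f_hat (l n, m1 n, m2 n) q b n xs x - f x)) \<longlonglongrightarrow> 0"
proof -
  note fD = is_densityD[OF f P0.prob_space_axioms]
  have "(\<lambda>n. \<bar>l0 - l n\<bar>) \<longlonglongrightarrow> \<bar>l0 - l0\<bar>" "(\<lambda>n. m1 n - \<mu>1) \<longlonglongrightarrow> \<mu>1 - \<mu>1" "(\<lambda>n. m2 n - \<mu>2) \<longlonglongrightarrow> \<mu>2 - \<mu>2"
    by (intro tendsto_intros lim)+
  then have "(\<lambda>n. ennreal \<bar>l0 - l n\<bar>) \<longlonglongrightarrow> 0" "(\<lambda>n. L1_modulus f (m1 n - \<mu>1)) \<longlonglongrightarrow> 0" "(\<lambda>n. L1_modulus f (m2 n - \<mu>2)) \<longlonglongrightarrow> 0"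
    using tendsto_ennrealI[of "\<lambda>n. \<bar>l0 - l n\<bar>" 0] by (auto intro: L1_modulus_tendsto[OF fD(3)])
  then have "(\<lambda>n. ennreal (1 / (2 * d)) * (L1_norm (\<lambda>x. g_hat q b n xs x - A_op (l0, \<mu>1, \<mu>2) f x) +
      (2 * ennreal \<bar>l0 - l n\<bar> + (L1_modulus f (m1 n - \<mu>1) + L1_modulus f (m2 n - \<mu>2))))) \<longlonglongrightarrow>
      ennreal (1 / (2 * d)) * (0 + (2 * 0 + (0 + 0)))"
    by (intro ennreal_tendsto_cmult tendsto_add kde) auto
  then have lim0: "(\<lambda>n. ennreal (1 / (2 * d)) * (L1_norm (\<lambda>x. g_hat q b n xs x - A_op (l0, \<mu>1, \<mu>2) f x) +
      (ennreal \<bar>l0 - l n\<bar> * 2 + (L1_modulus f (m1 n - \<mu>1) + L1_modulus f (m2 n - \<mu>2))))) \<longlonglongrightarrow> 0"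
    by (simp add: mult.commute)
  show ?thesis
  proof (rule tendsto_sandwich[OF _ _ tendsto_const lim0])
    show "\<forall>\<^sub>F n in sequentially. L1_norm (\<lambda>x. f_hat (l n, m1 n, m2 n) q b n xs x - f x) \<le>
      ennreal (1 / (2 * d)) * (L1_norm (\<lambda>x. g_hat q b n xs x - A_op (l0, \<mu>1, \<mu>2) f x) +
      (ennreal \<bar>l0 - l n\<bar> * 2 + (L1_modulus f (m1 n - \<mu>1) + L1_modulus f (m2 n - \<mu>2))))"
      using eventually_ge_at_top[of 1]
    proof eventually_elim
      case (elim n)
      show ?case
        using l[OF elim] by (intro f_hat_error d f q b elim) auto
    qed
  qed auto
qed

end

section \<open>Rates for the two estimation problems\<close>

lemma bandwidthD:
  assumes "bandwidth b"
  shows "\<And>n. 1 \<le> n \<Longrightarrow> 0 < b n" "b \<longlonglongrightarrow> 0"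
  using assms by (auto simp: bandwidth_def)

lemma bandwidth_square:
  assumes "bandwidth b"
  obtains c where "0 < c" "eventually (\<lambda>n. (b n)\<^sup>2 \<le> c * real n powr (- 1/2)) sequentially"
proof -
  obtain c where c: "0 < c" "eventually (\<lambda>n. norm (sqrt (real n) * (b n)\<^sup>2) \<le> c * norm (1::real)) sequentially"
    using assms by (auto simp: bandwidth_def elim: landau_o.bigE)
  have "eventually (\<lambda>n. (b n)\<^sup>2 \<le> c * real n powr (- 1/2)) sequentially"
    using c(2) eventually_ge_at_top[of 1]
  proof eventually_elim
    case (elim n)
    have "(b n)\<^sup>2 = sqrt (real n) * (b n)\<^sup>2 * real n powr (- 1/2)"
      using elim(2) by (simp add: powr_minus powr_half_sqrt field_simps)
    also have "\<dots> \<le> c * real n powr (- 1/2)"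
      using elim(1) by (intro mult_right_mono) auto
    finally show ?case .
  qed
  then show thesis
    using that c(1) by blast
qed

locale mixture_sample = iid_sample M X N + symmetric_mixture P0 F0 L l0 \<mu>1 \<mu>2 N
  for M :: "'a measure" and X N P0 F0 L l0 \<mu>1 \<mu>2
begin

lemma deviation_AE:
  assumes "0 < \<alpha>"
  shows "AE \<omega> in M. eventually (\<lambda>n. \<forall>y. \<bar>G_hat n (\<lambda>i. X i \<omega>) y - G y\<bar> \<le>
    real n powr (- 1/2 + \<alpha>) + 1 / real n) sequentially"
  using G_hat_deviation_AE[OF _ _ assms] by (simp add: cdf_N G_cont G_mono)

lemma deviation_null: "(\<lambda>n. real n powr (- 1/2 + 1/4) + 1 / real n) \<longlonglongrightarrow> 0"
  by real_asymp

section \<open>Known locations: consistency and the rate in probability\<close>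

lemma problem_P1D:
  assumes P1: "problem_P1 M X l0 \<mu>1 \<mu>2 d l_hat"
  shows "0 < d" "\<mu>1 \<noteq> \<mu>2" "l0 \<le> 1/2 - d"
    "\<And>n \<omega>. 1 \<le> n \<Longrightarrow> \<omega> \<in> space M \<Longrightarrow> 0 \<le> l_hat n \<omega> \<and> l_hat n \<omega> \<le> 1/2 - d"
    "\<And>n \<omega>. 1 \<le> n \<Longrightarrow> \<omega> \<in> space M \<Longrightarrow>
      contrast (l_hat n \<omega>, \<mu>1, \<mu>2) (G_hat n (\<lambda>i. X i \<omega>)) (G_hat n (\<lambda>i. X i \<omega>)) \<le>
      contrast (l0, \<mu>1, \<mu>2) (G_hat n (\<lambda>i. X i \<omega>)) (G_hat n (\<lambda>i. X i \<omega>))"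
  using P1 unfolding problem_P1_def is_arg_min_def by (auto simp: not_less)

text \<open>One nonrandom constant serves every outcome, with \<Delta> the deviation on that
  outcome. The almost sure and the in-probability statements differ only in the \<Delta> that is
  supplied.\<close>

lemma P1_rate:
  assumes P1: "problem_P1 M X l0 \<mu>1 \<mu>2 d l_hat"
  obtains C where "0 \<le> C"
    "\<And>n \<omega> \<Delta>. 1 \<le> n \<Longrightarrow> \<omega> \<in> space M \<Longrightarrow> (\<And>x. \<bar>G_hat n (\<lambda>i. X i \<omega>) x - G x\<bar> \<le> \<Delta>) \<Longrightarrow> \<bar>l_hat n \<omega> - l0\<bar> \<le> C * \<Delta>"
    "\<And>n \<omega> \<Delta>. 1 \<le> n \<Longrightarrow> \<omega> \<in> space M \<Longrightarrow> (\<And>x. \<bar>G_hat n (\<lambda>i. X i \<omega>) x - G x\<bar> \<le> \<Delta>) \<Longrightarrow>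
      \<bar>sup_norm (\<lambda>x. F_hat (l_hat n \<omega>, \<mu>1, \<mu>2) n (\<lambda>i. X i \<omega>) x - F0 x)\<bar> \<le> C * \<Delta>"
proof -
  note P = problem_P1D[OF P1]
  obtain C where C: "0 \<le> C" "\<And>n l xs \<Delta>. 1 \<le> n \<Longrightarrow> 0 \<le> l \<Longrightarrow> l \<le> 1/2 - d \<Longrightarrow>
    contrast (l, \<mu>1, \<mu>2) (G_hat n xs) (G_hat n xs) \<le> contrast (l0, \<mu>1, \<mu>2) (G_hat n xs) (G_hat n xs) \<Longrightarrow>
    (\<And>x. \<bar>G_hat n xs x - G x\<bar> \<le> \<Delta>) \<Longrightarrow> \<bar>l - l0\<bar> \<le> C * \<Delta>"
    using known_locations_rate[OF P(1-3)] by blast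
  define C' where "C' = max C ((1 + C) / (2 * d))"
  show thesis
  proof (rule that)
    show "0 \<le> C'"
      using C(1) by (simp add: C'_def)
    fix n \<omega> \<Delta> assume n: "1 \<le> n" and \<omega>: "\<omega> \<in> space M" and \<Delta>: "\<And>x. \<bar>G_hat n (\<lambda>i. X i \<omega>) x - G x\<bar> \<le> \<Delta>"
    have \<Delta>0: "0 \<le> \<Delta>"
      using \<Delta>[of 0] by linarith
    have l: "0 \<le> l_hat n \<omega>" "l_hat n \<omega> \<le> 1/2 - d"
      using P(4)[OF n \<omega>] by auto
    have r: "\<bar>l_hat n \<omega> - l0\<bar> \<le> C * \<Delta>"
      by (rule C(2)[OF n l P(5)[OF n \<omega>] \<Delta>])
    also have "\<dots> \<le> C' * \<Delta>"
      using \<Delta>0 by (intro mult_right_mono) (auto simp: C'_def)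
    finally show "\<bar>l_hat n \<omega> - l0\<bar> \<le> C' * \<Delta>" .
    note F = F_hat_error[OF P(1) l n \<Delta>, of \<mu>1 \<mu>2]
    have "sup_norm (\<lambda>x. F_hat (l_hat n \<omega>, \<mu>1, \<mu>2) n (\<lambda>i. X i \<omega>) x - F0 x) \<le> (\<Delta> + C * \<Delta>) / (2 * d)"
      using P(1) r by (intro order.trans[OF F(2)] divide_right_mono) auto
    also have "\<dots> = (1 + C) / (2 * d) * \<Delta>"
      by (simp add: algebra_simps)
    also have "\<dots> \<le> C' * \<Delta>"
      using \<Delta>0 by (intro mult_right_mono) (auto simp: C'_def)
    finally show "\<bar>sup_norm (\<lambda>x. F_hat (l_hat n \<omega>, \<mu>1, \<mu>2) n (\<lambda>i. X i \<omega>) x - F0 x)\<bar> \<le> C' * \<Delta>"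
      using F(1) by simp
  qed
qed

lemma P1_consistent:
  assumes P1: "problem_P1 M X l0 \<mu>1 \<mu>2 d l_hat"
  shows "AE \<omega> in M. (\<lambda>n. l_hat n \<omega>) \<longlonglongrightarrow> l0"
    "AE \<omega> in M. (\<lambda>n. sup_norm (\<lambda>x. F_hat (l_hat n \<omega>, \<mu>1, \<mu>2) n (\<lambda>i. X i \<omega>) x - F0 x)) \<longlonglongrightarrow> 0"
proof -
  obtain C where C: "0 \<le> C"
    "\<And>n \<omega> \<Delta>. 1 \<le> n \<Longrightarrow> \<omega> \<in> space M \<Longrightarrow> (\<And>x. \<bar>G_hat n (\<lambda>i. X i \<omega>) x - G x\<bar> \<le> \<Delta>) \<Longrightarrow> \<bar>l_hat n \<omega> - l0\<bar> \<le> C * \<Delta>"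
    "\<And>n \<omega> \<Delta>. 1 \<le> n \<Longrightarrow> \<omega> \<in> space M \<Longrightarrow> (\<And>x. \<bar>G_hat n (\<lambda>i. X i \<omega>) x - G x\<bar> \<le> \<Delta>) \<Longrightarrow>
      \<bar>sup_norm (\<lambda>x. F_hat (l_hat n \<omega>, \<mu>1, \<mu>2) n (\<lambda>i. X i \<omega>) x - F0 x)\<bar> \<le> C * \<Delta>"
    using P1_rate[OF P1] by blast
  have null: "(\<lambda>n. C * (real n powr (- 1/2 + 1/4) + 1 / real n)) \<longlonglongrightarrow> 0"
    using tendsto_mult_right_zero[OF deviation_null] .
  show "AE \<omega> in M. (\<lambda>n. l_hat n \<omega>) \<longlonglongrightarrow> l0"
    using deviation_AE[of "1/4", simplified] AE_space
  proof eventually_elim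
    case (elim \<omega>)
    have "(\<lambda>n. l_hat n \<omega> - l0) \<longlonglongrightarrow> 0"
    proof (rule Lim_null_comparison[OF _ null])
      show "eventually (\<lambda>n. norm (l_hat n \<omega> - l0) \<le> C * (real n powr (- 1/2 + 1/4) + 1 / real n)) sequentially"
        using elim(1) eventually_ge_at_top[of 1] by eventually_elim (simp add: C(2)[OF _ elim(2)])
    qed
    then show ?case
      by (simp add: LIM_zero_iff)
  qed
  show "AE \<omega> in M. (\<lambda>n. sup_norm (\<lambda>x. F_hat (l_hat n \<omega>, \<mu>1, \<mu>2) n (\<lambda>i. X i \<omega>) x - F0 x)) \<longlonglongrightarrow> 0"
    using deviation_AE[of "1/4", simplified] AE_space
  proof eventually_elim
    case (elim \<omega>)
    show ?case
    proof (rule Lim_null_comparison[OF _ null])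
      show "eventually (\<lambda>n. norm (sup_norm (\<lambda>x. F_hat (l_hat n \<omega>, \<mu>1, \<mu>2) n (\<lambda>i. X i \<omega>) x - F0 x)) \<le>
          C * (real n powr (- 1/2 + 1/4) + 1 / real n)) sequentially"
        using elim(1) eventually_ge_at_top[of 1] by eventually_elim (simp add: C(3)[OF _ elim(2)])
    qed
  qed
qed

lemma P1_bounded_in_probability:
  assumes P1: "problem_P1 M X l0 \<mu>1 \<mu>2 d l_hat"
  shows "bounded_in_probability M (\<lambda>n \<omega>. sqrt (real n) *
    sup_norm (\<lambda>x. F_hat (l_hat n \<omega>, \<mu>1, \<mu>2) n (\<lambda>i. X i \<omega>) x - F0 x))"
  unfolding bounded_in_probability_def
proof (intro allI impI)
  fix \<epsilon> :: real assume \<epsilon>: "0 < \<epsilon>"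
  let ?S = "\<lambda>n \<omega>. sup_norm (\<lambda>x. F_hat (l_hat n \<omega>, \<mu>1, \<mu>2) n (\<lambda>i. X i \<omega>) x - F0 x)"
  obtain C where C: "0 \<le> C"
    "\<And>n \<omega> \<Delta>. 1 \<le> n \<Longrightarrow> \<omega> \<in> space M \<Longrightarrow> (\<And>x. \<bar>G_hat n (\<lambda>i. X i \<omega>) x - G x\<bar> \<le> \<Delta>) \<Longrightarrow> \<bar>l_hat n \<omega> - l0\<bar> \<le> C * \<Delta>"
    "\<And>n \<omega> \<Delta>. 1 \<le> n \<Longrightarrow> \<omega> \<in> space M \<Longrightarrow> (\<And>x. \<bar>G_hat n (\<lambda>i. X i \<omega>) x - G x\<bar> \<le> \<Delta>) \<Longrightarrow> \<bar>?S n \<omega>\<bar> \<le> C * \<Delta>"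
    using P1_rate[OF P1] by blast
  obtain D where D: "0 < D" "\<And>n. 1 \<le> n \<Longrightarrow> \<exists>E\<in>events. prob E \<le> \<epsilon> \<and>
    (\<forall>\<omega>\<in>space M - E. \<forall>y. \<bar>G_hat n (\<lambda>i. X i \<omega>) y - G y\<bar> \<le> D / sqrt (real n))"
    using G_hat_deviation_in_probability[unfolded cdf_N, OF G_cont G_mono \<epsilon>] by blast
  show "\<exists>K. \<forall>n. \<exists>E\<in>events. {\<omega> \<in> space M. K < \<bar>sqrt (real n) * ?S n \<omega>\<bar>} \<subseteq> E \<and> prob E \<le> \<epsilon>"
  proof (intro exI[of _ "C * D"] allI)
    fix n
    show "\<exists>E\<in>events. {\<omega> \<in> space M. C * D < \<bar>sqrt (real n) * ?S n \<omega>\<bar>} \<subseteq> E \<and> prob E \<le> \<epsilon>"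
    proof (cases "1 \<le> n")
      case True
      obtain E where E: "E \<in> events" "prob E \<le> \<epsilon>"
        "\<And>\<omega> y. \<omega> \<in> space M - E \<Longrightarrow> \<bar>G_hat n (\<lambda>i. X i \<omega>) y - G y\<bar> \<le> D / sqrt (real n)"
        using D(2)[OF True] by blast
      have "\<bar>sqrt (real n) * ?S n \<omega>\<bar> \<le> C * D" if \<omega>: "\<omega> \<in> space M - E" for \<omega>
      proof -
        have "\<bar>?S n \<omega>\<bar> \<le> C * (D / sqrt (real n))"
          using \<omega> by (intro C(3) True E(3)) auto
        then have "sqrt (real n) * \<bar>?S n \<omega>\<bar> \<le> sqrt (real n) * (C * (D / sqrt (real n)))"
          by (intro mult_left_mono) auto
        also have "\<dots> = C * D"
          using True by simp
        finally show ?thesis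
          by (simp add: abs_mult)
      qed
      then show ?thesis
        using E(1,2) by (intro bexI[of _ E]) (auto simp: not_less[symmetric])
    next
      case False
      \<comment> \<open>The definition asks for all n. At n = 0 the factor
        \<open>sqrt (real n)\<close> is 0, so the empty event suffices.\<close>
      then have "n = 0" by simp
      then show ?thesis
        using C(1) D(1) \<epsilon> by (intro bexI[of _ "{}"]) (auto simp: not_less)
    qed
  qed
qed

lemma f_hat_AE_consistent:
  assumes d: "0 < d" and f: "is_density P0 f" and q: "smoothing_kernel q" and b: "bandwidth b"
    and l: "\<And>n \<omega>. 1 \<le> n \<Longrightarrow> \<omega> \<in> space M \<Longrightarrow> 0 \<le> l n \<omega> \<and> l n \<omega> \<le> 1/2 - d"
    and lim: "AE \<omega> in M. (\<lambda>n. l n \<omega>) \<longlonglongrightarrow> l0 \<and> (\<lambda>n. m1 n \<omega>) \<longlonglongrightarrow> \<mu>1 \<and> (\<lambda>n. m2 n \<omega>) \<longlonglongrightarrow> \<mu>2"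
  shows "AE \<omega> in M. (\<lambda>n. L1_norm (\<lambda>x. f_hat (l n \<omega>, m1 n \<omega>, m2 n \<omega>) q b n (\<lambda>i. X i \<omega>) x - f x)) \<longlonglongrightarrow> 0"
  using kde_L1_consistent[OF q b mixture_density[OF f]] lim AE_space
proof eventually_elim
  case (elim \<omega>)
  then show ?case
    using l bandwidthD(1)[OF b] by (intro f_hat_consistent[OF d f q]) auto
qed

lemma P1_density_consistent:
  assumes P1: "problem_P1 M X l0 \<mu>1 \<mu>2 d l_hat" and q: "smoothing_kernel q" and b: "bandwidth b"
    and f: "is_density P0 f"
  shows "AE \<omega> in M. (\<lambda>n. L1_norm (\<lambda>x. f_hat (l_hat n \<omega>, \<mu>1, \<mu>2) q b n (\<lambda>i. X i \<omega>) x - f x)) \<longlonglongrightarrow> 0"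
proof (rule f_hat_AE_consistent[OF problem_P1D(1)[OF P1] f q b problem_P1D(4)[OF P1]])
  show "AE \<omega> in M. (\<lambda>n. l_hat n \<omega>) \<longlonglongrightarrow> l0 \<and> (\<lambda>n. \<mu>1) \<longlonglongrightarrow> \<mu>1 \<and> (\<lambda>n. \<mu>2) \<longlonglongrightarrow> \<mu>2"
    using P1_consistent(1)[OF P1] by simp
qed

section \<open>Unknown locations: consistency and the almost sure rate\<close>

lemma problem_P2D:
  assumes P2: "problem_P2 M X q b l0 \<mu>1 \<mu>2 d \<X> \<theta>_hat"
  shows "0 < d" "\<mu>1 \<noteq> \<mu>2" "0 < l0" "l0 \<le> 1/2 - d" "compact \<X>" "\<X> \<inter> {(x, x) |x. True} = {}"
    "\<And>n \<omega>. 1 \<le> n \<Longrightarrow> \<omega> \<in> space M \<Longrightarrow> \<theta>_hat n \<omega> \<in> {0..1/2 - d} \<times> \<X>"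
    "\<And>n \<omega>. 1 \<le> n \<Longrightarrow> \<omega> \<in> space M \<Longrightarrow>
      contrast (\<theta>_hat n \<omega>) (G_tilde q b n (\<lambda>i. X i \<omega>)) (G_hat n (\<lambda>i. X i \<omega>)) \<le>
      contrast (l0, \<mu>1, \<mu>2) (G_tilde q b n (\<lambda>i. X i \<omega>)) (G_hat n (\<lambda>i. X i \<omega>))"
proof -
  have int: "(l0, \<mu>1, \<mu>2) \<in> interior ({0..1/2 - d} \<times> \<X>)" and X: "\<X> \<inter> {(x, x) |x. True} = {}"
    using P2 by (auto simp: problem_P2_def)
  then have mem: "(l0, \<mu>1, \<mu>2) \<in> {0..1/2 - d} \<times> \<X>"
    using interior_subset by blast
  show "0 < d" "compact \<X>" "\<X> \<inter> {(x, x) |x. True} = {}"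
    using P2 by (auto simp: problem_P2_def)
  show "\<mu>1 \<noteq> \<mu>2"
    using mem X by auto
  \<comment> \<open>Being interior excludes the endpoint 0, at which the first location would leave
    no trace in the mixture.\<close>
  show "0 < l0" "l0 \<le> 1/2 - d"
    using int by (auto simp: interior_Times interior_atLeastAtMost_real)
  have am: "is_arg_min (\<lambda>\<theta>. contrast \<theta> (G_tilde q b n (\<lambda>i. X i \<omega>)) (G_hat n (\<lambda>i. X i \<omega>)))
      (\<lambda>\<theta>. \<theta> \<in> {0..1/2 - d} \<times> \<X>) (\<theta>_hat n \<omega>)" if "1 \<le> n" "\<omega> \<in> space M" for n \<omega>
    using P2 that by (auto simp: problem_P2_def)
  show "\<theta>_hat n \<omega> \<in> {0..1/2 - d} \<times> \<X>" if "1 \<le> n" "\<omega> \<in> space M" for n \<omega>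
    using am[OF that] by (simp add: is_arg_min_def)
  show "contrast (\<theta>_hat n \<omega>) (G_tilde q b n (\<lambda>i. X i \<omega>)) (G_hat n (\<lambda>i. X i \<omega>)) \<le>
      contrast (l0, \<mu>1, \<mu>2) (G_tilde q b n (\<lambda>i. X i \<omega>)) (G_hat n (\<lambda>i. X i \<omega>))" if "1 \<le> n" "\<omega> \<in> space M" for n \<omega>
    using am[OF that] mem unfolding is_arg_min_def not_less[symmetric] by blast
qed

lemma P2_limit_contrast:
  assumes P2: "problem_P2 M X q b l0 \<mu>1 \<mu>2 d \<X> \<theta>_hat" and q: "smoothing_kernel q" and b: "bandwidth b"
  obtains C where "0 < C"
    "\<And>n \<omega> \<Delta>. 1 \<le> n \<Longrightarrow> \<omega> \<in> space M \<Longrightarrow> (\<And>x. \<bar>G_hat n (\<lambda>i. X i \<omega>) x - G x\<bar> \<le> \<Delta>) \<Longrightarrow>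
      limit_contrast (\<theta>_hat n \<omega>) \<le> C * (\<Delta>\<^sup>2 + (b n)\<^sup>2 + \<Delta>)"
proof -
  note P = problem_P2D[OF P2]
  obtain R where R: "0 < R" "\<And>x. q x \<noteq> 0 \<Longrightarrow> \<bar>x\<bar> \<le> R"
    using smoothing_kernel_support[OF q] by blast
  define A where "A = 1 / (2 * d) + 1"
  \<comment> \<open>The summands are the coefficients of \<open>\<Delta>\<^sup>2\<close>,
    \<open>(b n)\<^sup>2\<close> and \<Delta>, once \<open>\<Delta>'\<^sup>2\<close> has been
    bounded by twice the square of \<Delta> plus twice the square of the bias.\<close>
  define C where "C = 8 * A\<^sup>2 + 8 * A\<^sup>2 * (L * R)\<^sup>2 + 4 * (1 / (2 * d))\<^sup>2"
  have A: "0 < A"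
    using P(1) by (simp add: A_def add_pos_pos)
  show thesis
  proof (rule that)
    show "0 < C"
      using A by (auto simp: C_def intro!: add_pos_nonneg)
    fix n \<omega> \<Delta> assume n: "1 \<le> n" and \<omega>: "\<omega> \<in> space M" and \<Delta>: "\<And>x. \<bar>G_hat n (\<lambda>i. X i \<omega>) x - G x\<bar> \<le> \<Delta>"
    have \<Delta>0: "0 \<le> \<Delta>"
      using \<Delta>[of 0] by linarith
    obtain l m1 m2 where \<theta>: "\<theta>_hat n \<omega> = (l, m1, m2)" by (cases "\<theta>_hat n \<omega>")
    have l: "0 \<le> l" "l \<le> 1/2 - d"
      using P(7)[OF n \<omega>] by (auto simp: \<theta>)
    then have l': "0 \<le> l" "l < 1/2"
      using P(1) by auto
    define \<Delta>' where "\<Delta>' = \<Delta> + L * b n * R"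
    have dev: "\<bar>G_tilde q b n (\<lambda>i. X i \<omega>) x - G x\<bar> \<le> \<Delta>'" for x
      unfolding \<Delta>'_def by (rule G_tilde_deviation[where b = b and n = n and R = R and L = L, OF q R(2) bandwidthD(1)[OF b n] G_lip L_nonneg \<Delta>])
    have bd: "\<bar>G_tilde q b n (\<lambda>i. X i \<omega>) x\<bar> \<le> 1 + \<Delta>'" for x
      using dev[of x] G_bounds[of x] by linarith
    have "1 / (1 - 2 * l) \<le> 1 / (2 * d)"
      using l P(1) by (intro divide_left_mono) auto
    then have bv: "bounded_variation (1 / (2 * d)) (residual (l, m1, m2) G)"
      by (rule bounded_variation_weaken[OF residual_bounded_variation[OF l' asymmetry_bounded_variation[OF l']]])
    have "limit_contrast (l, m1, m2) \<le> 4 * (A * \<Delta>')\<^sup>2 + 4 * (1 / (2 * d))\<^sup>2 * \<Delta>"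
      unfolding limit_contrast_def A_def
      by (rule minimiser_bound[OF P(1) l P(4) n measurable_G_tilde[OF q] bd dev \<Delta> P(8)[OF n \<omega>, unfolded \<theta>] bv])
    also have "(A * \<Delta>')\<^sup>2 \<le> A\<^sup>2 * (2 * \<Delta>\<^sup>2 + 2 * (L * R)\<^sup>2 * (b n)\<^sup>2)"
    proof -
      have "\<Delta>'\<^sup>2 \<le> 2 * \<Delta>\<^sup>2 + 2 * (L * b n * R)\<^sup>2"
        using zero_le_power2[of "\<Delta> - L * b n * R"] by (simp add: \<Delta>'_def power2_eq_square algebra_simps)
      then have "A\<^sup>2 * \<Delta>'\<^sup>2 \<le> A\<^sup>2 * (2 * \<Delta>\<^sup>2 + 2 * (L * b n * R)\<^sup>2)"
        by (rule mult_left_mono) simp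
      then show ?thesis
        by (simp add: power_mult_distrib mult_ac)
    qed
    finally have "limit_contrast (l, m1, m2) \<le>
        8 * A\<^sup>2 * \<Delta>\<^sup>2 + 8 * A\<^sup>2 * (L * R)\<^sup>2 * (b n)\<^sup>2 + 4 * (1 / (2 * d))\<^sup>2 * \<Delta>"
      by (simp add: algebra_simps)
    also have "\<dots> \<le> C * \<Delta>\<^sup>2 + C * (b n)\<^sup>2 + C * \<Delta>"
      using \<Delta>0 by (intro add_mono mult_right_mono) (auto simp: C_def)
    finally show "limit_contrast (\<theta>_hat n \<omega>) \<le> C * (\<Delta>\<^sup>2 + (b n)\<^sup>2 + \<Delta>)"
      by (simp add: \<theta> algebra_simps)
  qed
qed

lemma P2_sup_norm:
  assumes P2: "problem_P2 M X q b l0 \<mu>1 \<mu>2 d \<X> \<theta>_hat"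
    and n: "1 \<le> n" and \<omega>: "\<omega> \<in> space M" and \<Delta>: "\<And>x. \<bar>G_hat n (\<lambda>i. X i \<omega>) x - G x\<bar> \<le> \<Delta>"
  shows "\<bar>sup_norm (\<lambda>x. F_hat (\<theta>_hat n \<omega>) n (\<lambda>i. X i \<omega>) x - F0 x)\<bar> \<le> (\<Delta> + (1 + L) * param_dist (\<theta>_hat n \<omega>)) / (2 * d)"
proof -
  note P = problem_P2D[OF P2]
  obtain l m1 m2 where \<theta>: "\<theta>_hat n \<omega> = (l, m1, m2)" by (cases "\<theta>_hat n \<omega>")
  have l: "0 \<le> l" "l \<le> 1/2 - d"
    using P(7)[OF n \<omega>] by (auto simp: \<theta>)
  note F = F_hat_error[OF P(1) l n \<Delta>, of m1 m2]
  have "\<bar>l - l0\<bar> + L * (\<bar>m1 - \<mu>1\<bar> + \<bar>m2 - \<mu>2\<bar>) \<le> (1 + L) * param_dist (l, m1, m2)"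
    using L_nonneg by (simp add: param_dist_def algebra_simps)
  then have "(\<Delta> + \<bar>l - l0\<bar> + L * (\<bar>m1 - \<mu>1\<bar> + \<bar>m2 - \<mu>2\<bar>)) / (2 * d) \<le> (\<Delta> + (1 + L) * param_dist (l, m1, m2)) / (2 * d)"
    using P(1) by (intro divide_right_mono) auto
  then show ?thesis
    unfolding \<theta> using F by simp
qed

text \<open>Eventually the limit contrast falls below the threshold that identification assigns to
  the distance \<epsilon>. Since no rate is claimed, C1 is enough here.\<close>

lemma P2_param_consistent:
  assumes P2: "problem_P2 M X q b l0 \<mu>1 \<mu>2 d \<X> \<theta>_hat" and q: "smoothing_kernel q" and b: "bandwidth b"
  shows "AE \<omega> in M. (\<lambda>n. param_dist (\<theta>_hat n \<omega>)) \<longlonglongrightarrow> 0"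
  using deviation_AE[of "1/4", simplified] AE_space
proof eventually_elim
  case (elim \<omega>)
  note P = problem_P2D[OF P2]
  obtain C where C: "0 < C" "\<And>n \<omega> \<Delta>. 1 \<le> n \<Longrightarrow> \<omega> \<in> space M \<Longrightarrow> (\<And>x. \<bar>G_hat n (\<lambda>i. X i \<omega>) x - G x\<bar> \<le> \<Delta>) \<Longrightarrow>
      limit_contrast (\<theta>_hat n \<omega>) \<le> C * (\<Delta>\<^sup>2 + (b n)\<^sup>2 + \<Delta>)"
    using P2_limit_contrast[OF P2 q b] by blast
  define \<Delta> where "\<Delta> n = real n powr (- 1/2 + 1/4) + 1 / real n" for n :: nat
  have "(\<lambda>n. C * ((\<Delta> n)\<^sup>2 + (b n)\<^sup>2 + \<Delta> n)) \<longlonglongrightarrow> C * (0\<^sup>2 + 0\<^sup>2 + 0)"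
    unfolding \<Delta>_def by (intro tendsto_intros deviation_null bandwidthD(2)[OF b])
  then have null: "(\<lambda>n. C * ((\<Delta> n)\<^sup>2 + (b n)\<^sup>2 + \<Delta> n)) \<longlonglongrightarrow> 0"
    by simp
  have pd0: "0 \<le> param_dist \<theta>" for \<theta>
    by (simp add: param_dist_def split: prod.split)
  show ?case
  proof (rule order_tendstoI)
    fix \<epsilon> :: real assume \<epsilon>: "0 < \<epsilon>"
    obtain \<kappa> where \<kappa>: "0 < \<kappa>" "\<And>\<theta>. \<theta> \<in> {0..1/2 - d} \<times> \<X> \<Longrightarrow> \<epsilon> \<le> param_dist \<theta> \<Longrightarrow> \<kappa> \<le> limit_contrast \<theta>"
      using unknown_locations_identified[OF P(1,5,6,3,2) \<epsilon>] by blast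
    have "eventually (\<lambda>n. C * ((\<Delta> n)\<^sup>2 + (b n)\<^sup>2 + \<Delta> n) < \<kappa>) sequentially"
      by (rule order_tendstoD(2)[OF null \<kappa>(1)])
    then show "eventually (\<lambda>n. param_dist (\<theta>_hat n \<omega>) < \<epsilon>) sequentially"
      using elim(1) eventually_ge_at_top[of 1]
    proof eventually_elim
      case (elim n)
      have "limit_contrast (\<theta>_hat n \<omega>) \<le> C * ((\<Delta> n)\<^sup>2 + (b n)\<^sup>2 + \<Delta> n)"
        using elim(2) by (intro C(2) elim(3) \<open>\<omega> \<in> space M\<close>) (simp add: \<Delta>_def)
      then have "limit_contrast (\<theta>_hat n \<omega>) < \<kappa>"
        using elim(1) by simp
      then show ?case
        using \<kappa>(2)[OF P(7)[OF elim(3) \<open>\<omega> \<in> space M\<close>]] by (auto simp: not_le[symmetric])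
    qed
  next
    fix a :: real assume "a < 0"
    then show "eventually (\<lambda>n. a < param_dist (\<theta>_hat n \<omega>)) sequentially"
      by (intro always_eventually allI less_le_trans[OF _ pd0])
  qed
qed

lemma P2_consistent:
  assumes P2: "problem_P2 M X q b l0 \<mu>1 \<mu>2 d \<X> \<theta>_hat" and q: "smoothing_kernel q" and b: "bandwidth b"
  shows "AE \<omega> in M. (\<lambda>n. sup_norm (\<lambda>x. F_hat (\<theta>_hat n \<omega>) n (\<lambda>i. X i \<omega>) x - F0 x)) \<longlonglongrightarrow> 0"
  using deviation_AE[of "1/4", simplified] P2_param_consistent[OF P2 q b] AE_space
proof eventually_elim
  case (elim \<omega>)
  note P = problem_P2D[OF P2]
  define \<Delta> where "\<Delta> n = real n powr (- 1/2 + 1/4) + 1 / real n" for n :: nat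
  have "(\<lambda>n. (\<Delta> n + (1 + L) * param_dist (\<theta>_hat n \<omega>)) / (2 * d)) \<longlonglongrightarrow> (0 + (1 + L) * 0) / (2 * d)"
    unfolding \<Delta>_def using P(1) by (intro tendsto_intros deviation_null elim(2)) auto
  then have null: "(\<lambda>n. (\<Delta> n + (1 + L) * param_dist (\<theta>_hat n \<omega>)) / (2 * d)) \<longlonglongrightarrow> 0"
    by simp
  show ?case
  proof (rule Lim_null_comparison[OF _ null])
    show "eventually (\<lambda>n. norm (sup_norm (\<lambda>x. F_hat (\<theta>_hat n \<omega>) n (\<lambda>i. X i \<omega>) x - F0 x)) \<le>
        (\<Delta> n + (1 + L) * param_dist (\<theta>_hat n \<omega>)) / (2 * d)) sequentially"
      using elim(1) eventually_ge_at_top[of 1]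
    proof eventually_elim
      case (elim n)
      then show ?case
        unfolding real_norm_def by (intro P2_sup_norm[OF P2] \<open>\<omega> \<in> space M\<close>) (simp_all add: \<Delta>_def)
    qed
  qed
qed

text \<open>With \<Delta> of order n^(-1/2+\<beta>) and the squared bandwidth O(n^(-1/2)), the
  quadratic lower bound makes the parameter error O(n^(-1/4+\<beta>/2)). As \<beta> is at most
  \<alpha>, the quotient by n^(-1/4+\<alpha>) is O(n^(\<beta>/2-\<alpha>)) and tends to 0.\<close>

lemma P2_rate:
  assumes P2: "problem_P2 M X q b l0 \<mu>1 \<mu>2 d \<X> \<theta>_hat" and q: "smoothing_kernel q" and b: "bandwidth b"
    and C2: "C2 F0" and \<alpha>: "0 < \<alpha>"
  shows "AE \<omega> in M. (\<lambda>n. sup_norm (\<lambda>x. F_hat (\<theta>_hat n \<omega>) n (\<lambda>i. X i \<omega>) x - F0 x) / real n powr (- 1/4 + \<alpha>)) \<longlonglongrightarrow> 0"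
proof -
  note P = problem_P2D[OF P2]
  \<comment> \<open>The cap 1/4 keeps \<open>Q n \<le> 1\<close>, so that the square of
    \<open>Q n\<close> is dominated by \<open>Q n\<close> and this by its square root, however large
    \<alpha> is.\<close>
  define \<beta> where "\<beta> = min \<alpha> (1/4)"
  have \<beta>: "0 < \<beta>" "\<beta> \<le> \<alpha>" "\<beta> \<le> 1/4"
    using \<alpha> by (auto simp: \<beta>_def)
  obtain C where C: "0 < C" "\<And>n \<omega> \<Delta>. 1 \<le> n \<Longrightarrow> \<omega> \<in> space M \<Longrightarrow> (\<And>x. \<bar>G_hat n (\<lambda>i. X i \<omega>) x - G x\<bar> \<le> \<Delta>) \<Longrightarrow>
      limit_contrast (\<theta>_hat n \<omega>) \<le> C * (\<Delta>\<^sup>2 + (b n)\<^sup>2 + \<Delta>)"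
    using P2_limit_contrast[OF P2 q b] by blast
  obtain c where c: "0 < c" "\<And>\<theta>. \<theta> \<in> {0..1/2 - d} \<times> \<X> \<Longrightarrow> c * (param_dist \<theta>)\<^sup>2 \<le> limit_contrast \<theta>"
    using unknown_locations_quadratic[OF P(1,5,6,3,2) C2] by blast
  obtain c' where c': "0 < c'" "eventually (\<lambda>n. (b n)\<^sup>2 \<le> c' * real n powr (- 1/2)) sequentially"
    using bandwidth_square[OF b] by blast
  define Q where "Q n = real n powr (- 1/2 + \<beta>)" for n :: nat
  define A where "A = C * (6 + c') / c"
  have A: "0 < A"
    using C(1) c(1) c'(1) by (simp add: A_def)
  define K where "K = (2 + (1 + L) * sqrt A) / (2 * d)"
  have null: "(\<lambda>n. K * real n powr (\<beta> / 2 - \<alpha>)) \<longlonglongrightarrow> 0"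
  proof -
    have "\<beta> / 2 - \<alpha> < 0"
      using \<beta> by simp
    then have "(\<lambda>n. real n powr (\<beta> / 2 - \<alpha>)) \<longlonglongrightarrow> 0"
      by (intro tendsto_neg_powr filterlim_real_sequentially)
    then show ?thesis
      by (rule tendsto_mult_right_zero)
  qed
  show ?thesis
    using deviation_AE[OF \<beta>(1)] AE_space
  proof eventually_elim
    case (elim \<omega>)
    show ?case
    proof (rule Lim_null_comparison[OF _ null])
      show "eventually (\<lambda>n. norm (sup_norm (\<lambda>x. F_hat (\<theta>_hat n \<omega>) n (\<lambda>i. X i \<omega>) x - F0 x) / real n powr (- 1/4 + \<alpha>)) \<le>
          K * real n powr (\<beta> / 2 - \<alpha>)) sequentially"
        using elim(1) c'(2) eventually_ge_at_top[of 1]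
      proof eventually_elim
        case (elim n)
        have n: "1 \<le> n" by fact
        have Q: "0 < Q n" "Q n \<le> 1"
          using n \<beta> powr_mono[of "- 1/2 + \<beta>" 0 "real n"] by (auto simp: Q_def)
        have nQ: "1 / real n \<le> Q n"
        proof -
          have "1 / real n = real n powr - 1"
            using n by (simp add: powr_minus_divide)
          also have "\<dots> \<le> Q n"
            unfolding Q_def using n \<beta> by (intro powr_mono) auto
          finally show ?thesis .
        qed
        have bQ: "(b n)\<^sup>2 \<le> c' * Q n"
          using elim(2) c'(1) n \<beta> powr_mono[of "- 1/2" "- 1/2 + \<beta>" "real n"]
          by (auto simp: Q_def intro: order.trans[OF _ mult_left_mono])
        have \<Delta>: "\<bar>G_hat n (\<lambda>i. X i \<omega>) x - G x\<bar> \<le> 2 * Q n" for x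
        proof -
          have "\<bar>G_hat n (\<lambda>i. X i \<omega>) x - G x\<bar> \<le> Q n + 1 / real n"
            using elim(1) by (simp add: Q_def)
          then show ?thesis
            using nQ by simp
        qed
        have sq: "(2 * Q n)\<^sup>2 \<le> 4 * Q n"
          using mult_left_mono[OF Q(2), of "4 * Q n"] Q(1) by (simp add: power2_eq_square)
        have "c * (param_dist (\<theta>_hat n \<omega>))\<^sup>2 \<le> limit_contrast (\<theta>_hat n \<omega>)"
          by (rule c(2)[OF P(7)[OF n \<open>\<omega> \<in> space M\<close>]])
        also have "\<dots> \<le> C * ((2 * Q n)\<^sup>2 + (b n)\<^sup>2 + 2 * Q n)"
          by (rule C(2)[OF n \<open>\<omega> \<in> space M\<close> \<Delta>])
        also have "\<dots> \<le> C * (4 * Q n + c' * Q n + 2 * Q n)"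
          using C(1) by (intro mult_left_mono add_mono sq bQ) auto
        also have "\<dots> = C * (6 + c') * Q n"
          by (simp add: algebra_simps)
        also have "\<dots> = c * (A * Q n)"
          using c(1) by (simp add: A_def)
        finally have "(param_dist (\<theta>_hat n \<omega>))\<^sup>2 \<le> A * Q n"
          using c(1) by simp
        then have "param_dist (\<theta>_hat n \<omega>) \<le> sqrt (A * Q n)"
          by (rule real_le_rsqrt)
        also have "\<dots> = sqrt A * sqrt (Q n)"
          by (rule real_sqrt_mult)
        finally have pd: "param_dist (\<theta>_hat n \<omega>) \<le> sqrt A * sqrt (Q n)" .
        have Qs: "Q n \<le> sqrt (Q n)"
          using Q by (intro real_le_rsqrt) (simp add: power2_eq_square mult_left_le)
        have "\<bar>sup_norm (\<lambda>x. F_hat (\<theta>_hat n \<omega>) n (\<lambda>i. X i \<omega>) x - F0 x)\<bar> \<le> (2 * Q n + (1 + L) * param_dist (\<theta>_hat n \<omega>)) / (2 * d)"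
          by (rule P2_sup_norm[OF P2 n \<open>\<omega> \<in> space M\<close> \<Delta>])
        also have "\<dots> \<le> (2 * sqrt (Q n) + (1 + L) * (sqrt A * sqrt (Q n))) / (2 * d)"
          using P(1) L_nonneg pd Qs by (intro divide_right_mono add_mono mult_left_mono) auto
        also have "\<dots> = K * sqrt (Q n)"
          by (simp add: K_def algebra_simps add_divide_distrib)
        also have "sqrt (Q n) = real n powr (\<beta> / 2 - \<alpha>) * real n powr (- 1/4 + \<alpha>)"
        proof -
          have "sqrt (Q n) = real n powr ((- 1/2 + \<beta>) * (1/2))"
            unfolding Q_def by (simp add: powr_half_sqrt[symmetric] powr_powr)
          also have "(- 1/2 + \<beta>) * (1/2) = (\<beta> / 2 - \<alpha>) + (- 1/4 + \<alpha>)"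
            by (simp add: algebra_simps)
          finally show ?thesis
            by (simp only: powr_add)
        qed
        finally show ?case
          using n by (simp add: abs_divide pos_divide_le_eq mult.assoc)
      qed
    qed
  qed
qed

lemma P2_density_consistent:
  assumes P2: "problem_P2 M X q b l0 \<mu>1 \<mu>2 d \<X> \<theta>_hat" and q: "smoothing_kernel q" and b: "bandwidth b"
    and f: "is_density P0 f"
  shows "AE \<omega> in M. (\<lambda>n. L1_norm (\<lambda>x. f_hat (\<theta>_hat n \<omega>) q b n (\<lambda>i. X i \<omega>) x - f x)) \<longlonglongrightarrow> 0"
proof -
  note P = problem_P2D[OF P2]
  have lim: "AE \<omega> in M. (\<lambda>n. fst (\<theta>_hat n \<omega>)) \<longlonglongrightarrow> l0 \<and> (\<lambda>n. fst (snd (\<theta>_hat n \<omega>))) \<longlonglongrightarrow> \<mu>1 \<and>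
      (\<lambda>n. snd (snd (\<theta>_hat n \<omega>))) \<longlonglongrightarrow> \<mu>2"
    using P2_param_consistent[OF P2 q b]
  proof eventually_elim
    case (elim \<omega>)
    have conv: "h \<longlonglongrightarrow> h0" if "\<And>n. \<bar>h n - h0\<bar> \<le> param_dist (\<theta>_hat n \<omega>)" for h :: "nat \<Rightarrow> real" and h0
    proof -
      have "(\<lambda>n. h n - h0) \<longlonglongrightarrow> 0"
        by (rule Lim_null_comparison[OF _ elim]) (use that in auto)
      then show ?thesis
        by (simp add: LIM_zero_iff)
    qed
    show ?case
      by (intro conjI conv) (auto simp: param_dist_def split_beta')
  qed
  have "AE \<omega> in M. (\<lambda>n. L1_norm (\<lambda>x. f_hat (fst (\<theta>_hat n \<omega>), fst (snd (\<theta>_hat n \<omega>)), snd (snd (\<theta>_hat n \<omega>)))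
      q b n (\<lambda>i. X i \<omega>) x - f x)) \<longlonglongrightarrow> 0"
  proof (rule f_hat_AE_consistent[OF P(1) f q b _ lim])
    show "0 \<le> fst (\<theta>_hat n \<omega>) \<and> fst (\<theta>_hat n \<omega>) \<le> 1/2 - d" if "1 \<le> n" "\<omega> \<in> space M" for n \<omega>
      using P(7)[OF that] by (auto simp: mem_Times_iff)
  qed
  then show ?thesis by simp
qed

end

section \<open>The theorem from the model assumptions\<close>

lemma mixture_sample_intro:
  fixes M :: "'a measure" and X :: "nat \<Rightarrow> 'a \<Rightarrow> real"
  assumes P0: "symmetric_law P0" and F0: "F0 = cdf P0" and M: "prob_space M"
    and indep: "prob_space.indep_vars M (\<lambda>_. borel) X {1..}"
    and cdf: "\<And>i x. i \<ge> 1 \<Longrightarrow> cdf (distr M borel (X i)) x = l0 * F0 (x - \<mu>1) + (1 - l0) * F0 (x - \<mu>2)"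
    and C1: "C1 F0" and l0: "0 \<le> l0" "l0 < 1/2"
  obtains L where "mixture_sample M X (distr M borel (X 1)) P0 F0 L l0 \<mu>1 \<mu>2"
proof -
  interpret prob_space M by fact
  have X: "X i \<in> borel_measurable M" if "1 \<le> i" for i
    using indep that by (auto simp: indep_vars_def)
  obtain L where L: "L-lipschitz_on UNIV F0" and mono: "strict_mono F0"
    using C1 by (auto simp: C1_def)
  have law: "distr M borel (X i) = distr M borel (X 1)" if "1 \<le> i" for i
    using X[OF that] X[of 1] cdf that by (intro cdf_unique real_distribution_distr ext) auto
  have "iid_sample M X (distr M borel (X 1))"
    by (intro iid_sample.intro iid_sample_axioms.intro M indep law)
  moreover have "symmetric_mixture P0 F0 L l0 \<mu>1 \<mu>2 (distr M borel (X 1))"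
  proof (rule symmetric_mixture.intro[OF P0 F0 mono L l0])
    show "real_distribution (distr M borel (X 1))"
      using X[of 1] by (intro real_distribution_distr) simp
    show "cdf (distr M borel (X 1)) = A_op (l0, \<mu>1, \<mu>2) F0"
      by (rule ext) (simp only: cdf[OF order.refl] A_op_eq)
  qed
  ultimately show thesis
    by (intro that mixture_sample.intro)
qed

theorem theorem3p4:
  fixes M :: "'a measure" and X :: "nat \<Rightarrow> 'a \<Rightarrow> real"
    and P0 :: "real measure" and F0 f0 :: "real \<Rightarrow> real"
    and l0 \<mu>1 \<mu>2 :: real
    and q :: "real \<Rightarrow> real" and b :: "nat \<Rightarrow> real"
  assumes "symmetric_law P0"
    and "F0 = cdf P0"
    and "(\<exists>f. is_density P0 f) \<Longrightarrow> is_density P0 f0"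
    and "prob_space M"
    and "prob_space.indep_vars M (\<lambda>_. borel) X {1..}"
    and "\<And>i x. i \<ge> 1 \<Longrightarrow>
           cdf (distr M borel (X i)) x = l0 * F0 (x - \<mu>1) + (1 - l0) * F0 (x - \<mu>2)"
    and "smoothing_kernel q"
    and "bandwidth b"
  shows
    "(C1 F0 \<longrightarrow>
       (\<forall>d l_hat. problem_P1 M X l0 \<mu>1 \<mu>2 d l_hat \<longrightarrow>
         (AE \<omega> in M. (\<lambda>n. sup_norm (\<lambda>x.
            F_hat (l_hat n \<omega>, \<mu>1, \<mu>2) n (\<lambda>i. X i \<omega>) x - F0 x)) \<longlonglongrightarrow> 0)) \<and>
       (\<forall>d \<X> \<theta>_hat. problem_P2 M X q b l0 \<mu>1 \<mu>2 d \<X> \<theta>_hat \<longrightarrow>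
         (AE \<omega> in M. (\<lambda>n. sup_norm (\<lambda>x.
            F_hat (\<theta>_hat n \<omega>) n (\<lambda>i. X i \<omega>) x - F0 x)) \<longlonglongrightarrow> 0)))
     \<and>
     (C1 F0 \<longrightarrow>
       (\<forall>d l_hat. problem_P1 M X l0 \<mu>1 \<mu>2 d l_hat \<longrightarrow>
         bounded_in_probability M (\<lambda>n \<omega>. sqrt (real n) * sup_norm (\<lambda>x.
            F_hat (l_hat n \<omega>, \<mu>1, \<mu>2) n (\<lambda>i. X i \<omega>) x - F0 x))))
     \<and>
     (C2 F0 \<longrightarrow>
       (\<forall>d \<X> \<theta>_hat. problem_P2 M X q b l0 \<mu>1 \<mu>2 d \<X> \<theta>_hat \<longrightarrow>
         (\<forall>\<alpha>>0. AE \<omega> in M. (\<lambda>n. sup_norm (\<lambda>x.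
            F_hat (\<theta>_hat n \<omega>) n (\<lambda>i. X i \<omega>) x - F0 x) / real n powr (- 1/4 + \<alpha>)) \<longlonglongrightarrow> 0)))
     \<and>
     (C1 F0 \<longrightarrow>
       (\<forall>d l_hat. problem_P1 M X l0 \<mu>1 \<mu>2 d l_hat \<longrightarrow>
         (AE \<omega> in M. (\<lambda>n. L1_norm (\<lambda>x.
            f_hat (l_hat n \<omega>, \<mu>1, \<mu>2) q b n (\<lambda>i. X i \<omega>) x - f0 x)) \<longlonglongrightarrow> 0)))
     \<and>
     (C2 F0 \<longrightarrow>
       (\<forall>d \<X> \<theta>_hat. problem_P2 M X q b l0 \<mu>1 \<mu>2 d \<X> \<theta>_hat \<longrightarrow>
         (AE \<omega> in M. (\<lambda>n. L1_norm (\<lambda>x.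
            f_hat (\<theta>_hat n \<omega>) q b n (\<lambda>i. X i \<omega>) x - f0 x)) \<longlonglongrightarrow> 0)))"
proof -
  note q = assms(7) and b = assms(8)
  have P1: "\<exists>L. mixture_sample M X (distr M borel (X 1)) P0 F0 L l0 \<mu>1 \<mu>2"
    if "C1 F0" "problem_P1 M X l0 \<mu>1 \<mu>2 d l_hat" for d l_hat
  proof -
    have "0 \<le> l0" "l0 < 1/2"
      using that(2) by (auto simp: problem_P1_def)
    then show ?thesis
      using mixture_sample_intro[OF assms(1,2,4,5,6) that(1)] by metis
  qed
  have P2: "\<exists>L. mixture_sample M X (distr M borel (X 1)) P0 F0 L l0 \<mu>1 \<mu>2"
    if "C1 F0" "problem_P2 M X q b l0 \<mu>1 \<mu>2 d \<X> \<theta>_hat" for d \<X> \<theta>_hat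
  proof -
    have "(l0, \<mu>1, \<mu>2) \<in> interior ({0..1/2 - d} \<times> \<X>)" and d: "0 < d"
      using that(2) by (simp_all add: problem_P2_def)
    then have "(l0, \<mu>1, \<mu>2) \<in> {0..1/2 - d} \<times> \<X>"
      by (meson interior_subset subsetD)
    with d have "0 \<le> l0" "l0 < 1/2"
      by auto
    then show ?thesis
      using mixture_sample_intro[OF assms(1,2,4,5,6) that(1)] by metis
  qed
  \<comment> \<open>\<open>f0\<close> is assumed to be a density only if one exists; a Lipschitz
    c.d.f. supplies the existence.\<close>
  have f0: "is_density P0 f0" if "C1 F0"
  proof -
    have "real_distribution P0"
      using assms(1) by (simp add: symmetric_law_def)
    then show ?thesis
      using that assms(2,3) lipschitz_cdf_imp_density unfolding C1_def by blast
  qed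
  have sup1: "AE \<omega> in M. (\<lambda>n. sup_norm (\<lambda>x. F_hat (l_hat n \<omega>, \<mu>1, \<mu>2) n (\<lambda>i. X i \<omega>) x - F0 x)) \<longlonglongrightarrow> 0"
    if C: "C1 F0" and prob: "problem_P1 M X l0 \<mu>1 \<mu>2 d l_hat" for d l_hat
  proof -
    obtain L where "mixture_sample M X (distr M borel (X 1)) P0 F0 L l0 \<mu>1 \<mu>2"
      using P1[OF C prob] by blast
    then interpret mixture_sample M X "distr M borel (X 1)" P0 F0 L l0 \<mu>1 \<mu>2 .
    show ?thesis
      by (rule P1_consistent(2)[OF prob])
  qed
  have sup2: "AE \<omega> in M. (\<lambda>n. sup_norm (\<lambda>x. F_hat (\<theta>_hat n \<omega>) n (\<lambda>i. X i \<omega>) x - F0 x)) \<longlonglongrightarrow> 0"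
    if C: "C1 F0" and prob: "problem_P2 M X q b l0 \<mu>1 \<mu>2 d \<X> \<theta>_hat" for d \<X> \<theta>_hat
  proof -
    obtain L where "mixture_sample M X (distr M borel (X 1)) P0 F0 L l0 \<mu>1 \<mu>2"
      using P2[OF C prob] by blast
    then interpret mixture_sample M X "distr M borel (X 1)" P0 F0 L l0 \<mu>1 \<mu>2 .
    show ?thesis
      by (rule P2_consistent[OF prob q b])
  qed
  have rate1: "bounded_in_probability M (\<lambda>n \<omega>. sqrt (real n) * sup_norm (\<lambda>x. F_hat (l_hat n \<omega>, \<mu>1, \<mu>2) n (\<lambda>i. X i \<omega>) x - F0 x))"
    if C: "C1 F0" and prob: "problem_P1 M X l0 \<mu>1 \<mu>2 d l_hat" for d l_hat
  proof -
    obtain L where "mixture_sample M X (distr M borel (X 1)) P0 F0 L l0 \<mu>1 \<mu>2"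
      using P1[OF C prob] by blast
    then interpret mixture_sample M X "distr M borel (X 1)" P0 F0 L l0 \<mu>1 \<mu>2 .
    show ?thesis
      by (rule P1_bounded_in_probability[OF prob])
  qed
  have rate2: "AE \<omega> in M. (\<lambda>n. sup_norm (\<lambda>x. F_hat (\<theta>_hat n \<omega>) n (\<lambda>i. X i \<omega>) x - F0 x) / real n powr (- 1/4 + \<alpha>)) \<longlonglongrightarrow> 0"
    if C: "C2 F0" and prob: "problem_P2 M X q b l0 \<mu>1 \<mu>2 d \<X> \<theta>_hat" and \<alpha>: "0 < \<alpha>" for d \<X> \<theta>_hat \<alpha>
  proof -
    obtain L where "mixture_sample M X (distr M borel (X 1)) P0 F0 L l0 \<mu>1 \<mu>2"
      using P2[OF C2_imp_C1[OF C] prob] by blast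
    then interpret mixture_sample M X "distr M borel (X 1)" P0 F0 L l0 \<mu>1 \<mu>2 .
    show ?thesis
      by (rule P2_rate[OF prob q b C \<alpha>])
  qed
  have dens1: "AE \<omega> in M. (\<lambda>n. L1_norm (\<lambda>x. f_hat (l_hat n \<omega>, \<mu>1, \<mu>2) q b n (\<lambda>i. X i \<omega>) x - f0 x)) \<longlonglongrightarrow> 0"
    if C: "C1 F0" and prob: "problem_P1 M X l0 \<mu>1 \<mu>2 d l_hat" for d l_hat
  proof -
    obtain L where "mixture_sample M X (distr M borel (X 1)) P0 F0 L l0 \<mu>1 \<mu>2"
      using P1[OF C prob] by blast
    then interpret mixture_sample M X "distr M borel (X 1)" P0 F0 L l0 \<mu>1 \<mu>2 .
    show ?thesis
      by (rule P1_density_consistent[OF prob q b f0[OF C]])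
  qed
  have dens2: "AE \<omega> in M. (\<lambda>n. L1_norm (\<lambda>x. f_hat (\<theta>_hat n \<omega>) q b n (\<lambda>i. X i \<omega>) x - f0 x)) \<longlonglongrightarrow> 0"
    if C: "C2 F0" and prob: "problem_P2 M X q b l0 \<mu>1 \<mu>2 d \<X> \<theta>_hat" for d \<X> \<theta>_hat
  proof -
    obtain L where "mixture_sample M X (distr M borel (X 1)) P0 F0 L l0 \<mu>1 \<mu>2"
      using P2[OF C2_imp_C1[OF C] prob] by blast
    then interpret mixture_sample M X "distr M borel (X 1)" P0 F0 L l0 \<mu>1 \<mu>2 .
    show ?thesis
      by (rule P2_density_consistent[OF prob q b f0[OF C2_imp_C1[OF C]]])
  qed
  show ?thesis
    by (intro conjI impI allI sup1 sup2 rate1 rate2 dens1 dens2; assumption)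
qed

end
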